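(* Let $X=\mathbb{R}$ or $X=\mathbb{T}=\mathbb{R}/2\pi\mathbb{Z}$, let $I\subset\mathbb{R}$ be an interval containing $0$, and let $\vec{S}:I\times X\to\mathbb{S}^2\subset\mathbb{R}^3$ be a (sufficiently regular) solution of the half-wave maps equation $$\partial_t\vec{S}=\vec{S}\wedge|\nabla|\vec{S}$$ for every $t\in I$. - If $X=\mathbb{R}$ and $\vec{S}(0,x)$ is a rational function of $x$, then $\vec{S}(t,x)$ is a rational function of $x$ for every $t\in I$. - If $X=\mathbb{T}$ and $\vec{S}(0,x)$ is a rational function of $e^{\mathrm{i}x}$, then $\vec{S}(t,x)$ is a rational function of $e^{\mathrm{i}x}$ for every $t\in I$.
   Context: $\wedge$ is the vector product in $\mathbb{R}^3$. The operator $|\nabla|$ acts componentwise in the variable $x$ and is the Fourier multiplier with symbol $|\xi|$ if $X=\mathbb{R}$, and with symbol $|n|$ ($n\in\mathbb{Z}$) if $X=\mathbb{T}$. A vector-valued function is called rational if each of its components is rational. "Sufficiently regular" is not quantified in the source; it means regular enough for all the expressions involved to be well-defined, and one may take, for instance, $\vec{S}$ bounded and smooth in $(t,x)$, with in addition, for $X=\mathbb{R}$, $\partial_x\vec{S}$ continuous in $t$ with values in every Sobolev space $H^s(\mathbb{R};\mathbb{R}^3)$ (in which case $|\nabla|\vec{S}$ is understood as $H\partial_x\vec{S}$, with $H$ the Hilbert transform $(Hf)(x)=\mathrm{p.v.}\,\frac1\pi\int_{\mathbb{R}}\frac{f(y)}{x-y}\,dy$). *)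

theory Defs
  imports "HOL-Analysis.Analysis" "HOL-Computational_Algebra.Polynomial"
begin

text \<open>
  Functions on \<open>I \<times> X\<close> are written \<open>S t x\<close>; only the values at \<open>t \<in> I\<close> matter. Functions on the
  torus \<open>X = \<real>/2\<pi>\<int>\<close> are represented by \<open>2\<pi>\<close>-periodic functions on the real line.
\<close>

definition rational_in_x :: "(real \<Rightarrow> real) \<Rightarrow> bool" where
  "rational_in_x f \<longleftrightarrow>
     (\<exists>p q :: real poly. \<forall>x. poly q x \<noteq> 0 \<and> f x = poly p x / poly q x)"

definition rational_in_exp_ix :: "(real \<Rightarrow> real) \<Rightarrow> bool" where
  "rational_in_exp_ix f \<longleftrightarrow>
     (\<exists>p q :: complex poly. \<forall>x. poly q (exp (\<i> * of_real x)) \<noteq> 0 \<and>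
        complex_of_real (f x) = poly p (exp (\<i> * of_real x)) / poly q (exp (\<i> * of_real x)))"

definition hilbert_transform :: "(real \<Rightarrow> real) \<Rightarrow> real \<Rightarrow> real" where
  "hilbert_transform f x =
     1 / pi * Lim (at_right 0) (\<lambda>\<epsilon>. LINT y:{y. \<epsilon> < \<bar>x - y\<bar>}|lborel. f y / (x - y))"

text \<open>
  With this sign the Hilbert transform has symbol \<open>- \<i> sgn \<xi>\<close>, so composing it with
  \<open>\<partial>\<^sub>x\<close> gives the symbol \<open>|\<xi>|\<close>. This form also makes sense for bounded \<open>f\<close> with no decay
  whose derivative is square integrable.
\<close>

definition abs_nabla_line :: "(real \<Rightarrow> real ^ 3) \<Rightarrow> real \<Rightarrow> real ^ 3" where
  "abs_nabla_line f x = (\<chi> i. hilbert_transform (deriv (\<lambda>y. f y $ i)) x)"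

definition fourier_coeff :: "(real \<Rightarrow> real) \<Rightarrow> int \<Rightarrow> complex" where
  "fourier_coeff f n =
     1 / (2 * pi) * (LINT y:{0..2 * pi}|lborel. of_real (f y) * exp (- \<i> * of_int n * of_real y))"

text \<open>The sum below is real for real-valued \<open>f\<close>; \<open>Re\<close> only adjusts the type.\<close>

definition abs_nabla_torus :: "(real \<Rightarrow> real ^ 3) \<Rightarrow> real \<Rightarrow> real ^ 3" where
  "abs_nabla_torus f x = (\<chi> i. Re (\<Sum>\<^sub>\<infinity>n\<in>UNIV.
     of_int \<bar>n\<bar> * fourier_coeff (\<lambda>y. f y $ i) n * exp (\<i> * of_int n * of_real x)))"

text \<open>
  \<open>D j k\<close> is the mixed partial derivative \<open>\<partial>\<^sub>t\<^sup>j \<partial>\<^sub>x\<^sup>k S\<close>. All of them are required to exist and to be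
  jointly continuous on \<open>I \<times> \<real>\<close>; time derivatives are one-sided at endpoints belonging to \<open>I\<close>.
\<close>

definition smooth_tx :: "real set \<Rightarrow> (real \<Rightarrow> real \<Rightarrow> real ^ 3) \<Rightarrow> bool" where
  "smooth_tx I S \<longleftrightarrow>
     (\<exists>D :: nat \<Rightarrow> nat \<Rightarrow> real \<Rightarrow> real \<Rightarrow> real ^ 3.
        D 0 0 = S \<and>
        (\<forall>j k. continuous_on (I \<times> UNIV) (\<lambda>(t, x). D j k t x) \<and>
          (\<forall>t\<in>I. \<forall>x.
             ((\<lambda>s. D j k s x) has_vector_derivative D (Suc j) k t x) (at t within I) \<and>
             (D j k t has_vector_derivative D j (Suc k) t x) (at x))))"

definition dx :: "(real \<Rightarrow> real ^ 3) \<Rightarrow> real \<Rightarrow> real ^ 3" where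
  "dx f x = vector_derivative f (at x)"

text \<open>
  Sobolev spaces of integer order, restricted to smooth functions, so that weak and classical
  derivatives agree.
\<close>

definition in_sobolev :: "nat \<Rightarrow> (real \<Rightarrow> real ^ 3) \<Rightarrow> bool" where
  "in_sobolev m f \<longleftrightarrow>
     (\<forall>j\<le>m. (dx ^^ j) f \<in> borel_measurable lborel \<and>
            integrable lborel (\<lambda>x. (norm ((dx ^^ j) f x))\<^sup>2))"

definition sobolev_norm :: "nat \<Rightarrow> (real \<Rightarrow> real ^ 3) \<Rightarrow> real" where
  "sobolev_norm m f = sqrt (\<Sum>j\<le>m. LINT x|lborel. (norm ((dx ^^ j) f x))\<^sup>2)"

definition continuous_in_sobolev :: "real set \<Rightarrow> nat \<Rightarrow> (real \<Rightarrow> real \<Rightarrow> real ^ 3) \<Rightarrow> bool" where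
  "continuous_in_sobolev I m u \<longleftrightarrow>
     (\<forall>t\<in>I. in_sobolev m (u t)) \<and>
     (\<forall>t\<in>I. ((\<lambda>s. sobolev_norm m (\<lambda>x. u s x - u t x)) \<longlongrightarrow> 0) (at t within I))"

definition half_wave_maps_line :: "real set \<Rightarrow> (real \<Rightarrow> real \<Rightarrow> real ^ 3) \<Rightarrow> bool" where
  "half_wave_maps_line I S \<longleftrightarrow>
     (\<forall>t\<in>I. \<forall>x. S t x \<in> sphere 0 1) \<and>
     smooth_tx I S \<and>
     (\<forall>m. continuous_in_sobolev I m (\<lambda>t. dx (S t))) \<and>
     (\<forall>t\<in>I. \<forall>x. ((\<lambda>s. S s x) has_vector_derivative cross3 (S t x) (abs_nabla_line (S t) x))
                    (at t within I))"

definition half_wave_maps_torus :: "real set \<Rightarrow> (real \<Rightarrow> real \<Rightarrow> real ^ 3) \<Rightarrow> bool" where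
  "half_wave_maps_torus I S \<longleftrightarrow>
     (\<forall>t\<in>I. \<forall>x. S t (x + 2 * pi) = S t x) \<and>
     (\<forall>t\<in>I. \<forall>x. S t x \<in> sphere 0 1) \<and>
     smooth_tx I S \<and>
     (\<forall>t\<in>I. \<forall>x. ((\<lambda>s. S s x) has_vector_derivative cross3 (S t x) (abs_nabla_torus (S t) x))
                    (at t within I))"

end

theory Submission
  imports Defs "HOL-Combinatorics.Permutations" "HOL-Real_Asymp.Real_Asymp"
begin

text \<open>
  Let \<open>\<phi>(u) = u\<close> on the line and \<open>\<phi>(u) = 2 sin(u/2)\<close> on the torus, and put
  \<open>\<kappa>(x, y) = (S(x) - S(y)) / \<phi>(x - y)\<close>. Written with real \<open>4 \<times> 4\<close> quaternion matrices, \<open>\<kappa>\<close> is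
  a Hilbert-Schmidt kernel \<open>K\<close>, and the equation becomes a Lax equation
  \<open>K_t(p, q) = A(p, q) - A(q, p)\<close>, in which \<open>A\<close> is built from \<open>S\<close>, \<open>T = |\<nabla>|S\<close>, \<open>\<kappa>\<close> and
  \<open>d = |\<nabla>|\<^sub>x \<kappa>\<close>. The flow is isospectral, so the integral of \<open>det(K(p\<^sub>i, q\<^sub>j))\<^sup>2\<close> over all points
  is conserved for every size of the determinant. For rational data \<open>K\<close> has finite rank, so the
  determinants of large size vanish initially, hence for all times; and a finite rank of \<open>K\<close>
  forces \<open>S\<close> to be rational.
\<close>

section \<open>Integrated minors of a kernel\<close>

text \<open>Up to the rescaling of time, the Lax operator behind \<open>A\<close> is B = (S
  |\<nabla>| + |\<nabla>| S - T)/2, where S and T act as quaternion matrices. These matrices are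
  skew and |\<nabla>| is symmetric, so B is formally skew-adjoint. The relation S(x) \<kappa>(x, y)
  = - \<kappa>(x, y) S(y), a consequence of |S| = 1, turns the kernel of B K into \<open>A\<close>;
  as K is antisymmetric, A(p, q) - A(q, p) is the kernel of [B, K]. The obstacle is that B is
  unbounded: neither a unitary propagator nor the spectrum of K is at hand. The proof keeps a single
  trace of skewness, that the integral of A(p, q) K(p, r) over p is antisymmetric in q and r. When a
  minor is expanded along one row, this annihilates the contribution of that row to the derivative
  of the integrated square, and likewise for columns. The price is that all kernels must be square
  integrable over pairs of points. Therefore |\<nabla>| is applied to difference quotients only, and
  on the line the decay of a bounded rational S(0) to its limit at infinity is needed. On the torus
  the half-angle keeps \<kappa> real and symmetric; it is antiperiodic, with half-integer
  frequencies.\<close>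

lemma nn_integral_PiM_pairs:
  fixes g :: "'i \<Rightarrow> 'a \<Rightarrow> 'a \<Rightarrow> ennreal"
  assumes M: "sigma_finite_measure M" and fin: "finite A"
    and inj: "inj_on u A" "inj_on v A" "u ` A \<inter> v ` A = {}"
    and meas: "\<And>a. a \<in> A \<Longrightarrow> case_prod (g a) \<in> borel_measurable (M \<Otimes>\<^sub>M M)"
  shows "(\<integral>\<^sup>+w. (\<Prod>a\<in>A. g a (w (u a)) (w (v a))) \<partial>PiM (u ` A \<union> v ` A) (\<lambda>_. M)) =
    (\<Prod>a\<in>A. \<integral>\<^sup>+p. case_prod (g a) p \<partial>(M \<Otimes>\<^sub>M M))"
proof -
  interpret M: sigma_finite_measure M by (rule M)
  interpret pair_sigma_finite M M ..
  interpret product_sigma_finite "\<lambda>_ :: 'j. M" by standard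
  show ?thesis
    using fin inj meas
  proof (induction A rule: finite_induct)
    case empty
    show ?case by (simp add: space_PiM_empty)
  next
    case (insert a A)
    let ?I = "u ` A \<union> v ` A"
    have fresh: "u a \<notin> ?I" "v a \<notin> ?I" "u a \<noteq> v a"
      using insert.prems insert.hyps by (auto simp: inj_on_def)
    have ne: "u b \<noteq> u a" "v b \<noteq> v a" "u b \<noteq> v a" "v b \<noteq> u a" if "b \<in> A" for b
      using fresh that by (metis UnI1 UnI2 image_eqI)+
    have finI: "finite ?I" using insert.hyps by simp
    have [measurable]: "case_prod (g b) \<in> borel_measurable (M \<Otimes>\<^sub>M M)" if "b \<in> insert a A" for b
      using insert.prems(4) that by blast
    have ga: "case_prod (g a) \<in> borel_measurable (M \<Otimes>\<^sub>M M)" by simp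
    have comp: "(\<lambda>w. g b (w (u b)) (w (v b))) \<in> borel_measurable (PiM J (\<lambda>_. M))"
      if "b \<in> insert a A" "u b \<in> J" "v b \<in> J" for b J
    proof -
      have "(\<lambda>w. (w (u b), w (v b))) \<in> PiM J (\<lambda>_. M) \<rightarrow>\<^sub>M M \<Otimes>\<^sub>M M"
        using that by (intro measurable_Pair measurable_component_singleton) auto
      from measurable_compose[OF this, of "case_prod (g b)"] show ?thesis
        using that by simp
    qed
    have eqI: "u ` insert a A \<union> v ` insert a A = insert (u a) (insert (v a) ?I)" by auto
    let ?P = "\<lambda>w. \<Prod>b\<in>A. g b (w (u b)) (w (v b))"
    have Pm[measurable]: "?P \<in> borel_measurable (PiM ?I (\<lambda>_. M))"
      by (intro borel_measurable_prod_ennreal comp) auto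
    have Pm'[measurable]: "?P \<in> borel_measurable (PiM (insert (v a) ?I) (\<lambda>_. M))"
      by (intro borel_measurable_prod_ennreal comp) auto
    have Pm''[measurable]: "?P \<in> borel_measurable (PiM (insert (u a) (insert (v a) ?I)) (\<lambda>_. M))"
      by (intro borel_measurable_prod_ennreal comp) auto
    have P1: "?P (w(u a := y)) = ?P w" "?P (w(v a := y)) = ?P w" for w y
      by (auto intro!: prod.cong simp: ne)
    have m1: "(\<lambda>w. \<integral>\<^sup>+y. g a y (w (v a)) \<partial>M) \<in> borel_measurable (PiM (insert (v a) ?I) (\<lambda>_. M))"
    proof -
      have "(\<lambda>z. \<integral>\<^sup>+y. g a y z \<partial>M) \<in> borel_measurable M"
        using M.borel_measurable_nn_integral[of "\<lambda>z y. g a y z" M] ga by simp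
      from measurable_compose[OF _ this, of "\<lambda>w. w (v a)"] show ?thesis
        by simp
    qed
    have m2: "(\<lambda>y. g a y z) \<in> borel_measurable M" if "z \<in> space M" for z
      using ga that by measurable
    have m3: "(\<lambda>z. \<integral>\<^sup>+y. g a y z \<partial>M) \<in> borel_measurable M"
      using M.borel_measurable_nn_integral[of "\<lambda>z y. g a y z" M] ga by simp
    have "(\<integral>\<^sup>+w. (\<Prod>b\<in>insert a A. g b (w (u b)) (w (v b))) \<partial>PiM (u ` insert a A \<union> v ` insert a A) (\<lambda>_. M))
      = (\<integral>\<^sup>+w. g a (w (u a)) (w (v a)) * ?P w \<partial>PiM (insert (u a) (insert (v a) ?I)) (\<lambda>_. M))"
      unfolding eqI using insert.hyps by simp
    also have "\<dots> = (\<integral>\<^sup>+w. (\<integral>\<^sup>+y. g a y (w (v a)) * ?P w \<partial>M) \<partial>PiM (insert (v a) ?I) (\<lambda>_. M))"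
      using fresh finI
      by (subst product_nn_integral_insert) (auto simp: ne fresh fresh(3)[symmetric] cong: prod.cong_simp intro!: borel_measurable_times_ennreal comp Pm'')
    also have "\<dots> = (\<integral>\<^sup>+w. (\<integral>\<^sup>+y. g a y (w (v a)) \<partial>M) * ?P w \<partial>PiM (insert (v a) ?I) (\<lambda>_. M))"
      by (intro nn_integral_cong nn_integral_multc m2) (auto simp: space_PiM PiE_iff)
    also have "\<dots> = (\<integral>\<^sup>+w. (\<integral>\<^sup>+z. (\<integral>\<^sup>+y. g a y z \<partial>M) * ?P w \<partial>M) \<partial>PiM ?I (\<lambda>_. M))"
      using fresh finI
      by (subst product_nn_integral_insert) (auto simp: ne cong: prod.cong_simp intro!: borel_measurable_times_ennreal m1 Pm')
    also have "\<dots> = (\<integral>\<^sup>+w. (\<integral>\<^sup>+z. (\<integral>\<^sup>+y. g a y z \<partial>M) \<partial>M) * ?P w \<partial>PiM ?I (\<lambda>_. M))"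
      by (intro nn_integral_cong nn_integral_multc m3)
    also have "\<dots> = (\<integral>\<^sup>+z. (\<integral>\<^sup>+y. g a y z \<partial>M) \<partial>M) * (\<integral>\<^sup>+w. ?P w \<partial>PiM ?I (\<lambda>_. M))"
      by (intro nn_integral_cmult Pm)
    also have "(\<integral>\<^sup>+z. (\<integral>\<^sup>+y. g a y z \<partial>M) \<partial>M) = (\<integral>\<^sup>+p. case_prod (g a) p \<partial>(M \<Otimes>\<^sub>M M))"
      using nn_integral_snd[OF ga] by simp
    also have "(\<integral>\<^sup>+w. ?P w \<partial>PiM ?I (\<lambda>_. M)) = (\<Prod>b\<in>A. \<integral>\<^sup>+p. case_prod (g b) p \<partial>(M \<Otimes>\<^sub>M M))"
      using insert.prems by (intro insert.IH) (auto simp: inj_on_insert)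
    finally show ?case using insert.hyps by simp
  qed
qed

section \<open>Square-integrable functions, and cancellation in one row\<close>

definition sq_integrable :: "'a measure \<Rightarrow> ('a \<Rightarrow> real) \<Rightarrow> bool" where
  "sq_integrable M f \<longleftrightarrow> f \<in> borel_measurable M \<and> integrable M (\<lambda>x. (f x)\<^sup>2)"

lemma sq_integrable_iff_nn:
  "sq_integrable M f \<longleftrightarrow> f \<in> borel_measurable M \<and> (\<integral>\<^sup>+x. ennreal ((f x)\<^sup>2) \<partial>M) < \<infinity>"
  by (auto simp: sq_integrable_def integrable_iff_bounded)

lemma sq_integrable_mult:
  assumes "sq_integrable M f" "sq_integrable M g"
  shows "integrable M (\<lambda>x. f x * g x)"
proof (rule Bochner_Integration.integrable_bound)
  show "integrable M (\<lambda>x. (f x)\<^sup>2 + (g x)\<^sup>2)"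
    using assms by (simp add: sq_integrable_def)
  show "(\<lambda>x. f x * g x) \<in> borel_measurable M"
    using assms by (auto simp: sq_integrable_def)
  have "\<bar>a * b\<bar> \<le> \<bar>a\<^sup>2 + b\<^sup>2\<bar>" for a b :: real
    using sum_squares_bound[of "\<bar>a\<bar>" "\<bar>b\<bar>"] sum_power2_ge_zero[of a b] abs_ge_zero[of "a * b"]
    unfolding abs_mult power2_abs by linarith
  then show "AE x in M. norm (f x * g x) \<le> norm ((f x)\<^sup>2 + (g x)\<^sup>2)" by simp
qed

lemma sq_integrable_bound:
  assumes "sq_integrable M f" "g \<in> borel_measurable M" "\<And>x. x \<in> space M \<Longrightarrow> \<bar>g x\<bar> \<le> \<bar>f x\<bar>"
  shows "sq_integrable M g"
  using assms unfolding sq_integrable_def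
  by (auto intro!: Bochner_Integration.integrable_bound[of M "\<lambda>x. (f x)\<^sup>2"] simp: abs_le_square_iff[symmetric])

lemma sq_integrable_add:
  assumes "sq_integrable M f" "sq_integrable M g"
  shows "sq_integrable M (\<lambda>x. f x + g x)"
  using sq_integrable_mult[OF assms] assms
  by (auto simp: sq_integrable_def power2_sum mult.assoc)

lemma sq_integrable_cmult: "sq_integrable M f \<Longrightarrow> sq_integrable M (\<lambda>x. c * f x)"
  by (auto simp: sq_integrable_def power_mult_distrib)

lemma sq_integrable_uminus: "sq_integrable M f \<Longrightarrow> sq_integrable M (\<lambda>x. - f x)"
  by (auto simp: sq_integrable_def)

lemma sq_integrable_zero: "sq_integrable M (\<lambda>x. 0)"
  by (simp add: sq_integrable_def)

lemma sq_integrable_sum: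
  "(\<And>i. i \<in> I \<Longrightarrow> sq_integrable M (f i)) \<Longrightarrow> sq_integrable M (\<lambda>x. \<Sum>i\<in>I. f i x)"
  by (induction I rule: infinite_finite_induct) (auto simp: sq_integrable_zero sq_integrable_add)

lemma antisymmetric_double_sum:
  fixes a :: "'i \<Rightarrow> 'i \<Rightarrow> real"
  assumes "\<And>i j. i \<in> P \<Longrightarrow> j \<in> P \<Longrightarrow> a i j = - a j i"
  shows "(\<Sum>i\<in>P. \<Sum>j\<in>P. a i j) = 0"
proof -
  have "(\<Sum>i\<in>P. \<Sum>j\<in>P. a i j) = (\<Sum>i\<in>P. \<Sum>j\<in>P. - a j i)"
    by (intro sum.cong refl assms)
  also have "\<dots> = - (\<Sum>i\<in>P. \<Sum>j\<in>P. a i j)"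
    by (subst sum.swap) (simp add: sum_negf)
  finally show ?thesis by simp
qed

text \<open>Integrating over coordinate \<open>i\<close> alone leaves a double sum of r_k r_l times
  the integral of A(p, u_k) K(p, u_l) over p: symmetric weights against antisymmetric integrals. The
  two factors stand for expansions of a form along one row, with row entries from \<open>A\<close>
  and from \<open>K\<close>.\<close>

lemma PiM_skew_integral_zero:
  fixes K A :: "'a \<Rightarrow> 'a \<Rightarrow> real"
  assumes M: "sigma_finite_measure M" and I: "finite I" "i \<in> I"
    and indep: "\<And>k w y. k \<in> P \<Longrightarrow> u k (w(i := y)) = u k w" "\<And>k w y. k \<in> P \<Longrightarrow> r k (w(i := y)) = r k w"
    and int: "\<And>q q'. integrable M (\<lambda>p. A p q * K p q')"
    and skew: "\<And>q q'. (LINT p|M. A p q * K p q') = - (LINT p|M. A p q' * K p q)"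
    and fg: "integrable (PiM I (\<lambda>_. M))
      (\<lambda>w. (\<Sum>k\<in>P. A (w i) (u k w) * r k w) * (\<Sum>k\<in>P. K (w i) (u k w) * r k w))"
  shows "(LINT w|PiM I (\<lambda>_. M). (\<Sum>k\<in>P. A (w i) (u k w) * r k w) * (\<Sum>k\<in>P. K (w i) (u k w) * r k w)) = 0"
    (is "integral\<^sup>L _ ?f = 0")
proof -
  interpret M: sigma_finite_measure M by (rule M)
  interpret product_sigma_finite "\<lambda>_ :: 'b. M" by standard
  have ins: "insert i (I - {i}) = I" using I by auto
  have "integral\<^sup>L (PiM I (\<lambda>_. M)) ?f =
     (\<integral>x. (\<integral>y. ?f (x(i := y)) \<partial>M) \<partial>PiM (I - {i}) (\<lambda>_. M))"
    by (rule product_integral_insert[of "I - {i}" i ?f, unfolded ins]) (use I fg in auto)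
  also have "(\<lambda>x. \<integral>y. ?f (x(i := y)) \<partial>M) = (\<lambda>x. 0)"
  proof
    fix x
    have "(\<integral>y. ?f (x(i := y)) \<partial>M)
      = (\<integral>y. (\<Sum>k\<in>P. \<Sum>l\<in>P. (r k x * r l x) * (A y (u k x) * K y (u l x))) \<partial>M)"
      by (simp add: indep sum_product mult_ac)
    also have "\<dots> = (\<Sum>k\<in>P. \<Sum>l\<in>P. (r k x * r l x) * (\<integral>y. A y (u k x) * K y (u l x) \<partial>M))"
      by (simp add: Bochner_Integration.integral_sum Bochner_Integration.integrable_sum int)
    also have "\<dots> = 0"
      by (rule antisymmetric_double_sum) (subst skew, simp)
    finally show "(\<integral>y. ?f (x(i := y)) \<partial>M) = 0" .
  qed
  finally show ?thesis by simp
qed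

text \<open>The fundamental theorem and the Cauchy-Schwarz inequality; the factors 2 come from
  splitting f t into f 0 and the increment. Stated in \<open>ennreal\<close>, the bound can be
  integrated over further parameters by Tonelli before anything is known to be finite.\<close>

lemma sq_le_integral_sq_deriv:
  fixes f :: "real \<Rightarrow> real"
  assumes "\<And>s. s \<in> {0..1} \<Longrightarrow> (f has_real_derivative f' s) (at s within {0..1})"
    and "continuous_on {0..1} f'" and t: "t \<in> {0..1}"
  shows "ennreal ((f t)\<^sup>2) \<le> 2 * ennreal ((f 0)\<^sup>2) +
           2 * (\<integral>\<^sup>+s. ennreal ((f' s)\<^sup>2) * indicator {0..1} s \<partial>lborel)"
proof -
  have c: "continuous_on {0..t} f'" using assms(2) by (rule continuous_on_subset) (use t in auto)
  have "f t - f 0 = (LINT s|lborel. indicator {0..t} s *\<^sub>R f' s)"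
    using t by (intro integral_FTC_Icc[symmetric] c)
      (auto simp: has_real_derivative_iff_has_vector_derivative[symmetric] intro!: DERIV_subset[OF assms(1)])
  then have "\<bar>f t - f 0\<bar> \<le> (LINT s|lborel. \<bar>indicator {0..t} s *\<^sub>R f' s\<bar>)"
    using integral_abs_bound[of lborel "\<lambda>s. indicator {0..t} s *\<^sub>R f' s"] by simp
  then have "ennreal \<bar>f t - f 0\<bar> \<le> ennreal (LINT s|lborel. \<bar>indicator {0..t} s *\<^sub>R f' s\<bar>)"
    by (rule ennreal_leI)
  also have "\<dots> = (\<integral>\<^sup>+s. ennreal \<bar>indicator {0..t} s *\<^sub>R f' s\<bar> \<partial>lborel)"
    by (rule nn_integral_eq_integral[symmetric])
      (use borel_integrable_compact[of "{0..t}" f'] c in \<open>auto intro!: integrable_abs simp: mult.commute scaleR_conv_of_real indicator_def if_distrib cong: if_cong\<close>)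
  also have "\<dots> \<le> (\<integral>\<^sup>+s. indicator {0..1} s * ennreal \<bar>indicator {0..1} s * f' s\<bar> \<partial>lborel)"
    using t by (intro nn_integral_mono) (auto simp: indicator_def)
  finally have 1: "ennreal \<bar>f t - f 0\<bar> \<le> \<dots>" .
  have m: "(\<lambda>s. indicator {0..1} s * f' s) \<in> borel_measurable borel"
    using borel_measurable_continuous_on_indicator[OF _ assms(2)] by (simp add: mult.commute)
  have "ennreal ((f t - f 0)\<^sup>2) = (ennreal \<bar>f t - f 0\<bar>)\<^sup>2"
    by (simp add: ennreal_power)
  also have "\<dots> \<le> (\<integral>\<^sup>+s. indicator {0..1} s * ennreal \<bar>indicator {0..1} s * f' s\<bar> \<partial>lborel)\<^sup>2"
    by (intro power_mono 1) auto
  also have "\<dots> \<le> (\<integral>\<^sup>+s. (indicator {0..1::real} s)\<^sup>2 \<partial>lborel) * (\<integral>\<^sup>+s. (ennreal \<bar>indicator {0..1} s * f' s\<bar>)\<^sup>2 \<partial>lborel)"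
    using m by (intro Cauchy_Schwarz_nn_integral) auto
  also have "(\<integral>\<^sup>+s. (indicator {0..1::real} s)\<^sup>2 \<partial>lborel) = (1 :: ennreal)"
  proof -
    have "(\<lambda>s. (indicator {0..1::real} s)\<^sup>2) = (indicator {0..1::real} :: _ \<Rightarrow> ennreal)"
      by (auto simp: fun_eq_iff indicator_def)
    then show ?thesis by simp
  qed
  also have "1 * (\<integral>\<^sup>+s. (ennreal \<bar>indicator {0..1} s * f' s\<bar>)\<^sup>2 \<partial>lborel) =
      (\<integral>\<^sup>+s. ennreal ((f' s)\<^sup>2) * indicator {0..1} s \<partial>lborel)"
    unfolding mult_1_left by (intro nn_integral_cong) (auto simp: indicator_def ennreal_power)
  finally have 2: "ennreal ((f t - f 0)\<^sup>2) \<le> \<dots>" .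
  have "(f t)\<^sup>2 \<le> 2 * (f 0)\<^sup>2 + 2 * (f t - f 0)\<^sup>2"
    using zero_le_power2[of "f t - 2 * f 0"] by (simp add: power2_eq_square algebra_simps)
  then have "ennreal ((f t)\<^sup>2) \<le> ennreal (2 * (f 0)\<^sup>2 + 2 * (f t - f 0)\<^sup>2)"
    by (rule ennreal_leI)
  also have "\<dots> = 2 * ennreal ((f 0)\<^sup>2) + 2 * ennreal ((f t - f 0)\<^sup>2)"
    by (simp add: ennreal_mult)
  also have "\<dots> \<le> 2 * ennreal ((f 0)\<^sup>2) + 2 * (\<integral>\<^sup>+s. ennreal ((f' s)\<^sup>2) * indicator {0..1} s \<partial>lborel)"
    using 2 by (intro add_left_mono mult_left_mono) auto
  finally show ?thesis .
qed

lemma nn_integral_sq_sum_le: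
  fixes \<alpha> :: "'j \<Rightarrow> real" and t :: "'j \<Rightarrow> 'w \<Rightarrow> real"
  assumes "\<And>j. j \<in> J \<Longrightarrow> t j \<in> borel_measurable N"
    and "\<And>j. j \<in> J \<Longrightarrow> (\<integral>\<^sup>+w. ennreal ((t j w)\<^sup>2) \<partial>N) \<le> D"
  shows "(\<integral>\<^sup>+w. ennreal ((\<Sum>j\<in>J. \<alpha> j * t j w)\<^sup>2) \<partial>N) \<le> ennreal (card J * (\<Sum>j\<in>J. (\<alpha> j)\<^sup>2)) * D"
proof -
  have "(\<integral>\<^sup>+w. ennreal ((\<Sum>j\<in>J. \<alpha> j * t j w)\<^sup>2) \<partial>N)
      \<le> (\<integral>\<^sup>+w. (\<Sum>j\<in>J. ennreal (card J * (\<alpha> j)\<^sup>2) * ennreal ((t j w)\<^sup>2)) \<partial>N)"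
  proof (intro nn_integral_mono)
    fix w
    have "(\<Sum>j\<in>J. \<alpha> j * t j w)\<^sup>2 \<le> (\<Sum>j\<in>J. card J * (\<alpha> j)\<^sup>2 * (t j w)\<^sup>2)"
      using sum_squared_le_sum_of_squares[of "\<lambda>j. \<alpha> j * t j w" J]
      by (simp add: sum_distrib_left sum_distrib_right power_mult_distrib mult_ac)
    then have "ennreal ((\<Sum>j\<in>J. \<alpha> j * t j w)\<^sup>2) \<le> ennreal (\<Sum>j\<in>J. card J * (\<alpha> j)\<^sup>2 * (t j w)\<^sup>2)"
      by (rule ennreal_leI)
    also have "\<dots> = (\<Sum>j\<in>J. ennreal (card J * (\<alpha> j)\<^sup>2) * ennreal ((t j w)\<^sup>2))"
      by (subst sum_ennreal[symmetric]) (auto simp: ennreal_mult)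
    finally show "ennreal ((\<Sum>j\<in>J. \<alpha> j * t j w)\<^sup>2) \<le> \<dots>" .
  qed
  also have "\<dots> = (\<Sum>j\<in>J. ennreal (card J * (\<alpha> j)\<^sup>2) * (\<integral>\<^sup>+w. ennreal ((t j w)\<^sup>2) \<partial>N))"
    using assms(1) by (subst nn_integral_sum) (auto intro!: sum.cong nn_integral_cmult)
  also have "\<dots> \<le> (\<Sum>j\<in>J. ennreal (card J * (\<alpha> j)\<^sup>2) * D)"
    using assms(2) by (intro sum_mono mult_left_mono) auto
  also have "\<dots> = ennreal (card J * (\<Sum>j\<in>J. (\<alpha> j)\<^sup>2)) * D"
    by (subst sum_distrib_right[symmetric], subst sum_ennreal) (auto simp: sum_distrib_left)
  finally show ?thesis .
qed

section \<open>Permutation terms of a minor as functions of 2n points\<close>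

lemma upt_image_shift_permutes:
  assumes "\<sigma> permutes {..<n}"
  shows "{..<n} \<union> (\<lambda>a. n + \<sigma> a) ` {..<n} = {..<2 * n :: nat}"
proof -
  have "(\<lambda>a. n + \<sigma> a) ` {..<n} = (+) n ` \<sigma> ` {..<n}" by (simp add: image_image)
  also have "\<dots> = {n..<2 * n}"
    unfolding permutes_image[OF assms] by (simp add: lessThan_atLeast0 mult_2)
  finally show ?thesis by auto
qed

text \<open>The row points w a and the column points w (n + \<sigma> a) run through all 2n
  coordinates once, so the square of a permutation term integrates to a product of n double
  integrals. The entries \<open>g a\<close> may differ, because after differentiation in time one of
  them is \<open>A\<close> or \<open>Kd\<close> instead of \<open>K\<close>.\<close>

lemma sq_pair_product:
  assumes M: "sigma_finite_measure M" and p: "\<sigma> permutes {..<n}"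
    and g: "\<And>a. a < n \<Longrightarrow> case_prod (g a) \<in> borel_measurable (M \<Otimes>\<^sub>M M)"
      "\<And>a. a < n \<Longrightarrow> (\<integral>\<^sup>+z. ennreal ((case_prod (g a) z)\<^sup>2) \<partial>(M \<Otimes>\<^sub>M M)) \<le> D"
  shows "(\<lambda>w. \<Prod>a<n. g a (w a) (w (n + \<sigma> a))) \<in> borel_measurable (PiM {..<2 * n} (\<lambda>_. M))"
    and "(\<integral>\<^sup>+w. ennreal ((\<Prod>a<n. g a (w a) (w (n + \<sigma> a)))\<^sup>2) \<partial>PiM {..<2 * n} (\<lambda>_. M)) \<le> D ^ n"
proof -
  have \<sigma>: "\<sigma> a < n" if "a < n" for a using permutes_in_image[OF p, of a] that by simp
  have "(\<lambda>w. g a (w a) (w (n + \<sigma> a))) \<in> borel_measurable (PiM {..<2 * n} (\<lambda>_. M))" if "a < n" for a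
  proof -
    have "(\<lambda>w. (w a, w (n + \<sigma> a))) \<in> PiM {..<2 * n} (\<lambda>_. M) \<rightarrow>\<^sub>M M \<Otimes>\<^sub>M M"
      using that \<sigma>[OF that] by (intro measurable_Pair measurable_component_singleton) auto
    from measurable_compose[OF this g(1)[OF that]] show ?thesis by simp
  qed
  then show "(\<lambda>w. \<Prod>a<n. g a (w a) (w (n + \<sigma> a))) \<in> borel_measurable (PiM {..<2 * n} (\<lambda>_. M))"
    by (intro borel_measurable_prod) auto
  have "(\<integral>\<^sup>+w. ennreal ((\<Prod>a<n. g a (w a) (w (n + \<sigma> a)))\<^sup>2) \<partial>PiM {..<2 * n} (\<lambda>_. M))
    = (\<integral>\<^sup>+w. (\<Prod>a\<in>{..<n}. ennreal ((g a (w (id a)) (w (n + \<sigma> a)))\<^sup>2)) \<partial>PiM (id ` {..<n} \<union> (\<lambda>a. n + \<sigma> a) ` {..<n}) (\<lambda>_. M))"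
    using upt_image_shift_permutes[OF p] by (simp add: prod_ennreal prod_power_distrib)
  also have "\<dots> = (\<Prod>a\<in>{..<n}. \<integral>\<^sup>+z. case_prod (\<lambda>x y. ennreal ((g a x y)\<^sup>2)) z \<partial>(M \<Otimes>\<^sub>M M))"
  proof (rule nn_integral_PiM_pairs[OF M, of "{..<n}" id _ "\<lambda>a x y. ennreal ((g a x y)\<^sup>2)"])
    show "inj_on (\<lambda>a. n + \<sigma> a) {..<n}"
      using permutes_inj_on[OF p] by (auto simp: inj_on_def)
    show "id ` {..<n} \<inter> (\<lambda>a. n + \<sigma> a) ` {..<n} = {}" by auto
    fix a assume "a \<in> {..<n}"
    then have ga: "case_prod (g a) \<in> borel_measurable (M \<Otimes>\<^sub>M M)" using g(1) by simp
    have "(\<lambda>z. ennreal ((case_prod (g a) z)\<^sup>2)) \<in> borel_measurable (M \<Otimes>\<^sub>M M)"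
      using ga by measurable
    then show "(\<lambda>(x, y). ennreal ((g a x y)\<^sup>2)) \<in> borel_measurable (M \<Otimes>\<^sub>M M)"
      by (simp add: case_prod_unfold)
  qed auto
  also have "\<dots> \<le> (\<Prod>a\<in>{..<n}. D)"
    using g(2) by (intro prod_mono_ennreal) (simp add: case_prod_unfold)
  finally show "(\<integral>\<^sup>+w. ennreal ((\<Prod>a<n. g a (w a) (w (n + \<sigma> a)))\<^sup>2) \<partial>PiM {..<2 * n} (\<lambda>_. M)) \<le> D ^ n"
    by simp
qed

text \<open>The points w 0, ..., w (n - 1) are the rows and w n, ..., w (2n - 1) the columns. With c
  = sign this is a determinant; the conservation law holds for every choice of weights.\<close>

definition perm_form :: "((nat \<Rightarrow> nat) \<Rightarrow> real) \<Rightarrow> nat \<Rightarrow> ('a \<Rightarrow> 'a \<Rightarrow> real) \<Rightarrow> (nat \<Rightarrow> 'a) \<Rightarrow> real" where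
  "perm_form c n K w = (\<Sum>\<sigma> | \<sigma> permutes {..<n}. c \<sigma> * (\<Prod>a<n. K (w a) (w (n + \<sigma> a))))"

text \<open>\<open>A\<close> stands for B K with B formally skew-adjoint. As \<open>K\<close> is
  antisymmetric, \<open>lax\<close> then reads K_t = [B, K], and \<open>skew\<close> says that the
  transpose of K times B K is skew. Square integrability of \<open>K\<close> is assumed at time 0
  only. \<open>AK_int\<close> and \<open>skew\<close> are stated for all q and r because the other
  coordinates are frozen while one row is integrated.\<close>

locale lax_kernel = sigma_finite_measure M for M :: "'a measure" +
  fixes K Kd A :: "real \<Rightarrow> 'a \<Rightarrow> 'a \<Rightarrow> real" and C :: real
  assumes deriv: "\<And>s p q. s \<in> {0..1} \<Longrightarrow> ((\<lambda>s. K s p q) has_real_derivative Kd s p q) (at s within {0..1})"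
    and cont_Kd: "\<And>p q. continuous_on {0..1} (\<lambda>s. Kd s p q)"
    and K_meas: "(\<lambda>(s, z). K s (fst z) (snd z)) \<in> borel_measurable (lborel \<Otimes>\<^sub>M (M \<Otimes>\<^sub>M M))"
    and Kd_meas: "(\<lambda>(s, z). Kd s (fst z) (snd z)) \<in> borel_measurable (lborel \<Otimes>\<^sub>M (M \<Otimes>\<^sub>M M))"
    and lax: "\<And>s p q. s \<in> {0..1} \<Longrightarrow> Kd s p q = A s p q - A s q p"
    and anti: "\<And>s p q. s \<in> {0..1} \<Longrightarrow> K s q p = - K s p q"
    and A_meas: "\<And>s. s \<in> {0..1} \<Longrightarrow> (\<lambda>(p, q). A s p q) \<in> borel_measurable (M \<Otimes>\<^sub>M M)"
    and A_bound: "\<And>s. s \<in> {0..1} \<Longrightarrow> (\<integral>\<^sup>+z. ennreal ((A s (fst z) (snd z))\<^sup>2) \<partial>(M \<Otimes>\<^sub>M M)) \<le> ennreal C"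
    and K0: "(\<integral>\<^sup>+z. ennreal ((K 0 (fst z) (snd z))\<^sup>2) \<partial>(M \<Otimes>\<^sub>M M)) < \<infinity>"
    and AK_int: "\<And>s q r. s \<in> {0..1} \<Longrightarrow> integrable M (\<lambda>p. A s p q * K s p r)"
    and skew: "\<And>s q r. s \<in> {0..1} \<Longrightarrow> (LINT p|M. A s p q * K s p r) = - (LINT p|M. A s p r * K s p q)"
begin

lemma section_meas:
  assumes "(\<lambda>(s, z). G s (fst z) (snd z)) \<in> borel_measurable (lborel \<Otimes>\<^sub>M (M \<Otimes>\<^sub>M M))"
  shows "(\<lambda>(p, q). G s p q) \<in> borel_measurable (M \<Otimes>\<^sub>M M)"
proof -
  have "(\<lambda>z. (s, z)) \<in> M \<Otimes>\<^sub>M M \<rightarrow>\<^sub>M lborel \<Otimes>\<^sub>M (M \<Otimes>\<^sub>M M)" by simp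
  from measurable_compose[OF this assms] show ?thesis by (simp add: case_prod_unfold)
qed

lemma A_swap:
  assumes "s \<in> {0..1}"
  shows "(\<lambda>(p, q). A s q p) \<in> borel_measurable (M \<Otimes>\<^sub>M M)"
    and "(\<integral>\<^sup>+z. ennreal ((A s (snd z) (fst z))\<^sup>2) \<partial>(M \<Otimes>\<^sub>M M)) \<le> ennreal C"
proof -
  note fubini = nn_integral_fst
  interpret pair_sigma_finite M M ..
  show "(\<lambda>(p, q). A s q p) \<in> borel_measurable (M \<Otimes>\<^sub>M M)"
    using measurable_pair_swap[OF A_meas[OF assms]] by (simp add: case_prod_unfold)
  have "(\<lambda>z. ennreal ((A s (fst z) (snd z))\<^sup>2)) \<in> borel_measurable (M \<Otimes>\<^sub>M M)"
    using A_meas[OF assms] by (simp add: case_prod_unfold)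
  then have "(\<integral>\<^sup>+q. \<integral>\<^sup>+p. ennreal ((A s p q)\<^sup>2) \<partial>M \<partial>M) = (\<integral>\<^sup>+z. ennreal ((A s (fst z) (snd z))\<^sup>2) \<partial>(M \<Otimes>\<^sub>M M))"
    using nn_integral_snd[of "\<lambda>z. ennreal ((A s (fst z) (snd z))\<^sup>2)"] by simp
  moreover have "(\<integral>\<^sup>+q. \<integral>\<^sup>+p. ennreal ((A s p q)\<^sup>2) \<partial>M \<partial>M) = (\<integral>\<^sup>+z. ennreal ((A s (snd z) (fst z))\<^sup>2) \<partial>(M \<Otimes>\<^sub>M M))"
    using fubini[of "\<lambda>z. ennreal ((A s (snd z) (fst z))\<^sup>2)" M] measurable_pair_swap[OF A_meas[OF assms]]
    by (simp add: case_prod_unfold)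
  ultimately have "(\<integral>\<^sup>+z. ennreal ((A s (snd z) (fst z))\<^sup>2) \<partial>(M \<Otimes>\<^sub>M M)) = (\<integral>\<^sup>+z. ennreal ((A s (fst z) (snd z))\<^sup>2) \<partial>(M \<Otimes>\<^sub>M M))"
    by simp
  with A_bound[OF assms] show "(\<integral>\<^sup>+z. ennreal ((A s (snd z) (fst z))\<^sup>2) \<partial>(M \<Otimes>\<^sub>M M)) \<le> ennreal C" by simp
qed

lemma Kd_bound:
  assumes "s \<in> {0..1}"
  shows "(\<integral>\<^sup>+z. ennreal ((Kd s (fst z) (snd z))\<^sup>2) \<partial>(M \<Otimes>\<^sub>M M)) \<le> ennreal (4 * \<bar>C\<bar>)"
proof -
  have [measurable]: "(\<lambda>z. A s (fst z) (snd z)) \<in> borel_measurable (M \<Otimes>\<^sub>M M)"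
     "(\<lambda>z. A s (snd z) (fst z)) \<in> borel_measurable (M \<Otimes>\<^sub>M M)"
    using A_meas[OF assms] A_swap(1)[OF assms] unfolding case_prod_unfold by this
  have "(\<integral>\<^sup>+z. ennreal ((Kd s (fst z) (snd z))\<^sup>2) \<partial>(M \<Otimes>\<^sub>M M)) \<le>
    (\<integral>\<^sup>+z. 2 * ennreal ((A s (fst z) (snd z))\<^sup>2) + 2 * ennreal ((A s (snd z) (fst z))\<^sup>2) \<partial>(M \<Otimes>\<^sub>M M))"
  proof (intro nn_integral_mono)
    fix z
    have "(a - b)\<^sup>2 \<le> 2 * a\<^sup>2 + 2 * b\<^sup>2" for a b :: real
      using zero_le_power2[of "a + b"] by (simp add: power2_eq_square algebra_simps)
    then have "ennreal ((Kd s (fst z) (snd z))\<^sup>2) \<le> ennreal (2 * (A s (fst z) (snd z))\<^sup>2 + 2 * (A s (snd z) (fst z))\<^sup>2)"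
      unfolding lax[OF assms] by (intro ennreal_leI)
    then show "ennreal ((Kd s (fst z) (snd z))\<^sup>2) \<le> 2 * ennreal ((A s (fst z) (snd z))\<^sup>2) + 2 * ennreal ((A s (snd z) (fst z))\<^sup>2)"
      by (simp add: ennreal_mult)
  qed
  also have "\<dots> = 2 * (\<integral>\<^sup>+z. ennreal ((A s (fst z) (snd z))\<^sup>2) \<partial>(M \<Otimes>\<^sub>M M)) + 2 * (\<integral>\<^sup>+z. ennreal ((A s (snd z) (fst z))\<^sup>2) \<partial>(M \<Otimes>\<^sub>M M))"
    by (simp add: nn_integral_add nn_integral_cmult)
  also have "\<dots> \<le> 2 * ennreal \<bar>C\<bar> + 2 * ennreal \<bar>C\<bar>"
    using A_bound[OF assms] A_swap(2)[OF assms]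
    by (intro add_mono mult_left_mono) (auto elim!: order.trans intro!: ennreal_leI)
  also have "\<dots> = ennreal (4 * \<bar>C\<bar>)"
  proof -
    have "ennreal (4 * \<bar>C\<bar>) = ennreal (2 * \<bar>C\<bar> + 2 * \<bar>C\<bar>)" by simp
    also have "\<dots> = 2 * ennreal \<bar>C\<bar> + 2 * ennreal \<bar>C\<bar>"
      by (subst ennreal_plus) (auto simp: ennreal_mult)
    finally show ?thesis ..
  qed
  finally show ?thesis .
qed

text \<open>The initial bound is transported by the time derivative:
  \<open>sq_le_integral_sq_deriv\<close> holds at every pair of points, and Tonelli replaces the
  time integral of the square of \<open>Kd\<close> by its uniform bound on [0, 1].\<close>

lemma K_bound:
  obtains B where "\<And>s. s \<in> {0..1} \<Longrightarrow> (\<integral>\<^sup>+z. ennreal ((K s (fst z) (snd z))\<^sup>2) \<partial>(M \<Otimes>\<^sub>M M)) \<le> ennreal B"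
proof -
  interpret MM: pair_sigma_finite M M ..
  interpret L: pair_sigma_finite lborel "M \<Otimes>\<^sub>M M" ..
  let ?k0 = "\<integral>\<^sup>+z. ennreal ((K 0 (fst z) (snd z))\<^sup>2) \<partial>(M \<Otimes>\<^sub>M M)"
  have [measurable]: "(\<lambda>z. K 0 (fst z) (snd z)) \<in> borel_measurable (M \<Otimes>\<^sub>M M)"
    using section_meas[OF K_meas] by (simp add: case_prod_unfold)
  let ?G = "\<lambda>s z. ennreal ((Kd s (fst z) (snd z))\<^sup>2) * indicator {0..1} s"
  have Gm: "case_prod ?G \<in> borel_measurable (lborel \<Otimes>\<^sub>M (M \<Otimes>\<^sub>M M))"
    using Kd_meas by (simp add: case_prod_unfold)
  have Gm': "(\<lambda>z. \<integral>\<^sup>+s. ?G s z \<partial>lborel) \<in> borel_measurable (M \<Otimes>\<^sub>M M)"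
    using lborel.borel_measurable_nn_integral_fst[of "\<lambda>(z, s). ?G s z" "M \<Otimes>\<^sub>M M"] measurable_pair_swap[OF Gm]
    by (simp add: case_prod_unfold)
  have "(\<integral>\<^sup>+z. ennreal ((K s (fst z) (snd z))\<^sup>2) \<partial>(M \<Otimes>\<^sub>M M)) \<le> 2 * ?k0 + 2 * ennreal (4 * \<bar>C\<bar>)"
    if s: "s \<in> {0..1}" for s
  proof -
    have "(\<integral>\<^sup>+z. ennreal ((K s (fst z) (snd z))\<^sup>2) \<partial>(M \<Otimes>\<^sub>M M)) \<le>
      (\<integral>\<^sup>+z. 2 * ennreal ((K 0 (fst z) (snd z))\<^sup>2) + 2 * (\<integral>\<^sup>+s. ?G s z \<partial>lborel) \<partial>(M \<Otimes>\<^sub>M M))"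
      by (intro nn_integral_mono sq_le_integral_sq_deriv deriv cont_Kd s)
    also have "\<dots> = 2 * ?k0 + 2 * (\<integral>\<^sup>+z. \<integral>\<^sup>+s. ?G s z \<partial>lborel \<partial>(M \<Otimes>\<^sub>M M))"
      using Gm' by (simp add: nn_integral_add nn_integral_cmult)
    also have "(\<integral>\<^sup>+z. \<integral>\<^sup>+s. ?G s z \<partial>lborel \<partial>(M \<Otimes>\<^sub>M M)) = (\<integral>\<^sup>+s. \<integral>\<^sup>+z. ?G s z \<partial>(M \<Otimes>\<^sub>M M) \<partial>lborel)"
      using L.Fubini'[OF Gm] by simp
    also have "\<dots> \<le> (\<integral>\<^sup>+s. ennreal (4 * \<bar>C\<bar>) * indicator {0..1} (s::real) \<partial>lborel)"
    proof (intro nn_integral_mono)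
      fix s :: real
      show "(\<integral>\<^sup>+z. ?G s z \<partial>(M \<Otimes>\<^sub>M M)) \<le> ennreal (4 * \<bar>C\<bar>) * indicator {0..1} s"
        using Kd_bound[of s] by (cases "s \<in> {0..1}") auto
    qed
    also have "\<dots> = ennreal (4 * \<bar>C\<bar>)" by (simp add: nn_integral_cmult_indicator)
    finally show ?thesis by (simp add: add_left_mono mult_left_mono)
  qed
  moreover have "2 * ?k0 + 2 * ennreal (4 * \<bar>C\<bar>) < top"
    using K0 by (auto simp: ennreal_mult_less_top less_top)
  ultimately show ?thesis
    using that[of "enn2real (2 * ?k0 + 2 * ennreal (4 * \<bar>C\<bar>))"] by (auto simp: less_top)
qed

end

context lax_kernel
begin

lemma component_pair_meas:
  assumes "(\<lambda>(s, z). G s (fst z) (snd z)) \<in> borel_measurable (lborel \<Otimes>\<^sub>M (M \<Otimes>\<^sub>M M))" "i \<in> I" "j \<in> I"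
  shows "(\<lambda>(s, w). G s (w i) (w j)) \<in> borel_measurable (lborel \<Otimes>\<^sub>M PiM I (\<lambda>_. M))"
proof -
  have "(\<lambda>z. (fst z, (snd z i, snd z j))) \<in> lborel \<Otimes>\<^sub>M PiM I (\<lambda>_. M) \<rightarrow>\<^sub>M lborel \<Otimes>\<^sub>M (M \<Otimes>\<^sub>M M)"
    using assms(2,3) by measurable
  from measurable_compose[OF this assms(1)] show ?thesis
    by (simp add: case_prod_unfold)
qed

text \<open>For F the form of \<open>K s\<close>, the integral of 2 F F_s over the points vanishes
  for each s: F_s is a sum of row terms \<open>X\<close> minus column terms \<open>Y\<close>, each
  orthogonal to F. The fundamental theorem is applied at fixed w and the s-integral is exchanged
  with the w-integral, so the integral of F^2 is never differentiated.\<close>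

lemma perm_form_zero:
  assumes start: "AE w in PiM {..<2 * n} (\<lambda>_. M). perm_form c n (K 0) w = 0"
  shows "AE w in PiM {..<2 * n} (\<lambda>_. M). perm_form c n (K 1) w = 0"
proof -
  let ?N = "PiM {..<2 * n} (\<lambda>_. M)"
  let ?P = "{\<sigma>. \<sigma> permutes {..<n}}"
  interpret product_sigma_finite "\<lambda>_ :: nat. M" by standard
  interpret N: sigma_finite_measure ?N by (rule sigma_finite) simp
  interpret L: pair_sigma_finite lborel ?N ..
  have finP: "finite ?P" by (simp add: finite_permutations)
  have perm_lt: "\<sigma> a < n" if "\<sigma> \<in> ?P" "a < n" for \<sigma> a
    using permutes_in_image[of \<sigma> "{..<n}" a] that by simp
  have inv_lt: "inv \<sigma> a < n" if "\<sigma> \<in> ?P" "a < n" for \<sigma> a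
    using permutes_in_image[OF permutes_inv, of \<sigma> "{..<n}" a] that by simp
  define F where "F s w = perm_form c n (K s) w" for s w
  define R where "R s \<sigma> a w = c \<sigma> * (\<Prod>b\<in>{..<n} - {a}. K s (w b) (w (n + \<sigma> b)))" for s \<sigma> a and w :: "nat \<Rightarrow> 'a"
  define Fd where "Fd s w = (\<Sum>\<sigma>\<in>?P. \<Sum>a<n. Kd s (w a) (w (n + \<sigma> a)) * R s \<sigma> a w)" for s w
  define X where "X s a w = (\<Sum>\<sigma>\<in>?P. A s (w a) (w (n + \<sigma> a)) * R s \<sigma> a w)" for s a w
  \<comment> \<open>Column b meets row inv \<sigma> b. The terms A(q, p) of the Lax equation are
    grouped by columns so that the variable w (n + b) stands in the first argument of
    \<open>A\<close>.\<close>
  define Y where "Y s b w = (\<Sum>\<sigma>\<in>?P. A s (w (n + b)) (w (inv \<sigma> b)) * R s \<sigma> (inv \<sigma> b) w)" for s b w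
  obtain B where B: "\<And>s. s \<in> {0..1} \<Longrightarrow> (\<integral>\<^sup>+z. ennreal ((K s (fst z) (snd z))\<^sup>2) \<partial>(M \<Otimes>\<^sub>M M)) \<le> ennreal B"
    using K_bound by blast
  define D where "D = ennreal (max \<bar>B\<bar> (4 * \<bar>C\<bar>))"
  have D: "(\<integral>\<^sup>+z. ennreal ((K s (fst z) (snd z))\<^sup>2) \<partial>(M \<Otimes>\<^sub>M M)) \<le> D"
    "(\<integral>\<^sup>+z. ennreal ((Kd s (fst z) (snd z))\<^sup>2) \<partial>(M \<Otimes>\<^sub>M M)) \<le> D"
    "(\<integral>\<^sup>+z. ennreal ((A s (fst z) (snd z))\<^sup>2) \<partial>(M \<Otimes>\<^sub>M M)) \<le> D"
    "(\<integral>\<^sup>+z. ennreal ((A s (snd z) (fst z))\<^sup>2) \<partial>(M \<Otimes>\<^sub>M M)) \<le> D"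
    if s: "s \<in> {0..1}" for s
  proof -
    have *: "ennreal B \<le> D" "ennreal (4 * \<bar>C\<bar>) \<le> D" "ennreal C \<le> D"
      unfolding D_def by (auto intro!: ennreal_leI)
    show "(\<integral>\<^sup>+z. ennreal ((K s (fst z) (snd z))\<^sup>2) \<partial>(M \<Otimes>\<^sub>M M)) \<le> D"
      by (rule order.trans[OF B[OF s] *(1)])
    show "(\<integral>\<^sup>+z. ennreal ((Kd s (fst z) (snd z))\<^sup>2) \<partial>(M \<Otimes>\<^sub>M M)) \<le> D"
      by (rule order.trans[OF Kd_bound[OF s] *(2)])
    show "(\<integral>\<^sup>+z. ennreal ((A s (fst z) (snd z))\<^sup>2) \<partial>(M \<Otimes>\<^sub>M M)) \<le> D"
      by (rule order.trans[OF A_bound[OF s] *(3)])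
    show "(\<integral>\<^sup>+z. ennreal ((A s (snd z) (fst z))\<^sup>2) \<partial>(M \<Otimes>\<^sub>M M)) \<le> D"
      by (rule order.trans[OF A_swap(2)[OF s] *(3)])
  qed
  have Dfin: "D < top" by (simp add: D_def)

  have tm: "(\<lambda>w. G (w a) (w (n + \<sigma> a)) * (\<Prod>b\<in>{..<n} - {a}. K s (w b) (w (n + \<sigma> b)))) \<in> borel_measurable ?N"
     "(\<integral>\<^sup>+w. ennreal ((G (w a) (w (n + \<sigma> a)) * (\<Prod>b\<in>{..<n} - {a}. K s (w b) (w (n + \<sigma> b))))\<^sup>2) \<partial>?N) \<le> D ^ n"
    if s: "s \<in> {0..1}" and \<sigma>: "\<sigma> \<in> ?P" and a: "a < n"
      and G: "(\<lambda>(p, q). G p q) \<in> borel_measurable (M \<Otimes>\<^sub>M M)" "(\<integral>\<^sup>+z. ennreal ((G (fst z) (snd z))\<^sup>2) \<partial>(M \<Otimes>\<^sub>M M)) \<le> D"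
    for s \<sigma> a and G :: "'a \<Rightarrow> 'a \<Rightarrow> real"
  proof -
    let ?g = "\<lambda>b. if b = a then G else K s"
    have eq: "(\<Prod>b<n. ?g b (w b) (w (n + \<sigma> b))) =
      G (w a) (w (n + \<sigma> a)) * (\<Prod>b\<in>{..<n} - {a}. K s (w b) (w (n + \<sigma> b)))" for w
      using a by (subst prod.remove[of _ a]) (auto intro!: prod.cong)
    have g1: "case_prod (?g b) \<in> borel_measurable (M \<Otimes>\<^sub>M M)" for b
      using G(1) section_meas[OF K_meas, of s] by auto
    have g2: "(\<integral>\<^sup>+z. ennreal ((case_prod (?g b) z)\<^sup>2) \<partial>(M \<Otimes>\<^sub>M M)) \<le> D" for b
      using G(2) D(1)[OF s] by (auto simp: case_prod_unfold)
    show "(\<lambda>w. G (w a) (w (n + \<sigma> a)) * (\<Prod>b\<in>{..<n} - {a}. K s (w b) (w (n + \<sigma> b)))) \<in> borel_measurable ?N"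
      using sq_pair_product(1)[OF sigma_finite_measure_axioms, of \<sigma> n ?g D] \<sigma> g1 g2 unfolding eq by auto
    show "(\<integral>\<^sup>+w. ennreal ((G (w a) (w (n + \<sigma> a)) * (\<Prod>b\<in>{..<n} - {a}. K s (w b) (w (n + \<sigma> b))))\<^sup>2) \<partial>?N) \<le> D ^ n"
      using sq_pair_product(2)[OF sigma_finite_measure_axioms, of \<sigma> n ?g D] \<sigma> g1 g2 unfolding eq by auto
  qed
  have tmK: "(\<lambda>w. \<Prod>b<n. K s (w b) (w (n + \<sigma> b))) \<in> borel_measurable ?N"
     "(\<integral>\<^sup>+w. ennreal ((\<Prod>b<n. K s (w b) (w (n + \<sigma> b)))\<^sup>2) \<partial>?N) \<le> D ^ n"
    if s: "s \<in> {0..1}" and \<sigma>: "\<sigma> \<in> ?P" for s \<sigma>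
    using sq_pair_product[OF sigma_finite_measure_axioms, of \<sigma> n "\<lambda>_. K s" D] \<sigma>
      section_meas[OF K_meas, of s] D(1)[OF s] by (auto simp: case_prod_unfold)

  have F_eq: "F s w = (\<Sum>\<sigma>\<in>?P. c \<sigma> * (\<Prod>b<n. K s (w b) (w (n + \<sigma> b))))" for s w
    by (simp add: F_def perm_form_def)
  have F_bd: "(\<integral>\<^sup>+w. ennreal ((F s w)\<^sup>2) \<partial>?N) \<le> ennreal (card ?P * (\<Sum>\<sigma>\<in>?P. (c \<sigma>)\<^sup>2)) * D ^ n"
    if "s \<in> {0..1}" for s
    unfolding F_eq by (rule nn_integral_sq_sum_le[where \<alpha>=c and t="\<lambda>\<sigma> w. \<Prod>b<n. K s (w b) (w (n + \<sigma> b))"]) (auto intro: tmK that)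
  have F_meas: "F s \<in> borel_measurable ?N" if "s \<in> {0..1}" for s
    unfolding F_eq by (intro borel_measurable_sum borel_measurable_times borel_measurable_const tmK that)
  have F_sq: "sq_integrable ?N (F s)" if "s \<in> {0..1}" for s
    unfolding sq_integrable_iff_nn using F_meas[OF that] F_bd[OF that] Dfin
    by (auto simp: ennreal_mult_less_top power_less_top_ennreal elim!: le_less_trans)
  have Fd_eq: "Fd s w = (\<Sum>j\<in>?P \<times> {..<n}. c (fst j) *
      (Kd s (w (snd j)) (w (n + fst j (snd j))) * (\<Prod>b\<in>{..<n} - {snd j}. K s (w b) (w (n + fst j b)))))" for s w
    unfolding Fd_def R_def by (simp add: sum.cartesian_product case_prod_unfold mult_ac)
  have Fd_bd: "(\<integral>\<^sup>+w. ennreal ((Fd s w)\<^sup>2) \<partial>?N) \<le>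
      ennreal (card (?P \<times> {..<n}) * (\<Sum>j\<in>?P \<times> {..<n}. (c (fst j))\<^sup>2)) * D ^ n" if s: "s \<in> {0..1}" for s
    unfolding Fd_eq
    by (rule nn_integral_sq_sum_le[where \<alpha>="\<lambda>j. c (fst j)" and t="\<lambda>j w. Kd s (w (snd j)) (w (n + fst j (snd j))) * (\<Prod>b\<in>{..<n} - {snd j}. K s (w b) (w (n + fst j b)))"])
      (auto intro!: tm s D section_meas[OF Kd_meas])
  have sqX: "sq_integrable ?N (X s a)" if s: "s \<in> {0..1}" and a: "a < n" for s a
    unfolding X_def
  proof (intro sq_integrable_sum)
    fix \<sigma> assume \<sigma>: "\<sigma> \<in> ?P"
    have "sq_integrable ?N (\<lambda>w. A s (w a) (w (n + \<sigma> a)) * (\<Prod>b\<in>{..<n} - {a}. K s (w b) (w (n + \<sigma> b))))"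
      unfolding sq_integrable_iff_nn using tm[OF s \<sigma> a A_meas[OF s] D(3)[OF s]] Dfin
      by (auto simp: power_less_top_ennreal elim!: le_less_trans)
    from sq_integrable_cmult[OF this, of "c \<sigma>"]
    show "sq_integrable ?N (\<lambda>w. A s (w a) (w (n + \<sigma> a)) * R s \<sigma> a w)" by (simp add: R_def mult_ac)
  qed
  have sqY: "sq_integrable ?N (Y s b)" if s: "s \<in> {0..1}" and b: "b < n" for s b
    unfolding Y_def
  proof (intro sq_integrable_sum)
    fix \<sigma> assume \<sigma>: "\<sigma> \<in> ?P"
    have \<sigma>i: "\<sigma> (inv \<sigma> b) = b" using \<sigma> by (simp add: permutes_inverses)
    have "sq_integrable ?N (\<lambda>w. A s (w (n + \<sigma> (inv \<sigma> b))) (w (inv \<sigma> b)) * (\<Prod>b'\<in>{..<n} - {inv \<sigma> b}. K s (w b') (w (n + \<sigma> b'))))"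
      unfolding sq_integrable_iff_nn
      using tm[OF s \<sigma> inv_lt[OF \<sigma> b], of "\<lambda>p q. A s q p"] A_swap(1)[OF s] D(4)[OF s] Dfin
      by (auto simp: power_less_top_ennreal elim!: le_less_trans)
    from sq_integrable_cmult[OF this, of "c \<sigma>"]
    show "sq_integrable ?N (\<lambda>w. A s (w (n + b)) (w (inv \<sigma> b)) * R s \<sigma> (inv \<sigma> b) w)" by (simp add: R_def mult_ac \<sigma>i)
  qed

  have FX: "F s w = (\<Sum>\<sigma>\<in>?P. K s (w a) (w (n + \<sigma> a)) * R s \<sigma> a w)" if "a < n" for s w a
    unfolding F_eq R_def using that by (intro sum.cong refl) (simp add: prod.remove[of "{..<n}" a] mult_ac)
  \<comment> \<open>The sign is the cost of transposing the one entry in column b, by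
    \<open>anti\<close>.\<close>
  have FY: "- F s w = (\<Sum>\<sigma>\<in>?P. K s (w (n + b)) (w (inv \<sigma> b)) * R s \<sigma> (inv \<sigma> b) w)"
    if s: "s \<in> {0..1}" and b: "b < n" for s w b
    unfolding F_eq R_def sum_negf[symmetric]
  proof (intro sum.cong refl)
    fix \<sigma> assume \<sigma>: "\<sigma> \<in> ?P"
    have \<sigma>i: "\<sigma> (inv \<sigma> b) = b" using \<sigma> by (simp add: permutes_inverses)
    show "- (c \<sigma> * (\<Prod>b<n. K s (w b) (w (n + \<sigma> b)))) = K s (w (n + b)) (w (inv \<sigma> b)) * (c \<sigma> * (\<Prod>b\<in>{..<n} - {inv \<sigma> b}. K s (w b) (w (n + \<sigma> b))))"
      using prod.remove[of "{..<n}" "inv \<sigma> b" "\<lambda>b. K s (w b) (w (n + \<sigma> b))"] inv_lt[OF \<sigma> b] anti[OF s, of "w (n + b)" "w (inv \<sigma> b)"] \<sigma>i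
      by (simp add: mult_ac)
  qed
  have X0: "(LINT w|?N. X s a w * F s w) = 0" if s: "s \<in> {0..1}" and a: "a < n" for s a
    unfolding X_def FX[OF a]
  proof (rule PiM_skew_integral_zero[OF sigma_finite_measure_axioms])
    show "integrable ?N (\<lambda>w. (\<Sum>\<sigma>\<in>?P. A s (w a) (w (n + \<sigma> a)) * R s \<sigma> a w) * (\<Sum>\<sigma>\<in>?P. K s (w a) (w (n + \<sigma> a)) * R s \<sigma> a w))"
      using sq_integrable_mult[OF sqX[OF s a] F_sq[OF s]] unfolding X_def FX[OF a] by simp
    show "R s k a (w(a := y)) = R s k a w" if "k \<in> ?P" for k w y
      using a by (auto simp: R_def intro!: prod.cong)
  qed (use a in \<open>auto intro: AK_int[OF s] skew[OF s]\<close>)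
  have Y0: "(LINT w|?N. Y s b w * (- F s w)) = 0" if s: "s \<in> {0..1}" and b: "b < n" for s b
    unfolding Y_def FY[OF s b]
  proof (rule PiM_skew_integral_zero[OF sigma_finite_measure_axioms])
    show "integrable ?N (\<lambda>w. (\<Sum>\<sigma>\<in>?P. A s (w (n + b)) (w (inv \<sigma> b)) * R s \<sigma> (inv \<sigma> b) w) *
         (\<Sum>\<sigma>\<in>?P. K s (w (n + b)) (w (inv \<sigma> b)) * R s \<sigma> (inv \<sigma> b) w))"
      using sq_integrable_mult[OF sqY[OF s b] sq_integrable_uminus[OF F_sq[OF s]]] unfolding Y_def FY[OF s b] by simp
    \<comment> \<open>Every row other than inv k b is paired with a column other than b, so this
      cofactor does not see w (n + b).\<close>
    show "R s k (inv k b) (w(n + b := y)) = R s k (inv k b) w" if k: "k \<in> ?P" for k w y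
    proof -
      have "k b' \<noteq> b" if "b' \<noteq> inv k b" for b'
        using k that by (metis mem_Collect_eq permutes_inv_eq)
      then show ?thesis by (auto simp: R_def intro!: prod.cong)
    qed
    show "(w(n + b := y)) (inv k b) = w (inv k b)" if k: "k \<in> ?P" for k y and w :: "nat \<Rightarrow> 'a"
      using inv_lt[OF k b] by simp
  qed (use b in \<open>auto intro: AK_int[OF s] skew[OF s]\<close>)

  have Fd_XY: "Fd s w = (\<Sum>a<n. X s a w) - (\<Sum>b<n. Y s b w)" if s: "s \<in> {0..1}" for s w
  proof -
    have "Fd s w = (\<Sum>\<sigma>\<in>?P. \<Sum>a<n. A s (w a) (w (n + \<sigma> a)) * R s \<sigma> a w) - (\<Sum>\<sigma>\<in>?P. \<Sum>a<n. A s (w (n + \<sigma> a)) (w a) * R s \<sigma> a w)"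
      unfolding Fd_def lax[OF s] by (simp add: left_diff_distrib sum_subtractf)
    also have "(\<Sum>\<sigma>\<in>?P. \<Sum>a<n. A s (w (n + \<sigma> a)) (w a) * R s \<sigma> a w) =
       (\<Sum>\<sigma>\<in>?P. \<Sum>b<n. A s (w (n + b)) (w (inv \<sigma> b)) * R s \<sigma> (inv \<sigma> b) w)"
    proof (rule sum.cong[OF refl])
      fix \<sigma> assume \<sigma>: "\<sigma> \<in> ?P"
      then have \<sigma>i: "\<sigma> (inv \<sigma> b) = b" for b by (simp add: permutes_inverses)
      show "(\<Sum>a<n. A s (w (n + \<sigma> a)) (w a) * R s \<sigma> a w) = (\<Sum>b<n. A s (w (n + b)) (w (inv \<sigma> b)) * R s \<sigma> (inv \<sigma> b) w)"
        using sum.permute[OF permutes_inv, of \<sigma> "{..<n}" "\<lambda>a. A s (w (n + \<sigma> a)) (w a) * R s \<sigma> a w"] \<sigma>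
        by (simp add: o_def \<sigma>i)
    qed
    finally show ?thesis unfolding X_def Y_def by (simp add: sum.swap[of _ "{..<n}"])
  qed
  have FFd0: "(LINT w|?N. 2 * F s w * Fd s w) = 0" if s: "s \<in> {0..1}" for s
  proof -
    have "(LINT w|?N. 2 * F s w * Fd s w) =
      (LINT w|?N. 2 * ((\<Sum>a<n. X s a w * F s w) + (\<Sum>b<n. Y s b w * (- F s w))))"
      unfolding Fd_XY[OF s] by (simp add: right_diff_distrib sum_distrib_left mult_ac sum_negf)
    also have "\<dots> = 2 * ((\<Sum>a<n. LINT w|?N. X s a w * F s w) + (\<Sum>b<n. LINT w|?N. Y s b w * (- F s w)))"
    proof -
      have iX: "integrable ?N (\<lambda>w. X s a w * F s w)" if "a < n" for a
        by (rule sq_integrable_mult[OF sqX[OF s that] F_sq[OF s]])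
      have iY: "integrable ?N (\<lambda>w. Y s b w * (- F s w))" if "b < n" for b
        by (rule sq_integrable_mult[OF sqY[OF s that] sq_integrable_uminus[OF F_sq[OF s]]])
      have "(LINT w|?N. 2 * ((\<Sum>a<n. X s a w * F s w) + (\<Sum>b<n. Y s b w * (- F s w)))) =
        2 * ((LINT w|?N. (\<Sum>a<n. X s a w * F s w)) + (LINT w|?N. (\<Sum>b<n. Y s b w * (- F s w))))"
        unfolding integral_mult_right_zero
        by (subst Bochner_Integration.integral_add; (intro Bochner_Integration.integrable_sum iX iY)?) auto
      also have "(LINT w|?N. (\<Sum>a<n. X s a w * F s w)) = (\<Sum>a<n. LINT w|?N. X s a w * F s w)"
        by (intro Bochner_Integration.integral_sum iX) simp
      also have "(LINT w|?N. (\<Sum>b<n. Y s b w * (- F s w))) = (\<Sum>b<n. LINT w|?N. Y s b w * (- F s w))"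
        by (intro Bochner_Integration.integral_sum iY) simp
      finally show ?thesis .
    qed
    also have "\<dots> = 0" using X0[OF s] Y0[OF s] by simp
    finally show ?thesis .
  qed

  have dF: "((\<lambda>s. F s w) has_real_derivative Fd s w) (at s within {0..1})" if s: "s \<in> {0..1}" for s w
  proof -
    have p: "((\<lambda>s. \<Prod>b<n. K s (w b) (w (n + \<sigma> b))) has_real_derivative
         (\<Sum>a<n. Kd s (w a) (w (n + \<sigma> a)) * (\<Prod>b\<in>{..<n} - {a}. K s (w b) (w (n + \<sigma> b))))) (at s within {0..1})" for \<sigma>
      unfolding has_field_derivative_def
      by (rule has_derivative_eq_rhs[OF has_derivative_prod[of "{..<n}" "\<lambda>b s. K s (w b) (w (n + \<sigma> b))" "\<lambda>b y. Kd s (w b) (w (n + \<sigma> b)) * y" s "{0..1}"]])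
        (use deriv[OF s] in \<open>simp_all add: has_field_derivative_def fun_eq_iff sum_distrib_right sum_distrib_left mult_ac mult_commute_abs\<close>)
    show ?thesis unfolding F_eq
      by (rule DERIV_cong, rule DERIV_sum, rule DERIV_cmult[OF p])
        (simp add: Fd_def R_def sum_distrib_left mult_ac)
  qed
  have cont_K: "continuous_on {0..1} (\<lambda>s. K s p q)" for p q
    by (rule DERIV_continuous_on[OF deriv])
  have cont_Fd: "continuous_on {0..1} (\<lambda>s. Fd s w)" for w
    unfolding Fd_def R_def by (intro continuous_intros cont_Kd cont_K)
  have cont_F: "continuous_on {0..1} (\<lambda>s. F s w)" for w
    unfolding F_eq by (intro continuous_intros cont_K)
  have FTC: "AE w in ?N. (F 1 w)\<^sup>2 = (LINT s|lborel. indicator {0..1} s *\<^sub>R (2 * F s w * Fd s w))"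
    using start
  proof eventually_elim
    fix w assume w: "perm_form c n (K 0) w = 0"
    have "(LINT s|lborel. indicator {0..1} s *\<^sub>R (2 * F s w * Fd s w)) = (F 1 w)\<^sup>2 - (F 0 w)\<^sup>2"
    proof (rule integral_FTC_Icc)
      fix s :: real assume "0 \<le> s" "s \<le> 1"
      then have "((\<lambda>s. (F s w)\<^sup>2) has_real_derivative 2 * F s w * Fd s w) (at s within {0..1})"
        by (auto intro!: derivative_eq_intros dF)
      then show "((\<lambda>s. (F s w)\<^sup>2) has_vector_derivative 2 * F s w * Fd s w) (at s within {0..1})"
        by (simp add: has_real_derivative_iff_has_vector_derivative)
    qed (auto intro!: continuous_intros cont_F cont_Fd)
    then show "(F 1 w)\<^sup>2 = (LINT s|lborel. indicator {0..1} s *\<^sub>R (2 * F s w * Fd s w))"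
      using w by (simp add: F_def)
  qed

  let ?H = "\<lambda>s w. indicator {0..1} s *\<^sub>R (2 * F s w * Fd s w)"
  have Hm: "case_prod ?H \<in> borel_measurable (lborel \<Otimes>\<^sub>M ?N)"
  proof -
    have Km: "(\<lambda>x. K (fst x) (snd x a) (snd x (n + \<sigma> a))) \<in> borel_measurable (lborel \<Otimes>\<^sub>M ?N)"
      if "\<sigma> \<in> ?P" "a < n" for \<sigma> a
      using component_pair_meas[OF K_meas, of a "{..<2 * n}" "n + \<sigma> a"] perm_lt[OF that] that
      by (simp add: case_prod_unfold)
    have Kdm: "(\<lambda>x. Kd (fst x) (snd x a) (snd x (n + \<sigma> a))) \<in> borel_measurable (lborel \<Otimes>\<^sub>M ?N)"
      if "\<sigma> \<in> ?P" "a < n" for \<sigma> a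
      using component_pair_meas[OF Kd_meas, of a "{..<2 * n}" "n + \<sigma> a"] perm_lt[OF that] that
      by (simp add: case_prod_unfold)
    have "(\<lambda>x. F (fst x) (snd x)) \<in> borel_measurable (lborel \<Otimes>\<^sub>M ?N)"
      unfolding F_eq by (intro borel_measurable_sum borel_measurable_times borel_measurable_const borel_measurable_prod Km) auto
    moreover have "(\<lambda>x. Fd (fst x) (snd x)) \<in> borel_measurable (lborel \<Otimes>\<^sub>M ?N)"
      unfolding Fd_def R_def
      by (intro borel_measurable_sum borel_measurable_times borel_measurable_const borel_measurable_prod Km Kdm) auto
    ultimately show ?thesis by (simp add: case_prod_unfold)
  qed
  \<comment> \<open>|2 F F_s| is at most F^2 + F_s^2, and both squares have w-integrals bounded
    uniformly in s; this licenses the exchange of the integrals.\<close>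
  have Hint: "integrable (lborel \<Otimes>\<^sub>M ?N) (case_prod ?H)"
  proof (rule integrableI_bounded[OF Hm])
    let ?E = "ennreal (card ?P * (\<Sum>\<sigma>\<in>?P. (c \<sigma>)\<^sup>2)) * D ^ n + ennreal (card (?P \<times> {..<n}) * (\<Sum>j\<in>?P \<times> {..<n}. (c (fst j))\<^sup>2)) * D ^ n"
    have "(\<integral>\<^sup>+x. ennreal (norm (case_prod ?H x)) \<partial>(lborel \<Otimes>\<^sub>M ?N)) =
      (\<integral>\<^sup>+s. \<integral>\<^sup>+w. ennreal (norm (?H s w)) \<partial>?N \<partial>lborel)"
      using Hm by (subst N.nn_integral_fst[symmetric]) simp_all
    also have "\<dots> \<le> (\<integral>\<^sup>+s. ?E * indicator {0..1} (s::real) \<partial>lborel)"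
    proof (intro nn_integral_mono)
      fix s :: real
      show "(\<integral>\<^sup>+w. ennreal (norm (?H s w)) \<partial>?N) \<le> ?E * indicator {0..1} s"
      proof (cases "s \<in> {0..1}")
        case s: True
        have Fdm: "Fd s \<in> borel_measurable ?N"
          unfolding Fd_XY[OF s] using sqX[OF s] sqY[OF s]
          by (intro borel_measurable_diff borel_measurable_sum) (auto simp: sq_integrable_def)
        have "(\<integral>\<^sup>+w. ennreal (norm (?H s w)) \<partial>?N) \<le> (\<integral>\<^sup>+w. ennreal ((F s w)\<^sup>2) + ennreal ((Fd s w)\<^sup>2) \<partial>?N)"
        proof (intro nn_integral_mono)
          fix w
          have "\<bar>2 * F s w * Fd s w\<bar> \<le> (F s w)\<^sup>2 + (Fd s w)\<^sup>2"
            using sum_squares_bound[of "\<bar>F s w\<bar>" "\<bar>Fd s w\<bar>"] by (simp add: abs_mult)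
          then show "ennreal (norm (?H s w)) \<le> ennreal ((F s w)\<^sup>2) + ennreal ((Fd s w)\<^sup>2)"
            using s by (simp flip: ennreal_plus add: ennreal_leI)
        qed
        also have "\<dots> = (\<integral>\<^sup>+w. ennreal ((F s w)\<^sup>2) \<partial>?N) + (\<integral>\<^sup>+w. ennreal ((Fd s w)\<^sup>2) \<partial>?N)"
          using F_meas[OF s] Fdm by (intro nn_integral_add) auto
        also have "\<dots> \<le> ?E" by (intro add_mono F_bd Fd_bd s)
        finally show ?thesis using s by simp
      qed simp
    qed
    also have "\<dots> = ?E" by (simp add: nn_integral_cmult_indicator)
    also have "\<dots> < \<infinity>" using Dfin by (simp add: ennreal_mult_less_top power_less_top_ennreal)
    finally show "(\<integral>\<^sup>+x. ennreal (norm (case_prod ?H x)) \<partial>(lborel \<Otimes>\<^sub>M ?N)) < \<infinity>" .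
  qed
  have "(LINT w|?N. (F 1 w)\<^sup>2) = (LINT w|?N. LINT s|lborel. ?H s w)"
  proof (rule integral_cong_AE[OF _ _ FTC])
    show "(\<lambda>w. (F 1 w)\<^sup>2) \<in> borel_measurable ?N" using F_meas[of 1] by simp
    show "(\<lambda>w. LINT s|lborel. ?H s w) \<in> borel_measurable ?N"
      using L.integrable_snd[OF Hint] by (rule borel_measurable_integrable)
  qed
  also have "\<dots> = (LINT s|lborel. LINT w|?N. ?H s w)"
    by (rule L.Fubini_integral[OF Hint])
  also have "\<dots> = (LINT s|(lborel :: real measure). 0)"
  proof (rule Bochner_Integration.integral_cong[OF refl])
    fix s :: real
    show "(LINT w|?N. ?H s w) = 0"
      using FFd0[of s] by (cases "s \<in> {0..1}") auto
  qed
  finally have "(LINT w|?N. (F 1 w)\<^sup>2) = 0" by simp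
  then have "AE w in ?N. (F 1 w)\<^sup>2 = 0"
    using F_sq[of 1] by (subst (asm) integral_nonneg_eq_0_iff_AE) (auto simp: sq_integrable_def)
  then show ?thesis by (simp add: F_def)
qed

end

section \<open>The quaternionic Lax pair\<close>

text \<open>Left multiplication by the imaginary quaternion v, in the basis 1, i, j, k. Compared
  with complex 2 x 2 Pauli matrices this keeps the kernel real and makes every \<open>quat v\<close>
  a skew matrix.\<close>

definition quat :: "real ^ 3 \<Rightarrow> real ^ 4 ^ 4" where
  "quat v = vector [vector [0, - v$1, - v$2, - v$3],
                    vector [v$1, 0, - v$3, v$2],
                    vector [v$2, v$3, 0, - v$1],
                    vector [v$3, - v$2, v$1, 0]]"

lemma vector_4 [simp]:
  "(vector [a, b, c, d] :: 'a::zero ^ 4) $ 1 = a"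
  "(vector [a, b, c, d] :: 'a::zero ^ 4) $ 2 = b"
  "(vector [a, b, c, d] :: 'a::zero ^ 4) $ 3 = c"
  "(vector [a, b, c, d] :: 'a::zero ^ 4) $ 4 = d"
  unfolding vector_def by simp_all

lemma quat_linear: "linear quat"
  by (rule linearI) (simp_all add: quat_def vec_eq_iff forall_4)

lemmas quat_add = linear_add[OF quat_linear]
  and quat_diff = linear_diff[OF quat_linear]
  and quat_scaleR = linear_scale[OF quat_linear]
  and quat_neg = linear_neg[OF quat_linear]

lemma transpose_quat: "transpose (quat v) = - quat v"
  by (simp add: quat_def transpose_def vec_eq_iff forall_4)

lemma quat_mult_cross: "quat a ** quat b - quat b ** quat a = 2 *\<^sub>R quat (cross3 a b)"
  by (simp add: quat_def matrix_matrix_mult_def vec_eq_iff forall_4 sum_4 cross3_simps)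

lemma quat_square: "quat a ** quat a = - (norm a)\<^sup>2 *\<^sub>R mat 1"
  unfolding power2_norm_eq_inner
  by (simp add: quat_def matrix_matrix_mult_def vec_eq_iff forall_4 sum_4 mat_def inner_vec_def sum_3 algebra_simps)

lemma quat_basis: "quat v = (\<Sum>a\<in>UNIV. v$a *\<^sub>R quat (axis a 1))"
  using basis_expansion[of v]
  by (simp add: linear_sum[OF quat_linear, symmetric] quat_scaleR[symmetric] scalar_mult_eq_scaleR)

lemma quat_entry_le: "\<bar>quat v $ i $ j\<bar> \<le> norm v"
  using component_le_norm_cart[of v 1] component_le_norm_cart[of v 2] component_le_norm_cart[of v 3] norm_ge_zero[of v]
  exhaust_4[of i] exhaust_4[of j]
  by (elim disjE) (simp_all add: quat_def)

lemma quat_mult_entry_le: "\<bar>(quat a ** quat b) $ i $ j\<bar> \<le> 4 * (norm a * norm b)"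
proof -
  have "\<bar>(quat a ** quat b) $ i $ j\<bar> \<le> (\<Sum>k\<in>UNIV. \<bar>quat a $ i $ k * quat b $ k $ j\<bar>)"
    by (simp add: matrix_matrix_mult_def)
  also have "\<dots> \<le> (\<Sum>k\<in>(UNIV::4 set). norm a * norm b)"
    unfolding abs_mult by (intro sum_mono mult_mono quat_entry_le) auto
  finally show ?thesis by simp
qed

section \<open>Matrix identities behind the Lax equation\<close>

lemma matrix_mult_distribs:
  fixes A B C :: "real ^ 'n ^ 'n"
  shows "(A + B) ** C = A ** C + B ** C" "C ** (A + B) = C ** A + C ** B"
    "(A - B) ** C = A ** C - B ** C" "C ** (A - B) = C ** A - C ** B"
    "(- A) ** C = - (A ** C)" "C ** (- A) = - (C ** A)"
    "(r *\<^sub>R A) ** C = r *\<^sub>R (A ** C)" "C ** (r *\<^sub>R A) = r *\<^sub>R (C ** A)"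
  by (simp_all add: matrix_matrix_mult_def vec_eq_iff algebra_simps sum.distrib sum_subtractf sum_negf sum_distrib_left)

lemma matrix_mult_sums:
  fixes A :: "'i \<Rightarrow> real ^ 'n ^ 'n"
  shows "sum A I ** C = (\<Sum>i\<in>I. A i ** C)" "C ** sum A I = (\<Sum>i\<in>I. C ** A i)"
proof -
  have z: "(0 :: real ^ 'n ^ 'n) ** C = 0" "C ** (0 :: real ^ 'n ^ 'n) = 0"
    by (simp_all add: matrix_matrix_mult_def vec_eq_iff)
  show "sum A I ** C = (\<Sum>i\<in>I. A i ** C)" "C ** sum A I = (\<Sum>i\<in>I. C ** A i)"
    by (induction I rule: infinite_finite_induct) (auto simp: z matrix_mult_distribs)
qed

lemma transpose_distribs:
  fixes A B :: "real ^ 'n ^ 'n"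
  shows "transpose (A + B) = transpose A + transpose B" "transpose (A - B) = transpose A - transpose B"
    "transpose (- A) = - transpose A" "transpose (r *\<^sub>R A) = r *\<^sub>R transpose A"
  by (simp_all add: transpose_def vec_eq_iff)

text \<open>Here a = S(x), b = S(y), T is taken at x, k = \<kappa>(x, y), and d is |\<nabla>| of
  \<kappa> in x. This is the kernel of B K, with |\<nabla>| S K rewritten as - |\<nabla>| K S by the
  anticommutation of S and \<kappa>, so that |\<nabla>| falls on \<kappa> alone. The factor \<tau>
  is the rescaling of time to [0, 1].\<close>

definition lax_mat :: "real \<Rightarrow> real ^ 3 \<Rightarrow> real ^ 3 \<Rightarrow> real ^ 3 \<Rightarrow> real ^ 3 \<Rightarrow> real ^ 3 \<Rightarrow> real ^ 4 ^ 4" where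
  "lax_mat \<tau> a b T d k = (\<tau> / 2) *\<^sub>R (quat a ** quat d - quat d ** quat b - quat T ** quat k)"

text \<open>Only the sum d + d' survives in the antisymmetric part. Once r (Ta - Tb) is inserted for
  it, mixed products such as \<open>quat a ** quat Tb\<close> cancel against those from T \<kappa>,
  and the two commutators of a with Ta and of b with Tb remain.\<close>

lemma lax_mat_antisym:
  assumes "d + d' = r *\<^sub>R (Ta - Tb)" and k: "k = r *\<^sub>R (a - b)"
  shows "lax_mat \<tau> a b Ta d k - transpose (lax_mat \<tau> b a Tb d' k) =
    quat (r *\<^sub>R (\<tau> *\<^sub>R cross3 a Ta - \<tau> *\<^sub>R cross3 b Tb))"
proof -
  have d': "d' = r *\<^sub>R (Ta - Tb) - d" using assms(1) by (simp add: algebra_simps)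
  have "lax_mat \<tau> a b Ta d k - transpose (lax_mat \<tau> b a Tb d' k) =
    (\<tau> * r / 2) *\<^sub>R ((quat a ** quat Ta - quat Ta ** quat a) - (quat b ** quat Tb - quat Tb ** quat b))"
    unfolding lax_mat_def d' k transpose_distribs matrix_transpose_mul transpose_quat
    by (simp add: matrix_mult_distribs quat_diff quat_add quat_scaleR algebra_simps)
  also have "\<dots> = quat (r *\<^sub>R (\<tau> *\<^sub>R cross3 a Ta - \<tau> *\<^sub>R cross3 b Tb))"
    unfolding quat_mult_cross by (simp add: quat_diff quat_scaleR algebra_simps)
  finally show ?thesis .
qed

text \<open>For unit imaginary quaternions, a (a - b) = - 1 - a b while (a - b) b = a b + 1.\<close>

lemma quat_unit_anticommute:
  assumes "norm a = 1" "norm b = 1"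
  shows "quat a ** quat (r *\<^sub>R (a - b)) = - (quat (r *\<^sub>R (a - b)) ** quat b)"
  by (simp add: quat_scaleR quat_diff matrix_mult_distribs quat_square assms scaleR_add_right scaleR_diff_right)

lemma lax_mat_skew:
  assumes n: "norm a = 1" "norm b = 1" "norm c = 1"
    and k: "k = r *\<^sub>R (a - b)" "k' = r' *\<^sub>R (a - c)"
  shows "transpose (quat k') ** lax_mat \<tau> a b T d k + transpose (lax_mat \<tau> a c T d' k') ** quat k =
    (\<tau> / 2) *\<^sub>R (quat c ** (quat k' ** quat d - quat d' ** quat k) + (quat k' ** quat d - quat d' ** quat k) ** quat b)"
proof -
  have 1: "quat a ** quat k = - (quat k ** quat b)"
    unfolding k by (rule quat_unit_anticommute[OF n(1,2)])
  have "k' = (- r') *\<^sub>R (c - a)" by (simp add: k algebra_simps)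
  then have 2: "quat k' ** quat a = - (quat c ** quat k')"
    using quat_unit_anticommute[OF n(3,1), of "- r'"] by simp
  have 3: "quat k' ** quat a ** quat d = - (quat c ** quat k' ** quat d)"
    by (simp add: 2 matrix_mult_distribs)
  have 4: "quat d' ** quat a ** quat k = - (quat d' ** quat k ** quat b)"
    by (simp add: matrix_mul_assoc[symmetric] 1 matrix_mult_distribs)
  show ?thesis
    unfolding lax_mat_def transpose_distribs matrix_transpose_mul transpose_quat
    by (simp add: matrix_mult_distribs 3 4 matrix_mul_assoc algebra_simps)
qed

text \<open>Two products contain d and one contains T, each entry being at most 4 times the product
  of the norms. Thus 32 = 2 * 8^2 / 4 and 8 = 2 * 4^2 / 4, with the factor 2 from squaring a sum and
  1/4 from (\<tau>/2)^2.\<close>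

lemma lax_mat_entry_le:
  assumes "norm a = 1" "norm b = 1"
  shows "(lax_mat \<tau> a b T d k $ i $ j)\<^sup>2 \<le> 32 * \<tau>\<^sup>2 * (norm d)\<^sup>2 + 8 * \<tau>\<^sup>2 * (norm T * norm k)\<^sup>2"
proof -
  have "\<bar>(quat a ** quat d - quat d ** quat b - quat T ** quat k) $ i $ j\<bar> \<le> 8 * norm d + 4 * (norm T * norm k)"
    using quat_mult_entry_le[of a d i j] quat_mult_entry_le[of d b i j] quat_mult_entry_le[of T k i j] assms
    by simp
  then have "((quat a ** quat d - quat d ** quat b - quat T ** quat k) $ i $ j)\<^sup>2 \<le> (8 * norm d + 4 * (norm T * norm k))\<^sup>2"
    by (metis abs_ge_zero power2_abs power_mono)
  also have "\<dots> \<le> 2 * (8 * norm d)\<^sup>2 + 2 * (4 * (norm T * norm k))\<^sup>2"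
    using zero_le_power2[of "8 * norm d - 4 * (norm T * norm k)"] by (simp add: power2_eq_square algebra_simps)
  finally have le: "((quat a ** quat d - quat d ** quat b - quat T ** quat k) $ i $ j)\<^sup>2 \<le>
     2 * (8 * norm d)\<^sup>2 + 2 * (4 * (norm T * norm k))\<^sup>2" .
  have "(lax_mat \<tau> a b T d k $ i $ j)\<^sup>2 = (\<tau> / 2)\<^sup>2 * ((quat a ** quat d - quat d ** quat b - quat T ** quat k) $ i $ j)\<^sup>2"
    by (simp only: lax_mat_def vector_scaleR_component real_scaleR_def power_mult_distrib)
  also have "\<dots> \<le> (\<tau> / 2)\<^sup>2 * (2 * (8 * norm d)\<^sup>2 + 2 * (4 * (norm T * norm k))\<^sup>2)"
    by (intro mult_left_mono le) auto
  also have "\<dots> = 32 * \<tau>\<^sup>2 * (norm d)\<^sup>2 + 8 * \<tau>\<^sup>2 * (norm T * norm k)\<^sup>2"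
    by (simp add: power_divide power_mult_distrib algebra_simps)
  finally show ?thesis .
qed

section \<open>Matrix kernels as scalar kernels on pairs of an index and a point\<close>

lemma integral_count_space_pair:
  fixes f :: "'i::finite \<Rightarrow> 'b \<Rightarrow> real"
  assumes N: "sigma_finite_measure N" and f: "\<And>i. integrable N (f i)"
  shows "integrable (count_space UNIV \<Otimes>\<^sub>M N) (\<lambda>p. f (fst p) (snd p))"
    and "(LINT p|(count_space UNIV \<Otimes>\<^sub>M N). f (fst p) (snd p)) = (\<Sum>i\<in>UNIV. LINT x|N. f i x)"
proof -
  interpret N: sigma_finite_measure N by (rule N)
  interpret C: sigma_finite_measure "count_space (UNIV :: 'i set)"
    by (rule sigma_finite_measure_count_space_countable) simp
  interpret P: pair_sigma_finite "count_space (UNIV :: 'i set)" N ..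
  have m: "(\<lambda>p. f (fst p) (snd p)) \<in> borel_measurable (count_space UNIV \<Otimes>\<^sub>M N)"
    using f by (intro measurable_pair_measure_countable1) auto
  show int: "integrable (count_space UNIV \<Otimes>\<^sub>M N) (\<lambda>p. f (fst p) (snd p))"
  proof (rule integrableI_bounded[OF m])
    have "(\<integral>\<^sup>+p. ennreal (norm (f (fst p) (snd p))) \<partial>(count_space UNIV \<Otimes>\<^sub>M N)) =
      (\<integral>\<^sup>+i. \<integral>\<^sup>+x. ennreal (norm (f i x)) \<partial>N \<partial>count_space UNIV)"
      using m by (subst N.nn_integral_fst[symmetric]) simp_all
    also have "\<dots> = (\<Sum>i\<in>UNIV. \<integral>\<^sup>+x. ennreal (norm (f i x)) \<partial>N)"
      by (simp add: nn_integral_count_space_finite)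
    also have "\<dots> < \<infinity>"
      using f by (auto simp: integrable_iff_bounded)
    finally show "(\<integral>\<^sup>+p. ennreal (norm (f (fst p) (snd p))) \<partial>(count_space UNIV \<Otimes>\<^sub>M N)) < \<infinity>" .
  qed
  show "(LINT p|(count_space UNIV \<Otimes>\<^sub>M N). f (fst p) (snd p)) = (\<Sum>i\<in>UNIV. LINT x|N. f i x)"
    using P.integral_fst'[OF int] by (simp add: lebesgue_integral_count_space_finite)
qed

lemma component_indexed_meas:
  fixes f :: "'i::finite \<Rightarrow> 'i \<Rightarrow> 'b \<Rightarrow> 'b \<Rightarrow> 'c"
  assumes m: "\<And>i j. (\<lambda>z. f i j (fst z) (snd z)) \<in> N \<Otimes>\<^sub>M N \<rightarrow>\<^sub>M K"
  shows "(\<lambda>z. f (fst (fst z)) (fst (snd z)) (snd (fst z)) (snd (snd z))) \<in>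
     ((count_space UNIV \<Otimes>\<^sub>M N) \<Otimes>\<^sub>M (count_space UNIV \<Otimes>\<^sub>M N)) \<rightarrow>\<^sub>M K"
proof (rule measurable_compose_countable[where g="\<lambda>z. fst (fst z)"])
  fix i
  show "(\<lambda>z. f i (fst (snd z)) (snd (fst z)) (snd (snd z))) \<in>
     ((count_space UNIV \<Otimes>\<^sub>M N) \<Otimes>\<^sub>M (count_space UNIV \<Otimes>\<^sub>M N)) \<rightarrow>\<^sub>M K"
  proof (rule measurable_compose_countable[where g="\<lambda>z. fst (snd z)"])
    fix j
    have "(\<lambda>z. (snd (fst z), snd (snd z))) \<in>
      (count_space UNIV \<Otimes>\<^sub>M N) \<Otimes>\<^sub>M (count_space UNIV \<Otimes>\<^sub>M N) \<rightarrow>\<^sub>M N \<Otimes>\<^sub>M N" by measurable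
    from measurable_compose[OF this m[of i j]]
    show "(\<lambda>z. f i j (snd (fst z)) (snd (snd z))) \<in>
     ((count_space UNIV \<Otimes>\<^sub>M N) \<Otimes>\<^sub>M (count_space UNIV \<Otimes>\<^sub>M N)) \<rightarrow>\<^sub>M K" by simp
  qed measurable
qed measurable

lemma nn_integral_count_space_pair2_le:
  fixes f :: "'i::finite \<Rightarrow> 'i \<Rightarrow> 'b \<Rightarrow> 'b \<Rightarrow> ennreal"
  assumes N: "sigma_finite_measure N"
    and m: "\<And>i j. (\<lambda>z. f i j (fst z) (snd z)) \<in> borel_measurable (N \<Otimes>\<^sub>M N)"
    and le: "\<And>i j. (\<integral>\<^sup>+z. f i j (fst z) (snd z) \<partial>(N \<Otimes>\<^sub>M N)) \<le> D"
  shows "(\<integral>\<^sup>+z. f (fst (fst z)) (fst (snd z)) (snd (fst z)) (snd (snd z))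
      \<partial>((count_space UNIV \<Otimes>\<^sub>M N) \<Otimes>\<^sub>M (count_space UNIV \<Otimes>\<^sub>M N))) \<le> of_nat (CARD('i) * CARD('i)) * D" (is "?L \<le> _")
proof -
  interpret N: sigma_finite_measure N by (rule N)
  interpret C: sigma_finite_measure "count_space (UNIV :: 'i set)"
    by (rule sigma_finite_measure_count_space_countable) simp
  interpret P: pair_sigma_finite "count_space (UNIV :: 'i set)" N ..
  have meas: "(\<lambda>z. f (fst (fst z)) (fst (snd z)) (snd (fst z)) (snd (snd z))) \<in>
     borel_measurable ((count_space UNIV \<Otimes>\<^sub>M N) \<Otimes>\<^sub>M (count_space UNIV \<Otimes>\<^sub>M N))"
    by (rule component_indexed_meas[OF m])
  have sec: "(\<lambda>y. f i j x y) \<in> borel_measurable N" if "x \<in> space N" for i j x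
    using measurable_compose[OF measurable_Pair1'[OF that] m[of i j]] by simp
  have mi: "(\<lambda>x. \<integral>\<^sup>+y. f i j x y \<partial>N) \<in> borel_measurable N" for i j
    using N.borel_measurable_nn_integral_fst[OF m[of i j]] by simp
  have "?L = (\<integral>\<^sup>+p. \<integral>\<^sup>+q. f (fst p) (fst q) (snd p) (snd q) \<partial>(count_space UNIV \<Otimes>\<^sub>M N) \<partial>(count_space UNIV \<Otimes>\<^sub>M N))"
    using P.nn_integral_fst[OF meas] by simp
  also have "\<dots> = (\<integral>\<^sup>+p. (\<Sum>j\<in>UNIV. \<integral>\<^sup>+y. f (fst p) j (snd p) y \<partial>N) \<partial>(count_space UNIV \<Otimes>\<^sub>M N))"
  proof (intro nn_integral_cong)
    fix p :: "'i \<times> 'b" assume p: "p \<in> space (count_space UNIV \<Otimes>\<^sub>M N)"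
    then have "snd p \<in> space N" by (auto simp: space_pair_measure)
    then have "(\<lambda>q. f (fst p) (fst q) (snd p) (snd q)) \<in> borel_measurable (count_space UNIV \<Otimes>\<^sub>M N)"
      using sec by (intro measurable_pair_measure_countable1) auto
    from N.nn_integral_fst[OF this]
    show "(\<integral>\<^sup>+q. f (fst p) (fst q) (snd p) (snd q) \<partial>(count_space UNIV \<Otimes>\<^sub>M N)) =
      (\<Sum>j\<in>UNIV. \<integral>\<^sup>+y. f (fst p) j (snd p) y \<partial>N)"
      by (simp add: nn_integral_count_space_finite)
  qed
  also have "\<dots> = (\<Sum>i\<in>UNIV. \<integral>\<^sup>+x. (\<Sum>j\<in>UNIV. \<integral>\<^sup>+y. f i j x y \<partial>N) \<partial>N)"
  proof -
    have "(\<lambda>p. \<Sum>j\<in>UNIV. \<integral>\<^sup>+y. f (fst p) j (snd p) y \<partial>N) \<in> borel_measurable (count_space UNIV \<Otimes>\<^sub>M N)"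
      using mi by (intro measurable_pair_measure_countable1) auto
    from N.nn_integral_fst[OF this] show ?thesis by (simp add: nn_integral_count_space_finite)
  qed
  also have "\<dots> = (\<Sum>i\<in>UNIV. \<Sum>j\<in>UNIV. \<integral>\<^sup>+x. \<integral>\<^sup>+y. f i j x y \<partial>N \<partial>N)"
    using mi by (simp add: nn_integral_sum)
  also have "\<dots> = (\<Sum>i\<in>UNIV. \<Sum>j\<in>UNIV. \<integral>\<^sup>+z. f i j (fst z) (snd z) \<partial>(N \<Otimes>\<^sub>M N))"
    using N.nn_integral_fst[OF m] by simp
  also have "\<dots> \<le> (\<Sum>i\<in>(UNIV::'i set). \<Sum>j\<in>(UNIV::'i set). D)"
    by (intro sum_mono le)
  finally show ?thesis by (simp add: mult.assoc)
qed

lemma component_indexed_meas_param: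
  fixes f :: "'i::finite \<Rightarrow> 'i \<Rightarrow> 'c \<Rightarrow> 'b \<Rightarrow> 'b \<Rightarrow> real"
  assumes m: "\<And>i j. (\<lambda>(s, z). f i j s (fst z) (snd z)) \<in> borel_measurable (L \<Otimes>\<^sub>M (N \<Otimes>\<^sub>M N))"
  shows "(\<lambda>(s, z). f (fst (fst z)) (fst (snd z)) s (snd (fst z)) (snd (snd z))) \<in>
     borel_measurable (L \<Otimes>\<^sub>M ((count_space UNIV \<Otimes>\<^sub>M N) \<Otimes>\<^sub>M (count_space UNIV \<Otimes>\<^sub>M N)))"
  unfolding case_prod_unfold
proof (rule measurable_compose_countable[where g="\<lambda>z. fst (fst (snd z))"])
  fix i
  show "(\<lambda>z. f i (fst (snd (snd z))) (fst z) (snd (fst (snd z))) (snd (snd (snd z)))) \<in>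
    borel_measurable (L \<Otimes>\<^sub>M ((count_space UNIV \<Otimes>\<^sub>M N) \<Otimes>\<^sub>M (count_space UNIV \<Otimes>\<^sub>M N)))"
  proof (rule measurable_compose_countable[where g="\<lambda>z. fst (snd (snd z))"])
    fix j
    have "(\<lambda>z. (fst z, (snd (fst (snd z)), snd (snd (snd z))))) \<in>
      L \<Otimes>\<^sub>M ((count_space UNIV \<Otimes>\<^sub>M N) \<Otimes>\<^sub>M (count_space UNIV \<Otimes>\<^sub>M N)) \<rightarrow>\<^sub>M L \<Otimes>\<^sub>M (N \<Otimes>\<^sub>M N)" by measurable
    from measurable_compose[OF this m[of i j]]
    show "(\<lambda>z. f i j (fst z) (snd (fst (snd z))) (snd (snd (snd z)))) \<in>
      borel_measurable (L \<Otimes>\<^sub>M ((count_space UNIV \<Otimes>\<^sub>M N) \<Otimes>\<^sub>M (count_space UNIV \<Otimes>\<^sub>M N)))"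
      by (simp add: case_prod_unfold)
  qed measurable
qed measurable

section \<open>From a half-wave map to a Lax kernel\<close>

lemma borel_measurable_component:
  fixes f :: "'a \<Rightarrow> real ^ 'n"
  assumes "f \<in> borel_measurable M"
  shows "(\<lambda>x. f x $ i) \<in> borel_measurable M"
  by (rule measurable_compose[OF assms borel_measurable_continuous_onI]) (intro continuous_intros)

text \<open>The common form of the two problems: \<open>N\<close> is Lebesgue measure on the line or
  on one period, time is rescaled to [0, 1] with \<tau> the time to be reached, and \<open>d\<close>
  is |\<nabla>| of \<kappa> in x. Two properties of |\<nabla>| enter: \<open>d_sum\<close>, the
  effect of applying it in x and in y to the difference quotient, and \<open>sym\<close>, its
  symmetry. Where \<phi> vanishes, inverse 0 = 0 makes \<kappa> zero, and \<open>d_sum\<close>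
  forces \<open>d\<close> to vanish on the diagonal.\<close>

locale half_wave_lax =
  fixes N :: "real measure" and \<phi> :: "real \<Rightarrow> real"
    and S Sd T :: "real \<Rightarrow> real \<Rightarrow> real ^ 3" and d :: "real \<Rightarrow> real \<Rightarrow> real \<Rightarrow> real ^ 3" and \<tau> C :: real
  assumes N: "sigma_finite_measure N" "sets N = sets borel"
    and \<phi>_odd: "\<And>u. \<phi> (- u) = - \<phi> u" and \<phi>_meas: "\<phi> \<in> borel_measurable borel"
    and unit: "\<And>t x. t \<in> {0..1} \<Longrightarrow> norm (S t x) = 1"
    and S_meas: "(\<lambda>(t, x). S t x) \<in> borel_measurable (borel \<Otimes>\<^sub>M borel)"
    and Sd_meas: "(\<lambda>(t, x). Sd t x) \<in> borel_measurable (borel \<Otimes>\<^sub>M borel)"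
    and S_deriv: "\<And>t x. t \<in> {0..1} \<Longrightarrow> ((\<lambda>t. S t x) has_vector_derivative Sd t x) (at t within {0..1})"
    and Sd_cont: "\<And>x. continuous_on {0..1} (\<lambda>t. Sd t x)"
    and Sd_eq: "\<And>t x. t \<in> {0..1} \<Longrightarrow> Sd t x = \<tau> *\<^sub>R cross3 (S t x) (T t x)"
    and d_sum: "\<And>t x y. t \<in> {0..1} \<Longrightarrow> d t x y + d t y x = inverse (\<phi> (x - y)) *\<^sub>R (T t x - T t y)"
    and T_meas: "\<And>t. t \<in> {0..1} \<Longrightarrow> T t \<in> borel_measurable borel"
    and d_meas: "\<And>t. t \<in> {0..1} \<Longrightarrow> (\<lambda>z. d t (fst z) (snd z)) \<in> borel_measurable (borel \<Otimes>\<^sub>M borel)"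
    and d_bound: "\<And>t. t \<in> {0..1} \<Longrightarrow> (\<integral>\<^sup>+z. ennreal ((norm (d t (fst z) (snd z)))\<^sup>2) \<partial>(N \<Otimes>\<^sub>M N)) \<le> ennreal C"
    and T_bound: "\<And>t. t \<in> {0..1} \<Longrightarrow> (\<integral>\<^sup>+z. ennreal ((norm (T t (fst z)) *
        norm (inverse (\<phi> (fst z - snd z)) *\<^sub>R (S t (fst z) - S t (snd z))))\<^sup>2) \<partial>(N \<Otimes>\<^sub>M N)) \<le> ennreal C"
    and K0_bound: "(\<integral>\<^sup>+z. ennreal ((norm (inverse (\<phi> (fst z - snd z)) *\<^sub>R (S 0 (fst z) - S 0 (snd z))))\<^sup>2) \<partial>(N \<Otimes>\<^sub>M N)) < \<infinity>"
    and k_sect: "\<And>t y. t \<in> {0..1} \<Longrightarrow> sq_integrable N (\<lambda>x. norm (inverse (\<phi> (x - y)) *\<^sub>R (S t x - S t y)))"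
    and d_sect: "\<And>t y. t \<in> {0..1} \<Longrightarrow> sq_integrable N (\<lambda>x. norm (d t x y))"
    and Tk_sect: "\<And>t y. t \<in> {0..1} \<Longrightarrow> sq_integrable N (\<lambda>x. norm (T t x) * norm (inverse (\<phi> (x - y)) *\<^sub>R (S t x - S t y)))"
    and sym: "\<And>t y z a b. t \<in> {0..1} \<Longrightarrow>
        (LINT x|N. (inverse (\<phi> (x - z)) *\<^sub>R (S t x - S t z)) $ a * d t x y $ b) =
        (LINT x|N. d t x z $ a * (inverse (\<phi> (x - y)) *\<^sub>R (S t x - S t y)) $ b)"
begin

definition \<kappa> :: "real \<Rightarrow> real \<Rightarrow> real \<Rightarrow> real ^ 3" where
  "\<kappa> t x y = inverse (\<phi> (x - y)) *\<^sub>R (S t x - S t y)"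

definition kerK :: "real \<Rightarrow> 4 \<times> real \<Rightarrow> 4 \<times> real \<Rightarrow> real" where
  "kerK t p q = quat (\<kappa> t (snd p) (snd q)) $ fst p $ fst q"

definition kerKd :: "real \<Rightarrow> 4 \<times> real \<Rightarrow> 4 \<times> real \<Rightarrow> real" where
  "kerKd t p q = quat (inverse (\<phi> (snd p - snd q)) *\<^sub>R (Sd t (snd p) - Sd t (snd q))) $ fst p $ fst q"

definition matA :: "real \<Rightarrow> real \<Rightarrow> real \<Rightarrow> real ^ 4 ^ 4" where
  "matA t x y = lax_mat \<tau> (S t x) (S t y) (T t x) (d t x y) (\<kappa> t x y)"

definition kerA :: "real \<Rightarrow> 4 \<times> real \<Rightarrow> 4 \<times> real \<Rightarrow> real" where
  "kerA t p q = matA t (snd p) (snd q) $ fst p $ fst q"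

lemma \<phi>_diff: "\<phi> (y - x) = - \<phi> (x - y)"
  using \<phi>_odd[of "x - y"] by simp

lemma \<kappa>_sym: "\<kappa> t y x = \<kappa> t x y"
  unfolding \<kappa>_def \<phi>_diff[of y x] by (simp add: algebra_simps)

lemma N_pair_sets: "sets (N \<Otimes>\<^sub>M N) = sets (borel \<Otimes>\<^sub>M borel)"
  by (rule sets_pair_measure_cong[OF N(2) N(2)])

lemma quat_meas: "(\<lambda>v. quat v $ i $ j) \<in> borel_measurable borel"
  by (intro borel_measurable_continuous_onI continuous_intros linear_continuous_on quat_linear
      linear_conv_bounded_linear[THEN iffD1])

lemma \<kappa>_meas: "(\<lambda>z. \<kappa> t (fst z) (snd z)) \<in> borel_measurable (borel \<Otimes>\<^sub>M borel)"
proof -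
  note [measurable] = \<phi>_meas
  have [measurable]: "S t \<in> borel_measurable borel"
    using measurable_compose[OF _ S_meas, of "\<lambda>x. (t, x)" borel] by simp
  show ?thesis unfolding \<kappa>_def by measurable
qed

lemma S_sect_meas: "S t \<in> borel_measurable borel"
  using measurable_compose[OF _ S_meas, of "\<lambda>x. (t, x)" borel] by simp

lemma matA_entry_meas:
  assumes t: "t \<in> {0..1}"
  shows "(\<lambda>z. matA t (fst z) (snd z) $ i $ j) \<in> borel_measurable (borel \<Otimes>\<^sub>M borel)"
proof -
  note [measurable] = \<kappa>_meas d_meas[OF t] T_meas[OF t] S_sect_meas quat_meas
  show ?thesis unfolding matA_def lax_mat_def by (simp add: matrix_matrix_mult_def)
qed

text \<open>\<open>lax_mat_antisym\<close> gives the evolution, \<open>lax_mat_skew\<close> together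
  with \<open>sym\<close> the skewness. In the constant, 40 = 32 + 8 adds the two coefficients of
  \<open>lax_mat_entry_le\<close>, and 16 counts the pairs of matrix indices.\<close>

lemma kernel: "lax_kernel (count_space UNIV \<Otimes>\<^sub>M N) kerK kerKd kerA (16 * (40 * \<tau>\<^sup>2 * \<bar>C\<bar>))"
proof -
  interpret N: sigma_finite_measure N by (rule N(1))
  interpret C4: sigma_finite_measure "count_space (UNIV :: 4 set)"
    by (rule sigma_finite_measure_count_space_countable) simp
  interpret P: pair_sigma_finite "count_space (UNIV :: 4 set)" N ..
  interpret M: sigma_finite_measure "count_space (UNIV :: 4 set) \<Otimes>\<^sub>M N" ..
  have meas_N: "f \<in> borel_measurable (N \<Otimes>\<^sub>M N)" if "f \<in> borel_measurable (borel \<Otimes>\<^sub>M borel)" for f :: "real \<times> real \<Rightarrow> 'z::topological_space"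
    using that by (simp cong: measurable_cong_sets add: N_pair_sets)
  have sets_LNN: "sets (lborel \<Otimes>\<^sub>M (N \<Otimes>\<^sub>M N)) = sets (borel \<Otimes>\<^sub>M (borel \<Otimes>\<^sub>M borel))"
    by (intro sets_pair_measure_cong N_pair_sets) simp
  have \<kappa>_param: "(\<lambda>(t, z). \<kappa> t (fst z) (snd z)) \<in> borel_measurable (borel \<Otimes>\<^sub>M (borel \<Otimes>\<^sub>M borel))"
  proof -
    note [measurable] = \<phi>_meas S_meas
    have 1: "(\<lambda>w. S (fst w) (fst (snd w))) \<in> borel_measurable (borel \<Otimes>\<^sub>M (borel \<Otimes>\<^sub>M borel))"
      using measurable_compose[OF _ S_meas, of "\<lambda>w. (fst w, fst (snd w))" "borel \<Otimes>\<^sub>M (borel \<Otimes>\<^sub>M borel)"] by simp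
    have 2: "(\<lambda>w. S (fst w) (snd (snd w))) \<in> borel_measurable (borel \<Otimes>\<^sub>M (borel \<Otimes>\<^sub>M borel))"
      using measurable_compose[OF _ S_meas, of "\<lambda>w. (fst w, snd (snd w))" "borel \<Otimes>\<^sub>M (borel \<Otimes>\<^sub>M borel)"] by simp
    show ?thesis using 1 2 unfolding \<kappa>_def case_prod_unfold by measurable
  qed
  have Sd_param: "(\<lambda>(t, z). inverse (\<phi> (fst z - snd z)) *\<^sub>R (Sd t (fst z) - Sd t (snd z))) \<in> borel_measurable (borel \<Otimes>\<^sub>M (borel \<Otimes>\<^sub>M borel))"
  proof -
    note [measurable] = \<phi>_meas Sd_meas
    have 1: "(\<lambda>w. Sd (fst w) (fst (snd w))) \<in> borel_measurable (borel \<Otimes>\<^sub>M (borel \<Otimes>\<^sub>M borel))"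
      using measurable_compose[OF _ Sd_meas, of "\<lambda>w. (fst w, fst (snd w))" "borel \<Otimes>\<^sub>M (borel \<Otimes>\<^sub>M borel)"] by simp
    have 2: "(\<lambda>w. Sd (fst w) (snd (snd w))) \<in> borel_measurable (borel \<Otimes>\<^sub>M (borel \<Otimes>\<^sub>M borel))"
      using measurable_compose[OF _ Sd_meas, of "\<lambda>w. (fst w, snd (snd w))" "borel \<Otimes>\<^sub>M (borel \<Otimes>\<^sub>M borel)"] by simp
    show ?thesis using 1 2 unfolding case_prod_unfold by measurable
  qed
  have sect_A: "sq_integrable N (\<lambda>x. matA t x y $ i $ j)" if t: "t \<in> {0..1}" for t y i j
  proof -
    \<comment> \<open>As 6^2 > 32 and 3^2 > 8, this combination dominates the entries by
      \<open>lax_mat_entry_le\<close>.\<close>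
    have "sq_integrable N (\<lambda>x. 6 * \<bar>\<tau>\<bar> * norm (d t x y) + 3 * \<bar>\<tau>\<bar> * (norm (T t x) * norm (\<kappa> t x y)))"
      unfolding \<kappa>_def by (intro sq_integrable_add sq_integrable_cmult d_sect Tk_sect t)
    then show ?thesis
    proof (rule sq_integrable_bound)
      have "(\<lambda>x. matA t x y $ i $ j) \<in> borel_measurable borel"
        using measurable_compose[OF _ matA_entry_meas[OF t], of "\<lambda>x. (x, y)" borel i j] by simp
      then show "(\<lambda>x. matA t x y $ i $ j) \<in> borel_measurable N"
        by (simp cong: measurable_cong_sets add: N(2))
      fix x
      let ?D = "norm (d t x y)" and ?E = "norm (T t x) * norm (\<kappa> t x y)"
      have "(matA t x y $ i $ j)\<^sup>2 \<le> 32 * \<tau>\<^sup>2 * ?D\<^sup>2 + 8 * \<tau>\<^sup>2 * ?E\<^sup>2"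
        unfolding matA_def by (intro lax_mat_entry_le unit t)
      also have "\<dots> \<le> (6 * \<bar>\<tau>\<bar> * ?D + 3 * \<bar>\<tau>\<bar> * ?E)\<^sup>2"
      proof -
        have "0 \<le> \<tau>\<^sup>2 * (4 * ?D\<^sup>2 + ?E\<^sup>2 + 36 * ?D * ?E)" by simp
        then show ?thesis by (simp add: power2_sum power_mult_distrib algebra_simps power2_eq_square)
      qed
      finally show "\<bar>matA t x y $ i $ j\<bar> \<le> \<bar>6 * \<bar>\<tau>\<bar> * ?D + 3 * \<bar>\<tau>\<bar> * ?E\<bar>"
        unfolding abs_le_square_iff .
    qed
  qed
  have sect_K: "sq_integrable N (\<lambda>x. quat (\<kappa> t x y) $ i $ j)" if t: "t \<in> {0..1}" for t y i j
  proof (rule sq_integrable_bound[OF k_sect[OF t, of y]])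
    have "(\<lambda>x. quat (\<kappa> t x y) $ i $ j) \<in> borel_measurable borel"
      using measurable_compose[OF measurable_compose[OF _ \<kappa>_meas, of "\<lambda>x. (x, y)" borel t] quat_meas[of i j]] by simp
    then show "(\<lambda>x. quat (\<kappa> t x y) $ i $ j) \<in> borel_measurable N"
      by (simp cong: measurable_cong_sets add: N(2))
    show "\<bar>quat (\<kappa> t x y) $ i $ j\<bar> \<le> \<bar>norm (inverse (\<phi> (x - y)) *\<^sub>R (S t x - S t y))\<bar>" for x
      unfolding \<kappa>_def[symmetric] by (simp add: quat_entry_le)
  qed
  have sect_vec: "sq_integrable N (\<lambda>x. d t x y $ b)" "sq_integrable N (\<lambda>x. \<kappa> t x y $ b)" if t: "t \<in> {0..1}" for t y b
  proof -
    show "sq_integrable N (\<lambda>x. d t x y $ b)"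
    proof (rule sq_integrable_bound[OF d_sect[OF t, of y]])
      have "(\<lambda>x. d t x y $ b) \<in> borel_measurable borel"
        using measurable_compose[OF _ d_meas[OF t], of "\<lambda>x. (x, y)" borel] by (intro borel_measurable_component) simp
      then show "(\<lambda>x. d t x y $ b) \<in> borel_measurable N" by (simp cong: measurable_cong_sets add: N(2))
    qed (simp add: component_le_norm_cart)
    show "sq_integrable N (\<lambda>x. \<kappa> t x y $ b)"
    proof (rule sq_integrable_bound[OF k_sect[OF t, of y]])
      have "(\<lambda>x. \<kappa> t x y $ b) \<in> borel_measurable borel"
        using measurable_compose[OF _ \<kappa>_meas[of t], of "\<lambda>x. (x, y)" borel] by (intro borel_measurable_component) simp
      then show "(\<lambda>x. \<kappa> t x y $ b) \<in> borel_measurable N" by (simp cong: measurable_cong_sets add: N(2))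
      show "\<bar>\<kappa> t x y $ b\<bar> \<le> \<bar>norm (inverse (\<phi> (x - y)) *\<^sub>R (S t x - S t y))\<bar>" for x
        unfolding \<kappa>_def[symmetric] by (simp add: component_le_norm_cart)
    qed
  qed
  have AK_x: "integrable N (\<lambda>x. matA t x y $ i $ j * quat (\<kappa> t x z) $ i $ k)" if t: "t \<in> {0..1}" for t i j k y z
    by (rule sq_integrable_mult[OF sect_A[OF t] sect_K[OF t]])
  have AK_int: "integrable (count_space UNIV \<Otimes>\<^sub>M N) (\<lambda>p. kerA t p q * kerK t p r)"
    and AK_eq: "(LINT p|(count_space UNIV \<Otimes>\<^sub>M N). kerA t p q * kerK t p r) =
      (\<Sum>i\<in>UNIV. LINT x|N. matA t x (snd q) $ i $ fst q * quat (\<kappa> t x (snd r)) $ i $ fst r)"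
    if t: "t \<in> {0..1}" for t q r
    using integral_count_space_pair[OF N(1), of "\<lambda>i x. matA t x (snd q) $ i $ fst q * quat (\<kappa> t x (snd r)) $ i $ fst r"]
      AK_x[OF t] by (simp_all add: kerA_def kerK_def)
  show ?thesis
  proof (unfold_locales)
    fix t :: real and p q :: "4 \<times> real" assume t: "t \<in> {0..1}"
    have "bounded_linear (\<lambda>v. quat v $ fst p $ fst q)"
      using bounded_linear_compose[OF bounded_linear_vec_nth bounded_linear_compose[OF bounded_linear_vec_nth linear_conv_bounded_linear[THEN iffD1, OF quat_linear]], of "fst p" "fst q"]
      by simp
    note bl = bounded_linear.has_vector_derivative[OF this]
    have "((\<lambda>t. \<kappa> t (snd p) (snd q)) has_vector_derivative inverse (\<phi> (snd p - snd q)) *\<^sub>R (Sd t (snd p) - Sd t (snd q))) (at t within {0..1})"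
      unfolding \<kappa>_def
      by (intro bounded_linear.has_vector_derivative[OF bounded_linear_scaleR_right] has_vector_derivative_diff S_deriv t)
    from bl[OF this] show "((\<lambda>s. kerK s p q) has_real_derivative kerKd t p q) (at t within {0..1})"
      by (simp add: kerK_def kerKd_def has_real_derivative_iff_has_vector_derivative)
    show "kerKd t p q = kerA t p q - kerA t q p"
    proof -
      have "matA t (snd p) (snd q) - transpose (matA t (snd q) (snd p)) =
        quat (inverse (\<phi> (snd p - snd q)) *\<^sub>R (Sd t (snd p) - Sd t (snd q)))"
        unfolding matA_def \<kappa>_sym[of t "snd q" "snd p"] Sd_eq[OF t]
        by (rule lax_mat_antisym[OF d_sum[OF t] \<kappa>_def])
      then show ?thesis
        unfolding kerKd_def kerA_def by (simp flip: \<open>_ = quat _\<close> add: transpose_def)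
    qed
    show "kerK t q p = - kerK t p q"
      unfolding kerK_def \<kappa>_sym[of t "snd q" "snd p"]
      using arg_cong[OF transpose_quat[of "\<kappa> t (snd p) (snd q)"], of "\<lambda>m. m $ fst p $ fst q"]
      by (simp add: transpose_def)
  next
    fix p q :: "4 \<times> real"
    have "bounded_linear (\<lambda>v. quat v $ fst p $ fst q)"
      using bounded_linear_compose[OF bounded_linear_vec_nth bounded_linear_compose[OF bounded_linear_vec_nth linear_conv_bounded_linear[THEN iffD1, OF quat_linear]], of "fst p" "fst q"]
      by simp
    then show "continuous_on {0..1} (\<lambda>s. kerKd s p q)"
      unfolding kerKd_def by (rule bounded_linear.continuous_on) (intro continuous_intros Sd_cont)
  next
    have "(\<lambda>(s, z). quat (\<kappa> s (fst z) (snd z)) $ i $ j) \<in> borel_measurable (lborel \<Otimes>\<^sub>M (N \<Otimes>\<^sub>M N))" for i j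
      using measurable_compose[OF \<kappa>_param quat_meas[of i j]]
      unfolding measurable_cong_sets[OF sets_LNN refl] by (simp add: case_prod_unfold)
    from component_indexed_meas_param[OF this]
    show "(\<lambda>(s, z). kerK s (fst z) (snd z)) \<in> borel_measurable (lborel \<Otimes>\<^sub>M (count_space UNIV \<Otimes>\<^sub>M N) \<Otimes>\<^sub>M count_space UNIV \<Otimes>\<^sub>M N)"
      by (simp add: kerK_def)
    have "(\<lambda>(s, z). quat (inverse (\<phi> (fst z - snd z)) *\<^sub>R (Sd s (fst z) - Sd s (snd z))) $ i $ j) \<in> borel_measurable (lborel \<Otimes>\<^sub>M (N \<Otimes>\<^sub>M N))" for i j
      using measurable_compose[OF Sd_param quat_meas[of i j]]
      unfolding measurable_cong_sets[OF sets_LNN refl] by (simp add: case_prod_unfold)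
    from component_indexed_meas_param[OF this]
    show "(\<lambda>(s, z). kerKd s (fst z) (snd z)) \<in> borel_measurable (lborel \<Otimes>\<^sub>M (count_space UNIV \<Otimes>\<^sub>M N) \<Otimes>\<^sub>M count_space UNIV \<Otimes>\<^sub>M N)"
      by (simp add: kerKd_def)
  next
    fix t :: real assume t: "t \<in> {0..1}"
    show "(\<lambda>(p, q). kerA t p q) \<in> borel_measurable ((count_space UNIV \<Otimes>\<^sub>M N) \<Otimes>\<^sub>M count_space UNIV \<Otimes>\<^sub>M N)"
      using component_indexed_meas[OF meas_N[OF matA_entry_meas[OF t]]]
      by (simp add: kerA_def case_prod_unfold)
    have 1: "(\<lambda>z. ennreal ((matA t (fst z) (snd z) $ i $ j)\<^sup>2)) \<in> borel_measurable (N \<Otimes>\<^sub>M N)" for i j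
      using meas_N[OF matA_entry_meas[OF t, of i j]] by simp
    have 2: "(\<integral>\<^sup>+z. ennreal ((matA t (fst z) (snd z) $ i $ j)\<^sup>2) \<partial>(N \<Otimes>\<^sub>M N)) \<le> ennreal (40 * \<tau>\<^sup>2 * \<bar>C\<bar>)" for i j
    proof -
      have m: "(\<lambda>z. d t (fst z) (snd z)) \<in> borel_measurable (N \<Otimes>\<^sub>M N)"
         "(\<lambda>z. \<kappa> t (fst z) (snd z)) \<in> borel_measurable (N \<Otimes>\<^sub>M N)"
         "(\<lambda>z. T t (fst z)) \<in> borel_measurable (N \<Otimes>\<^sub>M N)"
        using d_meas[OF t] \<kappa>_meas T_meas[OF t] by (auto intro!: meas_N)
      have "(\<integral>\<^sup>+z. ennreal ((matA t (fst z) (snd z) $ i $ j)\<^sup>2) \<partial>(N \<Otimes>\<^sub>M N)) \<le>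
        (\<integral>\<^sup>+z. ennreal (32 * \<tau>\<^sup>2) * ennreal ((norm (d t (fst z) (snd z)))\<^sup>2) + ennreal (8 * \<tau>\<^sup>2) * ennreal ((norm (T t (fst z)) * norm (\<kappa> t (fst z) (snd z)))\<^sup>2) \<partial>(N \<Otimes>\<^sub>M N))"
      proof (intro nn_integral_mono)
        fix z
        have "ennreal ((matA t (fst z) (snd z) $ i $ j)\<^sup>2) \<le> ennreal (32 * \<tau>\<^sup>2 * (norm (d t (fst z) (snd z)))\<^sup>2 + 8 * \<tau>\<^sup>2 * (norm (T t (fst z)) * norm (\<kappa> t (fst z) (snd z)))\<^sup>2)"
          unfolding matA_def by (intro ennreal_leI lax_mat_entry_le unit t)
        then show "ennreal ((matA t (fst z) (snd z) $ i $ j)\<^sup>2) \<le> ennreal (32 * \<tau>\<^sup>2) * ennreal ((norm (d t (fst z) (snd z)))\<^sup>2) + ennreal (8 * \<tau>\<^sup>2) * ennreal ((norm (T t (fst z)) * norm (\<kappa> t (fst z) (snd z)))\<^sup>2)"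
          by (simp flip: ennreal_mult ennreal_plus)
      qed
      also have "\<dots> = ennreal (32 * \<tau>\<^sup>2) * (\<integral>\<^sup>+z. ennreal ((norm (d t (fst z) (snd z)))\<^sup>2) \<partial>(N \<Otimes>\<^sub>M N)) +
        ennreal (8 * \<tau>\<^sup>2) * (\<integral>\<^sup>+z. ennreal ((norm (T t (fst z)) * norm (\<kappa> t (fst z) (snd z)))\<^sup>2) \<partial>(N \<Otimes>\<^sub>M N))"
        using m by (simp add: nn_integral_add nn_integral_cmult)
      also have "\<dots> \<le> ennreal (32 * \<tau>\<^sup>2) * ennreal \<bar>C\<bar> + ennreal (8 * \<tau>\<^sup>2) * ennreal \<bar>C\<bar>"
        using d_bound[OF t] T_bound[OF t] unfolding \<kappa>_def[symmetric]
        by (intro add_mono mult_left_mono) (auto elim!: order.trans intro!: ennreal_leI)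
      also have "\<dots> = ennreal (40 * \<tau>\<^sup>2 * \<bar>C\<bar>)"
        by (simp flip: ennreal_mult ennreal_plus)
      finally show ?thesis .
    qed
    have "(\<integral>\<^sup>+z. ennreal ((kerA t (fst z) (snd z))\<^sup>2) \<partial>((count_space UNIV \<Otimes>\<^sub>M N) \<Otimes>\<^sub>M count_space UNIV \<Otimes>\<^sub>M N)) \<le>
      of_nat (CARD(4) * CARD(4)) * ennreal (40 * \<tau>\<^sup>2 * \<bar>C\<bar>)"
      using nn_integral_count_space_pair2_le[OF N(1), of "\<lambda>i j x y. ennreal ((matA t x y $ i $ j)\<^sup>2)", OF 1 2] by (simp add: kerA_def)
    also have "\<dots> = ennreal (16 * (40 * \<tau>\<^sup>2 * \<bar>C\<bar>))"
      by (subst ennreal_mult) auto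
    finally show "(\<integral>\<^sup>+z. ennreal ((kerA t (fst z) (snd z))\<^sup>2) \<partial>((count_space UNIV \<Otimes>\<^sub>M N) \<Otimes>\<^sub>M count_space UNIV \<Otimes>\<^sub>M N)) \<le> ennreal (16 * (40 * \<tau>\<^sup>2 * \<bar>C\<bar>))" .
  next
    have 1: "(\<lambda>z. ennreal ((quat (\<kappa> 0 (fst z) (snd z)) $ i $ j)\<^sup>2)) \<in> borel_measurable (N \<Otimes>\<^sub>M N)" for i j
      using meas_N[OF measurable_compose[OF \<kappa>_meas quat_meas[of i j]]] by simp
    have 2: "(\<integral>\<^sup>+z. ennreal ((quat (\<kappa> 0 (fst z) (snd z)) $ i $ j)\<^sup>2) \<partial>(N \<Otimes>\<^sub>M N)) \<le>
       (\<integral>\<^sup>+z. ennreal ((norm (\<kappa> 0 (fst z) (snd z)))\<^sup>2) \<partial>(N \<Otimes>\<^sub>M N))" for i j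
    proof (intro nn_integral_mono ennreal_leI)
      fix z
      have "\<bar>quat (\<kappa> 0 (fst z) (snd z)) $ i $ j\<bar> \<le> \<bar>norm (\<kappa> 0 (fst z) (snd z))\<bar>" by (simp add: quat_entry_le)
      then show "(quat (\<kappa> 0 (fst z) (snd z)) $ i $ j)\<^sup>2 \<le> (norm (\<kappa> 0 (fst z) (snd z)))\<^sup>2"
        unfolding abs_le_square_iff .
    qed
    have "(\<integral>\<^sup>+z. ennreal ((kerK 0 (fst z) (snd z))\<^sup>2) \<partial>((count_space UNIV \<Otimes>\<^sub>M N) \<Otimes>\<^sub>M count_space UNIV \<Otimes>\<^sub>M N)) \<le>
      of_nat (CARD(4) * CARD(4)) * (\<integral>\<^sup>+z. ennreal ((norm (\<kappa> 0 (fst z) (snd z)))\<^sup>2) \<partial>(N \<Otimes>\<^sub>M N))"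
      using nn_integral_count_space_pair2_le[OF N(1), of "\<lambda>i j x y. ennreal ((quat (\<kappa> 0 x y) $ i $ j)\<^sup>2)", OF 1 2] by (simp add: kerK_def)
    also have "\<dots> < \<infinity>" using K0_bound unfolding \<kappa>_def[symmetric]
      by (simp add: ennreal_mult_less_top)
    finally show "(\<integral>\<^sup>+z. ennreal ((kerK 0 (fst z) (snd z))\<^sup>2) \<partial>((count_space UNIV \<Otimes>\<^sub>M N) \<Otimes>\<^sub>M count_space UNIV \<Otimes>\<^sub>M N)) < \<infinity>" .
  next
    fix t :: real and q r :: "4 \<times> real" assume t: "t \<in> {0..1}"
    show "integrable (count_space UNIV \<Otimes>\<^sub>M N) (\<lambda>p. kerA t p q * kerK t p r)" by (rule AK_int[OF t])
    obtain j y where q: "q = (j, y)" by (cases q)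
    obtain k z where r: "r = (k, z)" by (cases r)
    let ?w = "\<lambda>x a b. \<kappa> t x z $ a * d t x y $ b - d t x z $ a * \<kappa> t x y $ b"
    let ?G = "\<lambda>a b. quat (axis a 1) ** quat (axis b 1)"
    let ?c = "\<lambda>a b. (\<tau> / 2) * ((quat (S t z) ** ?G a b + ?G a b ** quat (S t y)) $ k $ j)"
    \<comment> \<open>In a basis of the imaginary quaternions the matrix identity becomes a
      combination of the scalars \<open>?w x a b\<close> with coefficients depending on y and z
      only, so that integration in x reduces the claim to \<open>sym\<close> for single
      components.\<close>
    have pt: "(\<Sum>i\<in>UNIV. matA t x y $ i $ j * quat (\<kappa> t x z) $ i $ k) + (\<Sum>i\<in>UNIV. matA t x z $ i $ k * quat (\<kappa> t x y) $ i $ j) =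
      (\<Sum>a\<in>UNIV. \<Sum>b\<in>UNIV. ?c a b * ?w x a b)" for x
    proof -
      let ?W = "quat (\<kappa> t x z) ** quat (d t x y) - quat (d t x z) ** quat (\<kappa> t x y)"
      have W: "?W = (\<Sum>a\<in>UNIV. \<Sum>b\<in>UNIV. ?w x a b *\<^sub>R ?G a b)"
      proof -
        have prod: "quat u ** quat v = (\<Sum>a\<in>UNIV. \<Sum>b\<in>UNIV. (u $ a * v $ b) *\<^sub>R ?G a b)" for u v
          by (subst quat_basis[of u], subst quat_basis[of v], subst matrix_mult_sums(1))
            (simp only: matrix_mult_sums(2) matrix_mult_distribs(7,8) scaleR_scaleR scaleR_sum_right mult.commute)
        show ?thesis unfolding prod[of "\<kappa> t x z" "d t x y"] prod[of "d t x z" "\<kappa> t x y"] by (simp only: sum_subtractf[symmetric] scaleR_diff_left)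
      qed
      have "(\<Sum>i\<in>UNIV. matA t x y $ i $ j * quat (\<kappa> t x z) $ i $ k) + (\<Sum>i\<in>UNIV. matA t x z $ i $ k * quat (\<kappa> t x y) $ i $ j) =
        (transpose (quat (\<kappa> t x z)) ** matA t x y + transpose (matA t x z) ** quat (\<kappa> t x y)) $ k $ j"
        by (simp add: matrix_matrix_mult_def transpose_def mult.commute)
      also have "\<dots> = ((\<tau> / 2) *\<^sub>R (quat (S t z) ** ?W + ?W ** quat (S t y))) $ k $ j"
        unfolding matA_def
        by (subst lax_mat_skew[OF unit[OF t] unit[OF t] unit[OF t] \<kappa>_def \<kappa>_def]) simp
      also have "\<dots> = (\<Sum>a\<in>UNIV. \<Sum>b\<in>UNIV. ?c a b * ?w x a b)"
        unfolding W matrix_mult_sums matrix_mult_distribs(7,8)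
        by (simp only: vector_scaleR_component vector_add_component sum_component real_scaleR_def
            sum.distrib[symmetric] sum_distrib_left distrib_left mult_ac)
      finally show ?thesis .
    qed
    have wi: "integrable N (\<lambda>x. ?w x a b)" for a b
      by (intro Bochner_Integration.integrable_diff sq_integrable_mult sect_vec t)
    have w0: "(LINT x|N. ?w x a b) = 0" for a b
      using sym[OF t, of z a y b] unfolding \<kappa>_def[symmetric]
      by (subst Bochner_Integration.integral_diff) (auto intro!: sq_integrable_mult sect_vec t)
    have "(LINT p|(count_space UNIV \<Otimes>\<^sub>M N). kerA t p q * kerK t p r) + (LINT p|(count_space UNIV \<Otimes>\<^sub>M N). kerA t p r * kerK t p q) =
      (LINT x|N. (\<Sum>i\<in>UNIV. matA t x y $ i $ j * quat (\<kappa> t x z) $ i $ k) + (\<Sum>i\<in>UNIV. matA t x z $ i $ k * quat (\<kappa> t x y) $ i $ j))"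
      unfolding AK_eq[OF t] q r using AK_x[OF t]
      by (simp add: Bochner_Integration.integral_sum Bochner_Integration.integrable_sum Bochner_Integration.integral_add)
    also have "\<dots> = (\<Sum>a\<in>UNIV. \<Sum>b\<in>UNIV. ?c a b * (LINT x|N. ?w x a b))"
      unfolding pt using wi by (simp only: Bochner_Integration.integral_sum Bochner_Integration.integrable_sum integrable_mult_right integral_mult_right_zero)
    also have "\<dots> = 0" by (simp only: w0 mult_zero_right sum.neutral_const)
    finally show "(LINT p|(count_space UNIV \<Otimes>\<^sub>M N). kerA t p q * kerK t p r) = - (LINT p|(count_space UNIV \<Otimes>\<^sub>M N). kerA t p r * kerK t p q)"
      by simp
  qed
qed

end

section \<open>Separable kernels and rationality\<close>

text \<open>Finite rank with the rank left open. The relation \<open>D\<close> restricts it to pairs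
  off the zeros of \<phi>, where the kernels are true quotients. With lists, a sum of two kernels
  corresponds to concatenation.\<close>

definition separable_on :: "('p \<Rightarrow> 'q \<Rightarrow> bool) \<Rightarrow> ('p \<Rightarrow> 'q \<Rightarrow> 'f::real_normed_field) \<Rightarrow> bool" where
  "separable_on D G \<longleftrightarrow> (\<exists>fs. \<forall>p q. D p q \<longrightarrow> G p q = (\<Sum>(f, g)\<leftarrow>fs. f p * g q))"

lemma separable_on_0: "separable_on D (\<lambda>p q. 0)"
  unfolding separable_on_def by (rule exI[of _ "[]"]) simp

lemma separable_on_cong:
  "separable_on D G \<Longrightarrow> (\<And>p q. D p q \<Longrightarrow> G p q = G' p q) \<Longrightarrow> separable_on D G'"
  unfolding separable_on_def by auto

lemma separable_on_prod: "separable_on D (\<lambda>p q. u p * v q)"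
  unfolding separable_on_def by (rule exI[of _ "[(u, v)]"]) simp

lemma separable_on_add:
  assumes "separable_on D G" "separable_on D H"
  shows "separable_on D (\<lambda>p q. G p q + H p q)"
proof -
  obtain fs gs where "\<And>p q. D p q \<Longrightarrow> G p q = (\<Sum>(f, g)\<leftarrow>fs. f p * g q)"
    "\<And>p q. D p q \<Longrightarrow> H p q = (\<Sum>(f, g)\<leftarrow>gs. f p * g q)"
    using assms unfolding separable_on_def by blast
  then show ?thesis unfolding separable_on_def by (intro exI[of _ "fs @ gs"]) simp
qed

lemma separable_on_scale:
  assumes "separable_on D G"
  shows "separable_on D (\<lambda>p q. u p * v q * G p q)"
proof -
  obtain fs where fs: "\<And>p q. D p q \<Longrightarrow> G p q = (\<Sum>(f, g)\<leftarrow>fs. f p * g q)"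
    using assms unfolding separable_on_def by blast
  let ?h = "\<lambda>(f, g). (\<lambda>p. u p * f p, \<lambda>q. v q * g q)"
  have eq: "u p * v q * (\<Sum>(f, g)\<leftarrow>fs. f p * g q) = (\<Sum>(f, g)\<leftarrow>map ?h fs. f p * g q)" for p q
    by (induction fs) (auto simp: algebra_simps)
  have "D p q \<longrightarrow> u p * v q * G p q = (\<Sum>(f, g)\<leftarrow>map ?h fs. f p * g q)" for p q
    using fs[of p q] eq[of p q] by auto
  then show ?thesis unfolding separable_on_def by blast
qed

lemma separable_on_sum:
  "(\<And>i. i \<in> I \<Longrightarrow> separable_on D (G i)) \<Longrightarrow> separable_on D (\<lambda>p q. \<Sum>i\<in>I. G i p q)"
  by (induction I rule: infinite_finite_induct) (auto intro: separable_on_0 separable_on_add)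

lemma separable_on_Re:
  fixes G :: "'p \<Rightarrow> 'q \<Rightarrow> complex"
  assumes "separable_on D G"
  shows "separable_on D (\<lambda>p q. Re (G p q))"
proof -
  obtain fs where fs: "\<And>p q. D p q \<Longrightarrow> G p q = (\<Sum>(f, g)\<leftarrow>fs. f p * g q)"
    using assms unfolding separable_on_def by blast
  have "separable_on D (\<lambda>p q. Re (\<Sum>(f, g)\<leftarrow>fs. f p * g q))"
  proof (induction fs)
    case Nil then show ?case using separable_on_0[of D] by simp
  next
    case (Cons a fs)
    obtain f g where a: "a = (f, g)" by (cases a)
    have "separable_on D (\<lambda>p q. Re (f p) * Re (g q) + - Im (f p) * Im (g q) + Re (\<Sum>(f, g)\<leftarrow>fs. f p * g q))"
      by (intro separable_on_add separable_on_prod Cons.IH)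
    then show ?case by (simp add: a)
  qed
  then show ?thesis by (rule separable_on_cong) (simp add: fs)
qed

lemma separable_on_compose:
  assumes "separable_on D G"
  shows "separable_on (\<lambda>p q. D (a p) (b q)) (\<lambda>p q. G (a p) (b q))"
proof -
  obtain fs where fs: "\<And>p q. D p q \<Longrightarrow> G p q = (\<Sum>(f, g)\<leftarrow>fs. f p * g q)"
    using assms unfolding separable_on_def by blast
  then show ?thesis unfolding separable_on_def
    by (intro exI[of _ "map (\<lambda>(f, g). (f \<circ> a, g \<circ> b)) fs"]) (simp add: o_def case_prod_unfold)
qed

section \<open>Determinants of kernels of finite rank\<close>

definition det_form :: "nat \<Rightarrow> ('a \<Rightarrow> 'a \<Rightarrow> real) \<Rightarrow> (nat \<Rightarrow> 'a) \<Rightarrow> real" where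
  "det_form = perm_form (\<lambda>\<sigma>. of_int (sign \<sigma>))"

text \<open>A determinant with two equal rows: composing with the transposition of a and b flips the
  sign and, since \<mu> a = \<mu> b, keeps the product.\<close>

lemma alternating_sum_zero:
  fixes G :: "nat \<Rightarrow> 'l \<Rightarrow> real"
  assumes ab: "a < n" "b < n" "a \<noteq> b" "\<mu> a = \<mu> b"
  shows "(\<Sum>\<sigma> | \<sigma> permutes {..<n}. of_int (sign \<sigma>) * (\<Prod>i<n. G (\<sigma> i) (\<mu> i))) = (0::real)"
proof -
  let ?\<tau> = "Transposition.transpose a b" and ?P = "{\<sigma>. \<sigma> permutes {..<n}}"
  let ?h = "\<lambda>\<sigma>. of_int (sign \<sigma>) * (\<Prod>i<n. G (\<sigma> i) (\<mu> i)) :: real"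
  have \<tau>: "?\<tau> permutes {..<n}" using ab by (simp add: permutes_swap_id)
  have "bij_betw (\<lambda>\<sigma>. \<sigma> \<circ> ?\<tau>) ?P ?P"
  proof (rule bij_betw_byWitness[where f'="\<lambda>\<sigma>. \<sigma> \<circ> ?\<tau>"])
    have "(\<sigma> \<circ> ?\<tau>) \<circ> ?\<tau> = \<sigma>" for \<sigma> :: "nat \<Rightarrow> nat" by (simp add: fun_eq_iff)
    then show "\<forall>\<sigma>\<in>?P. (\<sigma> \<circ> ?\<tau>) \<circ> ?\<tau> = \<sigma>" "\<forall>\<sigma>\<in>?P. (\<sigma> \<circ> ?\<tau>) \<circ> ?\<tau> = \<sigma>" by blast+
    show "(\<lambda>\<sigma>. \<sigma> \<circ> ?\<tau>) ` ?P \<subseteq> ?P" "(\<lambda>\<sigma>. \<sigma> \<circ> ?\<tau>) ` ?P \<subseteq> ?P"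
      using permutes_compose[OF \<tau>] by blast+
  qed
  then have "(\<Sum>\<sigma>\<in>?P. ?h \<sigma>) = (\<Sum>\<sigma>\<in>?P. ?h (\<sigma> \<circ> ?\<tau>))"
    by (rule sum.reindex_bij_betw[symmetric])
  also have "\<dots> = (\<Sum>\<sigma>\<in>?P. - ?h \<sigma>)"
  proof (rule sum.cong[OF refl])
    fix \<sigma> assume "\<sigma> \<in> ?P"
    then have "permutation \<sigma>" "permutation ?\<tau>"
      using permutes_imp_permutation[of "{..<n}"] \<tau> by blast+
    from sign_compose[OF this] have s: "sign (\<sigma> \<circ> ?\<tau>) = - sign \<sigma>"
      using ab(3) by (simp add: sign_swap_id)
    have "(\<Prod>i<n. G ((\<sigma> \<circ> ?\<tau>) i) (\<mu> i)) = (\<Prod>i<n. G ((\<sigma> \<circ> ?\<tau>) (?\<tau> i)) (\<mu> (?\<tau> i)))"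
      by (rule prod.permute[OF \<tau>, unfolded comp_def[of _ ?\<tau>]])
    also have "\<dots> = (\<Prod>i<n. G (\<sigma> i) (\<mu> i))"
    proof (rule prod.cong[OF refl])
      fix i
      have "\<mu> (?\<tau> i) = \<mu> i"
        using ab(4) by (cases "i = a"; cases "i = b") simp_all
      then show "G ((\<sigma> \<circ> ?\<tau>) (?\<tau> i)) (\<mu> (?\<tau> i)) = G (\<sigma> i) (\<mu> i)" by simp
    qed
    finally show "?h (\<sigma> \<circ> ?\<tau>) = - ?h \<sigma>" by (simp add: s)
  qed
  finally show ?thesis by (simp add: sum_negf)
qed

text \<open>As in the Cauchy-Binet formula, multiplying out gives a sum over maps \<mu> from n rows
  to m < n terms. No such map is injective, so every inner sum is alternating with a repeated
  index.\<close>

lemma det_form_low_rank: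
  fixes K :: "'a \<Rightarrow> 'a \<Rightarrow> real"
  assumes K: "\<And>p q. D p q \<Longrightarrow> K p q = (\<Sum>l<m. f l p * g l q)" and mn: "m < n"
    and w: "\<And>a b. a < n \<Longrightarrow> b < n \<Longrightarrow> D (w a) (w (n + b))"
  shows "det_form n K w = 0"
proof -
  let ?P = "{\<sigma>. \<sigma> permutes {..<n}}"
  let ?E = "{..<n} \<rightarrow>\<^sub>E {..<m}"
  have finP: "finite ?P" by (simp add: finite_permutations)
  have "det_form n K w = (\<Sum>\<sigma>\<in>?P. of_int (sign \<sigma>) * (\<Prod>a<n. \<Sum>l<m. f l (w a) * g l (w (n + \<sigma> a))))"
    unfolding det_form_def perm_form_def
  proof (intro sum.cong refl arg_cong2[where f="(*)"] prod.cong)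
    fix \<sigma> a assume "\<sigma> \<in> ?P" and a: "a \<in> {..<n}"
    then have "\<sigma> a < n" using permutes_in_image[of \<sigma> "{..<n}" a] by simp
    then show "K (w a) (w (n + \<sigma> a)) = (\<Sum>l<m. f l (w a) * g l (w (n + \<sigma> a)))"
      using a by (intro K w) auto
  qed
  also have "\<dots> = (\<Sum>\<sigma>\<in>?P. \<Sum>\<mu>\<in>?E. (\<Prod>a<n. f (\<mu> a) (w a)) * (of_int (sign \<sigma>) * (\<Prod>a<n. g (\<mu> a) (w (n + \<sigma> a)))))"
    by (intro sum.cong refl) (simp add: prod_sum_PiE sum_distrib_left prod.distrib mult_ac)
  also have "\<dots> = (\<Sum>\<mu>\<in>?E. (\<Prod>a<n. f (\<mu> a) (w a)) * (\<Sum>\<sigma>\<in>?P. of_int (sign \<sigma>) * (\<Prod>a<n. g (\<mu> a) (w (n + \<sigma> a)))))"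
    by (subst sum.swap) (simp add: sum_distrib_left)
  also have "\<dots> = 0"
  proof (rule sum.neutral, rule ballI)
    fix \<mu> assume \<mu>: "\<mu> \<in> ?E"
    have "\<not> inj_on \<mu> {..<n}"
    proof
      assume "inj_on \<mu> {..<n}"
      then have "card {..<n} \<le> card {..<m}"
        using \<mu> by (intro card_inj_on_le[of \<mu>]) auto
      then show False using mn by simp
    qed
    then obtain a b where ab: "a < n" "b < n" "a \<noteq> b" "\<mu> a = \<mu> b"
      by (auto simp: inj_on_def)
    show "(\<Prod>a<n. f (\<mu> a) (w a)) * (\<Sum>\<sigma>\<in>?P. of_int (sign \<sigma>) * (\<Prod>a<n. g (\<mu> a) (w (n + \<sigma> a)))) = 0"
      using alternating_sum_zero[OF ab, of "\<lambda>i l. g l (w (n + i))"] by simp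
  qed
  finally show ?thesis .
qed

lemma separable_on_det_form:
  fixes K :: "'a \<Rightarrow> 'a \<Rightarrow> real"
  assumes "separable_on D K"
  obtains n where "\<And>w. (\<And>a b. a < n \<Longrightarrow> b < n \<Longrightarrow> D (w a) (w (n + b))) \<Longrightarrow> det_form n K w = 0"
proof -
  obtain fs where fs: "\<And>p q. D p q \<Longrightarrow> K p q = (\<Sum>(f, g)\<leftarrow>fs. f p * g q)"
    using assms unfolding separable_on_def by blast
  have "K p q = (\<Sum>l<length fs. fst (fs ! l) p * snd (fs ! l) q)" if "D p q" for p q
    by (simp add: fs[OF that] sum_list_sum_nth case_prod_unfold lessThan_atLeast0)
  from det_form_low_rank[where D=D and K=K and m="length fs" and f="\<lambda>l. fst (fs ! l)" and g="\<lambda>l. snd (fs ! l)", OF this]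
  show ?thesis using that[of "Suc (length fs)"] by blast
qed

lemma det_form_0: "det_form 0 K w = 1"
  by (simp add: det_form_def perm_form_def)

text \<open>Laplace expansion along the last row, with the last cofactor identified.\<close>

lemma det_form_Suc_expand:
  fixes K :: "'a \<Rightarrow> 'a \<Rightarrow> real"
  obtains C where "C r = det_form r K (\<lambda>i. if i < r then x i else y (i - r))"
    and "\<And>p. det_form (Suc r) K (\<lambda>i. if i < r then x i else if i = r then p else y (i - Suc r)) = (\<Sum>b\<le>r. C b * K p (y b))"
proof -
  let ?P = "{\<sigma>. \<sigma> permutes {..<Suc r}}"
  define C where "C b = (\<Sum>\<sigma> | \<sigma> permutes {..<Suc r} \<and> \<sigma> r = b. of_int (sign \<sigma>) * (\<Prod>a<r. K (x a) (y (\<sigma> a))))" for b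
  have finP: "finite ?P" by (simp add: finite_permutations)
  have "{\<sigma>. \<sigma> permutes {..<Suc r} \<and> \<sigma> r = r} = {\<sigma>. \<sigma> permutes {..<r}}"
  proof safe
    fix \<sigma> assume s: "\<sigma> permutes {..<Suc r}" "\<sigma> r = r"
    then show "\<sigma> permutes {..<r}"
      using permutes_superset[OF s(1), of "{..<r}"] by (auto simp: less_Suc_eq)
  next
    fix \<sigma> assume "\<sigma> permutes {..<r}"
    then show "\<sigma> permutes {..<Suc r}" by (rule permutes_subset) auto
  qed (auto simp: permutes_def)
  then have 1: "C r = det_form r K (\<lambda>i. if i < r then x i else y (i - r))"
    unfolding C_def det_form_def perm_form_def by simp
  have 2: "det_form (Suc r) K (\<lambda>i. if i < r then x i else if i = r then p else y (i - Suc r)) = (\<Sum>b\<le>r. C b * K p (y b))" for p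
  proof -
    have "det_form (Suc r) K (\<lambda>i. if i < r then x i else if i = r then p else y (i - Suc r)) =
      (\<Sum>\<sigma>\<in>?P. of_int (sign \<sigma>) * (\<Prod>a<r. K (x a) (y (\<sigma> a))) * K p (y (\<sigma> r)))"
      unfolding det_form_def perm_form_def by (simp add: mult_ac cong: prod.cong_simp)
    also have "\<dots> = (\<Sum>b\<le>r. \<Sum>\<sigma>\<in>{\<sigma> \<in> ?P. \<sigma> r = b}. of_int (sign \<sigma>) * (\<Prod>a<r. K (x a) (y (\<sigma> a))) * K p (y (\<sigma> r)))"
    proof (rule sum.group[symmetric, OF finP])
      show "(\<lambda>\<sigma>. \<sigma> r) ` ?P \<subseteq> {..r}"
        using permutes_in_image[of _ "{..<Suc r}" r] by (auto simp: less_Suc_eq_le)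
    qed simp
    also have "\<dots> = (\<Sum>b\<le>r. C b * K p (y b))"
      unfolding C_def by (intro sum.cong refl) (simp add: sum_distrib_right)
    finally show ?thesis .
  qed
  show ?thesis by (rule that[OF 1 2])
qed

text \<open>Rationality off finitely many values of \<open>e x\<close>, with denominators cleared.
  Tolerating exceptional values lets poles appear in intermediate quotients; continuity of the final
  function removes them.\<close>

definition rat_on :: "real set \<Rightarrow> (real \<Rightarrow> complex) \<Rightarrow> (real \<Rightarrow> complex) \<Rightarrow> bool" where
  "rat_on X e f \<longleftrightarrow> (\<exists>p q. q \<noteq> 0 \<and> (\<forall>x\<in>X. poly q (e x) \<noteq> 0 \<longrightarrow> f x * poly q (e x) = poly p (e x)))"

lemma rat_onI:
  "q \<noteq> 0 \<Longrightarrow> (\<And>x. x \<in> X \<Longrightarrow> poly q (e x) \<noteq> 0 \<Longrightarrow> f x * poly q (e x) = poly p (e x)) \<Longrightarrow> rat_on X e f"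
  unfolding rat_on_def by blast

lemma rat_on_const: "rat_on X e (\<lambda>x. k)"
  by (rule rat_onI[of 1 _ _ _ "[:k:]"]) auto

lemma rat_on_mult:
  assumes "rat_on X e f" "rat_on X e g"
  shows "rat_on X e (\<lambda>x. f x * g x)"
proof -
  obtain p q where f: "q \<noteq> 0" "\<And>x. x \<in> X \<Longrightarrow> poly q (e x) \<noteq> 0 \<Longrightarrow> f x * poly q (e x) = poly p (e x)"
    using assms(1) unfolding rat_on_def by blast
  obtain p' q' where g: "q' \<noteq> 0" "\<And>x. x \<in> X \<Longrightarrow> poly q' (e x) \<noteq> 0 \<Longrightarrow> g x * poly q' (e x) = poly p' (e x)"
    using assms(2) unfolding rat_on_def by blast
  show ?thesis
  proof (rule rat_onI[of "q * q'" _ _ _ "p * p'"])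
    fix x assume x: "x \<in> X" "poly (q * q') (e x) \<noteq> 0"
    then have "f x * poly q (e x) = poly p (e x)" "g x * poly q' (e x) = poly p' (e x)"
      using f(2) g(2) by auto
    then show "f x * g x * poly (q * q') (e x) = poly (p * p') (e x)"
      by (metis (no_types, lifting) mult.assoc mult.left_commute poly_mult)
  qed (use f g in auto)
qed

lemma rat_on_add:
  assumes "rat_on X e f" "rat_on X e g"
  shows "rat_on X e (\<lambda>x. f x + g x)"
proof -
  obtain p q where f: "q \<noteq> 0" "\<And>x. x \<in> X \<Longrightarrow> poly q (e x) \<noteq> 0 \<Longrightarrow> f x * poly q (e x) = poly p (e x)"
    using assms(1) unfolding rat_on_def by blast
  obtain p' q' where g: "q' \<noteq> 0" "\<And>x. x \<in> X \<Longrightarrow> poly q' (e x) \<noteq> 0 \<Longrightarrow> g x * poly q' (e x) = poly p' (e x)"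
    using assms(2) unfolding rat_on_def by blast
  show ?thesis
  proof (rule rat_onI[of "q * q'" _ _ _ "p * q' + p' * q"])
    fix x assume x: "x \<in> X" "poly (q * q') (e x) \<noteq> 0"
    then have *: "f x * poly q (e x) = poly p (e x)" "g x * poly q' (e x) = poly p' (e x)"
      using f(2) g(2) by auto
    show "(f x + g x) * poly (q * q') (e x) = poly (p * q' + p' * q) (e x)"
      unfolding poly_mult poly_add *[symmetric] by (simp add: algebra_simps)
  qed (use f g in auto)
qed

lemma rat_on_uminus: "rat_on X e f \<Longrightarrow> rat_on X e (\<lambda>x. - f x)"
  using rat_on_mult[OF rat_on_const[of X e "-1"]] by simp

lemma rat_on_diff: "rat_on X e f \<Longrightarrow> rat_on X e g \<Longrightarrow> rat_on X e (\<lambda>x. f x - g x)"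
  using rat_on_add[OF _ rat_on_uminus] by force

lemma rat_on_sum: "(\<And>i. i \<in> I \<Longrightarrow> rat_on X e (f i)) \<Longrightarrow> rat_on X e (\<lambda>x. \<Sum>i\<in>I. f i x)"
  by (induction I rule: infinite_finite_induct) (auto intro: rat_on_const rat_on_add)

lemma rat_on_simple_pole: "rat_on X e (\<lambda>x. k / (e x - z))"
  by (rule rat_onI[of "[:- z, 1:]" _ _ _ "[:k:]"]) auto

text \<open>\<open>e\<close> is the coordinate in which functions are to be rational, x or exp(ix).
  By \<open>factor\<close>, 1/\<phi>(x - y) is the Cauchy kernel in this coordinate up to the
  product c x c y, and this is why finite rank and rationality correspond. \<open>e_sep\<close> says
  that the fibres of \<open>e\<close> are discrete.\<close>

locale kernel_param =
  fixes e c :: "real \<Rightarrow> complex" and \<phi> :: "real \<Rightarrow> real"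
  assumes \<phi>_cont: "continuous_on UNIV \<phi>" and \<phi>_odd: "\<And>u. \<phi> (- u) = - \<phi> u"
    and factor: "\<And>x y. \<phi> (x - y) \<noteq> 0 \<Longrightarrow> of_real (inverse (\<phi> (x - y))) = c x * c y / (e x - e y)"
    and c_nz: "\<And>x. c x \<noteq> 0"
    and e_cont: "continuous_on UNIV e"
    and e_sep: "\<And>x z. eventually (\<lambda>x'. e x' \<noteq> z) (at x)"
    and \<phi>_zero: "\<And>x y. \<phi> (x - y) = 0 \<longleftrightarrow> e x = e y"
begin

lemma eventually_poly_nz:
  assumes "q \<noteq> 0"
  shows "eventually (\<lambda>x. poly q (e x) \<noteq> 0) (at x0)"
proof -
  have "eventually (\<lambda>x. \<forall>z\<in>{z. poly q z = 0}. e x \<noteq> z) (at x0)"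
    using poly_roots_finite[OF assms] by (intro eventually_ball_finite ballI e_sep) auto
  then show ?thesis by eventually_elim auto
qed

lemma eventually_\<phi>_nz: "eventually (\<lambda>x. \<phi> (x - y) \<noteq> 0) (at x0)"
  using e_sep[of "e y" x0] by (simp add: \<phi>_zero)

lemma rat_on_divide:
  assumes g: "rat_on X e g" and h: "rat_on X e h" and r: "r \<noteq> 0"
    and eq: "\<And>x. x \<in> X \<Longrightarrow> poly r (e x) \<noteq> 0 \<Longrightarrow> f x * h x = g x"
    and nz: "eventually (\<lambda>x. x \<in> X \<and> h x \<noteq> 0) (at x0)"
  shows "rat_on X e f"
proof -
  obtain p q where g: "q \<noteq> 0" "\<And>x. x \<in> X \<Longrightarrow> poly q (e x) \<noteq> 0 \<Longrightarrow> g x * poly q (e x) = poly p (e x)"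
    using assms(1) unfolding rat_on_def by blast
  obtain p' q' where h: "q' \<noteq> 0" "\<And>x. x \<in> X \<Longrightarrow> poly q' (e x) \<noteq> 0 \<Longrightarrow> h x * poly q' (e x) = poly p' (e x)"
    using assms(2) unfolding rat_on_def by blast
  have "p' \<noteq> 0"
  proof
    assume p': "p' = 0"
    have "eventually (\<lambda>x. False) (at x0)"
      using nz eventually_poly_nz[OF h(1), of x0]
    proof eventually_elim
      case (elim x)
      then show ?case using h(2)[of x] p' by simp
    qed
    then show False by simp
  qed
  show ?thesis
  proof (rule rat_onI[of "p' * q * q' * r" _ _ _ "p * q' * q' * r"])
    show "p' * q * q' * r \<noteq> 0" using \<open>p' \<noteq> 0\<close> g(1) h(1) r by simp
    fix x assume x: "x \<in> X" "poly (p' * q * q' * r) (e x) \<noteq> 0"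
    then have 1: "g x * poly q (e x) = poly p (e x)" "h x * poly q' (e x) = poly p' (e x)" "f x * h x = g x"
      using g(2) h(2) eq by auto
    show "f x * poly (p' * q * q' * r) (e x) = poly (p * q' * q' * r) (e x)"
      unfolding poly_mult 1(1,2)[symmetric] 1(3)[symmetric] by (simp add: algebra_simps)
  qed
qed

lemma tendsto_eq_on_dense:
  fixes f g :: "real \<Rightarrow> complex"
  assumes "isCont f x0" "isCont g x0" "eventually (\<lambda>x. f x = g x) (at x0)"
  shows "f x0 = g x0"
proof -
  have "(f \<longlongrightarrow> f x0) (at x0)" "(g \<longlongrightarrow> g x0) (at x0)"
    using assms(1,2) by (auto simp: isCont_def)
  then have "(f \<longlongrightarrow> g x0) (at x0)" using assms(3) by (simp add: filterlim_cong)
  with \<open>(f \<longlongrightarrow> f x0) (at x0)\<close> show ?thesis by (intro tendsto_unique[of "at x0" f]) auto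
qed

lemma isCont_poly_e: "isCont (\<lambda>x. poly q (e x)) x"
  using e_cont by (intro continuous_intros) (simp add: continuous_on_eq_continuous_at)

text \<open>Where q vanishes at e x0, the identity makes p vanish too. Cancelling the linear factor
  preserves the identity off the fibre of e x0, continuity restores it on the fibre, and the degree
  of q has dropped.\<close>

lemma rational_reduce:
  assumes f: "\<And>x. isCont f x" and "q \<noteq> 0" "\<And>x. f x * poly q (e x) = poly p (e x)"
  shows "\<exists>p q. \<forall>x. poly q (e x) \<noteq> 0 \<and> f x = poly p (e x) / poly q (e x)"
  using assms(2,3)
proof (induction "degree q" arbitrary: p q rule: less_induct)
  case less
  show ?case
  proof (cases "\<exists>x. poly q (e x) = 0")
    case False
    then have "\<forall>x. poly q (e x) \<noteq> 0 \<and> f x = poly p (e x) / poly q (e x)"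
      using less.prems(2) by (auto simp: field_simps)
    then show ?thesis by blast
  next
    case True
    then obtain x0 where x0: "poly q (e x0) = 0" by blast
    then have "poly p (e x0) = 0" using less.prems(2)[of x0] by simp
    with x0 obtain p1 q1 where p1: "p = [:- e x0, 1:] * p1" and q1: "q = [:- e x0, 1:] * q1"
      by (auto simp: poly_eq_0_iff_dvd elim!: dvdE)
    have q10: "q1 \<noteq> 0" using less.prems(1) q1 by auto
    have "degree q1 < degree q" unfolding q1 using q10 by (subst degree_mult_eq) auto
    moreover have "f x * poly q1 (e x) = poly p1 (e x)" for x
    proof (rule tendsto_eq_on_dense)
      show "isCont (\<lambda>x. f x * poly q1 (e x)) x" "isCont (\<lambda>x. poly p1 (e x)) x"
        by (intro continuous_intros f isCont_poly_e)+
      show "eventually (\<lambda>x. f x * poly q1 (e x) = poly p1 (e x)) (at x)"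
        using e_sep[of "e x0" x]
      proof eventually_elim
        case (elim x)
        have "(e x - e x0) * (f x * poly q1 (e x)) = (e x - e x0) * poly p1 (e x)"
          using less.prems(2)[of x] unfolding p1 q1 by (simp add: algebra_simps)
        then show ?case using elim by simp
      qed
    qed
    ultimately show ?thesis using less.hyps[OF _ q10] by blast
  qed
qed

text \<open>Continuity carries the cleared identity from X to its closure, and \<open>ext\<close>
  brings every point into the closure without changing the values of \<open>e\<close> and f. On the
  circle this is a shift by a multiple of the period.\<close>

lemma rat_on_globalize:
  assumes f: "\<And>x. isCont f x" and X: "open X" and "rat_on X e f"
    and ext: "\<And>x. \<exists>x'\<in>closure X. e x' = e x \<and> f x' = f x"
  shows "\<exists>p q. \<forall>x. poly q (e x) \<noteq> 0 \<and> f x = poly p (e x) / poly q (e x)"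
proof -
  obtain p q where q: "q \<noteq> 0" "\<And>x. x \<in> X \<Longrightarrow> poly q (e x) \<noteq> 0 \<Longrightarrow> f x * poly q (e x) = poly p (e x)"
    using assms(3) unfolding rat_on_def by blast
  have cont: "isCont (\<lambda>x. f x * poly q (e x)) x" "isCont (\<lambda>x. poly p (e x)) x" for x
    by (intro continuous_intros f isCont_poly_e)+
  have "f x * poly q (e x) = poly p (e x)" if "x \<in> X" for x
  proof (rule tendsto_eq_on_dense[OF cont])
    have "eventually (\<lambda>x. x \<in> X) (at x)" using X that by (simp add: eventually_at_in_open')
    with eventually_poly_nz[OF q(1), of x]
    show "eventually (\<lambda>x. f x * poly q (e x) = poly p (e x)) (at x)"
      by eventually_elim (use q(2) in auto)
  qed
  then have "X \<subseteq> {x. f x * poly q (e x) = poly p (e x)}" by auto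
  moreover have "closed {x. f x * poly q (e x) = poly p (e x)}"
    using cont by (intro closed_Collect_eq) (auto simp: continuous_on_eq_continuous_at)
  ultimately have cl: "closure X \<subseteq> {x. f x * poly q (e x) = poly p (e x)}" by (rule closure_minimal)
  have "f x * poly q (e x) = poly p (e x)" for x
    using ext[of x] cl by (metis (mono_tags, lifting) mem_Collect_eq subset_iff)
  from rational_reduce[OF f q(1) this] show ?thesis .
qed

end

section \<open>From almost everywhere vanishing minors to vanishing minors\<close>

lemma det_form_cong: "(\<And>i. i < 2 * n \<Longrightarrow> w i = w' i) \<Longrightarrow> det_form n K w = det_form n K w'"
  unfolding det_form_def perm_form_def
proof (intro sum.cong refl arg_cong2[where f="(*)"] prod.cong)
  fix \<sigma> a assume w: "\<And>i. i < 2 * n \<Longrightarrow> w i = w' i" and s: "\<sigma> \<in> {\<sigma>. \<sigma> permutes {..<n}}" and a: "a \<in> {..<n}"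
  then have "\<sigma> a < n" using permutes_in_image[of \<sigma> "{..<n}" a] by simp
  then show "K (w a) (w (n + \<sigma> a)) = K (w' a) (w' (n + \<sigma> a))" using w a by simp
qed

text \<open>A small box around w has positive measure, so it cannot lie in the exceptional null set
  and contains a zero of the form. Zeros from shrinking boxes, with matrix indices kept fixed,
  converge to w, and on \<open>D\<close> the kernel is continuous.\<close>

lemma det_form_zero_of_AE:
  fixes K :: "'i::finite \<times> real \<Rightarrow> 'i \<times> real \<Rightarrow> real"
  assumes N: "sigma_finite_measure N" "sets N = sets borel"
    and pos: "\<And>U x. open U \<Longrightarrow> x \<in> U \<Longrightarrow> x \<in> X \<Longrightarrow> emeasure N U \<noteq> 0"
    and cont: "\<And>i j x y. D x y \<Longrightarrow> isCont (\<lambda>z. K (i, fst z) (j, snd z)) (x, y)"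
    and ae: "AE w in PiM {..<2 * n} (\<lambda>_. count_space UNIV \<Otimes>\<^sub>M N). det_form n K w = 0"
    and w: "\<And>i. i < 2 * n \<Longrightarrow> snd (w i) \<in> X" "\<And>a b. a < n \<Longrightarrow> b < n \<Longrightarrow> D (snd (w a)) (snd (w (n + b)))"
  shows "det_form n K w = 0"
proof -
  interpret N: sigma_finite_measure N by (rule N)
  interpret C: sigma_finite_measure "count_space (UNIV :: 'i set)"
    by (rule sigma_finite_measure_count_space_countable) simp
  interpret P: pair_sigma_finite "count_space (UNIV :: 'i set)" N ..
  interpret product_sigma_finite "\<lambda>_ :: nat. count_space (UNIV :: 'i set) \<Otimes>\<^sub>M N" by standard
  let ?M = "PiM {..<2 * n} (\<lambda>_. count_space (UNIV :: 'i set) \<Otimes>\<^sub>M N)"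
  let ?B = "\<lambda>k i. {fst (w i)} \<times> ball (snd (w i)) (inverse (real (Suc k)))"
  have ex: "\<exists>v. (\<forall>i<2 * n. v i \<in> ?B k i) \<and> det_form n K v = 0" for k
  proof (rule ccontr)
    assume *: "\<not> ?thesis"
    have Bs: "?B k i \<in> sets (count_space UNIV \<Otimes>\<^sub>M N)" for i
      by (intro pair_measureI) (auto simp: N(2))
    have box: "PiE {..<2 * n} (?B k) \<in> sets ?M"
      by (intro sets_PiM_I_finite Bs) auto
    have "AE v in ?M. v \<notin> PiE {..<2 * n} (?B k)"
      using ae
    proof eventually_elim
      case (elim v)
      then show ?case using * by (auto simp: PiE_iff)
    qed
    then have "emeasure ?M (PiE {..<2 * n} (?B k)) = 0"
      using AE_iff_null_sets[OF box] by auto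
    moreover have "emeasure ?M (PiE {..<2 * n} (?B k)) = (\<Prod>i<2 * n. emeasure (count_space UNIV \<Otimes>\<^sub>M N) (?B k i))"
      by (intro emeasure_PiM Bs) auto
    moreover have "emeasure (count_space UNIV \<Otimes>\<^sub>M N) (?B k i) \<noteq> 0" if "i < 2 * n" for i
    proof -
      have "emeasure (count_space UNIV \<Otimes>\<^sub>M N) (?B k i) = emeasure N (ball (snd (w i)) (inverse (real (Suc k))))"
        using N.emeasure_pair_measure_Times[of "{fst (w i)}" "count_space UNIV" "ball (snd (w i)) (inverse (real (Suc k)))"]
        by (simp add: N(2))
      then show ?thesis using pos[of "ball (snd (w i)) (inverse (real (Suc k)))" "snd (w i)"] w(1)[OF that] by simp
    qed
    ultimately show False by simp
  qed
  obtain v where v: "\<And>k i. i < 2 * n \<Longrightarrow> v k i \<in> ?B k i" and v0: "\<And>k. det_form n K (v k) = 0"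
    using ex by metis
  have lim: "(\<lambda>k. snd (v k i)) \<longlonglongrightarrow> snd (w i)" if "i < 2 * n" for i
  proof (rule metric_LIMSEQ_I)
    fix r :: real assume "r > 0"
    then obtain m where m: "inverse (real (Suc m)) < r" using reals_Archimedean by blast
    have "dist (snd (v k i)) (snd (w i)) < r" if "k \<ge> m" for k
    proof -
      have "dist (snd (v k i)) (snd (w i)) < inverse (real (Suc k))"
        using v[OF \<open>i < 2 * n\<close>, of k] by (auto simp: dist_commute mem_Times_iff)
      also have "\<dots> \<le> inverse (real (Suc m))" using that by (simp add: field_simps)
      finally show ?thesis using m by simp
    qed
    then show "\<exists>m. \<forall>k\<ge>m. dist (snd (v k i)) (snd (w i)) < r" by blast
  qed
  have fsteq: "fst (v k i) = fst (w i)" if "i < 2 * n" for k i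
    using v[OF that, of k] by (auto simp: mem_Times_iff)
  have "(\<lambda>k. det_form n K (v k)) \<longlonglongrightarrow> det_form n K w"
    unfolding det_form_def perm_form_def
  proof (intro tendsto_sum tendsto_mult tendsto_const tendsto_prod)
    fix \<sigma> a assume s: "\<sigma> \<in> {\<sigma>. \<sigma> permutes {..<n}}" and a: "a \<in> {..<n}"
    then have sa: "\<sigma> a < n" using permutes_in_image[of \<sigma> "{..<n}" a] by simp
    let ?i = "fst (w a)" and ?j = "fst (w (n + \<sigma> a))"
    have lp: "(\<lambda>k. (snd (v k a), snd (v k (n + \<sigma> a)))) \<longlonglongrightarrow> (snd (w a), snd (w (n + \<sigma> a)))"
      using a sa by (intro tendsto_Pair lim) auto
    have "(\<lambda>k. (\<lambda>z. K (?i, fst z) (?j, snd z)) (snd (v k a), snd (v k (n + \<sigma> a))))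
        \<longlonglongrightarrow> (\<lambda>z. K (?i, fst z) (?j, snd z)) (snd (w a), snd (w (n + \<sigma> a)))"
      by (rule isCont_tendsto_compose[OF cont lp]) (use w(2) a sa in auto)
    moreover have "(?i, snd (v k a)) = v k a" "(?j, snd (v k (n + \<sigma> a))) = v k (n + \<sigma> a)" for k
      using fsteq[of a k] fsteq[of "n + \<sigma> a" k] a sa by (simp_all add: prod_eq_iff)
    ultimately show "(\<lambda>k. K (v k a) (v k (n + \<sigma> a))) \<longlonglongrightarrow> K (w a) (w (n + \<sigma> a))" by simp
  qed
  then show ?thesis by (simp add: v0 LIMSEQ_const_iff)
qed

text \<open>For one pair of coordinates the exceptional set is null by integrating over the first
  coordinate alone; there are finitely many pairs.\<close>

lemma AE_PiM_off_diagonal: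
  fixes N :: "real measure" and n :: nat
  assumes N: "sigma_finite_measure N" "sets N = sets borel" and \<phi>: "\<phi> \<in> borel_measurable borel"
    and ae: "\<And>y. AE x in N. \<phi> (x - y) \<noteq> (0::real)"
  shows "AE w in PiM {..<2 * n} (\<lambda>_. count_space (UNIV :: 'i::finite set) \<Otimes>\<^sub>M N).
     \<forall>a\<in>{..<n}. \<forall>b\<in>{..<n}. \<phi> (snd (w a) - snd (w (n + b))) \<noteq> 0"
proof -
  interpret N: sigma_finite_measure N by (rule N)
  interpret C: sigma_finite_measure "count_space (UNIV :: 'i set)"
    by (rule sigma_finite_measure_count_space_countable) simp
  interpret P: pair_sigma_finite "count_space (UNIV :: 'i set)" N ..
  interpret product_sigma_finite "\<lambda>_ :: nat. count_space (UNIV :: 'i set) \<Otimes>\<^sub>M N" by standard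
  let ?M = "PiM {..<2 * n} (\<lambda>_. count_space (UNIV :: 'i set) \<Otimes>\<^sub>M N)"
  have idN: "(\<lambda>x. x) \<in> N \<rightarrow>\<^sub>M borel" by (rule measurable_ident_sets[OF N(2)])
  have pair0: "(\<integral>\<^sup>+p. (if \<phi> (snd p - y) = 0 then 1 else 0) \<partial>(count_space (UNIV :: 'i set) \<Otimes>\<^sub>M N)) = (0 :: ennreal)" for y
  proof -
    have [measurable]: "(\<lambda>x. \<phi> (x - y)) \<in> borel_measurable N"
      using measurable_compose[OF idN, of "\<lambda>x. \<phi> (x - y)" borel] \<phi> by simp
    have m: "(\<lambda>p. (if \<phi> (snd p - y) = 0 then 1 else 0) :: ennreal) \<in> borel_measurable (count_space (UNIV :: 'i set) \<Otimes>\<^sub>M N)"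
      by (intro measurable_pair_measure_countable1) auto
    have "(\<integral>\<^sup>+x. (if \<phi> (x - y) = 0 then 1 else 0) \<partial>N) = (0 :: ennreal)"
      using ae[of y] by (subst nn_integral_0_iff_AE) auto
    then show ?thesis using N.nn_integral_fst[OF m] by simp
  qed
  have one: "AE w in ?M. \<phi> (snd (w i) - snd (w j)) \<noteq> 0" if ij: "i < 2 * n" "j < 2 * n" "i \<noteq> j" for i j :: nat
  proof -
    have ins: "insert i ({..<2 * n} - {i}) = {..<2 * n}" using ij by auto
    have cm: "(\<lambda>w. snd (w l)) \<in> borel_measurable ?M" if "l < 2 * n" for l
    proof -
      have "(\<lambda>w. w l) \<in> ?M \<rightarrow>\<^sub>M count_space UNIV \<Otimes>\<^sub>M N"
        using that by (intro measurable_component_singleton) auto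
      from measurable_compose[OF measurable_compose[OF this measurable_snd] idN] show ?thesis .
    qed
    have m: "(\<lambda>w. (if \<phi> (snd (w i) - snd (w j)) = 0 then 1 else 0) :: ennreal) \<in> borel_measurable ?M"
    proof -
      have [measurable]: "(\<lambda>w. \<phi> (snd (w i) - snd (w j))) \<in> borel_measurable ?M"
        by (rule measurable_compose[OF borel_measurable_diff[OF cm[OF ij(1)] cm[OF ij(2)]] \<phi>])
      show ?thesis by measurable
    qed
    have "(\<integral>\<^sup>+w. (if \<phi> (snd (w i) - snd (w j)) = 0 then 1 else 0) \<partial>?M) =
      (\<integral>\<^sup>+w. \<integral>\<^sup>+p. (if \<phi> (snd ((w(i := p)) i) - snd ((w(i := p)) j)) = 0 then 1 else 0)
         \<partial>(count_space (UNIV :: 'i set) \<Otimes>\<^sub>M N) \<partial>PiM ({..<2 * n} - {i}) (\<lambda>_. count_space (UNIV :: 'i set) \<Otimes>\<^sub>M N))"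
      by (rule product_nn_integral_insert[of "{..<2 * n} - {i}" i, unfolded ins]) (use m in auto)
    also have "\<dots> = (0 :: ennreal)" using ij(3) by (simp add: pair0)
    finally have "AE w in ?M. ((if \<phi> (snd (w i) - snd (w j)) = 0 then 1 else 0) :: ennreal) = 0"
      using nn_integral_0_iff_AE[OF m] by simp
    then show ?thesis by eventually_elim (auto split: if_splits)
  qed
  show ?thesis
    by (intro AE_finite_allI one) auto
qed

section \<open>Rational functions have kernels of finite rank, and conversely\<close>

context kernel_param
begin

text \<open>Horner's recursion: the divided difference of a + z p(z) is e x times that of p, plus p
  (e y).\<close>

lemma separable_poly_quotient:
  "separable_on (\<lambda>x y. e x \<noteq> e y) (\<lambda>x y. (poly p (e x) - poly p (e y)) / (e x - e y))"
proof (induction p)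
  case 0
  then show ?case using separable_on_0 by simp
next
  case (pCons a p)
  have "separable_on (\<lambda>x y. e x \<noteq> e y) (\<lambda>x y. e x * 1 * ((poly p (e x) - poly p (e y)) / (e x - e y)) + 1 * poly p (e y))"
    by (intro separable_on_add separable_on_scale separable_on_prod pCons.IH)
  then show ?case
    by (rule separable_on_cong) (simp add: field_simps)
qed

text \<open>The quotient rule for differences: p/q has the difference (q(y) (p(x) - p(y)) - p(y)
  (q(x) - q(y))) / (q(x) q(y)), arguments being taken in the coordinate \<open>e\<close>. The kernel
  is real, so the complex separation may be replaced by its real part.\<close>

lemma separable_rational_quotient:
  fixes f :: "real \<Rightarrow> real"
  assumes f: "\<And>x. poly q (e x) \<noteq> 0 \<and> complex_of_real (f x) = poly p (e x) / poly q (e x)"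
  shows "separable_on (\<lambda>x y. \<phi> (x - y) \<noteq> 0) (\<lambda>x y. inverse (\<phi> (x - y)) * (f x - f y))"
proof -
  let ?P = "\<lambda>x y. (poly p (e x) - poly p (e y)) / (e x - e y)"
  let ?Q = "\<lambda>x y. (poly q (e x) - poly q (e y)) / (e x - e y)"
  have "separable_on (\<lambda>x y. e x \<noteq> e y) (\<lambda>x y.
      (c x / poly q (e x)) * (c y / poly q (e y)) * (1 * poly q (e y) * ?P x y + 1 * (- poly p (e y)) * ?Q x y))"
    by (intro separable_on_scale separable_on_add separable_poly_quotient)
  from separable_on_Re[OF this]
  have "separable_on (\<lambda>x y. \<phi> (x - y) \<noteq> 0) (\<lambda>x y. Re
      ((c x / poly q (e x)) * (c y / poly q (e y)) * (1 * poly q (e y) * ?P x y + 1 * (- poly p (e y)) * ?Q x y)))"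
    by (simp add: \<phi>_zero)
  then show ?thesis
  proof (rule separable_on_cong)
    fix x y assume xy: "\<phi> (x - y) \<noteq> 0"
    then have ne: "e x - e y \<noteq> 0" by (simp add: \<phi>_zero)
    have q: "poly q (e x) \<noteq> 0" "poly q (e y) \<noteq> 0" using f by auto
    have "complex_of_real (inverse (\<phi> (x - y)) * (f x - f y)) =
      (c x * c y / (e x - e y)) * (poly p (e x) / poly q (e x) - poly p (e y) / poly q (e y))"
      using f factor[OF xy] by (simp only: of_real_mult of_real_diff)
    also have "\<dots> = (c x / poly q (e x)) * (c y / poly q (e y)) * (1 * poly q (e y) * ?P x y + 1 * (- poly p (e y)) * ?Q x y)"
      using q ne by (simp add: divide_simps) (simp add: algebra_simps)
    finally show "Re ((c x / poly q (e x)) * (c y / poly q (e y)) * (1 * poly q (e y) * ?P x y + 1 * (- poly p (e y)) * ?Q x y)) =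
      inverse (\<phi> (x - y)) * (f x - f y)"
      by (metis Re_complex_of_real)
  qed
qed

text \<open>Take a nonzero minor of size r such that all minors of size r + 1 vanish. Bordering it
  by a fixed column \<eta> and a variable row (i, x), and expanding along that row, gives S(x) v(x)
  = u(x) as quaternions, with u and v combinations of the functions 1/\<phi>(x - y_b). Hence S is u
  times the conjugate of v over |v|^2, and the factor \<open>c x\<close> common to u and v drops out
  of this quotient.\<close>

lemma finite_rank_imp_rational:
  fixes S :: "real \<Rightarrow> real ^ 3"
  defines "K \<equiv> \<lambda>p q :: 4 \<times> real. quat (inverse (\<phi> (snd p - snd q)) *\<^sub>R (S (snd p) - S (snd q))) $ fst p $ fst q"
  assumes X: "open X" "x0 \<in> X"
    and zero: "\<And>w. (\<And>i. i < 2 * n \<Longrightarrow> snd (w i) \<in> X) \<Longrightarrow>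
       (\<And>a b. a < n \<Longrightarrow> b < n \<Longrightarrow> \<phi> (snd (w a) - snd (w (n + b))) \<noteq> 0) \<Longrightarrow> det_form n K w = 0"
  shows "rat_on X e (\<lambda>x. of_real (S x $ k))"
proof -
  define adm where "adm n w \<longleftrightarrow> (\<forall>i<2 * n. snd (w i) \<in> X) \<and> (\<forall>a<n. \<forall>b<n. \<phi> (snd (w a) - snd (w (n + b))) \<noteq> 0)"
    for n and w :: "nat \<Rightarrow> 4 \<times> real"
  define Z where "Z n \<longleftrightarrow> (\<forall>w. adm n w \<longrightarrow> det_form n K w = 0)" for n
  have "Z n" unfolding Z_def adm_def using zero by blast
  moreover have "\<not> Z 0" unfolding Z_def adm_def by (simp add: det_form_0)
  ultimately have "\<exists>r<n. (\<forall>i\<le>r. \<not> Z i) \<and> Z (Suc r)" by (rule ex_least_nat_less)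
  then obtain r where r: "\<not> Z r" "Z (Suc r)" by blast
  then obtain w where w: "adm r w" "det_form r K w \<noteq> 0" unfolding Z_def by blast
  \<comment> \<open>The bordering column must be off the zeros of \<phi> relative to all points
    already chosen; near x0 this excludes at most x0 itself.\<close>
  have "eventually (\<lambda>x. x \<in> X \<and> (\<forall>i\<in>{..<2 * r}. \<phi> (x - snd (w i)) \<noteq> 0)) (at x0)"
    using X by (intro eventually_conj eventually_ball_finite ballI eventually_\<phi>_nz)
      (auto simp: eventually_at_in_open')
  then obtain \<eta> where \<eta>: "\<eta> \<in> X" "\<And>i. i < 2 * r \<Longrightarrow> \<phi> (\<eta> - snd (w i)) \<noteq> 0"
    using eventually_happens[of _ "at x0"] by fastforce
  have \<phi>_sw: "\<phi> (a - b) = 0 \<longleftrightarrow> \<phi> (b - a) = 0" for a b using \<phi>_odd[of "a - b"] by auto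
  \<comment> \<open>The matrix index 1 of the new column is a free choice; it decides which
    component of v is shown to be nonzero below.\<close>
  define y where "y i = (if i < r then w (r + i) else (1, \<eta>))" for i
  have yX: "snd (y b) \<in> X" for b using w(1) \<eta>(1) unfolding y_def adm_def by auto
  obtain C where C1: "C r = det_form r K (\<lambda>i. if i < r then w i else y (i - r))"
    and C2: "\<And>p. det_form (Suc r) K (\<lambda>i. if i < r then w i else if i = r then p else y (i - Suc r)) = (\<Sum>b\<le>r. C b * K p (y b))"
    using det_form_Suc_expand[of r K w y] by blast
  have "C r = det_form r K w" unfolding C1 by (rule det_form_cong) (auto simp: y_def)
  then have Cr: "C r \<noteq> 0" using w by simp
  define g where "g x b = inverse (\<phi> (x - snd (y b)))" for x b
  define v where "v x i = (\<Sum>b\<le>r. if fst (y b) = i then C b * g x b else 0)" for x i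
  define u where "u x i = (\<Sum>b\<le>r. C b * g x b * quat (S (snd (y b))) $ i $ fst (y b))" for x i
  have lin: "(\<Sum>j\<in>UNIV. quat (S x) $ i $ j * v x j) = u x i"
    if x: "x \<in> X" and nz: "\<And>b. b \<le> r \<Longrightarrow> \<phi> (x - snd (y b)) \<noteq> 0" for x i
  proof -
    let ?w = "\<lambda>l. if l < r then w l else if l = r then (i, x) else y (l - Suc r)"
    have "adm (Suc r) ?w" unfolding adm_def
    proof (intro conjI allI impI)
      fix l assume "l < 2 * Suc r"
      then show "snd (?w l) \<in> X" using w(1) x yX unfolding adm_def by auto
    next
      fix a b assume ab: "a < Suc r" "b < Suc r"
      show "\<phi> (snd (?w a) - snd (?w (Suc r + b))) \<noteq> 0"
      proof (cases "a = r")
        case True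
        then show ?thesis using nz[of b] ab by simp
      next
        case False
        then have a: "a < r" using ab by simp
        show ?thesis
        proof (cases "b < r")
          case True
          then show ?thesis using w(1) a unfolding adm_def y_def by simp
        next
          case False
          then show ?thesis using \<eta>(2)[of a] a unfolding y_def by (simp add: \<phi>_sw[of _ \<eta>])
        qed
      qed
    qed
    then have "det_form (Suc r) K ?w = 0" using r(2) unfolding Z_def by blast
    then have "(\<Sum>b\<le>r. C b * K (i, x) (y b)) = 0" using C2[of "(i, x)"] by simp
    moreover have "(\<Sum>b\<le>r. C b * K (i, x) (y b)) = (\<Sum>b\<le>r. C b * g x b * quat (S x) $ i $ fst (y b)) - u x i"
      unfolding K_def u_def g_def sum_subtractf[symmetric]
      by (intro sum.cong refl) (simp add: quat_scaleR quat_diff algebra_simps)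
    moreover have "(\<Sum>j\<in>UNIV. quat (S x) $ i $ j * v x j) = (\<Sum>b\<le>r. C b * g x b * quat (S x) $ i $ fst (y b))"
      unfolding v_def sum_distrib_left
      by (subst sum.swap) (simp add: if_distrib[where f="\<lambda>z. _ * z"] mult_ac cong: if_cong)
    ultimately show ?thesis by simp
  qed
  define V where "V i x = (\<Sum>b\<le>r. (if fst (y b) = i then of_real (C b) * c (snd (y b)) else 0) / (e x - e (snd (y b))))" for i x
  define U where "U i x = (\<Sum>b\<le>r. (of_real (C b * quat (S (snd (y b))) $ i $ fst (y b)) * c (snd (y b))) / (e x - e (snd (y b))))" for i x
  have rV: "rat_on X e (V i)" and rU: "rat_on X e (U i)" for i
    unfolding V_def U_def by (intro rat_on_sum rat_on_simple_pole)+
  define pr where "pr = (\<Prod>b\<le>r. [:- e (snd (y b)), 1:])"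
  have pr: "pr \<noteq> 0" unfolding pr_def by (simp add: prod_zero_iff)
  have prnz: "\<phi> (x - snd (y b)) \<noteq> 0" if "poly pr (e x) \<noteq> 0" "b \<le> r" for x b
    using that unfolding pr_def poly_prod by (simp add: \<phi>_zero prod_zero_iff)
  have Vv: "of_real (v x i) = c x * V i x" and Uu: "of_real (u x i) = c x * U i x"
    if nz: "\<And>b. b \<le> r \<Longrightarrow> \<phi> (x - snd (y b)) \<noteq> 0" for x i
  proof -
    have g: "complex_of_real (g x b) = c x * c (snd (y b)) / (e x - e (snd (y b)))" if "b \<le> r" for b
      unfolding g_def by (rule factor[OF nz[OF that]])
    show "of_real (v x i) = c x * V i x"
      unfolding v_def V_def of_real_sum sum_distrib_left by (intro sum.cong refl) (simp add: g)
    show "of_real (u x i) = c x * U i x"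
      unfolding u_def U_def of_real_sum sum_distrib_left by (intro sum.cong refl) (simp add: g)
  qed
  let ?h = "\<lambda>x. V 1 x * V 1 x + V 2 x * V 2 x + V 3 x * V 3 x + V 4 x * V 4 x"
  \<comment> \<open>The imaginary components of u times the conjugate of v. \<open>?h\<close> is a
    sum of squares of complex numbers; it becomes the positive number |v|^2 after multiplication by
    (c x)^2.\<close>
  let ?n = "\<lambda>k x. if k = 1 then - (U 1 x * V 2 x) + U 2 x * V 1 x + - (U 3 x * V 4 x) + U 4 x * V 3 x
     else if k = 2 then - (U 1 x * V 3 x) + U 2 x * V 4 x + U 3 x * V 1 x + - (U 4 x * V 2 x)
     else - (U 1 x * V 4 x) + - (U 2 x * V 3 x) + U 3 x * V 2 x + U 4 x * V 1 x"
  have rn: "rat_on X e (?n k)"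
    by (cases "k = 1"; cases "k = 2") (auto intro!: rat_on_add rat_on_diff rat_on_mult rat_on_uminus rV rU)
  have rh: "rat_on X e ?h" by (intro rat_on_add rat_on_mult rV)
  have ev_nz: "eventually (\<lambda>x. \<forall>b\<in>{..r}. \<phi> (x - snd (y b)) \<noteq> 0) (at \<eta>)"
    by (intro eventually_ball_finite ballI eventually_\<phi>_nz) auto
  \<comment> \<open>As x tends to \<eta>, the column b = r contributes C r / \<phi>(x - \<eta>), the
    other columns stay bounded, and C r is the nonzero minor of size r.\<close>
  have v1: "eventually (\<lambda>x. v x 1 \<noteq> 0) (at \<eta>)"
  proof -
    have yr: "y r = (1, \<eta>)" by (simp add: y_def)
    have \<phi>t: "((\<lambda>x. \<phi> (x - z)) \<longlongrightarrow> \<phi> (\<eta> - z)) (at \<eta>)" for z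
    proof -
      have "isCont (\<lambda>x. \<phi> (x - z)) \<eta>"
        by (rule isCont_o2[where f="\<lambda>x. x - z" and g=\<phi>])
          (use \<phi>_cont in \<open>auto simp: continuous_on_eq_continuous_at\<close>)
      then show ?thesis by (simp add: isCont_def)
    qed
    have \<phi>0: "\<phi> 0 = 0" using \<phi>_odd[of 0] by simp
    have "((\<lambda>x. \<Sum>b\<le>r. (if fst (y b) = 1 then C b else 0) * (\<phi> (x - \<eta>) * g x b)) \<longlongrightarrow>
        (\<Sum>b\<le>r. (if fst (y b) = 1 then C b else 0) * (if b = r then 1 else 0))) (at \<eta>)"
    proof (intro tendsto_sum tendsto_mult tendsto_const)
      fix b assume b: "b \<in> {..r}"
      show "((\<lambda>x. \<phi> (x - \<eta>) * g x b) \<longlongrightarrow> (if b = r then 1 else 0)) (at \<eta>)"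
      proof (cases "b = r")
        case True
        have "eventually (\<lambda>x. \<phi> (x - \<eta>) * g x b = 1) (at \<eta>)"
          using eventually_\<phi>_nz[of \<eta> \<eta>] by eventually_elim (simp add: g_def True yr)
        then show ?thesis using True by (simp add: tendsto_eventually)
      next
        case False
        then have "b < r" using b by simp
        then have nz: "\<phi> (\<eta> - snd (y b)) \<noteq> 0" using \<eta>(2)[of "r + b"] by (simp add: y_def)
        have "((\<lambda>x. \<phi> (x - \<eta>) * g x b) \<longlongrightarrow> \<phi> (\<eta> - \<eta>) * inverse (\<phi> (\<eta> - snd (y b)))) (at \<eta>)"
          unfolding g_def by (intro tendsto_mult tendsto_inverse \<phi>t nz)
        then show ?thesis using False \<phi>0 by simp
      qed
    qed
    moreover have "(\<Sum>b\<le>r. (if fst (y b) = 1 then C b else 0) * (if b = r then 1 else 0)) = C r"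
      by (simp add: if_distrib[where f="\<lambda>z. _ * z"] yr cong: if_cong)
    moreover have "(\<Sum>b\<le>r. (if fst (y b) = 1 then C b else 0) * (\<phi> (x - \<eta>) * g x b)) = \<phi> (x - \<eta>) * v x 1" for x
      unfolding v_def sum_distrib_left by (intro sum.cong refl) simp
    ultimately have "((\<lambda>x. \<phi> (x - \<eta>) * v x 1) \<longlongrightarrow> C r) (at \<eta>)" by simp
    from tendsto_imp_eventually_ne[OF this Cr] show ?thesis by eventually_elim auto
  qed
  show ?thesis
  proof (rule rat_on_divide[OF rn rh pr])
    fix x assume x: "x \<in> X" "poly pr (e x) \<noteq> 0"
    have nz: "\<And>b. b \<le> r \<Longrightarrow> \<phi> (x - snd (y b)) \<noteq> 0" using prnz[OF x(2)] by blast
    have Vv': "of_real (v x i) = c x * V i x" and Uu': "of_real (u x i) = c x * U i x"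
      and lin': "(\<Sum>j\<in>UNIV. quat (S x) $ i $ j * v x j) = u x i" for i
      by (rule Vv Uu lin[OF x(1)]; fact nz)+
    have L: "(\<Sum>j\<in>UNIV. of_real (quat (S x) $ i $ j) * V j x) = U i x" for i
    proof -
      have "c x * (\<Sum>j\<in>UNIV. of_real (quat (S x) $ i $ j) * V j x) = of_real (\<Sum>j\<in>UNIV. quat (S x) $ i $ j * v x j)"
        unfolding of_real_sum of_real_mult Vv' sum_distrib_left by (simp add: mult_ac)
      also have "\<dots> = c x * U i x" unfolding lin' Uu' ..
      finally show ?thesis using c_nz[of x] by simp
    qed
    note L1 = L[of 1, symmetric, unfolded sum_4] and L2 = L[of 2, symmetric, unfolded sum_4]
      and L3 = L[of 3, symmetric, unfolded sum_4] and L4 = L[of 4, symmetric, unfolded sum_4]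
    have "k = 1 \<or> k = 2 \<or> k = 3" by (rule exhaust_3)
    then show "of_real (S x $ k) * ?h x = ?n k x"
      unfolding L1 L2 L3 L4 quat_def
      by (elim disjE) (simp_all add: algebra_simps)
  next
    have XX: "eventually (\<lambda>x. x \<in> X) (at \<eta>)" using X \<eta>(1) by (simp add: eventually_at_in_open')
    show "eventually (\<lambda>x. x \<in> X \<and> ?h x \<noteq> 0) (at \<eta>)"
      using ev_nz v1 XX
    proof eventually_elim
      case (elim x)
      then have nz: "\<And>b. b \<le> r \<Longrightarrow> \<phi> (x - snd (y b)) \<noteq> 0" by auto
      have "c x * c x * ?h x = (c x * V 1 x) * (c x * V 1 x) + (c x * V 2 x) * (c x * V 2 x) + (c x * V 3 x) * (c x * V 3 x) + (c x * V 4 x) * (c x * V 4 x)"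
        by (simp add: algebra_simps)
      also have "\<dots> = of_real (v x 1 * v x 1 + v x 2 * v x 2 + v x 3 * v x 3 + v x 4 * v x 4)"
      proof -
        have "c x * V i x = of_real (v x i)" for i by (rule Vv[symmetric]) (fact nz)
        then show ?thesis by simp
      qed
      finally have "c x * c x * ?h x = of_real (v x 1 * v x 1 + v x 2 * v x 2 + v x 3 * v x 3 + v x 4 * v x 4)" .
      moreover have "0 < v x 1 * v x 1 + v x 2 * v x 2 + v x 3 * v x 3 + v x 4 * v x 4"
        using elim by (intro add_pos_nonneg) (auto simp: zero_less_mult_iff linorder_neq_iff)
      then have "complex_of_real (v x 1 * v x 1 + v x 2 * v x 2 + v x 3 * v x 3 + v x 4 * v x 4) \<noteq> 0"
        unfolding of_real_eq_0_iff by linarith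
      ultimately have "c x * c x * ?h x \<noteq> 0" by (simp only: not_False_eq_True)
      then show ?case using elim by auto
    qed
  qed
qed

end

text \<open>On \<open>X\<close> every neighbourhood is charged by \<open>N\<close>, so that minors
  vanishing almost everywhere vanish wherever they are continuous; \<open>ext\<close> takes care of
  the points outside \<open>X\<close>.\<close>

lemma (in half_wave_lax) rational_propagates:
  fixes X :: "real set"
  assumes par: "kernel_param e c \<phi>"
    and init: "\<And>k. \<exists>p q. \<forall>x. poly q (e x) \<noteq> 0 \<and> complex_of_real (S 0 x $ k) = poly p (e x) / poly q (e x)"
    and null: "\<And>y. AE x in N. \<phi> (x - y) \<noteq> 0"
    and X: "open X" "X \<noteq> {}" and pos: "\<And>U x. open U \<Longrightarrow> x \<in> U \<Longrightarrow> x \<in> X \<Longrightarrow> emeasure N U \<noteq> 0"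
    and cont: "\<And>x. isCont (S 1) x"
    and ext: "\<And>x. \<exists>x'\<in>closure X. e x' = e x \<and> S 1 x' = S 1 x"
  shows "\<exists>p q. \<forall>x. poly q (e x) \<noteq> 0 \<and> complex_of_real (S 1 x $ k) = poly p (e x) / poly q (e x)"
proof -
  interpret kernel_param e c \<phi> by (rule par)
  interpret lax_kernel "count_space (UNIV :: 4 set) \<Otimes>\<^sub>M N" kerK kerKd kerA "16 * (40 * \<tau>\<^sup>2 * \<bar>C\<bar>)"
    by (rule kernel)
  let ?D = "\<lambda>(p :: 4 \<times> real) (q :: 4 \<times> real). \<phi> (snd p - snd q) \<noteq> 0"
  have "separable_on ?D (kerK 0)"
  proof -
    have 1: "separable_on ?D (\<lambda>p q. inverse (\<phi> (snd p - snd q)) * (S 0 (snd p) $ a - S 0 (snd q) $ a))" for a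
    proof -
      obtain p q where "\<forall>x. poly q (e x) \<noteq> 0 \<and> complex_of_real (S 0 x $ a) = poly p (e x) / poly q (e x)"
        using init by blast
      then have "separable_on (\<lambda>x y. \<phi> (x - y) \<noteq> 0) (\<lambda>x y. inverse (\<phi> (x - y)) * (S 0 x $ a - S 0 y $ a))"
        by (intro separable_rational_quotient[of q]) blast
      from separable_on_compose[OF this, where a="snd :: 4 \<times> real \<Rightarrow> real" and b="snd :: 4 \<times> real \<Rightarrow> real"] show ?thesis by simp
    qed
    \<comment> \<open>The indicators of the matrix indices turn the entry of a constant matrix into
      a finite sum of products of a function of p and a function of q.\<close>
    have "separable_on ?D (\<lambda>p q. \<Sum>a\<in>UNIV. \<Sum>i\<in>UNIV. \<Sum>j\<in>UNIV. of_bool (fst p = i) * (quat (axis a 1) $ i $ j * of_bool (fst q = j)) *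
       (inverse (\<phi> (snd p - snd q)) * (S 0 (snd p) $ a - S 0 (snd q) $ a)))"
      by (intro separable_on_sum separable_on_scale[OF 1])
    then show ?thesis
    proof (rule separable_on_cong)
      fix p q :: "4 \<times> real"
      have "kerK 0 p q = (\<Sum>a\<in>UNIV. quat (axis a 1) $ fst p $ fst q *
          (inverse (\<phi> (snd p - snd q)) * (S 0 (snd p) $ a - S 0 (snd q) $ a)))"
        unfolding kerK_def by (subst quat_basis) (simp add: \<kappa>_def sum_component mult_ac)
      also have "\<dots> = (\<Sum>a\<in>UNIV. \<Sum>i\<in>UNIV. \<Sum>j\<in>UNIV. of_bool (fst p = i) * (quat (axis a 1) $ i $ j * of_bool (fst q = j)) *
       (inverse (\<phi> (snd p - snd q)) * (S 0 (snd p) $ a - S 0 (snd q) $ a)))"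
      proof (rule sum.cong[OF refl])
        fix a :: 3
        have "(\<Sum>i\<in>UNIV. \<Sum>j\<in>UNIV. of_bool (i0 = i) * (g i j * of_bool (j0 = j)) * z) = g i0 j0 * z"
          for i0 j0 :: 4 and g :: "4 \<Rightarrow> 4 \<Rightarrow> real" and z
          using exhaust_4[of i0] exhaust_4[of j0] by (auto simp: sum_4)
        from this[of "fst p" "\<lambda>i j. quat (axis a 1) $ i $ j" "fst q", symmetric]
        show "quat (axis a 1) $ fst p $ fst q * (inverse (\<phi> (snd p - snd q)) * (S 0 (snd p) $ a - S 0 (snd q) $ a)) =
          (\<Sum>i\<in>UNIV. \<Sum>j\<in>UNIV. of_bool (fst p = i) * (quat (axis a 1) $ i $ j * of_bool (fst q = j)) *
       (inverse (\<phi> (snd p - snd q)) * (S 0 (snd p) $ a - S 0 (snd q) $ a)))" .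
      qed
      finally show "(\<Sum>a\<in>UNIV. \<Sum>i\<in>UNIV. \<Sum>j\<in>UNIV. of_bool (fst p = i) * (quat (axis a 1) $ i $ j * of_bool (fst q = j)) *
       (inverse (\<phi> (snd p - snd q)) * (S 0 (snd p) $ a - S 0 (snd q) $ a))) = kerK 0 p q" ..
    qed
  qed
  then obtain n where n: "\<And>w. (\<And>a b. a < n \<Longrightarrow> b < n \<Longrightarrow> ?D (w a) (w (n + b))) \<Longrightarrow> det_form n (kerK 0) w = 0"
    using separable_on_det_form by blast
  have "AE w in PiM {..<2 * n} (\<lambda>_. count_space (UNIV :: 4 set) \<Otimes>\<^sub>M N). det_form n (kerK 0) w = 0"
    using AE_PiM_off_diagonal[OF N \<phi>_meas null, of n]
    by eventually_elim (rule n, auto)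
  then have ae: "AE w in PiM {..<2 * n} (\<lambda>_. count_space (UNIV :: 4 set) \<Otimes>\<^sub>M N). det_form n (kerK 1) w = 0"
    unfolding det_form_def by (rule perm_form_zero)
  obtain x0 where x0: "x0 \<in> X" using X(2) by blast
  have rat: "rat_on X e (\<lambda>x. of_real (S 1 x $ k))"
  proof (rule finite_rank_imp_rational[OF X(1) x0])
    fix w :: "nat \<Rightarrow> 4 \<times> real"
    assume w: "\<And>i. i < 2 * n \<Longrightarrow> snd (w i) \<in> X"
      "\<And>a b. a < n \<Longrightarrow> b < n \<Longrightarrow> \<phi> (snd (w a) - snd (w (n + b))) \<noteq> 0"
    have "det_form n (kerK 1) w = 0"
    proof (rule det_form_zero_of_AE[where D="\<lambda>x y. \<phi> (x - y) \<noteq> 0" and X=X and K="kerK 1" and n=n and w=w and N=N, OF N pos _ ae w])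
      fix i j :: 4 and x y assume xy: "\<phi> (x - y) \<noteq> 0"
      have "isCont (\<lambda>z. \<phi> (fst z - snd z)) (x, y)"
        by (rule isCont_o2[where f="\<lambda>z. fst z - snd z" and g=\<phi>])
          (use \<phi>_cont in \<open>auto simp: continuous_on_eq_continuous_at intro!: continuous_intros\<close>)
      moreover have "isCont (\<lambda>z. S 1 (fst z)) (x, y)" "isCont (\<lambda>z. S 1 (snd z)) (x, y)"
        by (rule isCont_o2[where g="S 1"]; auto intro!: continuous_intros cont)+
      ultimately have "isCont (\<lambda>z. inverse (\<phi> (fst z - snd z)) *\<^sub>R (S 1 (fst z) - S 1 (snd z))) (x, y)"
        using xy by (intro continuous_intros) auto
      moreover have "isCont (\<lambda>v. quat v $ i $ j) v" for v
        by (intro linear_continuous_at bounded_linear_compose[OF bounded_linear_vec_nth]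
            quat_linear[unfolded linear_conv_bounded_linear])
      ultimately show "isCont (\<lambda>z. kerK 1 (i, fst z) (j, snd z)) (x, y)"
        unfolding kerK_def \<kappa>_def by (auto intro: isCont_o2)
    qed auto
    then show "det_form n (\<lambda>p q. quat (inverse (\<phi> (snd p - snd q)) *\<^sub>R (S 1 (snd p) - S 1 (snd q))) $ fst p $ fst q) w = 0"
      unfolding kerK_def[abs_def] \<kappa>_def .
  qed
  show ?thesis
  proof (rule rat_on_globalize[OF _ X(1) rat])
    show "isCont (\<lambda>x. complex_of_real (S 1 x $ k)) x" for x
      using cont by (intro continuous_intros)
    show "\<exists>x'\<in>closure X. e x' = e x \<and> complex_of_real (S 1 x' $ k) = complex_of_real (S 1 x $ k)" for x
      using ext[of x] by fastforce
  qed
qed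

section \<open>The torus\<close>

text \<open>Lebesgue measure of one period, kept as a measure on the whole line with all Borel sets,
  so that the torus and the line are instances of the same locale.\<close>

definition circle :: "real measure" where
  "circle = density lborel (\<lambda>x. ennreal (indicator {0..2 * pi} x))"

lemma sets_circle: "sets circle = sets borel" and space_circle: "space circle = UNIV"
  by (simp_all add: circle_def)

lemma measurable_circle: "f \<in> borel_measurable borel \<Longrightarrow> f \<in> borel_measurable circle"
  by (simp cong: measurable_cong_sets add: sets_circle)

lemma emeasure_circle:
  assumes "A \<in> sets borel"
  shows "emeasure circle A = emeasure lborel ({0..2 * pi} \<inter> A)"
proof -
  have "emeasure circle A = (\<integral>\<^sup>+x. ennreal (indicator {0..2 * pi} x) * indicator A x \<partial>lborel)"
    using assms unfolding circle_def by (subst emeasure_density) auto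
  also have "\<dots> = (\<integral>\<^sup>+x. indicator ({0..2 * pi} \<inter> A) x \<partial>lborel)"
    by (intro nn_integral_cong) (auto split: split_indicator)
  finally show ?thesis using assms by simp
qed

lemma finite_measure_circle: "finite_measure circle"
  by (rule finite_measureI) (simp add: space_circle emeasure_circle)

lemma integral_circle:
  fixes f :: "real \<Rightarrow> 'a::{banach, second_countable_topology}"
  assumes "f \<in> borel_measurable borel"
  shows "(LINT x|circle. f x) = (LINT x:{0..2 * pi}|lborel. f x)"
  using assms unfolding circle_def set_lebesgue_integral_def by (subst integral_density) auto

lemma integral_circle_FTC:
  fixes f F :: "real \<Rightarrow> 'a::euclidean_space"
  assumes "\<And>x. (F has_vector_derivative f x) (at x)" "continuous_on UNIV f"
  shows "(LINT x|circle. f x) = F (2 * pi) - F 0"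
proof -
  have "f \<in> borel_measurable borel" by (rule borel_measurable_continuous_onI[OF assms(2)])
  then have "(LINT x|circle. f x) = (LINT x:{0..2 * pi}|lborel. f x)" by (rule integral_circle)
  also have "\<dots> = F (2 * pi) - F 0"
    unfolding set_lebesgue_integral_def
    by (rule integral_FTC_Icc) (auto intro: has_vector_derivative_at_within assms continuous_on_subset)
  finally show ?thesis .
qed

lemma integrable_circle_bounded:
  fixes f :: "real \<Rightarrow> 'a::{banach, second_countable_topology}"
  assumes "f \<in> borel_measurable borel" "\<And>x. norm (f x) \<le> B"
  shows "integrable circle f"
  using assms by (intro finite_measure.integrable_const_bound[OF finite_measure_circle, where B=B] measurable_circle) auto

lemma measure_circle: "measure circle (space circle) = 2 * pi"
  by (simp add: measure_def space_circle emeasure_circle)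

lemma norm_integral_circle_le:
  fixes f :: "real \<Rightarrow> 'a::{banach, second_countable_topology}"
  assumes "f \<in> borel_measurable borel" "\<And>x. norm (f x) \<le> B"
  shows "norm (LINT x|circle. f x) \<le> 2 * pi * B"
proof -
  interpret finite_measure circle by (rule finite_measure_circle)
  have "norm (LINT x|circle. f x) \<le> (LINT x|circle. norm (f x))" by (rule integral_norm_bound)
  also have "\<dots> \<le> (LINT x|circle. B)"
    using assms by (intro integral_mono integrable_norm integrable_circle_bounded[of f B]) auto
  also have "\<dots> = 2 * pi * B" using measure_circle by (simp add: space_circle)
  finally show ?thesis .
qed

section \<open>Trigonometric integrals over a period\<close>

lemma has_vector_derivative_cis:
  "((\<lambda>x. cis (a * x + b)) has_vector_derivative \<i> * of_real a * cis (a * x + b)) (at x within S)"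
proof -
  have "((\<lambda>z. exp (\<i> * (of_real a * z + of_real b))) has_field_derivative
      exp (\<i> * (of_real a * of_real x + of_real b)) * (\<i> * of_real a)) (at (of_real x))"
    by (auto intro!: derivative_eq_intros)
  from has_vector_derivative_real_field[OF this, of S] show ?thesis
    by (simp add: cis_conv_exp mult_ac)
qed

lemma continuous_on_cis_linear: "continuous_on A (\<lambda>x. cis (a * x + b))"
  by (intro continuous_intros)

lemma cis_2pi_int: "cis (of_int m * (2 * pi) + b) = cis b"
  using cis_multiple_2pi[of "of_int m"] by (simp add: cis_mult[symmetric] mult.commute)

lemma integral_circle_cis:
  assumes "m \<noteq> 0"
  shows "(LINT x|circle. cis (of_int m * x + b)) = 0"
proof -
  have "((\<lambda>x. cis (of_int m * x + b) / (\<i> * of_int m)) has_vector_derivative cis (of_int m * x + b)) (at x)" for x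
    using has_vector_derivative_divide[OF has_vector_derivative_cis[of "of_int m" b x UNIV], of "\<i> * of_int m"] assms by simp
  from integral_circle_FTC[OF this continuous_on_cis_linear] show ?thesis
    by (simp add: cis_2pi_int)
qed

lemma integral_circle_sin: "(LINT x|circle. sin (of_int m * (x - b))) = 0"
proof (cases "m = 0")
  case False
  have "(LINT x|circle. sin (of_int m * (x - b))) = (LINT x|circle. Im (cis (of_int m * x + - (of_int m * b))))"
    by (simp add: algebra_simps)
  also have "\<dots> = Im (LINT x|circle. cis (of_int m * x + - (of_int m * b)))"
    by (intro integral_Im integrable_circle_bounded[of _ 1] borel_measurable_continuous_onI continuous_on_cis_linear) simp
  finally show ?thesis using integral_circle_cis[OF False, of "- (of_int m * b)"] by simp
qed simp

text \<open>The product of two half-integer waves contains the integer frequencies j + l + 1, which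
  is positive, and j - l, which is nonzero.\<close>

lemma integral_circle_Re_product:
  assumes "l \<noteq> j"
  shows "(LINT x|circle. Re (A * cis ((real j + 1/2) * x)) * Re (B * cis ((real l + 1/2) * x))) = 0"
proof -
  have eq: "Re (A * cis ((real j + 1/2) * x)) * Re (B * cis ((real l + 1/2) * x)) =
     Re (A * B / 2 * cis (of_int (int j + int l + 1) * x + 0) + A * cnj B / 2 * cis (of_int (int j - int l) * x + 0))" for x
  proof -
    have "Re z * Re w = Re (z * w + z * cnj w) / 2" for z w :: complex by simp
    from this[of "A * cis ((real j + 1/2) * x)" "B * cis ((real l + 1/2) * x)"]
    have "Re (A * cis ((real j + 1/2) * x)) * Re (B * cis ((real l + 1/2) * x)) =
       Re (A * B * (cis ((real j + 1/2) * x) * cis ((real l + 1/2) * x)) + A * cnj B * (cis ((real j + 1/2) * x) * cis (- ((real l + 1/2) * x)))) / 2"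
      by (simp only: complex_cnj_mult cis_cnj mult_ac)
    also have "\<dots> = Re (A * B / 2 * (cis ((real j + 1/2) * x) * cis ((real l + 1/2) * x)) + A * cnj B / 2 * (cis ((real j + 1/2) * x) * cis (- ((real l + 1/2) * x))))"
      by (simp add: Re_divide_numeral add_divide_distrib diff_divide_distrib)
    also have "cis ((real j + 1/2) * x) * cis ((real l + 1/2) * x) = cis (of_int (int j + int l + 1) * x + 0)"
      by (simp add: cis_mult algebra_simps)
    also have "cis ((real j + 1/2) * x) * cis (- ((real l + 1/2) * x)) = cis (of_int (int j - int l) * x + 0)"
      by (simp add: cis_mult algebra_simps)
    finally show ?thesis .
  qed
  have i: "integrable circle (\<lambda>x. D * cis (of_int m * x + 0))" for D m
    by (intro integrable_circle_bounded[of _ "norm D"] borel_measurable_continuous_onI continuous_intros) (simp add: norm_mult)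
  have z: "(LINT x|circle. D * cis (of_int m * x + 0)) = 0" if "m \<noteq> 0" for D m
    using integral_circle_cis[OF that, of 0] by simp
  have "(LINT x|circle. Re (A * cis ((real j + 1/2) * x)) * Re (B * cis ((real l + 1/2) * x))) =
    Re (LINT x|circle. A * B / 2 * cis (of_int (int j + int l + 1) * x + 0) + A * cnj B / 2 * cis (of_int (int j - int l) * x + 0))"
    unfolding eq by (intro integral_Re Bochner_Integration.integrable_add i)
  also have "\<dots> = 0"
  proof -
    have "(LINT x|circle. A * B / 2 * cis (of_int (int j + int l + 1) * x + 0)) = 0"
      "(LINT x|circle. A * cnj B / 2 * cis (of_int (int j - int l) * x + 0)) = 0"
      by (rule z, use assms in linarith)+
    then show ?thesis by (simp only: Bochner_Integration.integral_add[OF i i]) simp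
  qed
  finally show ?thesis .
qed

section \<open>Fourier coefficients of a smooth periodic function\<close>

locale smooth_periodic =
  fixes G :: "nat \<Rightarrow> real \<Rightarrow> real"
  assumes deriv: "\<And>j x. (G j has_real_derivative G (Suc j) x) (at x)"
    and periodic: "\<And>j x. G j (x + 2 * pi) = G j x"
begin

lemma cont: "continuous_on A (G j)"
  by (rule DERIV_continuous_on) (use deriv has_field_derivative_at_within in blast)

lemma meas: "G j \<in> borel_measurable borel"
  by (rule borel_measurable_continuous_onI[OF cont])

lemma periodic_int: "G j (x + 2 * pi * of_int k) = G j x"
proof -
  have n: "G j (x + 2 * pi * of_nat k) = G j x" for k x
  proof (induction k)
    case (Suc k)
    then show ?case using periodic[of j "x + 2 * pi * of_nat k"] by (simp add: algebra_simps)
  qed simp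
  show ?thesis
  proof (cases "k \<ge> 0")
    case True
    then show ?thesis using n[of x "nat k"] by simp
  next
    case False
    then show ?thesis using n[of "x + 2 * pi * of_int k" "nat (- k)"] by simp
  qed
qed

lemma reduce:
  obtains k :: int where "\<bar>x + 2 * pi * of_int k - y\<bar> \<le> pi"
proof -
  define k where "k = - round ((x - y) / (2 * pi))"
  have "\<bar>of_int (round ((x - y) / (2 * pi))) - (x - y) / (2 * pi)\<bar> \<le> 1 / 2"
    by (rule of_int_round_abs_le)
  then have "2 * pi * \<bar>of_int (round ((x - y) / (2 * pi))) - (x - y) / (2 * pi)\<bar> \<le> pi"
    by (simp add: field_simps)
  moreover have "2 * pi * \<bar>of_int (round ((x - y) / (2 * pi))) - (x - y) / (2 * pi)\<bar> = \<bar>x + 2 * pi * of_int k - y\<bar>"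
  proof -
    have "2 * pi * \<bar>of_int (round ((x - y) / (2 * pi))) - (x - y) / (2 * pi)\<bar> =
      \<bar>2 * pi * (of_int (round ((x - y) / (2 * pi))) - (x - y) / (2 * pi))\<bar>" by (simp add: abs_mult)
    also have "2 * pi * (of_int (round ((x - y) / (2 * pi))) - (x - y) / (2 * pi)) = - (x + 2 * pi * of_int k - y)"
      unfolding k_def by (simp add: field_simps)
    finally show ?thesis by simp
  qed
  ultimately show ?thesis using that[of k] by simp
qed

lemma bounded: obtains B where "\<And>x. \<bar>G j x\<bar> \<le> B"
proof -
  have "compact (G j ` {- pi..pi})" by (intro compact_continuous_image cont) simp
  then obtain B where B: "\<And>x. x \<in> {- pi..pi} \<Longrightarrow> \<bar>G j x\<bar> \<le> B"
    by (metis bounded_iff compact_imp_bounded image_eqI real_norm_def)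
  have "\<bar>G j x\<bar> \<le> B" for x
  proof -
    obtain k where "\<bar>x + 2 * pi * of_int k - 0\<bar> \<le> pi" by (rule reduce)
    then have "\<bar>G j (x + 2 * pi * of_int k)\<bar> \<le> B" by (intro B) auto
    then show ?thesis by (simp add: periodic_int)
  qed
  then show ?thesis by (rule that)
qed

abbreviation fc :: "nat \<Rightarrow> int \<Rightarrow> complex" where "fc j n \<equiv> fourier_coeff (G j) n"

lemma fc_circle: "fc j n = 1 / (2 * pi) * (LINT x|circle. of_real (G j x) * cis (- of_int n * x + 0))"
proof -
  have "(\<lambda>x. of_real (G j x) * cis (- of_int n * x + 0)) \<in> borel_measurable borel"
    by (intro borel_measurable_continuous_onI continuous_intros cont)
  from integral_circle[OF this] show ?thesis
    unfolding fourier_coeff_def by (simp add: cis_conv_exp mult_ac)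
qed

lemma fc_Suc: "fc (Suc j) n = \<i> * of_int n * fc j n"
proof -
  let ?F = "\<lambda>x. of_real (G j x) * cis (- of_int n * x + 0)"
  let ?f = "\<lambda>x. of_real (G (Suc j) x) * cis (- of_int n * x + 0)"
  have "(?F has_vector_derivative of_real (G j x) * (\<i> * of_real (- of_int n) * cis (- of_int n * x + 0)) + ?f x) (at x)" for x
    by (rule has_vector_derivative_mult[OF has_vector_derivative_of_real has_vector_derivative_cis])
      (use deriv in \<open>simp add: has_real_derivative_iff_has_vector_derivative\<close>)
  then have "(LINT x|circle. of_real (G j x) * (\<i> * of_real (- of_int n) * cis (- of_int n * x + 0)) + ?f x) = ?F (2 * pi) - ?F 0"
    by (rule integral_circle_FTC) (intro continuous_intros cont)
  also have "\<dots> = 0"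
    using cis_2pi_int[of "- n" 0] periodic[of j 0] by simp
  finally have "(LINT x|circle. (- \<i> * of_int n) * ?F x + ?f x) = 0"
    by (simp add: mult_ac)
  moreover have i: "integrable circle (\<lambda>x. of_real (G j x) * cis (- of_int n * x + 0))" for j
  proof -
    obtain B where B: "\<And>x. \<bar>G j x\<bar> \<le> B" using bounded by blast
    then show ?thesis
      by (intro integrable_circle_bounded[of _ B] borel_measurable_continuous_onI continuous_intros cont)
        (auto simp: norm_mult)
  qed
  ultimately have "(- \<i> * of_int n) * (LINT x|circle. ?F x) + (LINT x|circle. ?f x) = 0"
    by (subst (asm) Bochner_Integration.integral_add) (auto simp del: add_0_right)
  then show ?thesis unfolding fc_circle by (simp add: field_simps)
qed

lemma fc_bound: assumes "\<And>x. \<bar>G j x\<bar> \<le> B" shows "norm (fc j n) \<le> B"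
proof -
  have "norm (LINT x|circle. of_real (G j x) * cis (- of_int n * x + 0)) \<le> 2 * pi * B"
    by (intro norm_integral_circle_le borel_measurable_continuous_onI continuous_intros cont)
      (use assms in \<open>simp add: norm_mult\<close>)
  then show ?thesis unfolding fc_circle by (simp add: norm_mult norm_divide field_simps)
qed

text \<open>Four integrations by parts. At this rate the sum of n^2 |c_n| converges, as the
  quadratic bound \<open>norm_dmode_le\<close> demands.\<close>

lemma fc_decay: assumes "\<And>x. \<bar>G 4 x\<bar> \<le> B" shows "\<bar>of_int n\<bar> ^ 4 * norm (fc 0 n) \<le> B"
proof -
  have "fc 4 n = (\<i> * of_int n) ^ 4 * fc 0 n"
    using fc_Suc[of 0 n] fc_Suc[of 1 n] fc_Suc[of 2 n] fc_Suc[of 3 n]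
    by (simp add: eval_nat_numeral)
  then have "norm (fc 4 n) = \<bar>of_int n\<bar> ^ 4 * norm (fc 0 n)" by (simp add: norm_mult norm_power)
  with fc_bound[OF assms, of n] show ?thesis by simp
qed

lemma fc_cnj: "fc j (- n) = cnj (fc j n)"
proof -
  have "cnj (LINT x|circle. of_real (G j x) * cis (- of_int n * x + 0)) = (LINT x|circle. cnj (of_real (G j x) * cis (- of_int n * x + 0)))"
    by (rule Bochner_Integration.integral_cnj[symmetric])
  also have "\<dots> = (LINT x|circle. of_real (G j x) * cis (- of_int (- n) * x + 0))"
    by (simp add: cis_cnj)
  finally show ?thesis unfolding fc_circle by simp
qed

end

text \<open>Summing m consecutive differences would otherwise move \<gamma> by about m L. This takes
  the place of the Riemann-Lebesgue lemma: boundedness of the coefficients is enough once the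
  partial sums are known to converge.\<close>

lemma telescoping_limit_zero:
  fixes \<gamma> :: "nat \<Rightarrow> real"
  assumes B: "\<And>n. \<bar>\<gamma> n\<bar> \<le> B" and lim: "(\<lambda>n. \<gamma> n - \<gamma> (Suc n)) \<longlonglongrightarrow> L"
  shows "L = 0"
proof (rule ccontr)
  assume L: "L \<noteq> 0"
  then obtain k where k: "\<And>n. n \<ge> k \<Longrightarrow> \<bar>\<gamma> n - \<gamma> (Suc n) - L\<bar> < \<bar>L\<bar> / 2"
    using LIMSEQ_D[OF lim, of "\<bar>L\<bar> / 2"] by auto
  have *: "\<bar>\<gamma> k - \<gamma> (k + m) - real m * L\<bar> \<le> real m * (\<bar>L\<bar> / 2)" for m
  proof (induction m)
    case (Suc m)
    have "\<gamma> k - \<gamma> (k + Suc m) - real (Suc m) * L =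
      (\<gamma> k - \<gamma> (k + m) - real m * L) + (\<gamma> (k + m) - \<gamma> (Suc (k + m)) - L)"
      by (simp add: algebra_simps)
    moreover have "real (Suc m) * (\<bar>L\<bar> / 2) = real m * (\<bar>L\<bar> / 2) + \<bar>L\<bar> / 2" by (simp add: algebra_simps)
    ultimately show ?case using Suc k[of "k + m"] by linarith
  qed simp
  have "\<forall>y. \<exists>n. y < real n * (\<bar>L\<bar> / 2)" by (rule reals_Archimedean3) (use L in simp)
  then obtain m where m: "2 * B < real m * (\<bar>L\<bar> / 2)" by blast
  have "real m * \<bar>L\<bar> = \<bar>real m * L\<bar>" by (simp add: abs_mult)
  then have "real m * \<bar>L\<bar> \<le> \<bar>\<gamma> k\<bar> + \<bar>\<gamma> (k + m)\<bar> + real m * (\<bar>L\<bar> / 2)" using *[of m] by linarith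
  then show False using m B[of k] B[of "k + m"] by simp
qed

text \<open>As pi/2 < 2, |t|^3 is at most 4 |t|; the cubic Taylor error then costs 4/6 and leaves
  1/3.\<close>

lemma abs_sin_ge:
  fixes t :: real
  assumes "\<bar>t\<bar> \<le> pi / 2"
  shows "\<bar>t\<bar> / 3 \<le> \<bar>sin t\<bar>"
proof -
  have "\<bar>sin t - t\<bar> \<le> \<bar>t\<bar> ^ 3 / 6"
    using Maclaurin_sin_bound[of t 3] by (simp add: eval_nat_numeral sin_coeff_def)
  moreover have "\<bar>t\<bar> ^ 3 \<le> 4 * \<bar>t\<bar>"
  proof -
    have "\<bar>t\<bar> * \<bar>t\<bar> \<le> 2 * 2" using assms pi_less_4 by (intro mult_mono) auto
    then have "\<bar>t\<bar> * (\<bar>t\<bar> * \<bar>t\<bar>) \<le> \<bar>t\<bar> * 4" by (intro mult_left_mono) auto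
    then show ?thesis by (simp add: power3_eq_cube mult_ac)
  qed
  ultimately show ?thesis by linarith
qed

lemma circle_sums_integral:
  fixes a :: "nat \<Rightarrow> real \<Rightarrow> real"
  assumes a: "\<And>n. a n \<in> borel_measurable borel" "\<And>n x. \<bar>a n x\<bar> \<le> \<alpha> n" "summable \<alpha>"
    and h: "h \<in> borel_measurable borel" "\<And>x. \<bar>h x\<bar> \<le> B"
  shows "(\<lambda>n. LINT x|circle. a n x * h x) sums (LINT x|circle. (\<Sum>n. a n x) * h x)"
proof -
  interpret finite_measure circle by (rule finite_measure_circle)
  have B0: "B \<ge> 0" using h(2)[of 0] by linarith
  have le: "\<bar>a n x * h x\<bar> \<le> \<alpha> n * B" for n x
    unfolding abs_mult using a(2)[of n x] h(2)[of x] by (intro mult_mono) auto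
  have m: "(\<lambda>x. a n x * h x) \<in> borel_measurable borel" for n using a(1) h(1) by measurable
  have s: "summable (\<lambda>n. norm (a n x * h x))" for x
    by (rule summable_comparison_test'[OF summable_mult2[OF a(3), of B]]) (use le in auto)
  have sa: "summable (\<lambda>n. a n x)" for x
    by (rule summable_comparison_test'[OF a(3)]) (use a(2) in auto)
  have "summable (\<lambda>n. LINT x|circle. norm (a n x * h x))"
  proof (rule summable_comparison_test'[OF summable_mult[OF summable_mult2[OF a(3), of B], of "2 * pi"]])
    fix n
    show "norm (LINT x|circle. norm (a n x * h x)) \<le> 2 * pi * (\<alpha> n * B)"
      using m[of n] le[of n] by (intro norm_integral_circle_le) auto
  qed
  moreover have "integrable circle (\<lambda>x. a n x * h x)" for n
    by (rule integrable_circle_bounded[OF m]) (use le in auto)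
  ultimately have "(\<lambda>n. LINT x|circle. a n x * h x) sums (LINT x|circle. (\<Sum>n. a n x * h x))"
    by (intro sums_integral AE_I2) (use s in auto)
  then show ?thesis by (simp add: suminf_mult2[OF sa])
qed

section \<open>Half-integer modes of the difference quotient\<close>

definition antiperiodic :: "real \<Rightarrow> real" where
  "antiperiodic u = 2 * sin (u / 2)"

text \<open>The quotient of exp(inx) - exp(iny) by \<phi>(x - y) is a geometric sum, and these are
  its n terms, with frequencies j + 1/2 in x and n - 1/2 - j in y, all positive for j < n.
  \<open>kmode\<close> is the quotient itself, and in \<open>dmode\<close> the weight j + 1/2 is the
  symbol of |\<nabla>| in x.\<close>

definition mode :: "nat \<Rightarrow> nat \<Rightarrow> real \<Rightarrow> real \<Rightarrow> complex" where
  "mode n j x y = \<i> * cis ((real j + 1/2) * x) * cis ((real n - 1/2 - real j) * y)"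

definition kmode :: "nat \<Rightarrow> real \<Rightarrow> real \<Rightarrow> complex" where
  "kmode n x y = (\<Sum>j<n. mode n j x y)"

definition dmode :: "nat \<Rightarrow> real \<Rightarrow> real \<Rightarrow> complex" where
  "dmode n x y = (\<Sum>j<n. of_real (real j + 1/2) * mode n j x y)"

text \<open>Multiplication by \<phi>(x - y) shifts a half-integer mode to the two neighbouring
  integer ones with opposite signs, and the sum over j telescopes.\<close>

lemma antiperiodic_kmode: "of_real (antiperiodic (x - y)) * kmode n x y = cis (real n * x) - cis (real n * y)"
proof -
  let ?A = "\<lambda>j. cis (real j * x) * cis ((real n - real j) * y)"
  have "of_real (antiperiodic (x - y)) * mode n j x y = ?A (Suc j) - ?A j" for j
  proof -
    have "of_real (antiperiodic (x - y)) = - \<i> * (cis ((x - y) / 2) - cis (- ((x - y) / 2)))"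
      by (simp add: antiperiodic_def complex_eq_iff)
    moreover have "(- \<i> * (a - b)) * (\<i> * p * q) = a * (p * q) - b * (p * q)" for a b p q :: complex
      by (auto simp: complex_eq_iff algebra_simps)
    ultimately have "of_real (antiperiodic (x - y)) * mode n j x y =
      cis ((x - y) / 2) * (cis ((real j + 1/2) * x) * cis ((real n - 1/2 - real j) * y)) -
      cis (- ((x - y) / 2)) * (cis ((real j + 1/2) * x) * cis ((real n - 1/2 - real j) * y))"
      by (simp only: mode_def)
    also have "\<dots> = ?A (Suc j) - ?A j"
      unfolding cis_mult by (intro arg_cong2[where f="(-)"] arg_cong[where f=cis]) (simp_all add: field_simps)
    finally show ?thesis .
  qed
  then have "of_real (antiperiodic (x - y)) * kmode n x y = (\<Sum>j<n. ?A (Suc j) - ?A j)"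
    unfolding kmode_def sum_distrib_left by simp
  also have "\<dots> = ?A n - ?A 0" by (rule sum_lessThan_telescope)
  finally show ?thesis by simp
qed

text \<open>In each mode the frequencies in x and y add up to n, and swapping x and y reverses the
  order of the modes. Thus |\<nabla>| in x plus |\<nabla>| in y multiplies the n-th part of \<kappa>
  by n, just as |\<nabla>| multiplies exp(inx): this is the source of \<open>d_sum\<close> on the
  torus.\<close>

lemma dmode_swap: "dmode n x y + dmode n y x = of_nat n * kmode n x y"
proof -
  have "dmode n y x = (\<Sum>j<n. of_real (real (n - Suc j) + 1/2) * mode n (n - Suc j) y x)"
    unfolding dmode_def by (rule sum.nat_diff_reindex[symmetric])
  also have "\<dots> = (\<Sum>j<n. of_real (real n - 1/2 - real j) * mode n j x y)"
  proof (rule sum.cong[OF refl])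
    fix j assume "j \<in> {..<n}"
    then have r: "real (n - Suc j) = real n - 1 - real j" by (simp add: of_nat_diff)
    show "of_real (real (n - Suc j) + 1/2) * mode n (n - Suc j) y x = of_real (real n - 1/2 - real j) * mode n j x y"
      unfolding mode_def r by (simp add: algebra_simps)
  qed
  finally have D: "dmode n y x = (\<Sum>j<n. of_real (real n - 1/2 - real j) * mode n j x y)" .
  have "of_real (real j + 1/2) * w + of_real (real n - 1/2 - real j) * w = of_nat n * w" for j and w :: complex
    by (subst distrib_right[symmetric], subst of_real_add[symmetric]) simp
  then show ?thesis
    unfolding D unfolding dmode_def kmode_def sum_distrib_left sum.distrib[symmetric] by (intro sum.cong refl)
qed

lemma norm_mode: "norm (mode n j x y) = 1"
  by (simp add: mode_def norm_mult)

lemma norm_kmode_le: "norm (kmode n x y) \<le> real n"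
  unfolding kmode_def by (rule order.trans[OF norm_sum]) (simp add: norm_mode)

lemma norm_dmode_le: "norm (dmode n x y) \<le> (real n)\<^sup>2"
proof -
  have "norm (dmode n x y) \<le> (\<Sum>j<n. real j + 1/2)"
    unfolding dmode_def by (rule order.trans[OF norm_sum])
      (intro sum_mono, simp add: norm_mult norm_mode del: of_real_add)
  also have "\<dots> \<le> (\<Sum>j<n. real n)" by (intro sum_mono) auto
  finally show ?thesis by (simp add: power2_eq_square)
qed

lemma continuous_mode: "continuous_on A (\<lambda>z. mode n j (fst z) (snd z))"
  unfolding mode_def by (intro continuous_intros)

lemma dmode_meas: "(\<lambda>z. dmode n (fst z) (snd z)) \<in> borel_measurable borel"
  unfolding dmode_def
  by (intro borel_measurable_continuous_onI continuous_intros continuous_mode)+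

lemma Re_kmode_meas1: "(\<lambda>x. 2 * Re (c * kmode n x y)) \<in> borel_measurable borel"
  and Re_dmode_meas1: "(\<lambda>x. 2 * Re (c * dmode n x y)) \<in> borel_measurable borel"
  unfolding kmode_def dmode_def mode_def
  by (intro borel_measurable_continuous_onI continuous_intros)+

text \<open>Symmetry of |\<nabla>| on trigonometric sums: distinct half-integer frequencies are
  orthogonal over a period, and for equal ones the difference of the two weights is zero.\<close>

lemma integral_circle_modes:
  "(LINT x|circle. 2 * Re (a * kmode n x z) * (2 * Re (b * dmode m x y))) =
   (LINT x|circle. 2 * Re (a * dmode n x z) * (2 * Re (b * kmode m x y)))"
proof -
  let ?r = "\<lambda>j. real j + 1/2"
  let ?A = "\<lambda>j. a * \<i> * cis ((real n - 1/2 - real j) * z)" and ?B = "\<lambda>l. b * \<i> * cis ((real m - 1/2 - real l) * y)"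
  let ?u = "\<lambda>j x. Re (?A j * cis (?r j * x))" and ?v = "\<lambda>l x. Re (?B l * cis (?r l * x))"
  have k: "Re (a * kmode n x z) = (\<Sum>j<n. ?u j x)" "Re (b * kmode m x y) = (\<Sum>l<m. ?v l x)" for x
    unfolding kmode_def mode_def sum_distrib_left Re_sum by (intro sum.cong refl; simp add: mult_ac)+
  have r: "Re (a * (of_real t * (\<i> * p * q))) = t * Re (a * \<i> * q * p)" for t a p q
  proof -
    have "a * (of_real t * (\<i> * p * q)) = of_real t * (a * \<i> * q * p)" by (simp only: mult_ac)
    then show ?thesis by (simp only: Re_complex_of_real Im_complex_of_real times_complex.sel mult_zero_left diff_0_right)
  qed
  have d: "Re (a * dmode n x z) = (\<Sum>j<n. ?r j * ?u j x)" "Re (b * dmode m x y) = (\<Sum>l<m. ?r l * ?v l x)" for x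
    unfolding dmode_def mode_def sum_distrib_left Re_sum
    by (intro sum.cong refl r)+
  have i: "integrable circle (\<lambda>x. ?u j x * ?v l x)" for j l
  proof (rule integrable_circle_bounded[where B="norm a * norm b"])
    show "(\<lambda>x. ?u j x * ?v l x) \<in> borel_measurable borel"
      by (intro borel_measurable_continuous_onI continuous_intros)
    fix x
    have "\<bar>?u j x\<bar> \<le> norm a" "\<bar>?v l x\<bar> \<le> norm b"
      by (rule order.trans[OF abs_Re_le_cmod], simp add: norm_mult)+
    then show "norm (?u j x * ?v l x) \<le> norm a * norm b"
      by (auto simp: abs_mult intro!: mult_mono)
  qed
  have "(LINT x|circle. 2 * Re (a * kmode n x z) * (2 * Re (b * dmode m x y))) -
   (LINT x|circle. 2 * Re (a * dmode n x z) * (2 * Re (b * kmode m x y))) =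
   (\<Sum>j<n. \<Sum>l<m. 4 * (?r l - ?r j) * (LINT x|circle. ?u j x * ?v l x))"
  proof -
    have g1: "2 * (\<Sum>j<n. u j) * (2 * (\<Sum>l<m. r l * v l)) = (\<Sum>j<n. \<Sum>l<m. 4 * r l * (u j * v l))"
      and g2: "2 * (\<Sum>j<n. r j * u j) * (2 * (\<Sum>l<m. v l)) = (\<Sum>j<n. \<Sum>l<m. 4 * r j * (u j * v l))" for u v r :: "nat \<Rightarrow> real"
    proof -
      have e: "2 * U * (2 * V) = 4 * (U * V)" for U V :: real by simp
      show "2 * (\<Sum>j<n. u j) * (2 * (\<Sum>l<m. r l * v l)) = (\<Sum>j<n. \<Sum>l<m. 4 * r l * (u j * v l))"
        "2 * (\<Sum>j<n. r j * u j) * (2 * (\<Sum>l<m. v l)) = (\<Sum>j<n. \<Sum>l<m. 4 * r j * (u j * v l))"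
        unfolding e unfolding sum_product unfolding sum_distrib_left by (simp_all add: mult_ac)
    qed
    have e1: "2 * Re (a * kmode n x z) * (2 * Re (b * dmode m x y)) = (\<Sum>j<n. \<Sum>l<m. 4 * ?r l * (?u j x * ?v l x))" for x
      unfolding k d by (rule g1)
    have e2: "2 * Re (a * dmode n x z) * (2 * Re (b * kmode m x y)) = (\<Sum>j<n. \<Sum>l<m. 4 * ?r j * (?u j x * ?v l x))" for x
      unfolding k d by (rule g2)
    have I: "(LINT x|circle. (\<Sum>j<n. \<Sum>l<m. w j l * (?u j x * ?v l x))) = (\<Sum>j<n. \<Sum>l<m. w j l * (LINT x|circle. ?u j x * ?v l x))" for w
      using i by (simp only: Bochner_Integration.integral_sum Bochner_Integration.integrable_sum integrable_mult_right integral_mult_right_zero)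
    show ?thesis unfolding e1 e2 I sum_subtractf[symmetric] by (intro sum.cong refl) (simp only: left_diff_distrib right_diff_distrib)
  qed
  also have "\<dots> = 0"
  proof (intro sum.neutral ballI)
    fix j l
    show "4 * (?r l - ?r j) * (LINT x|circle. ?u j x * ?v l x) = 0"
      using integral_circle_Re_product[of l j "?A j" "?B l"] by (cases "l = j") auto
  qed
  finally show ?thesis by simp
qed

text \<open>For c the Fourier coefficients, n \<ge> 0, of a real function f, this is (f x - f
  y)/\<phi>(x - y): doubling the real part accounts for the frequencies - n, and the constant term
  drops out because \<open>kmode\<close> 0 is an empty sum. \<open>dser\<close> is |\<nabla>| of it
  in x.\<close>

definition kser :: "(nat \<Rightarrow> complex) \<Rightarrow> real \<Rightarrow> real \<Rightarrow> real" where
  "kser c x y = (\<Sum>n. 2 * Re (c n * kmode n x y))"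

definition dser :: "(nat \<Rightarrow> complex) \<Rightarrow> real \<Rightarrow> real \<Rightarrow> real" where
  "dser c x y = (\<Sum>n. 2 * Re (c n * dmode n x y))"

lemma abs_2Re_le: "norm w \<le> r \<Longrightarrow> \<bar>2 * Re (c * w)\<bar> \<le> 2 * (norm c * r)"
  using abs_Re_le_cmod[of "c * w"] mult_left_mono[of "norm w" r "norm c"] by (simp add: norm_mult)

context
  fixes c :: "nat \<Rightarrow> complex"
  assumes c: "summable (\<lambda>n. norm (c n) * (real n)\<^sup>2)"
begin

lemma kbound: "\<bar>2 * Re (c n * kmode n x y)\<bar> \<le> 2 * (norm (c n) * (real n)\<^sup>2)"
proof (rule abs_2Re_le)
  have "real n \<le> (real n)\<^sup>2" by (cases n) (auto simp: power2_eq_square)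
  then show "norm (kmode n x y) \<le> (real n)\<^sup>2" using norm_kmode_le[of n x y] by linarith
qed

lemma dbound: "\<bar>2 * Re (c n * dmode n x y)\<bar> \<le> 2 * (norm (c n) * (real n)\<^sup>2)"
  by (rule abs_2Re_le[OF norm_dmode_le])

lemma c2: "summable (\<lambda>n. 2 * (norm (c n) * (real n)\<^sup>2))"
  using summable_mult[OF c] .

lemma kser_summable: "summable (\<lambda>n. 2 * Re (c n * kmode n x y))"
  by (rule summable_comparison_test'[OF c2]) (use kbound in auto)

lemma dser_summable: "summable (\<lambda>n. 2 * Re (c n * dmode n x y))"
  by (rule summable_comparison_test'[OF c2]) (use dbound in auto)

lemma kser_le: "\<bar>kser c x y\<bar> \<le> (\<Sum>n. 2 * (norm (c n) * (real n)\<^sup>2))"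
  unfolding kser_def using summable_norm_comparison_test[of "\<lambda>n. 2 * Re (c n * kmode n x y)"]
  by (intro order.trans[OF summable_rabs] suminf_le c2 summable_comparison_test'[OF c2]) (use kbound in auto)

lemma dser_le: "\<bar>dser c x y\<bar> \<le> (\<Sum>n. 2 * (norm (c n) * (real n)\<^sup>2))"
  unfolding dser_def
  by (intro order.trans[OF summable_rabs] suminf_le c2 summable_comparison_test'[OF c2]) (use dbound in auto)

lemma kser_meas: "(\<lambda>x. kser c x y) \<in> borel_measurable borel"
  unfolding kser_def by (intro borel_measurable_suminf Re_kmode_meas1)

lemma dser_meas: "(\<lambda>x. dser c x y) \<in> borel_measurable borel"
  unfolding dser_def by (intro borel_measurable_suminf Re_dmode_meas1)

lemma dser_meas2: "(\<lambda>z. dser c (fst z) (snd z)) \<in> borel_measurable borel"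
proof -
  note [measurable] = dmode_meas
  show ?thesis unfolding dser_def by (intro borel_measurable_suminf) measurable
qed

end

lemma integral_circle_series:
  assumes c: "summable (\<lambda>n. norm (c n) * (real n)\<^sup>2)" and c': "summable (\<lambda>n. norm (c' n) * (real n)\<^sup>2)"
  shows "(LINT x|circle. kser c x z * dser c' x y) = (LINT x|circle. dser c x z * kser c' x y)"
proof -
  have 1: "(\<lambda>n. LINT x|circle. 2 * Re (c n * kmode n x z) * dser c' x y) sums (LINT x|circle. kser c x z * dser c' x y)"
    unfolding kser_def[of c]
    by (rule circle_sums_integral[OF Re_kmode_meas1 kbound[OF c] c2[OF c] dser_meas[OF c'] dser_le[OF c']])
  have 2: "(\<lambda>n. LINT x|circle. 2 * Re (c n * dmode n x z) * kser c' x y) sums (LINT x|circle. dser c x z * kser c' x y)"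
    unfolding dser_def[of c]
    by (rule circle_sums_integral[OF Re_dmode_meas1 dbound[OF c] c2[OF c] kser_meas[OF c'] kser_le[OF c']])
  have "(LINT x|circle. 2 * Re (c n * kmode n x z) * dser c' x y) = (LINT x|circle. 2 * Re (c n * dmode n x z) * kser c' x y)" for n
  proof -
    have 3: "(\<lambda>m. LINT x|circle. 2 * Re (c' m * dmode m x y) * (2 * Re (c n * kmode n x z))) sums (LINT x|circle. dser c' x y * (2 * Re (c n * kmode n x z)))"
      unfolding dser_def[of c']
      by (rule circle_sums_integral[OF Re_dmode_meas1 dbound[OF c'] c2[OF c'] Re_kmode_meas1 kbound[OF c]])
    have 4: "(\<lambda>m. LINT x|circle. 2 * Re (c' m * kmode m x y) * (2 * Re (c n * dmode n x z))) sums (LINT x|circle. kser c' x y * (2 * Re (c n * dmode n x z)))"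
      unfolding kser_def[of c']
      by (rule circle_sums_integral[OF Re_kmode_meas1 kbound[OF c'] c2[OF c'] Re_dmode_meas1 dbound[OF c]])
    have "(\<lambda>m. LINT x|circle. 2 * Re (c' m * dmode m x y) * (2 * Re (c n * kmode n x z))) =
       (\<lambda>m. LINT x|circle. 2 * Re (c' m * kmode m x y) * (2 * Re (c n * dmode n x z)))"
      using integral_circle_modes[of _ _ y "c n" n z] by (intro ext) (rule integral_circle_modes[symmetric])
    then have "(LINT x|circle. dser c' x y * (2 * Re (c n * kmode n x z))) = (LINT x|circle. kser c' x y * (2 * Re (c n * dmode n x z)))"
      using sums_unique2[OF 3] 4 by simp
    then show ?thesis by (simp only: mult.commute)
  qed
  then show ?thesis using sums_unique2[OF 1] 2 by simp
qed

section \<open>Fourier inversion, and series for the difference quotient\<close>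

context smooth_periodic
begin

lemma coeff_summable: "summable (\<lambda>n. norm (fc 0 (int n)) * (real n)\<^sup>2)"
proof -
  obtain B where B: "\<And>x. \<bar>G 4 x\<bar> \<le> B" using bounded by blast
  show ?thesis
  proof (rule summable_comparison_test'[OF summable_mult[OF inverse_power_summable[of 2], of B]])
    fix n :: nat
    show "norm (norm (fc 0 (int n)) * (real n)\<^sup>2) \<le> B * inverse (real n ^ 2)"
    proof (cases "n = 0")
      case False
      have "real n ^ 4 * norm (fc 0 (int n)) \<le> B" using fc_decay[OF B, of "int n"] by simp
      then have "(real n)\<^sup>2 * (norm (fc 0 (int n)) * (real n)\<^sup>2) \<le> B" by (simp add: power4_eq_xxxx power2_eq_square mult_ac)
      then show ?thesis using False by (simp add: field_simps)
    qed simp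
  qed simp
qed

lemma coeff_summable0: "summable (\<lambda>n. norm (fc 0 (int n)))"
proof (rule summable_comparison_test'[OF coeff_summable, of 1])
  fix n :: nat assume n: "1 \<le> n"
  then have "1 \<le> (real n)\<^sup>2" by simp
  then show "norm (norm (fc 0 (int n))) \<le> norm (fc 0 (int n)) * (real n)\<^sup>2"
    using mult_left_mono[of 1 "(real n)\<^sup>2" "norm (fc 0 (int n))"] by simp
qed

text \<open>Subtracting a multiple of sin(x - x0) instead of x - x0 keeps the remainder periodic; it
  still vanishes to second order, by the mean value theorem applied twice.\<close>

lemma second_order_bound:
  obtains M where "\<And>x x0. \<bar>G 0 x - G 0 x0 - G 1 x0 * sin (x - x0)\<bar> \<le> M * (x - x0)\<^sup>2" "M \<ge> 0"
proof -
  obtain B2 where B2: "\<And>x. \<bar>G 2 x\<bar> \<le> B2" using bounded by blast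
  obtain B1 where B1: "\<And>x. \<bar>G 1 x\<bar> \<le> B1" using bounded by blast
  let ?M = "B2 + B1"
  have M0: "?M \<ge> 0" using B1[of 0] B2[of 0] by linarith
  have "\<bar>G 0 x - G 0 x0 - G 1 x0 * sin (x - x0)\<bar> \<le> ?M * (x - x0)\<^sup>2" for x x0
  proof -
    define r where "r = \<bar>x - x0\<bar>"
    have in_ball: "x \<in> cball x0 r" "x0 \<in> cball x0 r" by (auto simp: r_def dist_real_def)
    have d1: "\<bar>G 1 y - G 1 x0 * cos (y - x0)\<bar> \<le> ?M * r" if y: "y \<in> cball x0 r" for y
    proof -
      have "norm ((G 1 y - G 1 x0 * cos (y - x0)) - (G 1 x0 - G 1 x0 * cos (x0 - x0))) \<le> ?M * norm (y - x0)"
      proof (rule field_differentiable_bound[of "cball x0 r" _ "\<lambda>z. G 2 z + G 1 x0 * sin (z - x0)"])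
        fix z assume "z \<in> cball x0 r"
        show "((\<lambda>y. G 1 y - G 1 x0 * cos (y - x0)) has_field_derivative G 2 z + G 1 x0 * sin (z - x0)) (at z within cball x0 r)"
          using deriv[of 1 z] by (auto intro!: derivative_eq_intros simp: has_field_derivative_at_within numeral_2_eq_2)
        have "\<bar>G 1 x0 * sin (z - x0)\<bar> \<le> B1 * 1"
          unfolding abs_mult using B1[of x0] by (intro mult_mono) auto
        then show "norm (G 2 z + G 1 x0 * sin (z - x0)) \<le> ?M" using B2[of z] unfolding real_norm_def by linarith
      qed (use y in_ball in auto)
      also have "\<dots> \<le> ?M * r" using y M0 by (intro mult_left_mono) (auto simp: dist_real_def)
      finally show ?thesis by simp
    qed
    have "norm ((G 0 x - G 1 x0 * sin (x - x0)) - (G 0 x0 - G 1 x0 * sin (x0 - x0))) \<le> ?M * r * norm (x - x0)"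
    proof (rule field_differentiable_bound[of "cball x0 r" _ "\<lambda>z. G 1 z - G 1 x0 * cos (z - x0)"])
      fix z assume z: "z \<in> cball x0 r"
      show "((\<lambda>y. G 0 y - G 1 x0 * sin (y - x0)) has_field_derivative G 1 z - G 1 x0 * cos (z - x0)) (at z within cball x0 r)"
        using deriv[of 0 z] by (auto intro!: derivative_eq_intros simp: has_field_derivative_at_within)
      show "norm (G 1 z - G 1 x0 * cos (z - x0)) \<le> ?M * r" using d1[OF z] by simp
    qed (use in_ball in auto)
    also have "?M * r * norm (x - x0) = ?M * (x - x0)\<^sup>2"
      by (simp add: r_def power2_eq_square[symmetric])
    finally show ?thesis by (simp add: algebra_simps)
  qed
  then show ?thesis using that M0 by blast
qed

text \<open>Chernoff's proof of the inversion formula: after subtracting \<open>f(x\<^sub>0) + f'(x\<^sub>0) sin(x - x\<^sub>0)\<close>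
  the function is \<open>4 sin\<^sup>2((x - x\<^sub>0)/2)\<close> times a bounded function, whose cosine coefficients \<open>\<gamma>\<close>
  make the partial sums telescope.\<close>

lemma fourier_inversion:
  "(\<lambda>n. (if n = 0 then 1 else 2) * Re (fc 0 (int n) * cis (real n * x0))) sums G 0 x0"
proof -
  let ?w = "\<lambda>x. 4 * (sin ((x - x0) / 2))\<^sup>2"
  define \<psi> where "\<psi> x = G 0 x - G 0 x0 - G 1 x0 * sin (x - x0)" for x
  define g where "g x = \<psi> x / ?w x" for x
  let ?c = "\<lambda>n x. cos (real n * (x - x0))"
  define \<gamma> where "\<gamma> n = (LINT x|circle. g x * ?c n x)" for n
  obtain M where M: "\<And>x. \<bar>\<psi> x\<bar> \<le> M * (x - x0)\<^sup>2" "M \<ge> 0"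
    unfolding \<psi>_def using second_order_bound by metis
  \<comment> \<open>After reduction to |v| \<le> pi, \<open>abs_sin_ge\<close> gives |v|/6 \<le>
    |sin(v/2)|, hence v^2 is at most 36 sin^2(v/2), which is 9 \<open>?w\<close>.\<close>
  have wlow: "\<bar>\<psi> x\<bar> \<le> 9 * M * ?w x" for x
  proof -
    obtain k where k: "\<bar>x + 2 * pi * of_int k - x0\<bar> \<le> pi" by (rule reduce)
    define v where "v = x + 2 * pi * of_int k - x0"
    have sv: "sin v = sin (x - x0)"
    proof -
      have "sin v = sin ((x - x0) + 2 * pi * of_int k)" by (simp add: v_def algebra_simps)
      also have "\<dots> = sin (x - x0)" by (simp add: sin_add sin_int_2pin cos_int_2pin)
      finally show ?thesis .
    qed
    have "cos v = cos (x - x0)"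
    proof -
      have "cos v = cos ((x - x0) + 2 * pi * of_int k)" by (simp add: v_def algebra_simps)
      also have "\<dots> = cos (x - x0)" by (simp add: cos_add sin_int_2pin cos_int_2pin)
      finally show ?thesis .
    qed
    moreover have half: "2 * (sin (t / 2))\<^sup>2 = 1 - cos t" for t :: real
      using cos_double_sin[of "t / 2"] by simp
    ultimately have wv: "?w x = 4 * (sin (v / 2))\<^sup>2"
      using half[of v] half[of "x - x0"] by linarith
    have "\<psi> x = \<psi> (x + 2 * pi * of_int k)" unfolding \<psi>_def periodic_int using sv by (simp add: v_def)
    then have "\<bar>\<psi> x\<bar> \<le> M * v\<^sup>2" using M(1)[of "x + 2 * pi * of_int k"] by (simp add: v_def)
    moreover have "v\<^sup>2 \<le> 9 * ?w x"
    proof -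
      have "\<bar>v / 2\<bar> / 3 \<le> \<bar>sin (v / 2)\<bar>" using k by (intro abs_sin_ge) (simp add: v_def)
      then have "(\<bar>v / 2\<bar> / 3)\<^sup>2 \<le> \<bar>sin (v / 2)\<bar>\<^sup>2" by (intro power_mono) auto
      then show ?thesis unfolding wv by (simp add: power_divide)
    qed
    then have "M * v\<^sup>2 \<le> M * (9 * ?w x)" using M(2) by (rule mult_left_mono)
    ultimately show ?thesis by simp
  qed
  have gb: "\<bar>g x\<bar> \<le> 9 * M" for x
  proof (cases "?w x = 0")
    case True
    then show ?thesis using M(2) by (simp add: g_def)
  next
    case False
    then have "?w x > 0" by simp
    then show ?thesis using wlow[of x] by (simp add: g_def abs_divide pos_divide_le_eq del: zero_less_mult_iff)
  qed
  have wg: "?w x * g x = \<psi> x" for x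
    using wlow[of x] by (cases "?w x = 0") (auto simp: g_def)
  have \<psi>m: "\<psi> \<in> borel_measurable borel"
    unfolding \<psi>_def by (intro borel_measurable_continuous_onI continuous_intros cont)
  have gm: "g \<in> borel_measurable borel"
    unfolding g_def using \<psi>m by (intro borel_measurable_divide) (auto intro!: borel_measurable_continuous_onI continuous_intros)
  have gcm: "(\<lambda>x. g x * ?c n x) \<in> borel_measurable borel" for n
    using gm by (intro borel_measurable_times) (auto intro!: borel_measurable_continuous_onI continuous_intros)
  have gcb: "\<bar>g x * ?c n x\<bar> \<le> 9 * M" for n x
    using mult_mono[OF gb[of x] abs_cos_le_one[of "real n * (x - x0)"]] M(2) by (simp add: abs_mult)
  have gci: "integrable circle (\<lambda>x. g x * ?c n x)" for n
    by (rule integrable_circle_bounded[OF gcm, where B="9 * M"]) (use gcb in auto)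
  have \<gamma>b: "\<bar>\<gamma> n\<bar> \<le> 2 * pi * (9 * M)" for n
    unfolding \<gamma>_def using norm_integral_circle_le[OF gcm, of n "9 * M"] gcb by simp
  have ci: "integrable circle (\<lambda>x. F x)" if "continuous_on UNIV F" "\<And>x. \<bar>F x\<bar> \<le> B" for F :: "real \<Rightarrow> real" and B
    by (rule integrable_circle_bounded[of _ B]) (use that in \<open>auto intro: borel_measurable_continuous_onI\<close>)
  obtain B0 where B0: "\<And>x. \<bar>G 0 x\<bar> \<le> B0" using bounded by blast
  have i1: "integrable circle (\<lambda>x. G 0 x * ?c n x)" for n
  proof (rule ci[of _ B0])
    show "\<bar>G 0 x * ?c n x\<bar> \<le> B0" for x
      using mult_mono[OF B0[of x] abs_cos_le_one[of "real n * (x - x0)"]] B0[of x] by (simp add: abs_mult)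
  qed (intro continuous_intros cont)
  have i2: "integrable circle (?c n)" for n by (rule ci[of _ 1]) (auto intro!: continuous_intros)
  have i3: "integrable circle (\<lambda>x. sin (of_int m * (x - x0)))" for m
    by (rule ci[of _ 1]) (auto intro!: continuous_intros)
  have cosint: "(LINT x|circle. ?c n x) = (if n = 0 then 2 * pi else 0)" for n
  proof (cases "n = 0")
    case True
    then show ?thesis using measure_circle by (simp add: space_circle)
  next
    case False
    have "(LINT x|circle. ?c n x) = (LINT x|circle. Re (cis (of_int (int n) * x + - (real n * x0))))"
      by (simp add: algebra_simps)
    also have "\<dots> = Re (LINT x|circle. cis (of_int (int n) * x + - (real n * x0)))"
      by (intro integral_Re integrable_circle_bounded[of _ 1] borel_measurable_continuous_onI continuous_on_cis_linear) simp
    also have "\<dots> = 0" using integral_circle_cis[of "int n" "- (real n * x0)"] False by simp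
    finally show ?thesis using False by simp
  qed
  have sinint: "(LINT x|circle. sin (x - x0) * ?c n x) = 0"
    and i4: "integrable circle (\<lambda>x. sin (x - x0) * ?c n x)" for n
  proof -
    have e: "sin (x - x0) * ?c n x = (sin (of_int (1 + int n) * (x - x0)) + sin (of_int (1 - int n) * (x - x0))) / 2" for x
      using sin_times_cos[of "x - x0" "real n * (x - x0)"] by (simp add: algebra_simps)
    show "integrable circle (\<lambda>x. sin (x - x0) * ?c n x)"
      unfolding e by (intro Bochner_Integration.integrable_divide Bochner_Integration.integrable_add i3)
    show "(LINT x|circle. sin (x - x0) * ?c n x) = 0"
      unfolding e Bochner_Integration.integral_divide_zero Bochner_Integration.integral_add[OF i3 i3] integral_circle_sin by simp
  qed
  let ?C = "\<lambda>n. LINT x|circle. G 0 x * ?c n x"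
  have psi_int: "(LINT x|circle. \<psi> x * ?c n x) = ?C n - (if n = 0 then 2 * pi * G 0 x0 else 0)" for n
  proof -
    have "(LINT x|circle. \<psi> x * ?c n x) = (LINT x|circle. G 0 x * ?c n x - G 0 x0 * ?c n x - G 1 x0 * (sin (x - x0) * ?c n x))"
      by (simp add: \<psi>_def algebra_simps)
    also have "\<dots> = ?C n - G 0 x0 * (LINT x|circle. ?c n x) - G 1 x0 * (LINT x|circle. sin (x - x0) * ?c n x)"
      using i1 i2 i4 by simp
    finally show ?thesis unfolding sinint cosint by simp
  qed
  \<comment> \<open>As 4 sin^2(t/2) = 2 - 2 cos t, multiplication by \<open>?w\<close> acts on
    cosine coefficients as minus the second difference; at n = 0 the even reflection identifies the
    coefficients at 1 and - 1.\<close>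
  have psi_\<gamma>: "(LINT x|circle. \<psi> x * ?c (Suc n) x) = 2 * \<gamma> (Suc n) - \<gamma> n - \<gamma> (Suc (Suc n))"
    and psi_\<gamma>0: "(LINT x|circle. \<psi> x * ?c 0 x) = 2 * \<gamma> 0 - 2 * \<gamma> 1" for n
  proof -
    have half: "2 * (sin (t / 2))\<^sup>2 = 1 - cos t" for t :: real
      using cos_double_sin[of "t / 2"] by simp
    have w: "?w x = 2 - 2 * cos (x - x0)" for x
      using half[of "x - x0"] by linarith
    have "\<psi> x * ?c (Suc n) x = 2 * (g x * ?c (Suc n) x) - g x * ?c n x - g x * ?c (Suc (Suc n)) x" for x
    proof -
      have "2 * cos (x - x0) * ?c (Suc n) x = ?c n x + ?c (Suc (Suc n)) x"
        using cos_times_cos[of "real (Suc n) * (x - x0)" "x - x0"] by (simp add: algebra_simps)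
      then have "(2 - 2 * cos (x - x0)) * ?c (Suc n) x = 2 * ?c (Suc n) x - ?c n x - ?c (Suc (Suc n)) x"
        unfolding left_diff_distrib by linarith
      then have "g x * ((2 - 2 * cos (x - x0)) * ?c (Suc n) x) = g x * (2 * ?c (Suc n) x - ?c n x - ?c (Suc (Suc n)) x)" by simp
      moreover have "\<psi> x * ?c (Suc n) x = g x * ((2 - 2 * cos (x - x0)) * ?c (Suc n) x)"
        unfolding wg[of x, symmetric] w by (simp only: mult_ac)
      ultimately show ?thesis by (simp only: right_diff_distrib mult_ac)
    qed
    then show "(LINT x|circle. \<psi> x * ?c (Suc n) x) = 2 * \<gamma> (Suc n) - \<gamma> n - \<gamma> (Suc (Suc n))"
      unfolding \<gamma>_def using gci[of n] gci[of "Suc n"] gci[of "Suc (Suc n)"]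
      by (simp only: Bochner_Integration.integral_diff Bochner_Integration.integrable_diff integrable_mult_right integral_mult_right_zero)
    have "\<psi> x * ?c 0 x = 2 * (g x * ?c 0 x) - 2 * (g x * ?c 1 x)" for x
      unfolding wg[of x, symmetric] w by (simp add: algebra_simps)
    then show "(LINT x|circle. \<psi> x * ?c 0 x) = 2 * \<gamma> 0 - 2 * \<gamma> 1"
      unfolding \<gamma>_def using gci[of 0] gci[of 1]
      by (simp only: Bochner_Integration.integral_diff Bochner_Integration.integrable_diff integrable_mult_right integral_mult_right_zero)
  qed
  define a where "a n = (if n = 0 then 1 else 2) * Re (fc 0 (int n) * cis (real n * x0))" for n
  have aC: "2 * pi * a n = (if n = 0 then 1 else 2) * ?C n" for n
  proof -
    have "fc 0 (int n) * cis (real n * x0) = 1 / (2 * pi) * (LINT x|circle. of_real (G 0 x) * cis (- of_int (int n) * x + 0) * cis (real n * x0))"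
      unfolding fc_circle by simp
    also have "(\<lambda>x. of_real (G 0 x) * cis (- of_int (int n) * x + 0) * cis (real n * x0)) = (\<lambda>x. of_real (G 0 x) * cis (- (real n * (x - x0))))"
      by (simp add: mult.assoc cis_mult algebra_simps)
    finally have "Re (fc 0 (int n) * cis (real n * x0)) = 1 / (2 * pi) * Re (LINT x|circle. of_real (G 0 x) * cis (- (real n * (x - x0))))"
      by simp
    also have "Re (LINT x|circle. of_real (G 0 x) * cis (- (real n * (x - x0)))) = (LINT x|circle. Re (of_real (G 0 x) * cis (- (real n * (x - x0)))))"
      using B0 by (intro integral_Re[symmetric] integrable_circle_bounded[of _ B0] borel_measurable_continuous_onI continuous_intros cont)
        (simp add: norm_mult)
    also have "\<dots> = ?C n" by simp
    finally have R: "Re (fc 0 (int n) * cis (real n * x0)) = 1 / (2 * pi) * ?C n" .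
    show ?thesis unfolding a_def R by simp
  qed
  have part: "2 * pi * (\<Sum>k\<le>n. a k) = 2 * pi * G 0 x0 + 2 * (\<gamma> n - \<gamma> (Suc n))" for n
  proof (induction n)
    case 0
    then show ?case using aC[of 0] psi_int[of 0] psi_\<gamma>0 by simp
  next
    case (Suc n)
    have "2 * pi * a (Suc n) = 2 * (2 * \<gamma> (Suc n) - \<gamma> n - \<gamma> (Suc (Suc n)))"
      using aC[of "Suc n"] psi_int[of "Suc n"] psi_\<gamma>[of n] by simp
    then show ?case using Suc by (simp add: distrib_left)
  qed
  have asum: "summable a"
  proof (rule summable_comparison_test'[OF summable_mult[OF coeff_summable0, of 2]])
    fix n
    have "\<bar>Re (fc 0 (int n) * cis (real n * x0))\<bar> \<le> norm (fc 0 (int n))"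
      using abs_Re_le_cmod[of "fc 0 (int n) * cis (real n * x0)"] by (simp add: norm_mult)
    then show "norm (a n) \<le> 2 * norm (fc 0 (int n))" by (auto simp: a_def)
  qed
  have "(\<lambda>n. \<Sum>k\<le>n. a k) \<longlonglongrightarrow> suminf a" using summable_LIMSEQ'[OF asum] .
  moreover have "\<gamma> n - \<gamma> (Suc n) = pi * ((\<Sum>k\<le>n. a k) - G 0 x0)" for n
    using part[of n] by (simp add: algebra_simps)
  ultimately have "(\<lambda>n. \<gamma> n - \<gamma> (Suc n)) \<longlonglongrightarrow> pi * (suminf a - G 0 x0)"
    by (simp only:) (intro tendsto_intros)
  from telescoping_limit_zero[OF \<gamma>b this] have "suminf a = G 0 x0" by simp
  then show ?thesis using summable_sums[OF asum] unfolding a_def by simp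
qed

abbreviation cf :: "nat \<Rightarrow> complex" where "cf n \<equiv> fc 0 (int n)"

text \<open>The series of |\<nabla>| with the frequencies n and - n combined, a form that can be
  compared term by term with \<open>dser\<close>.\<close>

definition hT :: "real \<Rightarrow> real" where
  "hT x = (\<Sum>n. 2 * real n * Re (cf n * cis (real n * x)))"

lemma hT_summable: "summable (\<lambda>n. norm (cf n * (of_nat n * cis (real n * x))))"
proof (rule summable_comparison_test'[OF coeff_summable])
  fix n :: nat
  have "real n \<le> (real n)\<^sup>2" by (cases n) (auto simp: power2_eq_square)
  then show "norm (norm (cf n * (of_nat n * cis (real n * x)))) \<le> norm (cf n) * (real n)\<^sup>2"
    by (simp add: norm_mult mult_left_mono)
qed

lemma hT_eq: "Re (\<Sum>\<^sub>\<infinity>n\<in>UNIV. of_int \<bar>n\<bar> * fourier_coeff (G 0) n * exp (\<i> * of_int n * of_real x)) = hT x"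
proof -
  let ?h = "\<lambda>n :: int. of_int \<bar>n\<bar> * fourier_coeff (G 0) n * exp (\<i> * of_int n * of_real x)"
  define b where "b n = cf n * (of_nat n * cis (real n * x))" for n
  have bs: "summable (\<lambda>n. norm (b n))" unfolding b_def by (rule hT_summable)
  then have bS: "summable (\<lambda>n. norm (b (Suc n)))" by (subst summable_Suc_iff)
  define A where "A = (\<Sum>n. b (Suc n))"
  have "(\<lambda>n. b (Suc n)) sums A" unfolding A_def by (rule summable_sums[OF summable_norm_cancel[OF bS]])
  from norm_summable_imp_has_sum[OF bS this] have p: "((\<lambda>n. b (Suc n)) has_sum A) UNIV" .
  then have m: "((\<lambda>n. cnj (b (Suc n))) has_sum cnj A) UNIV" by (simp add: has_sum_cnj_iff)
  have hb: "?h (int (Suc n)) = b (Suc n)" "?h (- int (Suc n)) = cnj (b (Suc n))" for n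
  proof -
    show "?h (int (Suc n)) = b (Suc n)" unfolding b_def by (simp add: cis_conv_exp mult_ac)
    have "exp (\<i> * of_int (- int (Suc n)) * of_real x) = cis (- (real (Suc n) * x))"
      by (simp add: cis_conv_exp algebra_simps)
    then show "?h (- int (Suc n)) = cnj (b (Suc n))" unfolding b_def fc_cnj by (simp add: cis_cnj mult_ac del: of_nat_Suc)
  qed
  have inj: "inj (\<lambda>n. int (Suc n))" "inj (\<lambda>n. - int (Suc n))" by (auto simp: inj_on_def)
  have comp: "?h \<circ> (\<lambda>n. int (Suc n)) = (\<lambda>n. b (Suc n))" "?h \<circ> (\<lambda>n. - int (Suc n)) = (\<lambda>n. cnj (b (Suc n)))"
    by (simp_all only: fun_eq_iff o_apply hb simp_thms)
  have "(?h has_sum A) (range (\<lambda>n. int (Suc n)))"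
    unfolding has_sum_reindex[OF inj(1)] comp by (rule p)
  moreover have "(?h has_sum cnj A) (range (\<lambda>n. - int (Suc n)))"
    unfolding has_sum_reindex[OF inj(2)] comp by (rule m)
  ultimately have "(?h has_sum (A + cnj A)) (range (\<lambda>n. int (Suc n)) \<union> range (\<lambda>n. - int (Suc n)))"
    by (rule has_sum_Un_disjoint) auto
  moreover have "(?h has_sum 0) {0}" by (simp add: has_sum_finiteI)
  ultimately have "(?h has_sum (A + cnj A + 0)) ((range (\<lambda>n. int (Suc n)) \<union> range (\<lambda>n. - int (Suc n))) \<union> {0})"
    by (rule has_sum_Un_disjoint) auto
  moreover have "(range (\<lambda>n. int (Suc n)) \<union> range (\<lambda>n. - int (Suc n))) \<union> {0} = UNIV"
  proof -
    have "i \<in> range (\<lambda>n. int (Suc n)) \<or> i \<in> range (\<lambda>n. - int (Suc n)) \<or> i = 0" for i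
    proof (cases i rule: int_cases3)
      case (pos n)
      then show ?thesis using rangeI[of "\<lambda>n. int (Suc n)" "n - 1"] by auto
    next
      case (neg n)
      then show ?thesis using rangeI[of "\<lambda>n. - int (Suc n)" "n - 1"] by auto
    qed simp
    then show ?thesis by blast
  qed
  ultimately have "(\<Sum>\<^sub>\<infinity>n\<in>UNIV. ?h n) = A + cnj A" by (simp add: infsumI)
  then have "Re (\<Sum>\<^sub>\<infinity>n\<in>UNIV. ?h n) = 2 * Re A" by simp
  also have "Re A = (\<Sum>n. Re (b (Suc n)))"
    unfolding A_def using summable_norm_cancel[OF bS] by (rule Re_suminf)
  also have "\<dots> = (\<Sum>n. Re (b n))"
    using suminf_split_head[of "\<lambda>n. Re (b n)"] summable_Re[OF summable_norm_cancel[OF bs]] by (simp add: b_def)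
  also have "2 * \<dots> = hT x"
    unfolding hT_def using summable_Re[OF summable_norm_cancel[OF bs]]
    by (subst suminf_mult[symmetric]) (auto simp: b_def algebra_simps)
  finally show ?thesis .
qed

lemma kser_cf: "antiperiodic (x - y) * kser cf x y = G 0 x - G 0 y"
proof -
  have "(\<lambda>n. antiperiodic (x - y) * (2 * Re (cf n * kmode n x y))) sums (antiperiodic (x - y) * kser cf x y)"
    unfolding kser_def by (intro sums_mult summable_sums kser_summable coeff_summable)
  moreover have "antiperiodic (x - y) * (2 * Re (cf n * kmode n x y)) =
    (if n = 0 then 1 else 2) * Re (cf n * cis (real n * x)) - (if n = 0 then 1 else 2) * Re (cf n * cis (real n * y))" for n
  proof -
    have "antiperiodic (x - y) * (2 * Re (cf n * kmode n x y)) = 2 * Re (cf n * (of_real (antiperiodic (x - y)) * kmode n x y))"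
      by (simp add: algebra_simps)
    then show ?thesis unfolding antiperiodic_kmode by (auto simp: algebra_simps)
  qed
  ultimately show ?thesis
    using sums_unique2 sums_diff[OF fourier_inversion fourier_inversion] by (simp only:) blast
qed

text \<open>Term by term from \<open>dmode_swap\<close>; the factor n produced there is the symbol
  of |\<nabla>|.\<close>

lemma dser_cf: "antiperiodic (x - y) * (dser cf x y + dser cf y x) = hT x - hT y"
proof -
  have "(\<lambda>n. antiperiodic (x - y) * (2 * Re (cf n * dmode n x y) + 2 * Re (cf n * dmode n y x))) sums
      (antiperiodic (x - y) * (dser cf x y + dser cf y x))"
    unfolding dser_def by (intro sums_mult sums_add summable_sums dser_summable coeff_summable)
  moreover have "antiperiodic (x - y) * (2 * Re (cf n * dmode n x y) + 2 * Re (cf n * dmode n y x)) =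
     2 * real n * Re (cf n * cis (real n * x)) - 2 * real n * Re (cf n * cis (real n * y))" for n
  proof -
    have "antiperiodic (x - y) * (2 * Re (cf n * dmode n x y) + 2 * Re (cf n * dmode n y x)) =
      2 * Re (cf n * (of_real (antiperiodic (x - y)) * (dmode n x y + dmode n y x)))"
      by (simp add: algebra_simps)
    also have "of_real (antiperiodic (x - y)) * (dmode n x y + dmode n y x) = of_nat n * (of_real (antiperiodic (x - y)) * kmode n x y)"
      unfolding dmode_swap by (simp only: mult_ac)
    also have "2 * Re (cf n * (of_nat n * (of_real (antiperiodic (x - y)) * kmode n x y))) =
      2 * real n * Re (cf n * cis (real n * x)) - 2 * real n * Re (cf n * cis (real n * y))"
      unfolding antiperiodic_kmode by (simp add: algebra_simps)
    finally show ?thesis .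
  qed
  moreover have "summable (\<lambda>n. 2 * real n * Re (cf n * cis (real n * x)))" for x
  proof -
    have "summable (\<lambda>n. 2 * Re (cf n * (of_nat n * cis (real n * x))))"
      by (intro summable_mult summable_Re summable_norm_cancel[OF hT_summable])
    then show ?thesis by (simp add: algebra_simps)
  qed
  then have "(\<lambda>n. 2 * real n * Re (cf n * cis (real n * x)) - 2 * real n * Re (cf n * cis (real n * y))) sums (hT x - hT y)"
    unfolding hT_def by (intro sums_diff summable_sums)
  ultimately show ?thesis using sums_unique2 by (simp only:) blast
qed

lemma hT_abs_le: "\<bar>hT x\<bar> \<le> (\<Sum>n. 2 * (norm (cf n) * (real n)\<^sup>2))"
proof -
  have le: "\<bar>2 * real n * Re (cf n * cis (real n * x))\<bar> \<le> 2 * (norm (cf n) * (real n)\<^sup>2)" for n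
  proof -
    have "\<bar>Re (cf n * cis (real n * x))\<bar> \<le> norm (cf n)"
      using abs_Re_le_cmod[of "cf n * cis (real n * x)"] by (simp add: norm_mult)
    moreover have "real n \<le> (real n)\<^sup>2" by (cases n) (auto simp: power2_eq_square)
    ultimately have "real n * \<bar>Re (cf n * cis (real n * x))\<bar> \<le> (real n)\<^sup>2 * norm (cf n)" by (intro mult_mono) auto
    then show ?thesis by (simp only: abs_mult) (simp add: mult_ac)
  qed
  show ?thesis unfolding hT_def
    by (intro order.trans[OF summable_rabs] suminf_le c2[OF coeff_summable] summable_comparison_test'[OF c2[OF coeff_summable]])
      (use le in auto)
qed

lemma coeff_sum_le:
  assumes "\<And>x. \<bar>G 4 x\<bar> \<le> B"
  shows "(\<Sum>n. 2 * (norm (cf n) * (real n)\<^sup>2)) \<le> 2 * B * (\<Sum>n. inverse (real n ^ 2))"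
proof -
  have s: "summable (\<lambda>n. inverse (real n ^ 2))" by (rule inverse_power_summable) simp
  have "2 * (norm (cf n) * (real n)\<^sup>2) \<le> 2 * B * inverse (real n ^ 2)" for n
  proof (cases "n = 0")
    case False
    have "real n ^ 4 * norm (cf n) \<le> B" using fc_decay[OF assms, of "int n"] by simp
    then have "(real n)\<^sup>2 * (norm (cf n) * (real n)\<^sup>2) \<le> B" by (simp add: power4_eq_xxxx power2_eq_square mult_ac)
    then show ?thesis using False by (simp add: field_simps)
  qed simp
  then have "(\<Sum>n. 2 * (norm (cf n) * (real n)\<^sup>2)) \<le> (\<Sum>n. 2 * B * inverse (real n ^ 2))"
    by (intro suminf_le c2[OF coeff_summable] summable_mult s)
  then show ?thesis using suminf_mult[OF s, of "2 * B"] by simp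
qed

lemma hT_meas: "hT \<in> borel_measurable borel"
  unfolding hT_def
  by (intro borel_measurable_suminf borel_measurable_continuous_onI continuous_intros)

end

section \<open>Smooth flows along a segment of time\<close>

lemma borel_measurable_vecI:
  fixes f :: "'a \<Rightarrow> real ^ 'n"
  assumes "\<And>i. (\<lambda>x. f x $ i) \<in> borel_measurable M"
  shows "f \<in> borel_measurable M"
proof -
  have "(\<lambda>x. \<Sum>i\<in>UNIV. f x $ i *\<^sub>R axis i (1::real)) \<in> borel_measurable M"
    using assms by measurable
  moreover have "(\<Sum>i\<in>UNIV. v $ i *\<^sub>R axis i (1::real)) = v" for v :: "real ^ 'n"
    using basis_expansion[of v] by (simp add: scalar_mult_eq_scaleR)
  ultimately show ?thesis by simp
qed

text \<open>Shared by the line and the torus: \<open>An\<close> is the operator |\<nabla>|, and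
  \<tau> is the time at which rationality is to be shown.\<close>

locale smooth_flow =
  fixes I :: "real set" and S :: "real \<Rightarrow> real \<Rightarrow> real ^ 3" and D :: "nat \<Rightarrow> nat \<Rightarrow> real \<Rightarrow> real \<Rightarrow> real ^ 3"
    and An :: "(real \<Rightarrow> real ^ 3) \<Rightarrow> real \<Rightarrow> real ^ 3" and \<tau> :: real
  assumes I: "is_interval I" "0 \<in> I" "\<tau> \<in> I"
    and D0: "D 0 0 = S"
    and D_cont: "\<And>j k. continuous_on (I \<times> UNIV) (\<lambda>(t, x). D j k t x)"
    and D_t: "\<And>j k t x. t \<in> I \<Longrightarrow> ((\<lambda>s. D j k s x) has_vector_derivative D (Suc j) k t x) (at t within I)"
    and D_x: "\<And>j k t x. t \<in> I \<Longrightarrow> (D j k t has_vector_derivative D j (Suc k) t x) (at x)"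
    and sphere: "\<And>t x. t \<in> I \<Longrightarrow> S t x \<in> sphere 0 1"
    and pde: "\<And>t x. t \<in> I \<Longrightarrow> ((\<lambda>s. S s x) has_vector_derivative cross3 (S t x) (An (S t) x)) (at t within I)"
begin

text \<open>The segment from 0 to \<tau>, run backwards in time if \<tau> < 0. Clamping makes it
  total with values in \<open>I\<close>, so that continuity and measurability in (r, x) hold on the
  whole plane.\<close>

definition path :: "real \<Rightarrow> real" where "path r = \<tau> * max 0 (min 1 r)"

lemma path_I: "path r \<in> I"
proof -
  have "convex I" using I(1) by (simp add: is_interval_convex_1)
  from convexD_alt[OF this I(2,3), of "max 0 (min 1 r)"] show ?thesis
    by (simp add: path_def mult.commute)
qed

lemma path_01: "path 0 = 0" "path 1 = \<tau>"
  by (simp_all add: path_def)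

lemma path_cont: "continuous_on A path"
  unfolding path_def by (intro continuous_intros)

lemma path_compact: "compact (path ` {0..1})"
  by (intro compact_continuous_image path_cont) simp

lemma D_path_cont: "continuous_on UNIV (\<lambda>z. D j k (path (fst z)) (snd z))"
proof -
  have "continuous_on UNIV (\<lambda>z. (case (path (fst z), snd z) of (t, x) \<Rightarrow> D j k t x))"
    by (rule continuous_on_compose2[OF D_cont])
      (auto intro!: continuous_intros continuous_on_compose2[OF path_cont] path_I)
  then show ?thesis by simp
qed

lemma D_path_meas: "(\<lambda>(r, x). D j k (path r) x) \<in> borel_measurable (borel \<Otimes>\<^sub>M borel)"
  unfolding borel_prod case_prod_unfold by (rule borel_measurable_continuous_onI[OF D_path_cont])

lemma path_deriv:
  assumes "r \<in> {0..1}"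
  shows "((\<lambda>r. D j k (path r) x) has_vector_derivative \<tau> *\<^sub>R D (Suc j) k (path r) x) (at r within {0..1})"
proof -
  have "((\<lambda>r. \<tau> * r) has_vector_derivative \<tau>) (at r within {0..1})"
    by (auto intro!: derivative_eq_intros simp: has_real_derivative_iff_has_vector_derivative[symmetric])
  then have p: "(path has_vector_derivative \<tau>) (at r within {0..1})"
    by (rule has_vector_derivative_transform[OF assms, rotated]) (simp add: path_def)
  have "((\<lambda>s. D j k s x) has_vector_derivative D (Suc j) k (path r) x) (at (path r) within path ` {0..1})"
    by (rule has_vector_derivative_within_subset[OF D_t[OF path_I]]) (use path_I in auto)
  from vector_diff_chain_within[OF p this] show ?thesis by (simp add: o_def)
qed

text \<open>Both the smoothness datum \<open>D 1 0\<close> and the right-hand side of the equation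
  are time derivatives of S within \<open>I\<close>. They agree when \<open>I\<close> has no
  isolated point, which a nonzero \<tau> guarantees; for \<tau> = 0 both sides vanish.\<close>

lemma D_t_eq:
  "\<tau> *\<^sub>R D 1 0 (path r) x = \<tau> *\<^sub>R cross3 (S (path r) x) (An (S (path r)) x)"
proof (cases "\<tau> = 0")
  case False
  have "connected I" using I(1) by (simp add: is_interval_connected_1)
  moreover have "\<not> (\<exists>x. I = {x})" using I(2,3) False by auto
  ultimately have "path r islimpt I" using path_I by (intro connected_imp_perfect) auto
  then have "at (path r) within I \<noteq> bot" using trivial_limit_within by blast
  from vector_derivative_unique_within[OF this pde[OF path_I[of r], of x] D_t[OF path_I[of r], of 0 0 x, unfolded D0]]
  show ?thesis by simp
qed simp

lemma unit: "norm (S (path r) x) = 1"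
  using sphere[OF path_I, of r x] by simp

lemma path_section_cont: "continuous_on A (\<lambda>r. D j k (path r) x)"
proof -
  have "continuous_on A (\<lambda>r. (\<lambda>z. D j k (path (fst z)) (snd z)) (r, x))"
    by (rule continuous_on_compose2[OF D_path_cont]) (auto intro!: continuous_intros)
  then show ?thesis by simp
qed

lemma D_component_deriv:
  assumes "t \<in> I"
  shows "((\<lambda>x. D 0 j t x $ a) has_real_derivative D 0 (Suc j) t x $ a) (at x)"
  using bounded_linear.has_vector_derivative[OF bounded_linear_vec_nth D_x[OF assms, of 0 j x], of a]
  by (simp add: has_real_derivative_iff_has_vector_derivative)

end

section \<open>The circle as an instance\<close>

lemma antiperiodic_zero_iff: "antiperiodic u = 0 \<longleftrightarrow> (\<exists>k::int. u = of_int k * (2 * pi))"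
  unfolding antiperiodic_def using sin_zero_iff_int2[of "u / 2"] by (auto simp: field_simps)

lemma AE_circle_antiperiodic: "AE x in circle. antiperiodic (x - y) \<noteq> 0"
proof -
  have "countable (range (\<lambda>k::int. y + of_int k * (2 * pi)))" by simp
  then have "AE x in lborel. x \<notin> range (\<lambda>k::int. y + of_int k * (2 * pi))"
    by (rule AE_not_in[OF countable_imp_null_set_lborel])
  then have "AE x in lborel. antiperiodic (x - y) \<noteq> 0"
  proof eventually_elim
    case (elim x)
    show ?case
    proof
      assume "antiperiodic (x - y) = 0"
      then obtain k :: int where "x - y = of_int k * (2 * pi)" by (auto simp: antiperiodic_zero_iff)
      then have "x = y + of_int k * (2 * pi)" by simp
      then show False using elim by blast
    qed
  qed
  then show ?thesis unfolding circle_def by (subst AE_density) (auto elim: eventually_mono)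
qed

lemma cis_eq_iff_antiperiodic: "antiperiodic (x - y) = 0 \<longleftrightarrow> cis x = cis y"
proof -
  have "norm (cis x - cis y) = \<bar>antiperiodic (x - y)\<bar>"
  proof -
    have "cis x - cis y = of_real (antiperiodic (x - y)) * kmode 1 x y"
      using antiperiodic_kmode[of x y 1] by simp
    then show ?thesis using norm_mode[of 1 0 x y] by (simp add: norm_mult kmode_def)
  qed
  then show ?thesis by (metis abs_eq_0 eq_iff_diff_eq_0 norm_eq_zero)
qed

text \<open>exp(ix) - exp(iy) = 2i sin((x - y)/2) exp(i(x + y)/2). The phase pi/4 distributes the
  factor i evenly over \<open>c x\<close> and \<open>c y\<close>.\<close>

lemma kernel_param_circle: "kernel_param cis (\<lambda>x. cis (pi / 4 + x / 2)) antiperiodic"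
proof
  show "continuous_on UNIV antiperiodic" unfolding antiperiodic_def by (auto intro!: continuous_intros)
  show "antiperiodic (- u) = - antiperiodic u" for u by (simp add: antiperiodic_def)
  show "antiperiodic (x - y) = 0 \<longleftrightarrow> cis x = cis y" for x y by (rule cis_eq_iff_antiperiodic)
  show "continuous_on UNIV cis" by (intro continuous_intros)
  show "cis (pi / 4 + x / 2) \<noteq> 0" for x by simp
  show "of_real (inverse (antiperiodic (x - y))) = cis (pi / 4 + x / 2) * cis (pi / 4 + y / 2) / (cis x - cis y)"
    if nz: "antiperiodic (x - y) \<noteq> 0" for x y
  proof -
    have "cis (pi / 4 + x / 2) * cis (pi / 4 + y / 2) = cis (pi / 2) * (cis (x / 2) * cis (y / 2))"
      unfolding cis_mult by (rule arg_cong[where f=cis]) (simp add: field_simps)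
    also have "\<dots> = kmode 1 x y" by (simp add: kmode_def mode_def)
    finally have c: "cis (pi / 4 + x / 2) * cis (pi / 4 + y / 2) = kmode 1 x y" .
    have "cis x - cis y = of_real (antiperiodic (x - y)) * kmode 1 x y"
      using antiperiodic_kmode[of x y 1] by simp
    moreover have "kmode 1 x y \<noteq> 0" unfolding c[symmetric] by simp
    ultimately show ?thesis unfolding c using nz by (simp add: field_simps)
  qed
  show "\<forall>\<^sub>F x' in at x. cis x' \<noteq> z" for x z
  proof (cases "cis x = z")
    case False
    have "(cis \<longlongrightarrow> cis x) (at x)" by (intro tendsto_intros)
    from tendsto_imp_eventually_ne[OF this False] show ?thesis .
  next
    case True
    have "eventually (\<lambda>x'. x' \<in> ball x pi) (at x)" by (rule eventually_at_in_open') auto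
    then show ?thesis using eventually_neq_at_within[of x x UNIV]
    proof eventually_elim
      case (elim x')
      have "sin ((x' - x) / 2) \<noteq> 0"
      proof
        assume "sin ((x' - x) / 2) = 0"
        then have "\<bar>(x' - x) / 2\<bar> / 3 \<le> 0"
          using abs_sin_ge[of "(x' - x) / 2"] elim by (auto simp: dist_real_def abs_minus_commute)
        then show False using elim by simp
      qed
      then have "antiperiodic (x' - x) \<noteq> 0" by (simp add: antiperiodic_def)
      then show ?case using True cis_eq_iff_antiperiodic by auto
    qed
  qed
qed

lemma nn_integral_circle2_le:
  assumes "\<And>z. h z \<le> b" "0 \<le> b"
  shows "(\<integral>\<^sup>+z. ennreal (h z) \<partial>(circle \<Otimes>\<^sub>M circle)) \<le> ennreal (b * (2 * pi * (2 * pi)))"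
proof -
  interpret finite_measure circle by (rule finite_measure_circle)
  have em: "emeasure circle (space circle) = ennreal (2 * pi)"
    using emeasure_eq_measure[of "space circle"] measure_circle by simp
  have "(\<integral>\<^sup>+z. ennreal (h z) \<partial>(circle \<Otimes>\<^sub>M circle)) \<le> (\<integral>\<^sup>+z. ennreal b \<partial>(circle \<Otimes>\<^sub>M circle))"
    using assms by (intro nn_integral_mono ennreal_leI)
  also have "\<dots> = ennreal b * (ennreal (2 * pi) * ennreal (2 * pi))"
    using emeasure_pair_measure_Times[of "space circle" circle "space circle"] em
    by (simp add: space_pair_measure[symmetric])
  also have "\<dots> = ennreal (b * (2 * pi * (2 * pi)))"
    using assms(2) ennreal_mult[of b "2 * pi * (2 * pi)"] ennreal_mult[of "2 * pi" "2 * pi"] by (simp only: pi_ge_zero mult_nonneg_nonneg zero_le_numeral)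
  finally show ?thesis .
qed

lemma sq_integrable_circle_bounded:
  assumes "f \<in> borel_measurable borel" "\<And>x. \<bar>f x\<bar> \<le> b"
  shows "sq_integrable circle f"
  unfolding sq_integrable_def
proof
  show "f \<in> borel_measurable circle" by (rule measurable_circle[OF assms(1)])
  show "integrable circle (\<lambda>x. (f x)\<^sup>2)"
  proof (rule integrable_circle_bounded[where B="b\<^sup>2"])
    show "norm ((f x)\<^sup>2) \<le> b\<^sup>2" for x
      using power_mono[OF assms(2)[of x], of 2] by simp
  qed (use assms(1) in measurable)
qed

lemma emeasure_lborel_open_nonzero:
  fixes x :: real
  assumes "open U" "x \<in> U"
  shows "emeasure lborel U \<noteq> 0"
proof -
  obtain r where r: "r > 0" "ball x r \<subseteq> U" using assms open_contains_ball by blast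
  have "emeasure lborel (ball x r) \<le> emeasure lborel U"
    using r(2) assms(1) by (intro emeasure_mono) auto
  moreover have "emeasure lborel (ball x r) = ennreal (2 * r)"
    using r(1) by (simp add: ball_eq_greaterThanLessThan)
  ultimately show ?thesis using r(1) by auto
qed

lemma norm_le_3:
  fixes v :: "real ^ 3"
  assumes "\<And>a. \<bar>v $ a\<bar> \<le> q"
  shows "norm v \<le> 3 * q"
  using norm_le_l1_cart[of v] assms[of 1] assms[of 2] assms[of 3] by (simp add: sum_3)

theorem torus_rational:
  assumes I: "is_interval I" "0 \<in> I" and hw: "half_wave_maps_torus I S"
    and init: "\<And>i. rational_in_exp_ix (\<lambda>x. S 0 x $ i)" and \<tau>: "\<tau> \<in> I"
  shows "rational_in_exp_ix (\<lambda>x. S \<tau> x $ i)"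
proof -
  obtain D where D: "D 0 0 = S" "\<And>j k. continuous_on (I \<times> UNIV) (\<lambda>(t, x). D j k t x)"
    "\<And>j k t x. t \<in> I \<Longrightarrow> ((\<lambda>s. D j k s x) has_vector_derivative D (Suc j) k t x) (at t within I)"
    "\<And>j k t x. t \<in> I \<Longrightarrow> (D j k t has_vector_derivative D j (Suc k) t x) (at x)"
    using hw unfolding half_wave_maps_torus_def smooth_tx_def by blast
  interpret smooth_flow I S D abs_nabla_torus \<tau>
    using I \<tau> D hw unfolding half_wave_maps_torus_def by unfold_locales auto
  define G where "G r a j x = D 0 j (path r) x $ a" for r a j x
  have per: "D 0 j t (x + 2 * pi) = D 0 j t x" if t: "t \<in> I" for j t x
  proof (induction j arbitrary: x)
    case 0
    then show ?case using hw t D(1) unfolding half_wave_maps_torus_def by simp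
  next
    case (Suc j)
    have "((\<lambda>x. x + 2 * pi) has_vector_derivative 1) (at x)"
      by (auto intro!: derivative_eq_intros simp: has_real_derivative_iff_has_vector_derivative[symmetric])
    then have "((\<lambda>x. D 0 j t (x + 2 * pi)) has_vector_derivative 1 *\<^sub>R D 0 (Suc j) t (x + 2 * pi)) (at x)"
      using vector_diff_chain_at[of "\<lambda>x. x + 2 * pi" 1 x "D 0 j t" "D 0 (Suc j) t (x + 2 * pi)"] D_x[OF t, of 0 j "x + 2 * pi"]
      by (simp add: o_def)
    moreover have "(\<lambda>x. D 0 j t (x + 2 * pi)) = D 0 j t" using Suc by auto
    ultimately show ?case using D_x[OF t, of 0 j x] vector_derivative_unique_at by fastforce
  qed
  have sp: "smooth_periodic (G r a)" for r a
    unfolding G_def using D_component_deriv[OF path_I] per[OF path_I] by unfold_locales auto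
  note cs = smooth_periodic.coeff_summable[OF sp]
  define c where "c r a n = fourier_coeff (G r a 0) (int n)" for r a n
  have c_sum: "summable (\<lambda>n. norm (c r a n) * (real n)\<^sup>2)" for r a
    unfolding c_def by (rule cs)
  obtain B where B: "\<And>r a x. r \<in> {0..1} \<Longrightarrow> \<bar>G r a 4 x\<bar> \<le> B"
  proof -
    have "compact ((\<lambda>z. D 0 4 (path (fst z)) (snd z)) ` ({0..1} \<times> {- pi..pi}))"
      by (intro compact_continuous_image continuous_on_subset[OF D_path_cont] compact_Times) auto
    then obtain B where B: "\<And>r x. r \<in> {0..1} \<Longrightarrow> x \<in> {- pi..pi} \<Longrightarrow> norm (D 0 4 (path r) x) \<le> B"
      unfolding bounded_iff[symmetric] using compact_imp_bounded by (fastforce simp: bounded_iff)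
    have "\<bar>G r a 4 x\<bar> \<le> B" if r: "r \<in> {0..1}" for r a x
    proof -
      interpret smooth_periodic "G r a" by (rule sp)
      obtain k where k: "\<bar>x + 2 * pi * of_int k - 0\<bar> \<le> pi" by (rule reduce)
      then have "norm (D 0 4 (path r) (x + 2 * pi * of_int k)) \<le> B" using r by (intro B) auto
      then have "\<bar>G r a 4 (x + 2 * pi * of_int k)\<bar> \<le> B"
        unfolding G_def using component_le_norm_cart order.trans by blast
      then show ?thesis by (simp add: periodic_int)
    qed
    then show ?thesis by (rule that)
  qed
  \<comment> \<open>One bound for all components, points and times in [0, 1]: the fourth derivatives
    are bounded on the compact time path, so the coefficients decay like n^(-4) uniformly.\<close>
  define Q where "Q = 2 * B * (\<Sum>n. inverse (real n ^ 2))"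
  have cQ: "(\<Sum>n. 2 * (norm (c r a n) * (real n)\<^sup>2)) \<le> Q" if "r \<in> {0..1}" for r a
    unfolding Q_def c_def by (rule smooth_periodic.coeff_sum_le[OF sp B[OF that]])
  define T where "T r x = abs_nabla_torus (S (path r)) x" for r x
  have G0: "G r a 0 = (\<lambda>x. S (path r) x $ a)" for r a by (auto simp: G_def D0)
  have Ta: "T r x $ a = smooth_periodic.hT (G r a) x" for r x a
    unfolding T_def abs_nabla_torus_def using smooth_periodic.hT_eq[OF sp, of r a x] by (simp add: G0)
  \<comment> \<open>The series need not vanish on the zeros of \<phi>, but \<open>d_sum\<close> with
    inverse 0 = 0 asks for zero there; the change affects a null set of x for each y.\<close>
  define d where "d r x y = (\<chi> a. if antiperiodic (x - y) = 0 then 0 else dser (c r a) x y)" for r x y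
  define \<kappa>' where "\<kappa>' r x y = inverse (antiperiodic (x - y)) *\<^sub>R (S (path r) x - S (path r) y)" for r x y
  have \<kappa>a: "\<kappa>' r x y $ a = (if antiperiodic (x - y) = 0 then 0 else kser (c r a) x y)" for r x y a
  proof (cases "antiperiodic (x - y) = 0")
    case False
    have "antiperiodic (x - y) * kser (c r a) x y = S (path r) x $ a - S (path r) y $ a"
      using smooth_periodic.kser_cf[OF sp, of x y r a] unfolding c_def[abs_def] by (simp add: G0)
    then show ?thesis using False by (simp add: \<kappa>'_def field_simps)
  qed (simp add: \<kappa>'_def)
  have Q0: "Q \<ge> 0" using cQ[of 0 1] kser_le[OF c_sum, of 0 1 0 0] by (auto intro: order.trans)
  have bk: "norm (\<kappa>' r x y) \<le> 3 * Q" and bd: "norm (d r x y) \<le> 3 * Q" and bT: "norm (T r x) \<le> 3 * Q"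
    if r: "r \<in> {0..1}" for r x y
  proof -
    show "norm (\<kappa>' r x y) \<le> 3 * Q"
      by (rule norm_le_3) (use \<kappa>a Q0 order.trans[OF kser_le[OF c_sum] cQ[OF r]] in auto)
    show "norm (d r x y) \<le> 3 * Q"
      by (rule norm_le_3) (use Q0 order.trans[OF dser_le[OF c_sum] cQ[OF r]] in \<open>auto simp: d_def\<close>)
    show "norm (T r x) \<le> 3 * Q"
    proof (rule norm_le_3)
      fix a
      show "\<bar>T r x $ a\<bar> \<le> Q"
        using order.trans[OF smooth_periodic.hT_abs_le[OF sp, of r a x] cQ[OF r, of a, unfolded c_def]] by (simp add: Ta)
    qed
  qed
  have anti_m: "antiperiodic \<in> borel_measurable borel"
    unfolding antiperiodic_def by (auto intro!: borel_measurable_continuous_onI continuous_intros)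
  have Sm: "S (path r) \<in> borel_measurable borel" for r
  proof -
    have "(\<lambda>x. D 0 0 (path r) x) \<in> borel_measurable borel"
      using measurable_compose[OF _ D_path_meas[of 0 0], of "\<lambda>x. (r, x)" borel] by simp
    then show ?thesis by (simp add: D0)
  qed
  have Tm: "T r \<in> borel_measurable borel" for r
    by (rule borel_measurable_vecI) (simp add: Ta smooth_periodic.hT_meas[OF sp])
  have dm: "(\<lambda>z. d r (fst z) (snd z)) \<in> borel_measurable (borel \<Otimes>\<^sub>M borel)" for r
  proof (rule borel_measurable_vecI)
    fix a
    have [measurable]: "(\<lambda>z. dser (c r a) (fst z) (snd z)) \<in> borel_measurable (borel \<Otimes>\<^sub>M borel)"
      using dser_meas2[OF c_sum] by (simp add: borel_prod)
    note [measurable] = anti_m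
    show "(\<lambda>z. d r (fst z) (snd z) $ a) \<in> borel_measurable (borel \<Otimes>\<^sub>M borel)"
      unfolding d_def vec_lambda_beta by measurable
  qed
  have dm1: "(\<lambda>x. d r x y) \<in> borel_measurable borel" for r y
    using measurable_compose[OF _ dm[of r], of "\<lambda>x. (x, y)" borel] by simp
  have km1: "(\<lambda>x. \<kappa>' r x y) \<in> borel_measurable borel" for r y
    unfolding \<kappa>'_def using anti_m Sm[of r] by measurable
  \<comment> \<open>|d| \<le> 3 Q yields 9 Q^2, |T| |\<kappa>| \<le> 9 Q^2 yields 81 Q^4 after
    squaring, and (2 pi)^2 is the total mass of pairs of points.\<close>
  let ?C = "(81 * Q ^ 4 + 9 * Q\<^sup>2) * (2 * pi * (2 * pi))"
  have sqb: "(norm v)\<^sup>2 \<le> 9 * Q\<^sup>2" if "norm v \<le> 3 * Q" for v :: "real ^ 3"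
    using power_mono[OF that, of 2] by (simp add: power_mult_distrib)
  interpret hwl: half_wave_lax circle antiperiodic "\<lambda>r. S (path r)" "\<lambda>r x. \<tau> *\<^sub>R D 1 0 (path r) x" T d \<tau> ?C
  proof (rule half_wave_lax.intro)
    show "sigma_finite_measure circle" using finite_measure_circle by (simp add: finite_measure_def)
    show "sets circle = sets borel" by (rule sets_circle)
    show "antiperiodic (- u) = - antiperiodic u" for u by (simp add: antiperiodic_def)
    show "antiperiodic \<in> borel_measurable borel" by (rule anti_m)
    show "(\<lambda>(r, x). S (path r) x) \<in> borel_measurable (borel \<Otimes>\<^sub>M borel)" using D_path_meas[of 0 0] by (simp add: D0)
    show "(\<lambda>(r, x). \<tau> *\<^sub>R D 1 0 (path r) x) \<in> borel_measurable (borel \<Otimes>\<^sub>M borel)"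
      using D_path_meas[of 1 0] by (simp add: case_prod_unfold)
    show "continuous_on {0..1} (\<lambda>r. \<tau> *\<^sub>R D 1 0 (path r) x)" for x by (intro continuous_intros path_section_cont)
  next
    fix r :: real assume r: "r \<in> {0..1}"
    show "norm (S (path r) x) = 1" for x by (rule unit)
    show "((\<lambda>r. S (path r) x) has_vector_derivative \<tau> *\<^sub>R D 1 0 (path r) x) (at r within {0..1})" for x
      using path_deriv[OF r, of 0 0 x] by (simp add: D0)
    show "\<tau> *\<^sub>R D 1 0 (path r) x = \<tau> *\<^sub>R cross3 (S (path r) x) (T r x)" for x
      unfolding T_def by (rule D_t_eq)
    show "d r x y + d r y x = inverse (antiperiodic (x - y)) *\<^sub>R (T r x - T r y)" for x y
    proof -
      have sw: "antiperiodic (y - x) = 0 \<longleftrightarrow> antiperiodic (x - y) = 0"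
        unfolding cis_eq_iff_antiperiodic by auto
      have h: "T r x $ a - T r y $ a = antiperiodic (x - y) * (dser (c r a) x y + dser (c r a) y x)" for a
        using smooth_periodic.dser_cf[OF sp, of x y r a] unfolding c_def[abs_def] Ta by simp
      have "(d r x y + d r y x) $ a = (inverse (antiperiodic (x - y)) *\<^sub>R (T r x - T r y)) $ a" for a
        by (cases "antiperiodic (x - y) = 0") (simp_all add: d_def sw h)
      then show ?thesis by (simp add: vec_eq_iff)
    qed
    show "T r \<in> borel_measurable borel" by (rule Tm)
    show "(\<lambda>z. d r (fst z) (snd z)) \<in> borel_measurable (borel \<Otimes>\<^sub>M borel)" by (rule dm)
    have le: "9 * Q\<^sup>2 \<le> 81 * Q ^ 4 + 9 * Q\<^sup>2" "81 * Q ^ 4 \<le> 81 * Q ^ 4 + 9 * Q\<^sup>2" "0 \<le> 81 * Q ^ 4 + 9 * Q\<^sup>2" by auto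
    show "(\<integral>\<^sup>+z. ennreal ((norm (d r (fst z) (snd z)))\<^sup>2) \<partial>(circle \<Otimes>\<^sub>M circle)) \<le> ennreal ?C"
      by (rule nn_integral_circle2_le[OF order.trans[OF sqb[OF bd[OF r]] le(1)] le(3)])
    have Tk: "norm (T r x) * norm (\<kappa>' r x y) \<le> 9 * Q\<^sup>2" for x y
      using mult_mono[OF bT[OF r, of x] bk[OF r, of x y]] Q0 by (simp add: power2_eq_square)
    have Tk2: "(norm (T r x) * norm (\<kappa>' r x y))\<^sup>2 \<le> 81 * Q ^ 4" for x y
      using power_mono[OF Tk[of x y], of 2] by (simp add: power_mult_distrib)
    show "(\<integral>\<^sup>+z. ennreal ((norm (T r (fst z)) * norm (inverse (antiperiodic (fst z - snd z)) *\<^sub>R (S (path r) (fst z) - S (path r) (snd z))))\<^sup>2) \<partial>(circle \<Otimes>\<^sub>M circle)) \<le> ennreal ?C"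
      unfolding \<kappa>'_def[symmetric] by (rule nn_integral_circle2_le[OF order.trans[OF Tk2 le(2)] le(3)])
    show "sq_integrable circle (\<lambda>x. norm (inverse (antiperiodic (x - y)) *\<^sub>R (S (path r) x - S (path r) y)))" for y
      unfolding \<kappa>'_def[symmetric]
    proof (rule sq_integrable_circle_bounded[where b="3 * Q"])
      show "(\<lambda>x. norm (\<kappa>' r x y)) \<in> borel_measurable borel" using km1[of r y] by measurable
      show "\<bar>norm (\<kappa>' r x y)\<bar> \<le> 3 * Q" for x using bk[OF r, of x y] by simp
    qed
    show "sq_integrable circle (\<lambda>x. norm (d r x y))" for y
    proof (rule sq_integrable_circle_bounded[where b="3 * Q"])
      show "(\<lambda>x. norm (d r x y)) \<in> borel_measurable borel" using dm1[of r y] by measurable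
      show "\<bar>norm (d r x y)\<bar> \<le> 3 * Q" for x using bd[OF r, of x y] by simp
    qed
    show "sq_integrable circle (\<lambda>x. norm (T r x) * norm (inverse (antiperiodic (x - y)) *\<^sub>R (S (path r) x - S (path r) y)))" for y
      unfolding \<kappa>'_def[symmetric]
    proof (rule sq_integrable_circle_bounded[where b="9 * Q\<^sup>2"])
      show "(\<lambda>x. norm (T r x) * norm (\<kappa>' r x y)) \<in> borel_measurable borel"
        using Tm[of r] km1[of r y] by measurable
      show "\<bar>norm (T r x) * norm (\<kappa>' r x y)\<bar> \<le> 9 * Q\<^sup>2" for x using Tk[of x y] by simp
    qed
    show "(LINT x|circle. (inverse (antiperiodic (x - z)) *\<^sub>R (S (path r) x - S (path r) z)) $ a * d r x y $ b) =
        (LINT x|circle. d r x z $ a * (inverse (antiperiodic (x - y)) *\<^sub>R (S (path r) x - S (path r) y)) $ b)" for y z a b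
    proof -
      have dmc: "(\<lambda>x. d r x y $ a) \<in> borel_measurable borel" and kmc: "(\<lambda>x. \<kappa>' r x y $ a) \<in> borel_measurable borel" for y a
        using borel_measurable_component[OF dm1] borel_measurable_component[OF km1] by auto
      note ms = dmc kmc kser_meas[OF c_sum] dser_meas[OF c_sum]
      have "(LINT x|circle. \<kappa>' r x z $ a * d r x y $ b) = (LINT x|circle. kser (c r a) x z * dser (c r b) x y)"
      proof (rule integral_cong_AE)
        show "AE x in circle. \<kappa>' r x z $ a * d r x y $ b = kser (c r a) x z * dser (c r b) x y"
          using AE_circle_antiperiodic[of z] AE_circle_antiperiodic[of y]
          by eventually_elim (simp add: \<kappa>a d_def)
      qed (intro measurable_circle borel_measurable_times ms)+
      also have "\<dots> = (LINT x|circle. dser (c r a) x z * kser (c r b) x y)"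
        by (rule integral_circle_series[OF c_sum c_sum])
      also have "\<dots> = (LINT x|circle. d r x z $ a * \<kappa>' r x y $ b)"
      proof (rule integral_cong_AE)
        show "AE x in circle. dser (c r a) x z * kser (c r b) x y = d r x z $ a * \<kappa>' r x y $ b"
          using AE_circle_antiperiodic[of z] AE_circle_antiperiodic[of y]
          by eventually_elim (simp add: \<kappa>a d_def)
      qed (intro measurable_circle borel_measurable_times ms)+
      finally show ?thesis unfolding \<kappa>'_def .
    qed
  next
    have "(\<integral>\<^sup>+z. ennreal ((norm (\<kappa>' 0 (fst z) (snd z)))\<^sup>2) \<partial>(circle \<Otimes>\<^sub>M circle)) \<le> ennreal (9 * Q\<^sup>2 * (2 * pi * (2 * pi)))"
      by (rule nn_integral_circle2_le[OF sqb[OF bk]]) auto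
    also have "\<dots> < \<infinity>" by simp
    finally show "(\<integral>\<^sup>+z. ennreal ((norm (inverse (antiperiodic (fst z - snd z)) *\<^sub>R (S (path 0) (fst z) - S (path 0) (snd z))))\<^sup>2) \<partial>(circle \<Otimes>\<^sub>M circle)) < \<infinity>"
      unfolding \<kappa>'_def .
  qed
  have ecis: "exp (\<i> * of_real x) = cis x" for x by (simp add: cis_conv_exp)
  have "\<exists>p q. \<forall>x. poly q (cis x) \<noteq> 0 \<and> complex_of_real (S (path 1) x $ i) = poly p (cis x) / poly q (cis x)"
  \<comment> \<open>Each point of the open period has only charged neighbourhoods, and its closure
    contains a representative of every real number modulo 2 pi.\<close>
  proof (rule hwl.rational_propagates[OF kernel_param_circle, where X="{0<..<2 * pi}"])
    show "\<exists>p q. \<forall>x. poly q (cis x) \<noteq> 0 \<and> complex_of_real (S (path 0) x $ k) = poly p (cis x) / poly q (cis x)" for k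
      using init[of k] unfolding rational_in_exp_ix_def ecis path_01 .
    show "AE x in circle. antiperiodic (x - y) \<noteq> 0" for y by (rule AE_circle_antiperiodic)
    show "open {0<..<2 * pi}" by simp
    show "{0<..<2 * pi} \<noteq> {}" using pi_gt_zero by (simp del: pi_gt_zero)
    show "emeasure circle U \<noteq> 0" if U: "open U" "x \<in> U" "x \<in> {0<..<2 * pi}" for U x
    proof -
      have "open (U \<inter> {0<..<2 * pi})" using U by auto
      then have "emeasure lborel (U \<inter> {0<..<2 * pi}) \<noteq> 0"
        using U by (intro emeasure_lborel_open_nonzero[of _ x]) auto
      moreover have "emeasure lborel (U \<inter> {0<..<2 * pi}) \<le> emeasure circle U"
        using U(1) by (subst emeasure_circle) (auto intro!: emeasure_mono)
      ultimately show ?thesis by auto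
    qed
    show "isCont (S (path 1)) x" for x
      using has_vector_derivative_continuous[OF D_x[OF path_I, of 0 0 1 x]] by (simp add: D0)
    show "\<exists>x'\<in>closure {0<..<2 * pi}. cis x' = cis x \<and> S (path 1) x' = S (path 1) x" for x
    proof -
      interpret s1: smooth_periodic "G 1 1" by (rule sp)
      obtain k where k: "\<bar>x + 2 * pi * of_int k - pi\<bar> \<le> pi" by (rule s1.reduce)
      have "cis (x + 2 * pi * of_int k) = cis x"
        using cis_2pi_int[of k x] by (simp add: algebra_simps)
      moreover have "S (path 1) (x + 2 * pi * of_int k) = S (path 1) x"
        using smooth_periodic.periodic_int[OF sp, of 1 _ 0 x k] by (simp add: vec_eq_iff G0)
      moreover have "x + 2 * pi * of_int k \<in> closure {0<..<2 * pi}" using k by auto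
      ultimately show ?thesis by blast
    qed
  qed
  then show ?thesis unfolding rational_in_exp_ix_def ecis path_01 .
qed

section \<open>The Hilbert transform on the line\<close>

lemma real_sq_sum_le: "(a + b)\<^sup>2 \<le> 2 * a\<^sup>2 + 2 * (b :: real)\<^sup>2"
  using zero_le_power2[of "a - b"] by (simp add: power2_eq_square algebra_simps)

lemma real_sq_diff_le: "(a - b)\<^sup>2 \<le> 2 * a\<^sup>2 + 2 * (b :: real)\<^sup>2"
  using zero_le_power2[of "a + b"] by (simp add: power2_eq_square algebra_simps)

lemma nn_integral_translate:
  fixes f :: "real \<Rightarrow> ennreal"
  assumes "f \<in> borel_measurable borel"
  shows "(\<integral>\<^sup>+x. f (x + a) \<partial>lborel) = (\<integral>\<^sup>+x. f x \<partial>lborel)"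
  using nn_integral_real_affine[OF assms, of 1 a] by (simp add: add.commute)

lemma nn_integral_reflect:
  fixes f :: "real \<Rightarrow> ennreal"
  assumes "f \<in> borel_measurable borel"
  shows "(\<integral>\<^sup>+x. f (a - x) \<partial>lborel) = (\<integral>\<^sup>+x. f x \<partial>lborel)"
  using nn_integral_real_affine[OF assms, of "-1" a] by simp

text \<open>With f integrable, dominated convergence identifies the integral as the limit over
  symmetric intervals, so only the symmetric increments of F need a limit.\<close>

lemma integral_FTC_symmetric_limit:
  fixes f F :: "real \<Rightarrow> real"
  assumes "\<And>x. (F has_real_derivative f x) (at x)" "continuous_on UNIV f" "integrable lborel f"
    and lim: "(\<lambda>n. F (real n) - F (- real n)) \<longlonglongrightarrow> L"
  shows "(LINT x|lborel. f x) = L"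
proof -
  have "(\<lambda>n. LINT x|lborel. indicator {- real n..real n} x *\<^sub>R f x) \<longlonglongrightarrow> (LINT x|lborel. f x)"
  proof (rule integral_dominated_convergence[where w="\<lambda>x. \<bar>f x\<bar>"])
    show "AE x in lborel. (\<lambda>n. indicator {- real n..real n} x *\<^sub>R f x) \<longlonglongrightarrow> f x"
    proof (rule AE_I2)
      fix x
      obtain N where "\<bar>x\<bar> \<le> real N" using real_arch_simple by blast
      then have "eventually (\<lambda>n. indicator {- real n..real n} x *\<^sub>R f x = f x) sequentially"
        by (intro eventually_sequentiallyI[of N]) (auto simp: indicator_def)
      then show "(\<lambda>n. indicator {- real n..real n} x *\<^sub>R f x) \<longlonglongrightarrow> f x" by (rule tendsto_eventually)
    qed
    show "AE x in lborel. norm (indicator {- real n..real n} x *\<^sub>R f x) \<le> \<bar>f x\<bar>" for n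
      by (auto simp: indicator_def)
  qed (use assms(3) in auto)
  moreover have "(LINT x|lborel. indicator {- real n..real n} x *\<^sub>R f x) = F (real n) - F (- real n)" for n
    by (rule integral_FTC_Icc)
      (auto intro!: continuous_on_subset[OF assms(2)] has_field_derivative_at_within[OF assms(1)]
        simp: has_real_derivative_iff_has_vector_derivative[symmetric])
  ultimately show ?thesis using lim LIMSEQ_unique by force
qed

text \<open>The Poisson kernel and its conjugate: \<open>1/u = qk u + pk u / u\<close> splits the Hilbert kernel into
  an \<open>L\<^sup>2\<close> kernel and a remainder that only sees differences of the function.\<close>

definition pk :: "real \<Rightarrow> real" where "pk u = inverse (1 + u\<^sup>2)"
definition qk :: "real \<Rightarrow> real" where "qk u = u * inverse (1 + u\<^sup>2)"

lemma one_plus_sq_pos: "0 < 1 + (u::real)\<^sup>2"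
  by (simp add: add_pos_nonneg)

lemma pk_pos: "0 < pk u" and pk_le1: "pk u \<le> 1"
  using one_plus_sq_pos[of u] by (simp_all add: pk_def field_simps)

lemma pk_cont: "continuous_on A pk" and qk_cont: "continuous_on A qk"
  using one_plus_sq_pos unfolding pk_def qk_def by (auto intro!: continuous_intros simp: less_imp_neq[symmetric])

lemma pk_meas[measurable]: "pk \<in> borel_measurable borel" and qk_meas[measurable]: "qk \<in> borel_measurable borel"
  by (intro borel_measurable_continuous_onI pk_cont qk_cont)+

lemma qk_sq_le: "(qk u)\<^sup>2 \<le> pk u"
proof -
  have "(qk u)\<^sup>2 = (u\<^sup>2 * pk u) * pk u" by (simp add: qk_def pk_def power2_eq_square)
  also have "u\<^sup>2 * pk u \<le> 1" using one_plus_sq_pos[of u] by (simp add: pk_def field_simps)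
  finally show ?thesis using pk_pos[of u] by (simp add: mult_right_mono)
qed

lemma pk_sq_le: "(pk u)\<^sup>2 \<le> pk u"
  using mult_left_mono[OF pk_le1[of u], of "pk u"] pk_pos[of u] by (simp add: power2_eq_square)

lemma nn_integral_pk_half: "(\<integral>\<^sup>+u. ennreal (pk u) * indicator {0..} u \<partial>lborel) = ennreal (pi / 2)"
proof -
  have "(\<integral>\<^sup>+u. ennreal (pk u) * indicator {0..} u \<partial>lborel) = ennreal (pi / 2 - arctan 0)"
  proof (rule nn_integral_FTC_atLeast)
    show "DERIV arctan x :> pk x" for x unfolding pk_def by (rule DERIV_arctan)
    show "0 \<le> pk x" for x using pk_pos[of x] by simp
    show "(arctan \<longlongrightarrow> pi / 2) at_top" by (rule tendsto_arctan_at_top)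
  qed measurable
  then show ?thesis by simp
qed

lemma nn_integral_pk: "(\<integral>\<^sup>+u. ennreal (pk u) \<partial>lborel) = ennreal pi"
proof -
  have 1: "(\<integral>\<^sup>+u. ennreal (pk u) * indicator {..0} u \<partial>lborel) = ennreal (pi / 2)"
    using nn_integral_reflect[of "\<lambda>u. ennreal (pk u) * indicator {0..} u" 0] nn_integral_pk_half
    by (simp add: pk_def indicator_def)
  have "(\<integral>\<^sup>+u. ennreal (pk u) \<partial>lborel) = (\<integral>\<^sup>+u. ennreal (pk u) * indicator {0..} u + ennreal (pk u) * indicator {..0} u \<partial>lborel)"
    using AE_lborel_singleton[of "0::real"] by (intro nn_integral_cong_AE) (auto elim!: eventually_mono simp: indicator_def)
  also have "\<dots> = ennreal (pi / 2) + ennreal (pi / 2)"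
    by (subst nn_integral_add) (simp_all add: 1 nn_integral_pk_half)
  also have "\<dots> = ennreal pi" by (subst ennreal_plus[symmetric]) simp_all
  finally show ?thesis .
qed

lemma pk_integrable: "integrable lborel pk"
  using nn_integral_pk pk_pos by (simp add: integrable_iff_bounded less_imp_le)

lemma inverse_sq_le_pk: "1 \<le> \<bar>u\<bar> \<Longrightarrow> inverse (u\<^sup>2) \<le> 2 * pk u"
proof -
  assume "1 \<le> \<bar>u\<bar>"
  then have "1 \<le> u\<^sup>2" by (simp add: abs_le_square_iff[of 1 u, simplified])
  then have "inverse (2 * u\<^sup>2) \<le> inverse (1 + u\<^sup>2)"
    using one_plus_sq_pos[of u] by (intro le_imp_inverse_le) auto
  then show ?thesis unfolding pk_def by simp
qed

lemma one_le_pk: "\<bar>u\<bar> \<le> 1 \<Longrightarrow> 1 \<le> 2 * pk u"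
proof -
  assume "\<bar>u\<bar> \<le> 1"
  then have "u\<^sup>2 \<le> 1" by (simp add: abs_le_square_iff[of u 1, simplified])
  then show ?thesis using one_plus_sq_pos[of u] unfolding pk_def by (simp add: field_simps)
qed

section \<open>L2 norms in \<open>ennreal\<close>, translations, and the two Poisson kernels\<close>

definition nn2 :: "(real \<Rightarrow> real) \<Rightarrow> ennreal" where
  "nn2 f = (\<integral>\<^sup>+x. ennreal ((f x)\<^sup>2) \<partial>lborel)"

lemma nn2_translate: "f \<in> borel_measurable borel \<Longrightarrow> nn2 (\<lambda>x. f (x + a)) = nn2 f"
  unfolding nn2_def using nn_integral_translate[of "\<lambda>x. ennreal ((f x)\<^sup>2)" a] by simp

lemma nn2_add_le:
  assumes [measurable]: "f \<in> borel_measurable borel" "g \<in> borel_measurable borel"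
  shows "nn2 (\<lambda>x. f x + g x) \<le> 2 * nn2 f + 2 * nn2 g"
proof -
  have "nn2 (\<lambda>x. f x + g x) \<le> (\<integral>\<^sup>+x. 2 * ennreal ((f x)\<^sup>2) + 2 * ennreal ((g x)\<^sup>2) \<partial>lborel)"
    unfolding nn2_def
  proof (rule nn_integral_mono)
    fix x
    show "ennreal ((f x + g x)\<^sup>2) \<le> 2 * ennreal ((f x)\<^sup>2) + 2 * ennreal ((g x)\<^sup>2)"
      using ennreal_leI[OF real_sq_sum_le[of "f x" "g x"]] by (simp add: ennreal_mult)
  qed
  also have "\<dots> = 2 * nn2 f + 2 * nn2 g"
    unfolding nn2_def by (simp add: nn_integral_add nn_integral_cmult)
  finally show ?thesis .
qed

lemma nn2_uminus: "nn2 (\<lambda>x. - f x) = nn2 f"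
  by (simp add: nn2_def)

lemma nn2_diff_le:
  assumes "f \<in> borel_measurable borel" "g \<in> borel_measurable borel"
  shows "nn2 (\<lambda>x. f x - g x) \<le> 2 * nn2 f + 2 * nn2 g"
  using nn2_add_le[of f "\<lambda>x. - g x"] assms by (simp add: nn2_uminus)

text \<open>The increment is an integral of g' over the segment between the two shifts, and each
  shift of g' has the same L2 norm. The factor 2 is inherited from
  \<open>sq_le_integral_sq_deriv\<close>.\<close>

lemma nn2_translate_diff:
  assumes d: "\<And>x. (g has_real_derivative g' x) (at x)" and c: "continuous_on UNIV g'"
  shows "nn2 (\<lambda>x. g (x + a) - g (x + b)) \<le> ennreal (2 * (a - b)\<^sup>2) * nn2 g'"
proof -
  have [measurable]: "g' \<in> borel_measurable borel" by (rule borel_measurable_continuous_onI[OF c])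
  let ?G = "\<lambda>x s. ennreal (((a - b) * g' (x + b + s * (a - b)))\<^sup>2) * indicator {0..1} s"
  have "nn2 (\<lambda>x. g (x + a) - g (x + b)) \<le> (\<integral>\<^sup>+x. 2 * (\<integral>\<^sup>+s. ?G x s \<partial>lborel) \<partial>lborel)"
    unfolding nn2_def
  proof (rule nn_integral_mono)
    fix x
    let ?f = "\<lambda>s. g (x + b + s * (a - b)) - g (x + b)"
    have "ennreal ((?f 1)\<^sup>2) \<le> 2 * ennreal ((?f 0)\<^sup>2) + 2 * (\<integral>\<^sup>+s. ennreal (((a - b) * g' (x + b + s * (a - b)))\<^sup>2) * indicator {0..1} s \<partial>lborel)"
    proof (rule sq_le_integral_sq_deriv)
      show "(?f has_real_derivative (a - b) * g' (x + b + s * (a - b))) (at s within {0..1})" for s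
      proof -
        have "((\<lambda>s. x + b + s * (a - b)) has_real_derivative (a - b)) (at s within {0..1})"
          by (auto intro!: derivative_eq_intros)
        from DERIV_diff[OF DERIV_chain2[OF d this] DERIV_const[of "g (x + b)"]] show ?thesis
          by (simp add: mult.commute)
      qed
      show "continuous_on {0..1} (\<lambda>s. (a - b) * g' (x + b + s * (a - b)))"
        by (intro continuous_intros continuous_on_compose2[OF c]) auto
    qed simp
    then show "ennreal ((g (x + a) - g (x + b))\<^sup>2) \<le> 2 * (\<integral>\<^sup>+s. ?G x s \<partial>lborel)" by (simp add: algebra_simps)
  qed
  also have "\<dots> = 2 * (\<integral>\<^sup>+x. \<integral>\<^sup>+s. ?G x s \<partial>lborel \<partial>lborel)"
    by (intro nn_integral_cmult) measurable
  also have "(\<integral>\<^sup>+x. \<integral>\<^sup>+s. ?G x s \<partial>lborel \<partial>lborel) = (\<integral>\<^sup>+s. \<integral>\<^sup>+x. ?G x s \<partial>lborel \<partial>lborel)"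
    by (rule lborel_pair.Fubini'[symmetric]) measurable
  also have "\<dots> = (\<integral>\<^sup>+s. ennreal ((a - b)\<^sup>2) * nn2 g' * indicator {0..1} (s::real) \<partial>lborel)"
  proof (rule nn_integral_cong)
    fix s :: real
    have "(\<integral>\<^sup>+x. ?G x s \<partial>lborel) = (\<integral>\<^sup>+x. ennreal ((a - b)\<^sup>2) * ennreal ((g' (x + (b + s * (a - b))))\<^sup>2) * indicator {0..1} s \<partial>lborel)"
      by (simp add: power_mult_distrib ennreal_mult add.assoc)
    also have "\<dots> = ennreal ((a - b)\<^sup>2) * (\<integral>\<^sup>+x. ennreal ((g' (x + (b + s * (a - b))))\<^sup>2) \<partial>lborel) * indicator {0..1} s"
      by (subst nn_integral_multc, measurable, subst nn_integral_cmult, measurable)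
    also have "(\<integral>\<^sup>+x. ennreal ((g' (x + (b + s * (a - b))))\<^sup>2) \<partial>lborel) = nn2 g'"
      using nn2_translate[of g' "b + s * (a - b)"] by (simp add: nn2_def)
    finally show "(\<integral>\<^sup>+x. ?G x s \<partial>lborel) = ennreal ((a - b)\<^sup>2) * nn2 g' * indicator {0..1} s" .
  qed
  also have "\<dots> = ennreal ((a - b)\<^sup>2) * nn2 g'" by (simp add: nn_integral_cmult_indicator)
  finally show ?thesis by (simp add: ennreal_mult mult.assoc)
qed

text \<open>With a = x - y and b = x - z, the numerator of the difference is a (1 + b^2) - b (1 +
  a^2) = (b - a) (a b - 1).\<close>

lemma qk_diff: "qk (x - y) - qk (x - z) = (y - z) * (qk (x - y) * qk (x - z) - pk (x - y) * pk (x - z))"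
proof -
  have "qk a - qk b = (b - a) * (qk a * qk b - pk a * pk b)" for a b
  proof -
    define P Q where "P = inverse (1 + a\<^sup>2)" and "Q = inverse (1 + b\<^sup>2)"
    have "P * (1 + a\<^sup>2) = 1" "Q * (1 + b\<^sup>2) = 1"
      using one_plus_sq_pos[of a] one_plus_sq_pos[of b] by (simp_all add: P_def Q_def less_imp_neq[symmetric])
    then have "a * P - b * Q = a * P * (Q * (1 + b\<^sup>2)) - b * Q * (P * (1 + a\<^sup>2))" by simp
    also have "\<dots> = (b - a) * ((a * P) * (b * Q) - P * Q)" by (simp add: algebra_simps power2_eq_square)
    finally show ?thesis by (simp add: qk_def pk_def P_def Q_def)
  qed
  from this[of "x - y" "x - z"] show ?thesis by (simp add: algebra_simps)
qed

lemma product_integrable_shift: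
  assumes [measurable]: "f \<in> borel_measurable borel" and f: "\<And>u. (f u)\<^sup>2 \<le> pk u"
  shows "integrable lborel (\<lambda>x. f (x - y) * f (x - z))"
proof -
  have "sq_integrable lborel (\<lambda>x. f (x - y))" for y
  proof -
    have "integrable lborel (\<lambda>x. (f x)\<^sup>2)"
      by (rule Bochner_Integration.integrable_bound[OF pk_integrable]) (use f pk_pos in \<open>auto simp: less_imp_le\<close>)
    then show ?thesis unfolding sq_integrable_def
      using lborel_integrable_real_affine[of "\<lambda>x. (f x)\<^sup>2" 1 "- y"] by simp
  qed
  then show ?thesis by (intro sq_integrable_mult)
qed

text \<open>The limit of \<open>qk_diff\<close> as the two shifts merge; it settles the diagonal
  case of the autocorrelation.\<close>

lemma qk_deriv: "(qk has_real_derivative (pk u)\<^sup>2 - (qk u)\<^sup>2) (at u)"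
proof -
  have "((\<lambda>u :: real. 1 + u\<^sup>2) has_real_derivative 2 * u) (at u)"
    by (auto intro!: derivative_eq_intros)
  from DERIV_divide[OF DERIV_ident this] one_plus_sq_pos[of u]
  have "((\<lambda>u. u / (1 + u\<^sup>2)) has_real_derivative (1 * (1 + u\<^sup>2) - u * (2 * u)) / ((1 + u\<^sup>2) * (1 + u\<^sup>2))) (at u)"
    by simp
  moreover have "(1 * (1 + u\<^sup>2) - u * (2 * u)) / ((1 + u\<^sup>2) * (1 + u\<^sup>2)) = (pk u)\<^sup>2 - (qk u)\<^sup>2"
  proof -
    have P: "inverse ((1 + u\<^sup>2) * (1 + u\<^sup>2)) = pk u * pk u" by (simp add: pk_def)
    have "(1 * (1 + u\<^sup>2) - u * (2 * u)) * (pk u * pk u) = (pk u)\<^sup>2 - (u * pk u)\<^sup>2"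
      by (simp add: power2_eq_square algebra_simps)
    then show ?thesis unfolding divide_inverse P by (simp add: qk_def pk_def)
  qed
  ultimately show ?thesis by (simp add: qk_def[abs_def] divide_inverse)
qed

lemma ln_shift_deriv: "((\<lambda>x. ln (1 + (x - y)\<^sup>2)) has_real_derivative 2 * qk (x - y)) (at x)"
proof -
  have "((\<lambda>x :: real. 1 + (x - y)\<^sup>2) has_real_derivative 2 * (x - y)) (at x)"
    by (auto intro!: derivative_eq_intros)
  from DERIV_chain2[OF DERIV_ln[OF one_plus_sq_pos[of "x - y"]] this] show ?thesis
    by (rule DERIV_cong) (simp add: qk_def algebra_simps)
qed

text \<open>By partial fractions, \<open>qk\<close> and \<open>pk\<close> have the same autocorrelation, so convolution with either
  has the same \<open>L\<^sup>2\<close> norm; for \<open>pk\<close> it is bounded by the Cauchy-Schwarz inequality.\<close>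

lemma qk_autocorrelation:
  "(LINT x|lborel. qk (x - y) * qk (x - z)) = (LINT x|lborel. pk (x - y) * pk (x - z))"
proof (cases "y = z")
  case True
  have "(LINT x|lborel. (pk (x - y))\<^sup>2 - (qk (x - y))\<^sup>2) = 0"
  proof (rule integral_FTC_symmetric_limit[where F="\<lambda>x. qk (x - y)"])
    show "((\<lambda>x. qk (x - y)) has_real_derivative (pk (x - y))\<^sup>2 - (qk (x - y))\<^sup>2) (at x)" for x
      using DERIV_chain2[OF qk_deriv DERIV_diff[OF DERIV_ident DERIV_const[of y]]] by simp
    show "continuous_on UNIV (\<lambda>x. (pk (x - y))\<^sup>2 - (qk (x - y))\<^sup>2)"
      by (intro continuous_intros continuous_on_compose2[OF pk_cont] continuous_on_compose2[OF qk_cont]) auto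
    show "integrable lborel (\<lambda>x. (pk (x - y))\<^sup>2 - (qk (x - y))\<^sup>2)"
      unfolding power2_eq_square
      by (intro Bochner_Integration.integrable_diff product_integrable_shift pk_sq_le qk_sq_le) measurable
    show "(\<lambda>n. qk (real n - y) - qk (- real n - y)) \<longlonglongrightarrow> 0"
      unfolding qk_def by real_asymp
  qed
  then show ?thesis using True
    by (simp add: power2_eq_square product_integrable_shift[OF pk_meas pk_sq_le] product_integrable_shift[OF qk_meas qk_sq_le])
next
  case False
  \<comment> \<open>Half the logarithm of the quotient of 1 + (x - y)^2 and 1 + (x - z)^2. Each
    logarithm alone diverges, but the quotient tends to 1 at both ends.\<close>
  let ?F = "\<lambda>x. ln ((1 + (x - y)\<^sup>2) / (1 + (x - z)\<^sup>2)) / 2"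
  have "(LINT x|lborel. qk (x - y) - qk (x - z)) = 0"
  proof (rule integral_FTC_symmetric_limit[where F="?F"])
    show "(?F has_real_derivative qk (x - y) - qk (x - z)) (at x)" for x
    proof -
      have "((\<lambda>x. (ln (1 + (x - y)\<^sup>2) - ln (1 + (x - z)\<^sup>2)) / 2) has_real_derivative qk (x - y) - qk (x - z)) (at x)"
        by (rule DERIV_cong[OF DERIV_cdivide[OF DERIV_diff[OF ln_shift_deriv[of y x] ln_shift_deriv[of z x]], of 2]]) simp
      moreover have "(\<lambda>x. (ln (1 + (x - y)\<^sup>2) - ln (1 + (x - z)\<^sup>2)) / 2) = ?F"
        by (simp add: ln_div less_imp_neq[OF one_plus_sq_pos, symmetric] fun_eq_iff)
      ultimately show ?thesis by simp
    qed
    show "continuous_on UNIV (\<lambda>x. qk (x - y) - qk (x - z))"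
      by (intro continuous_intros continuous_on_compose2[OF qk_cont]) auto
    show "integrable lborel (\<lambda>x. qk (x - y) - qk (x - z))"
      unfolding qk_diff
      by (intro integrable_mult_right Bochner_Integration.integrable_diff product_integrable_shift pk_sq_le qk_sq_le) measurable
    show "(\<lambda>n. ?F (real n) - ?F (- real n)) \<longlonglongrightarrow> 0" by real_asymp
  qed
  then have "(y - z) * ((LINT x|lborel. qk (x - y) * qk (x - z)) - (LINT x|lborel. pk (x - y) * pk (x - z))) = 0"
    unfolding qk_diff
    by (simp add: product_integrable_shift[OF pk_meas pk_sq_le] product_integrable_shift[OF qk_meas qk_sq_le])
  then have "(LINT x|lborel. qk (x - y) * qk (x - z)) - (LINT x|lborel. pk (x - y) * pk (x - z)) = 0"
    using False by (simp only: mult_eq_0_iff) simp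
  then show ?thesis by linarith
qed

section \<open>Convolution with the Poisson kernel and its conjugate\<close>

lemma LINT_Cauchy_Schwarz:
  fixes a b :: "'a \<Rightarrow> real"
  assumes [measurable]: "a \<in> borel_measurable M" "b \<in> borel_measurable M"
  shows "ennreal ((LINT y|M. a y * b y)\<^sup>2) \<le> (\<integral>\<^sup>+y. ennreal ((a y)\<^sup>2) \<partial>M) * (\<integral>\<^sup>+y. ennreal ((b y)\<^sup>2) \<partial>M)"
proof (cases "integrable M (\<lambda>y. a y * b y)")
  case True
  have "ennreal \<bar>LINT y|M. a y * b y\<bar> \<le> (\<integral>\<^sup>+y. ennreal \<bar>a y\<bar> * ennreal \<bar>b y\<bar> \<partial>M)"
    using integral_norm_bound_ennreal[OF True] by (simp add: abs_mult ennreal_mult)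
  then have "(ennreal \<bar>LINT y|M. a y * b y\<bar>)\<^sup>2 \<le> (\<integral>\<^sup>+y. ennreal \<bar>a y\<bar> * ennreal \<bar>b y\<bar> \<partial>M)\<^sup>2"
    by (rule power_mono) simp
  also have "\<dots> \<le> (\<integral>\<^sup>+y. (ennreal \<bar>a y\<bar>)\<^sup>2 \<partial>M) * (\<integral>\<^sup>+y. (ennreal \<bar>b y\<bar>)\<^sup>2 \<partial>M)"
    by (rule Cauchy_Schwarz_nn_integral) measurable
  finally show ?thesis by (simp add: ennreal_power)
qed (simp add: not_integrable_integral_eq)

lemma abs_mult_le_sq_sum: "\<bar>a * b\<bar> \<le> a\<^sup>2 + (b :: real)\<^sup>2"
proof -
  have "2 * (\<bar>a\<bar> * \<bar>b\<bar>) \<le> a\<^sup>2 + b\<^sup>2" using sum_squares_bound[of "\<bar>a\<bar>" "\<bar>b\<bar>"] by simp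
  moreover have "0 \<le> \<bar>a\<bar> * \<bar>b\<bar>" by simp
  ultimately show ?thesis unfolding abs_mult by linarith
qed

lemma nn_integral_pk_shift: "(\<integral>\<^sup>+x. ennreal (pk (x - y)) \<partial>lborel) = ennreal pi"
  using nn_integral_translate[of "\<lambda>x. ennreal (pk x)" "- y"] nn_integral_pk by simp

lemma nn_integral_pk_shift': "(\<integral>\<^sup>+y. ennreal (pk (x - y)) \<partial>lborel) = ennreal pi"
  using nn_integral_reflect[of "\<lambda>x. ennreal (pk x)" x] nn_integral_pk by simp

lemma nn_integral_sq_shift_le:
  assumes [measurable]: "k \<in> borel_measurable borel" and "\<And>u. (k u)\<^sup>2 \<le> pk u"
  shows "(\<integral>\<^sup>+x. ennreal ((k (x - y))\<^sup>2) \<partial>lborel) \<le> ennreal pi"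
  unfolding nn_integral_pk_shift[of y, symmetric] using assms(2) by (intro nn_integral_mono ennreal_leI)

lemma convolution_integrable:
  fixes k G A :: "real \<Rightarrow> real"
  assumes [measurable]: "k \<in> borel_measurable borel" and k: "\<And>u. (k u)\<^sup>2 \<le> pk u"
    and G: "integrable lborel G" and A: "sq_integrable lborel A"
  shows "integrable (lborel \<Otimes>\<^sub>M lborel) (\<lambda>(x, y). k (x - y) * G y * A x)"
proof (rule integrableI_bounded)
  have [measurable]: "G \<in> borel_measurable borel" "A \<in> borel_measurable borel"
    using G A by (auto simp: sq_integrable_def)
  show "(\<lambda>(x, y). k (x - y) * G y * A x) \<in> borel_measurable (lborel \<Otimes>\<^sub>M lborel)" by measurable
  have A2: "nn2 A < \<infinity>" using A by (simp add: sq_integrable_iff_nn nn2_def)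
  have "(\<integral>\<^sup>+z. ennreal (norm (case z of (x, y) \<Rightarrow> k (x - y) * G y * A x)) \<partial>(lborel \<Otimes>\<^sub>M lborel))
      = (\<integral>\<^sup>+y. \<integral>\<^sup>+x. ennreal \<bar>k (x - y) * G y * A x\<bar> \<partial>lborel \<partial>lborel)"
    by (subst lborel_pair.nn_integral_snd[symmetric]) simp_all
  also have "\<dots> \<le> (\<integral>\<^sup>+y. ennreal \<bar>G y\<bar> * (ennreal pi + nn2 A) \<partial>lborel)"
  proof (rule nn_integral_mono)
    fix y
    have "(\<integral>\<^sup>+x. ennreal \<bar>k (x - y) * G y * A x\<bar> \<partial>lborel)
        \<le> (\<integral>\<^sup>+x. ennreal \<bar>G y\<bar> * (ennreal ((k (x - y))\<^sup>2) + ennreal ((A x)\<^sup>2)) \<partial>lborel)"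
    proof (rule nn_integral_mono)
      fix x
      have "\<bar>k (x - y) * G y * A x\<bar> = \<bar>G y\<bar> * \<bar>k (x - y) * A x\<bar>" by (simp add: abs_mult)
      also have "\<dots> \<le> \<bar>G y\<bar> * ((k (x - y))\<^sup>2 + (A x)\<^sup>2)"
        by (intro mult_left_mono abs_mult_le_sq_sum) simp
      finally show "ennreal \<bar>k (x - y) * G y * A x\<bar> \<le> ennreal \<bar>G y\<bar> * (ennreal ((k (x - y))\<^sup>2) + ennreal ((A x)\<^sup>2))"
        by (simp add: ennreal_mult[symmetric] ennreal_plus[symmetric] del: ennreal_plus)
    qed
    also have "\<dots> = ennreal \<bar>G y\<bar> * ((\<integral>\<^sup>+x. ennreal ((k (x - y))\<^sup>2) \<partial>lborel) + nn2 A)"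
      unfolding nn2_def by (subst nn_integral_cmult, measurable, subst nn_integral_add) measurable
    also have "\<dots> \<le> ennreal \<bar>G y\<bar> * (ennreal pi + nn2 A)"
      by (intro mult_left_mono add_right_mono nn_integral_sq_shift_le k) auto
    finally show "(\<integral>\<^sup>+x. ennreal \<bar>k (x - y) * G y * A x\<bar> \<partial>lborel) \<le> ennreal \<bar>G y\<bar> * (ennreal pi + nn2 A)" .
  qed
  also have "\<dots> = (\<integral>\<^sup>+y. ennreal \<bar>G y\<bar> \<partial>lborel) * (ennreal pi + nn2 A)"
    by (rule nn_integral_multc) measurable
  also have "\<dots> < \<infinity>"
    using G A2 by (auto simp: integrable_iff_bounded ennreal_mult_less_top)
  finally show "(\<integral>\<^sup>+z. ennreal (norm (case z of (x, y) \<Rightarrow> k (x - y) * G y * A x)) \<partial>(lborel \<Otimes>\<^sub>M lborel)) < \<infinity>" .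
qed

lemma convolution_fubini:
  assumes "k \<in> borel_measurable borel" "\<And>u. (k u)\<^sup>2 \<le> pk u" "integrable lborel G" "sq_integrable lborel A"
  shows "(LINT x|lborel. (LINT y|lborel. k (x - y) * G y) * A x) = (LINT y|lborel. G y * (LINT x|lborel. k (x - y) * A x))"
proof -
  have "(LINT x|lborel. (LINT y|lborel. k (x - y) * G y) * A x) = (LINT x|lborel. LINT y|lborel. k (x - y) * G y * A x)"
    by simp
  also have "\<dots> = (LINT y|lborel. LINT x|lborel. k (x - y) * G y * A x)"
    by (rule lborel_pair.Fubini_integral[OF convolution_integrable[OF assms], symmetric])
  also have "\<dots> = (LINT y|lborel. LINT x|lborel. G y * (k (x - y) * A x))"
    by (simp only: mult_ac)
  finally show ?thesis by simp
qed

text \<open>Young's inequality for an L1 function and an L2 kernel: Cauchy-Schwarz with |G| as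
  weight, and Tonelli. The hypothesis on k bounds its squared norm by the integral pi of
  \<open>pk\<close>.\<close>

lemma convolution_sq_integrable:
  fixes k G :: "real \<Rightarrow> real"
  assumes [measurable]: "k \<in> borel_measurable borel" and k: "\<And>u. (k u)\<^sup>2 \<le> pk u" and G: "integrable lborel G"
  shows "sq_integrable lborel (\<lambda>x. LINT y|lborel. k (x - y) * G y)"
proof -
  have [measurable]: "G \<in> borel_measurable borel" using G by auto
  let ?I = "\<integral>\<^sup>+y. ennreal \<bar>G y\<bar> \<partial>lborel"
  have I: "?I < \<infinity>" using G by (simp add: integrable_iff_bounded)
  have "(\<integral>\<^sup>+x. ennreal ((LINT y|lborel. k (x - y) * G y)\<^sup>2) \<partial>lborel)
      \<le> (\<integral>\<^sup>+x. (\<integral>\<^sup>+y. ennreal ((k (x - y))\<^sup>2 * \<bar>G y\<bar>) \<partial>lborel) * ?I \<partial>lborel)"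
  proof (rule nn_integral_mono)
    fix x
    have "(k (x - y) * sqrt \<bar>G y\<bar>) * (sgn (G y) * sqrt \<bar>G y\<bar>) = k (x - y) * G y" for y
      by (auto simp: algebra_simps sgn_if)
    moreover have "(k (x - y) * sqrt \<bar>G y\<bar>)\<^sup>2 = (k (x - y))\<^sup>2 * \<bar>G y\<bar>" "(sgn (G y) * sqrt \<bar>G y\<bar>)\<^sup>2 = \<bar>G y\<bar>" for y
      by (auto simp: power_mult_distrib sgn_if)
    moreover have "ennreal ((LINT y|lborel. (k (x - y) * sqrt \<bar>G y\<bar>) * (sgn (G y) * sqrt \<bar>G y\<bar>))\<^sup>2)
        \<le> (\<integral>\<^sup>+y. ennreal ((k (x - y) * sqrt \<bar>G y\<bar>)\<^sup>2) \<partial>lborel) * (\<integral>\<^sup>+y. ennreal ((sgn (G y) * sqrt \<bar>G y\<bar>)\<^sup>2) \<partial>lborel)"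
      by (rule LINT_Cauchy_Schwarz) measurable
    ultimately show "ennreal ((LINT y|lborel. k (x - y) * G y)\<^sup>2) \<le> (\<integral>\<^sup>+y. ennreal ((k (x - y))\<^sup>2 * \<bar>G y\<bar>) \<partial>lborel) * ?I"
      by (simp only:)
  qed
  also have "\<dots> = (\<integral>\<^sup>+x. \<integral>\<^sup>+y. ennreal ((k (x - y))\<^sup>2 * \<bar>G y\<bar>) \<partial>lborel \<partial>lborel) * ?I"
    by (rule nn_integral_multc) measurable
  also have "(\<integral>\<^sup>+x. \<integral>\<^sup>+y. ennreal ((k (x - y))\<^sup>2 * \<bar>G y\<bar>) \<partial>lborel \<partial>lborel) = (\<integral>\<^sup>+y. \<integral>\<^sup>+x. ennreal ((k (x - y))\<^sup>2 * \<bar>G y\<bar>) \<partial>lborel \<partial>lborel)"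
    by (rule lborel_pair.Fubini'[symmetric]) measurable
  also have "\<dots> = (\<integral>\<^sup>+y. (\<integral>\<^sup>+x. ennreal ((k (x - y))\<^sup>2) \<partial>lborel) * ennreal \<bar>G y\<bar> \<partial>lborel)"
    by (simp add: ennreal_mult nn_integral_multc)
  also have "\<dots> \<le> (\<integral>\<^sup>+y. ennreal pi * ennreal \<bar>G y\<bar> \<partial>lborel)"
    by (intro nn_integral_mono mult_right_mono nn_integral_sq_shift_le k) auto
  also have "\<dots> = ennreal pi * ?I" by (rule nn_integral_cmult) measurable
  finally have "(\<integral>\<^sup>+x. ennreal ((LINT y|lborel. k (x - y) * G y)\<^sup>2) \<partial>lborel) \<le> ennreal pi * ?I * ?I"
    by (simp add: mult_right_mono)
  also have "\<dots> < \<infinity>" using I by (simp add: ennreal_mult_less_top)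
  finally show ?thesis unfolding sq_integrable_iff_nn by simp
qed

text \<open>Cauchy-Schwarz with \<open>pk\<close> as weight, whose mass is pi in either
  variable.\<close>

lemma pk_convolution_bound:
  assumes [measurable]: "G \<in> borel_measurable borel"
  shows "nn2 (\<lambda>x. LINT y|lborel. pk (x - y) * G y) \<le> ennreal (pi\<^sup>2) * nn2 G"
proof -
  have "nn2 (\<lambda>x. LINT y|lborel. pk (x - y) * G y)
      \<le> (\<integral>\<^sup>+x. ennreal pi * (\<integral>\<^sup>+y. ennreal (pk (x - y) * (G y)\<^sup>2) \<partial>lborel) \<partial>lborel)"
    unfolding nn2_def
  proof (rule nn_integral_mono)
    fix x
    have "sqrt (pk (x - y)) * (sqrt (pk (x - y)) * G y) = pk (x - y) * G y"
      "(sqrt (pk (x - y)))\<^sup>2 = pk (x - y)" "(sqrt (pk (x - y)) * G y)\<^sup>2 = pk (x - y) * (G y)\<^sup>2" for y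
      using pk_pos[of "x - y"] by (simp_all add: power_mult_distrib flip: mult.assoc)
    note eqs = this
    have "ennreal ((LINT y|lborel. sqrt (pk (x - y)) * (sqrt (pk (x - y)) * G y))\<^sup>2)
        \<le> (\<integral>\<^sup>+y. ennreal ((sqrt (pk (x - y)))\<^sup>2) \<partial>lborel) * (\<integral>\<^sup>+y. ennreal ((sqrt (pk (x - y)) * G y)\<^sup>2) \<partial>lborel)"
      by (rule LINT_Cauchy_Schwarz) measurable
    then show "ennreal ((LINT y|lborel. pk (x - y) * G y)\<^sup>2) \<le> ennreal pi * (\<integral>\<^sup>+y. ennreal (pk (x - y) * (G y)\<^sup>2) \<partial>lborel)"
      unfolding eqs nn_integral_pk_shift' .
  qed
  also have "\<dots> = ennreal pi * (\<integral>\<^sup>+x. \<integral>\<^sup>+y. ennreal (pk (x - y) * (G y)\<^sup>2) \<partial>lborel \<partial>lborel)"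
    by (rule nn_integral_cmult) measurable
  also have "(\<integral>\<^sup>+x. \<integral>\<^sup>+y. ennreal (pk (x - y) * (G y)\<^sup>2) \<partial>lborel \<partial>lborel) = (\<integral>\<^sup>+y. \<integral>\<^sup>+x. ennreal (pk (x - y) * (G y)\<^sup>2) \<partial>lborel \<partial>lborel)"
    by (rule lborel_pair.Fubini'[symmetric]) measurable
  also have "\<dots> = (\<integral>\<^sup>+y. ennreal pi * ennreal ((G y)\<^sup>2) \<partial>lborel)"
    using pk_pos by (simp add: ennreal_mult less_imp_le nn_integral_multc nn_integral_pk_shift)
  also have "\<dots> = ennreal pi * nn2 G" unfolding nn2_def by (rule nn_integral_cmult) measurable
  finally show ?thesis by (simp add: power2_eq_square ennreal_mult mult.assoc)
qed

text \<open>The norm of a convolution sees the kernel only through its autocorrelation; this is how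
  the bound for \<open>pk\<close> passes to \<open>qk\<close>.\<close>

lemma convolution_norm:
  assumes k: "k \<in> borel_measurable borel" "\<And>u. (k u)\<^sup>2 \<le> pk u" and G: "integrable lborel G"
  shows "nn2 (\<lambda>x. LINT y|lborel. k (x - y) * G y)
    = ennreal (LINT y|lborel. G y * (LINT z|lborel. G z * (LINT x|lborel. k (x - z) * k (x - y))))"
proof -
  let ?A = "\<lambda>x. LINT y|lborel. k (x - y) * G y"
  have A: "sq_integrable lborel ?A" by (rule convolution_sq_integrable[OF k G])
  have ky: "sq_integrable lborel (\<lambda>x. k (x - y))" for y
    using product_integrable_shift[OF k, of y y] k(1) by (simp add: sq_integrable_def power2_eq_square)
  have "nn2 ?A = ennreal (LINT x|lborel. (?A x)\<^sup>2)"
    using A unfolding nn2_def sq_integrable_def by (intro nn_integral_eq_integral) auto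
  also have "(LINT x|lborel. (?A x)\<^sup>2) = (LINT y|lborel. G y * (LINT x|lborel. k (x - y) * ?A x))"
    unfolding power2_eq_square by (rule convolution_fubini[OF k G A])
  also have "(\<lambda>y. LINT x|lborel. k (x - y) * ?A x) = (\<lambda>y. LINT z|lborel. G z * (LINT x|lborel. k (x - z) * k (x - y)))"
    using convolution_fubini[OF k G ky] by (simp add: mult.commute)
  finally show ?thesis .
qed

lemma qk_convolution_bound_integrable:
  assumes "integrable lborel G"
  shows "nn2 (\<lambda>x. LINT y|lborel. qk (x - y) * G y) \<le> ennreal (pi\<^sup>2) * nn2 G"
  using pk_convolution_bound[of G] assms
  unfolding convolution_norm[OF qk_meas qk_sq_le assms] convolution_norm[OF pk_meas pk_sq_le assms] qk_autocorrelation
  by auto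

lemma sq_integrable_qk_shift: "sq_integrable lborel (\<lambda>y. qk (x - y))"
proof -
  have "(\<integral>\<^sup>+y. ennreal ((qk (x - y))\<^sup>2) \<partial>lborel) \<le> (\<integral>\<^sup>+y. ennreal (pk (x - y)) \<partial>lborel)"
    by (intro nn_integral_mono ennreal_leI qk_sq_le)
  also have "\<dots> < \<infinity>" by (simp add: nn_integral_pk_shift')
  finally show ?thesis by (simp add: sq_integrable_iff_nn)
qed

text \<open>The bound is known for integrable functions. Truncation to [- n, n], pointwise
  convergence of the convolutions and Fatou's lemma extend it to all of L2.\<close>

lemma qk_convolution_bound:
  assumes g: "sq_integrable lborel g"
  shows "nn2 (\<lambda>x. LINT y|lborel. qk (x - y) * g y) \<le> ennreal (pi\<^sup>2) * nn2 g"
proof -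
  have [measurable]: "g \<in> borel_measurable borel" using g by (simp add: sq_integrable_def)
  define gn where "gn n y = indicator {- real n..real n} y * g y" for n :: nat and y
  have [measurable]: "gn n \<in> borel_measurable borel" for n unfolding gn_def by measurable
  have gn: "integrable lborel (gn n)" for n
  proof -
    have "sq_integrable lborel (indicator {- real n..real n} :: real \<Rightarrow> real)"
      unfolding sq_integrable_def by (simp add: power2_eq_square indicator_inter_arith[symmetric])
    from sq_integrable_mult[OF this g] show ?thesis by (simp add: gn_def[abs_def])
  qed
  let ?Q = "\<lambda>n x. LINT y|lborel. qk (x - y) * gn n y"
  have lim: "(\<lambda>n. ?Q n x) \<longlonglongrightarrow> (LINT y|lborel. qk (x - y) * g y)" for x
  proof (rule integral_dominated_convergence[where w="\<lambda>y. \<bar>qk (x - y) * g y\<bar>"])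
    show "integrable lborel (\<lambda>y. \<bar>qk (x - y) * g y\<bar>)"
      by (intro integrable_abs sq_integrable_mult sq_integrable_qk_shift g)
    show "AE y in lborel. (\<lambda>n. qk (x - y) * gn n y) \<longlonglongrightarrow> qk (x - y) * g y"
    proof (rule AE_I2)
      fix y
      obtain N where "\<bar>y\<bar> \<le> real N" using real_arch_simple by blast
      then have "eventually (\<lambda>n. qk (x - y) * gn n y = qk (x - y) * g y) sequentially"
        by (intro eventually_sequentiallyI[of N]) (auto simp: indicator_def gn_def)
      then show "(\<lambda>n. qk (x - y) * gn n y) \<longlonglongrightarrow> qk (x - y) * g y" by (rule tendsto_eventually)
    qed
    show "AE y in lborel. norm (qk (x - y) * gn n y) \<le> \<bar>qk (x - y) * g y\<bar>" for n
      by (auto simp: gn_def indicator_def)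
  qed measurable
  have "nn2 (\<lambda>x. LINT y|lborel. qk (x - y) * g y) = (\<integral>\<^sup>+x. liminf (\<lambda>n. ennreal ((?Q n x)\<^sup>2)) \<partial>lborel)"
    unfolding nn2_def
  proof (rule nn_integral_cong)
    fix x
    have "(\<lambda>n. ennreal ((?Q n x)\<^sup>2)) \<longlonglongrightarrow> ennreal ((LINT y|lborel. qk (x - y) * g y)\<^sup>2)"
      by (intro tendsto_ennrealI tendsto_power lim)
    then show "ennreal ((LINT y|lborel. qk (x - y) * g y)\<^sup>2) = liminf (\<lambda>n. ennreal ((?Q n x)\<^sup>2))"
      by (intro lim_imp_Liminf[symmetric]) auto
  qed
  also have "\<dots> \<le> liminf (\<lambda>n. nn2 (?Q n))"
    unfolding nn2_def by (rule nn_integral_liminf) measurable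
  also have "\<dots> \<le> ennreal (pi\<^sup>2) * nn2 g"
  proof (intro Liminf_le always_eventually allI)
    fix n
    have "nn2 (?Q n) \<le> ennreal (pi\<^sup>2) * nn2 (gn n)" by (rule qk_convolution_bound_integrable[OF gn])
    also have "nn2 (gn n) \<le> nn2 g"
      unfolding nn2_def gn_def by (intro nn_integral_mono ennreal_leI) (auto simp: indicator_def)
    finally show "nn2 (?Q n) \<le> ennreal (pi\<^sup>2) * nn2 g" by (simp add: mult_left_mono)
  qed simp
  finally show ?thesis .
qed

text \<open>The principal value folded onto u > 0: pairing x - u with x + u makes the integral
  absolutely convergent for Lipschitz g in L2.\<close>

definition hl_int :: "(real \<Rightarrow> real) \<Rightarrow> real \<Rightarrow> real \<Rightarrow> real" where
  "hl_int g x u = indicator {0<..} u * ((g (x - u) - g (x + u)) / u)"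

definition Hl :: "(real \<Rightarrow> real) \<Rightarrow> real \<Rightarrow> real" where
  "Hl g x = (LINT u|lborel. hl_int g x u) / pi"

lemma hl_int_meas:
  assumes [measurable]: "g \<in> borel_measurable borel"
  shows "(\<lambda>(x, u). hl_int g x u) \<in> borel_measurable (borel \<Otimes>\<^sub>M borel)" "hl_int g x \<in> borel_measurable borel"
  unfolding hl_int_def by measurable

lemma Hl_meas:
  assumes [measurable]: "g \<in> borel_measurable borel"
  shows "Hl g \<in> borel_measurable borel"
proof -
  have "(\<lambda>(x, u). hl_int g x u) \<in> borel_measurable (borel \<Otimes>\<^sub>M lborel)" unfolding hl_int_def by measurable
  then have "(\<lambda>x. LINT u|lborel. hl_int g x u) \<in> borel_measurable borel"
    by (rule lborel.borel_measurable_lebesgue_integral)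
  then show ?thesis unfolding Hl_def[abs_def] by (intro borel_measurable_divide borel_measurable_const)
qed

lemma Lipschitz_of_deriv:
  assumes "\<And>x. (g has_real_derivative g' x) (at x)" "\<And>x. \<bar>g' x\<bar> \<le> B"
  shows "\<bar>g a - g b\<bar> \<le> B * \<bar>a - b\<bar>"
  using field_differentiable_bound[of UNIV g g' B a b] assms by simp

text \<open>For u \<le> 1 the Lipschitz bound gives 2 B. For u > 1 the product of the difference and
  1/u is at most half the sum of their squares, and 1/u^2 is at most 2 \<open>pk u\<close>. The
  result is uniform in x.\<close>

lemma hl_int_nn_le:
  assumes [measurable]: "g \<in> borel_measurable borel" and lip: "\<And>a b. \<bar>g a - g b\<bar> \<le> B * \<bar>a - b\<bar>"
  shows "(\<integral>\<^sup>+u. ennreal \<bar>hl_int g x u\<bar> \<partial>lborel) \<le> ennreal (2 * B + pi) + 2 * nn2 g"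
proof -
  have B: "0 \<le> B" using lip[of 0 1] by simp
  have "(\<integral>\<^sup>+u. ennreal \<bar>hl_int g x u\<bar> \<partial>lborel)
      \<le> (\<integral>\<^sup>+u. ennreal (2 * B) * indicator {0..1} u + ennreal (pk u) + ennreal ((g (x - u))\<^sup>2) + ennreal ((g (u + x))\<^sup>2) \<partial>lborel)"
  proof (rule nn_integral_mono)
    fix u
    have "\<bar>hl_int g x u\<bar> \<le> 2 * B * indicator {0..1} u + pk u + (g (x - u))\<^sup>2 + (g (u + x))\<^sup>2"
    proof (cases "0 < u")
      case True
      show ?thesis
      proof (cases "u \<le> 1")
        case le: True
        have "\<bar>hl_int g x u\<bar> \<le> 2 * B"
        proof -
          have "\<bar>g (x - u) - g (x + u)\<bar> \<le> B * \<bar>(x - u) - (x + u)\<bar>" by (rule lip)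
          also have "\<bar>(x - u) - (x + u)\<bar> = 2 * u" using True by simp
          finally have "\<bar>g (x - u) - g (x + u)\<bar> / u \<le> B * (2 * u) / u" using True by (intro divide_right_mono) auto
          also have "\<dots> = 2 * B" using True by simp
          finally show ?thesis using True by (simp add: hl_int_def)
        qed
        moreover have "0 < pk u" "0 \<le> (g (x - u))\<^sup>2" "0 \<le> (g (u + x))\<^sup>2" by (simp_all add: pk_pos)
        ultimately have "\<bar>hl_int g x u\<bar> \<le> 2 * B + pk u + (g (x - u))\<^sup>2 + (g (u + x))\<^sup>2" by linarith
        then show ?thesis using True le by simp
      next
        case False
        let ?d = "g (x - u) - g (x + u)"
        have i: "inverse (u\<^sup>2) \<le> 2 * pk u" using False by (intro inverse_sq_le_pk) auto
        have s: "2 * (\<bar>?d\<bar> * inverse u) \<le> ?d\<^sup>2 + (inverse u)\<^sup>2"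
          using sum_squares_bound[of "\<bar>?d\<bar>" "inverse u"] by simp
        have "\<bar>hl_int g x u\<bar> = \<bar>?d\<bar> * inverse u"
          using True by (simp add: hl_int_def divide_inverse abs_mult)
        moreover have "(inverse u)\<^sup>2 = inverse (u\<^sup>2)" by (rule power_inverse)
        moreover have "g (u + x) = g (x + u)" by (rule arg_cong[of _ _ g]) (rule add.commute)
        moreover have "indicator {0..1} u = (0 :: real)" using False by simp
        ultimately show ?thesis
          using s i real_sq_diff_le[of "g (x - u)" "g (x + u)"] by ((simp only: mult_zero_right); (linarith)?)
      qed
    next
      case False
      then have "\<bar>hl_int g x u\<bar> = 0" by (simp add: hl_int_def)
      also have "0 \<le> 2 * B * indicator {0..1} u + pk u + (g (x - u))\<^sup>2 + (g (u + x))\<^sup>2"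
        using B by (intro add_nonneg_nonneg mult_nonneg_nonneg less_imp_le[OF pk_pos]) auto
      finally show ?thesis .
    qed
    then have "ennreal \<bar>hl_int g x u\<bar> \<le> ennreal (2 * B * indicator {0..1} u + pk u + (g (x - u))\<^sup>2 + (g (u + x))\<^sup>2)"
      by (rule ennreal_leI)
    also have "\<dots> = ennreal (2 * B) * indicator {0..1} u + ennreal (pk u) + ennreal ((g (x - u))\<^sup>2) + ennreal ((g (u + x))\<^sup>2)"
      using B less_imp_le[OF pk_pos[of u]] by (cases "u \<in> {0..1}") simp_all
    finally show "ennreal \<bar>hl_int g x u\<bar> \<le> ennreal (2 * B) * indicator {0..1} u + ennreal (pk u) + ennreal ((g (x - u))\<^sup>2) + ennreal ((g (u + x))\<^sup>2)" .
  qed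
  also have "\<dots> = ennreal (2 * B) + ennreal pi + nn2 g + nn2 g"
  proof -
    have "(\<integral>\<^sup>+u. ennreal ((g (x - u))\<^sup>2) \<partial>lborel) = nn2 g" "(\<integral>\<^sup>+u. ennreal ((g (u + x))\<^sup>2) \<partial>lborel) = nn2 g"
      unfolding nn2_def by (rule nn_integral_reflect nn_integral_translate; measurable)+
    moreover have "(\<integral>\<^sup>+u. ennreal (2 * B) * indicator {0..1::real} u \<partial>lborel) = ennreal (2 * B)"
      by (subst nn_integral_cmult_indicator) simp_all
    ultimately show ?thesis
      by (subst nn_integral_add, measurable, subst nn_integral_add, measurable, subst nn_integral_add, measurable,
        simp only: nn_integral_pk)
  qed
  also have "\<dots> = ennreal (2 * B + pi) + 2 * nn2 g"
    unfolding mult_2[of "nn2 g"] using B by (subst ennreal_plus) (simp_all only: pi_ge_zero mult_nonneg_nonneg zero_le_numeral add.assoc)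
  finally show ?thesis .
qed

lemma hl_int_integrable:
  assumes "g \<in> borel_measurable borel" "\<And>a b. \<bar>g a - g b\<bar> \<le> B * \<bar>a - b\<bar>" "nn2 g < \<infinity>"
  shows "integrable lborel (hl_int g x)"
proof (rule integrableI_bounded)
  show "hl_int g x \<in> borel_measurable lborel" using hl_int_meas(2)[OF assms(1)] by simp
  have "(\<integral>\<^sup>+u. ennreal \<bar>hl_int g x u\<bar> \<partial>lborel) \<le> ennreal (2 * B + pi) + 2 * nn2 g"
    by (rule hl_int_nn_le[OF assms(1,2)])
  also have "\<dots> < \<infinity>" using assms(3) by (simp add: ennreal_mult_less_top)
  finally show "(\<integral>\<^sup>+u. ennreal (norm (hl_int g x u)) \<partial>lborel) < \<infinity>" by simp
qed

lemma sq_integrable_reflect: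
  fixes k :: "real \<Rightarrow> real"
  assumes "sq_integrable lborel k" shows "sq_integrable lborel (\<lambda>y. k (x - y))"
proof -
  have [measurable]: "k \<in> borel_measurable borel" using assms by (simp add: sq_integrable_def)
  show ?thesis
    using assms lborel_integrable_real_affine[of "\<lambda>y. (k y)\<^sup>2" "-1" x] by (simp add: sq_integrable_def)
qed

text \<open>Reflecting the half line u < 0 in the convolution integral; oddness of k turns the sum
  of the two halves into a difference.\<close>

lemma odd_kernel_half_line:
  fixes k g :: "real \<Rightarrow> real"
  assumes k: "sq_integrable lborel k" and odd: "\<And>u. k (- u) = - k u" and g: "sq_integrable lborel g"
  shows "integrable lborel (\<lambda>u. indicator {0<..} u * (k u * (g (x - u) - g (x + u))))"
    "(LINT u|lborel. indicator {0<..} u * (k u * (g (x - u) - g (x + u)))) = (LINT y|lborel. k (x - y) * g y)"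
proof -
  define F where "F u = k u * g (x - u)" for u
  have i: "integrable lborel (\<lambda>y. k (x - y) * g y)" by (intro sq_integrable_mult sq_integrable_reflect k g)
  have F: "integrable lborel F"
    using lborel_integrable_real_affine[OF i, of "-1" x] by (simp add: F_def[abs_def])
  have Fm: "integrable lborel (\<lambda>u. F (- u))"
    using lborel_integrable_real_affine[OF F, of "-1" 0] by simp
  have hF: "integrable lborel (\<lambda>u. indicator {0<..} u * F u)" "integrable lborel (\<lambda>u. indicator {0<..} u * F (- u))"
    using integrable_mult_indicator[OF _ F, of "{0<..}"] integrable_mult_indicator[OF _ Fm, of "{0<..}"] by auto
  have "indicator {0<..} u * (k u * (g (x - u) - g (x + u))) = indicator {0<..} u * F u + indicator {0<..} u * F (- u)" for u
    by (simp add: F_def odd algebra_simps)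
  then have e: "(\<lambda>u. indicator {0<..} u * (k u * (g (x - u) - g (x + u)))) = (\<lambda>u. indicator {0<..} u * F u + indicator {0<..} u * F (- u))" by auto
  show "integrable lborel (\<lambda>u. indicator {0<..} u * (k u * (g (x - u) - g (x + u))))"
    unfolding e using hF by (rule Bochner_Integration.integrable_add)
  have "(LINT u|lborel. indicator {0<..} u * F (- u)) = (LINT u|lborel. indicator {..<0} u * F u)"
    by (subst lborel_integral_real_affine[of "-1" _ 0]) (auto simp: indicator_def intro!: Bochner_Integration.integral_cong)
  moreover have hF': "integrable lborel (\<lambda>u. indicator {..<0} u * F u)"
    using integrable_mult_indicator[OF _ F, of "{..<0}"] by auto
  ultimately have "(LINT u|lborel. indicator {0<..} u * F u + indicator {0<..} u * F (- u))
      = (LINT u|lborel. indicator {0<..} u * F u + indicator {..<0} u * F u)"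
    using hF by simp
  also have "\<dots> = (LINT u|lborel. F u)"
  proof (rule integral_cong_AE)
    show "AE u in lborel. indicator {0<..} u * F u + indicator {..<0} u * F u = F u"
      using AE_lborel_singleton[of "0::real"] by eventually_elim (auto simp: indicator_def)
  qed (use F hF hF' in auto)
  also have "\<dots> = (LINT y|lborel. k (x - y) * g y)"
    by (subst (2) lborel_integral_real_affine[of "-1" _ x]) (simp_all add: F_def[abs_def])
  finally show "(LINT u|lborel. indicator {0<..} u * (k u * (g (x - u) - g (x + u)))) = (LINT y|lborel. k (x - y) * g y)"
    unfolding e .
qed

lemma Hl_abs_le:
  assumes "g \<in> borel_measurable borel" "\<And>a b. \<bar>g a - g b\<bar> \<le> B * \<bar>a - b\<bar>" "nn2 g \<le> ennreal K" "0 \<le> K"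
  shows "\<bar>Hl g x\<bar> \<le> (2 * B + pi + 2 * K) / pi"
proof -
  have B: "0 \<le> B" using assms(2)[of 0 1] by simp
  have "nn2 g < \<infinity>" using assms(3) le_less_trans by fastforce
  from integral_norm_bound_ennreal[OF hl_int_integrable[OF assms(1,2) this], of x]
  have "ennreal \<bar>LINT u|lborel. hl_int g x u\<bar> \<le> ennreal (2 * B + pi) + 2 * nn2 g"
    using hl_int_nn_le[OF assms(1,2), of x] by simp
  also have "\<dots> \<le> ennreal (2 * B + pi) + 2 * ennreal K" by (intro add_left_mono mult_left_mono assms(3)) auto
  also have "\<dots> = ennreal (2 * B + pi + 2 * K)" using B assms(4) by (simp add: ennreal_mult)
  finally have "\<bar>LINT u|lborel. hl_int g x u\<bar> \<le> 2 * B + pi + 2 * K"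
    using B assms(4) by (subst (asm) ennreal_le_iff) auto
  then show ?thesis by (simp add: Hl_def divide_right_mono)
qed

text \<open>By 1/u = qk u + pk u / u, \<open>Hl g\<close> is 1/pi times a convolution with
  \<open>qk\<close>, of norm at most pi times that of g, plus a part that averages difference
  quotients of g against \<open>pk\<close> and is controlled by g'. This bound stands in for the
  isometry on L2, since derivatives of g are under control in every application.\<close>

theorem Hl_bound:
  assumes d: "\<And>x. (g has_real_derivative g' x) (at x)" and c: "continuous_on UNIV g'"
    and B: "\<And>x. \<bar>g' x\<bar> \<le> B" and g: "nn2 g < \<infinity>"
  shows "nn2 (Hl g) \<le> 2 * nn2 g + 4 * nn2 g'"
proof -
  have [measurable]: "g \<in> borel_measurable borel"
    using d by (intro borel_measurable_continuous_onI) (auto simp: continuous_on_eq_continuous_at intro: DERIV_isCont)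
  have [measurable]: "g' \<in> borel_measurable borel" by (rule borel_measurable_continuous_onI[OF c])
  have sg: "sq_integrable lborel g" using g by (simp add: sq_integrable_iff_nn nn2_def)
  note lip = Lipschitz_of_deriv[OF d B]
  have qk_sq: "sq_integrable lborel qk"
    using sq_integrable_reflect[OF sq_integrable_qk_shift[of 0], of 0] by simp
  have qk_odd: "qk (- u) = - qk u" for u by (simp add: qk_def)
  define P where "P x u = indicator {0<..} u * (pk u * ((g (x - u) - g (x + u)) / u))" for x u
  have Pm [measurable]: "(\<lambda>(x, u). P x u) \<in> borel_measurable (borel \<Otimes>\<^sub>M borel)" unfolding P_def by measurable
  let ?Q = "\<lambda>x. LINT y|lborel. qk (x - y) * g y"
  let ?q = "\<lambda>x u. indicator {0<..} u * (qk u * (g (x - u) - g (x + u)))"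
  have split: "hl_int g x u = ?q x u + P x u" for x u
  proof (cases "0 < u")
    case True
    have "inverse u = qk u + pk u * inverse u"
    proof -
      have "(1 + u\<^sup>2) * pk u = 1" using one_plus_sq_pos[of u] by (simp add: pk_def)
      then have "inverse u = (1 + u\<^sup>2) * pk u * inverse u" by simp
      also have "\<dots> = qk u + pk u * inverse u" using True by (simp add: qk_def pk_def power2_eq_square algebra_simps)
      finally show ?thesis .
    qed
    then have "(g (x - u) - g (x + u)) * inverse u = (g (x - u) - g (x + u)) * (qk u + pk u * inverse u)" by simp
    then show ?thesis using True unfolding hl_int_def P_def divide_inverse by (simp add: algebra_simps)
  qed (simp add: hl_int_def P_def)
  have Pi: "integrable lborel (P x)" for x
  proof -
    have "P x = (\<lambda>u. hl_int g x u - ?q x u)" using split by auto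
    then show ?thesis
      using hl_int_integrable[OF _ lip g, of x] odd_kernel_half_line(1)[OF qk_sq qk_odd sg, of x] by simp
  qed
  have H: "Hl g x = (?Q x + (LINT u|lborel. P x u)) / pi" for x
    unfolding Hl_def split using odd_kernel_half_line[OF qk_sq qk_odd sg, of x] Pi[of x] by simp
  have Pn: "nn2 (\<lambda>x. LINT u|lborel. P x u) \<le> ennreal (2 * pi\<^sup>2) * nn2 g'"
  proof -
    let ?R = "\<lambda>x u. indicator {0<..} u * (ennreal (pk u / u\<^sup>2) * ennreal ((g (x - u) - g (x + u))\<^sup>2))"
    have "nn2 (\<lambda>x. LINT u|lborel. P x u) \<le> (\<integral>\<^sup>+x. ennreal (pi / 2) * (\<integral>\<^sup>+u. ?R x u \<partial>lborel) \<partial>lborel)"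
      unfolding nn2_def
    proof (rule nn_integral_mono)
      fix x
      let ?a = "\<lambda>u. indicator {0..} u * sqrt (pk u)"
      let ?b = "\<lambda>u. indicator {0<..} u * (sqrt (pk u) * ((g (x - u) - g (x + u)) / u))"
      have "?a u * ?b u = P x u" for u
        using pk_pos[of u] by (auto simp: P_def indicator_def)
      moreover have "ennreal ((?a u)\<^sup>2) = ennreal (pk u) * indicator {0..} u" for u
        using pk_pos[of u] by (auto simp: indicator_def)
      moreover have "ennreal ((?b u)\<^sup>2) = ?R x u" for u
        using pk_pos[of u] by (auto simp: indicator_def power_mult_distrib power_divide ennreal_mult[symmetric])
      ultimately show "ennreal ((LINT u|lborel. P x u)\<^sup>2) \<le> ennreal (pi / 2) * (\<integral>\<^sup>+u. ?R x u \<partial>lborel)"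
        using LINT_Cauchy_Schwarz[of ?a lborel ?b] by (simp add: nn_integral_pk_half)
    qed
    also have "\<dots> = ennreal (pi / 2) * (\<integral>\<^sup>+x. \<integral>\<^sup>+u. ?R x u \<partial>lborel \<partial>lborel)"
      by (rule nn_integral_cmult) measurable
    also have "(\<integral>\<^sup>+x. \<integral>\<^sup>+u. ?R x u \<partial>lborel \<partial>lborel) = (\<integral>\<^sup>+u. \<integral>\<^sup>+x. ?R x u \<partial>lborel \<partial>lborel)"
      by (rule lborel_pair.Fubini'[symmetric]) measurable
    also have "\<dots> \<le> (\<integral>\<^sup>+u. (ennreal (pk u) * indicator {0..} u) * (8 * nn2 g') \<partial>lborel)"
    proof (rule nn_integral_mono)
      fix u :: real
      have "(\<integral>\<^sup>+x. ?R x u \<partial>lborel) = indicator {0<..} u * (ennreal (pk u / u\<^sup>2) * nn2 (\<lambda>x. g (x + - u) - g (x + u)))"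
        unfolding nn2_def by (subst nn_integral_cmult, measurable, subst nn_integral_cmult) simp_all
      also have "\<dots> \<le> indicator {0<..} u * (ennreal (pk u / u\<^sup>2) * (ennreal (2 * (- u - u)\<^sup>2) * nn2 g'))"
        by (intro mult_left_mono nn2_translate_diff[OF d c]) auto
      also have "\<dots> \<le> (ennreal (pk u) * indicator {0..} u) * (8 * nn2 g')"
      proof (cases "0 < u")
        case True
        \<comment> \<open>The points x - u and x + u are 2 u apart, so the translation bound gives 2
          (2 u)^2 = 8 u^2, which cancels the u^2 of the kernel.\<close>
        have "ennreal (pk u / u\<^sup>2) * ennreal (2 * (- u - u)\<^sup>2) = ennreal (pk u * 8)"
          using True pk_pos[of u] by (subst ennreal_mult[symmetric]) (auto simp: power2_eq_square field_simps)
        also have "\<dots> = ennreal (pk u) * 8" using pk_pos[of u] by (simp add: ennreal_mult)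
        finally show ?thesis using True by (simp add: mult.assoc[symmetric])
      qed simp
      finally show "(\<integral>\<^sup>+x. ?R x u \<partial>lborel) \<le> (ennreal (pk u) * indicator {0..} u) * (8 * nn2 g')" .
    qed
    also have "\<dots> = ennreal (pi / 2) * (8 * nn2 g')"
      by (subst nn_integral_multc) (measurable, simp add: nn_integral_pk_half)
    finally have "nn2 (\<lambda>x. LINT u|lborel. P x u) \<le> ennreal (pi / 2) * (ennreal (pi / 2) * (ennreal 8 * nn2 g'))"
      by (simp add: mult_left_mono)
    also have "\<dots> = ennreal (pi / 2 * (pi / 2 * 8)) * nn2 g'"
      by (simp only: mult.assoc[symmetric] ennreal_mult[symmetric] pi_half_ge_zero mult_nonneg_nonneg zero_le_numeral)
    finally show ?thesis by (simp add: power2_eq_square)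
  qed
  have "nn2 (Hl g) = (\<integral>\<^sup>+x. ennreal (1 / pi\<^sup>2) * ennreal ((?Q x + (LINT u|lborel. P x u))\<^sup>2) \<partial>lborel)"
    unfolding nn2_def H by (simp add: power_divide ennreal_mult[symmetric])
  also have "\<dots> = ennreal (1 / pi\<^sup>2) * nn2 (\<lambda>x. ?Q x + (LINT u|lborel. P x u))"
    unfolding nn2_def by (rule nn_integral_cmult) measurable
  also have "\<dots> \<le> ennreal (1 / pi\<^sup>2) * (2 * nn2 ?Q + 2 * nn2 (\<lambda>x. LINT u|lborel. P x u))"
    by (intro mult_left_mono nn2_add_le) measurable
  also have "\<dots> \<le> ennreal (1 / pi\<^sup>2) * (2 * (ennreal (pi\<^sup>2) * nn2 g) + 2 * (ennreal (2 * pi\<^sup>2) * nn2 g'))"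
    by (intro mult_left_mono add_mono qk_convolution_bound[OF sg] Pn) auto
  also have "\<dots> = 2 * nn2 g + 4 * nn2 g'"
  proof -
    have 1: "ennreal (1 / pi\<^sup>2) * ennreal (pi\<^sup>2) = 1" "ennreal (1 / pi\<^sup>2) * ennreal (2 * pi\<^sup>2) = 2"
      by (subst ennreal_mult[symmetric]; simp)+
    have 2: "e * (2 * (a * x) + 2 * (b * y)) = 2 * ((e * a) * x) + 2 * ((e * b) * y)" for e a b x y :: ennreal
      by (simp add: distrib_left mult_ac)
    show ?thesis unfolding 2 1 by (simp add: mult.assoc[symmetric])
  qed
  finally show ?thesis .
qed

section \<open>Difference quotients on the line\<close>

definition \<delta>2 :: "(real \<Rightarrow> real) \<Rightarrow> real \<Rightarrow> real \<Rightarrow> real" where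
  "\<delta>2 g u x = 2 * g x - g (x - u) - g (x + u)"

text \<open>1/pi times the integral of this over u is |\<nabla>| g at x. The formula makes sense for
  bounded g without decay, and the symmetry of |\<nabla>| becomes that of the second difference
  \<open>\<delta>2\<close>.\<close>

definition frac_int :: "(real \<Rightarrow> real) \<Rightarrow> real \<Rightarrow> real \<Rightarrow> real" where
  "frac_int g x u = indicator {0<..} u * (\<delta>2 g u x / u\<^sup>2)"

text \<open>One component of S at a fixed time, with \<open>G j\<close> its j-th derivative.
  \<open>G 0\<close> is only bounded; it need not be square integrable. Four derivatives are
  controlled because the Lipschitz bound for |\<nabla>| S goes through the supremum of
  \<open>G 3\<close>, hence through \<open>G 4\<close> in L2.\<close>

locale line_component =
  fixes G :: "nat \<Rightarrow> real \<Rightarrow> real" and A :: real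
  assumes deriv: "\<And>j x. (G j has_real_derivative G (Suc j) x) (at x)"
    and bound: "\<And>x. \<bar>G 0 x\<bar> \<le> 1"
    and nn2_bound: "\<And>j. 1 \<le> j \<Longrightarrow> j \<le> 4 \<Longrightarrow> nn2 (G j) \<le> ennreal A" and A: "0 \<le> A"
begin

lemma G_cont: "continuous_on U (G j)"
  using DERIV_isCont[OF deriv] by (intro continuous_at_imp_continuous_on) auto

lemma G_meas [measurable]: "G j \<in> borel_measurable borel"
  by (rule borel_measurable_continuous_onI[OF G_cont])

definition B :: real where "B = sqrt (8 * A)"

lemma B: "0 \<le> B" "B\<^sup>2 = 8 * A"
  using A by (auto simp: B_def)

text \<open>A Sobolev embedding. The auxiliary function s G_j(x + 1 - s) runs from 0 to G_j(x) as s
  runs from 0 to 1, so no boundary value enters; the constant is 8 A = 2 (2 A + 2 A).\<close>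

lemma G_sup:
  assumes j: "1 \<le> j" "j \<le> 3"
  shows "\<bar>G j x\<bar> \<le> B"
proof -
  let ?f = "\<lambda>s. s * G j (x + 1 - s)" and ?f' = "\<lambda>s. G j (x + 1 - s) - s * G (Suc j) (x + 1 - s)"
  have "ennreal ((?f 1)\<^sup>2) \<le> 2 * ennreal ((?f 0)\<^sup>2) + 2 * (\<integral>\<^sup>+s. ennreal ((?f' s)\<^sup>2) * indicator {0..1} s \<partial>lborel)"
  proof (rule sq_le_integral_sq_deriv)
    show "(?f has_real_derivative ?f' s) (at s within {0..1})" for s
    proof -
      have "((\<lambda>s. x + 1 - s) has_real_derivative -1) (at s)" by (auto intro!: derivative_eq_intros)
      from DERIV_mult[OF DERIV_ident DERIV_chain2[OF deriv this]]
      have "(?f has_real_derivative ?f' s) (at s)" by (rule DERIV_cong) (simp add: algebra_simps)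
      then show ?thesis by (rule has_field_derivative_at_within)
    qed
    show "continuous_on {0..1} ?f'"
      by (intro continuous_intros continuous_on_compose2[OF G_cont]) auto
  qed simp
  also have "(\<integral>\<^sup>+s. ennreal ((?f' s)\<^sup>2) * indicator {0..1} s \<partial>lborel)
      \<le> (\<integral>\<^sup>+s. 2 * ennreal ((G j (x + 1 - s))\<^sup>2) + 2 * ennreal ((G (Suc j) (x + 1 - s))\<^sup>2) \<partial>lborel)"
  proof (rule nn_integral_mono)
    fix s :: real
    show "ennreal ((?f' s)\<^sup>2) * indicator {0..1} s \<le> 2 * ennreal ((G j (x + 1 - s))\<^sup>2) + 2 * ennreal ((G (Suc j) (x + 1 - s))\<^sup>2)"
    proof (cases "s \<in> {0..1}")
      case True
      then have "s\<^sup>2 * (G (Suc j) (x + 1 - s))\<^sup>2 \<le> 1 * (G (Suc j) (x + 1 - s))\<^sup>2"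
        by (intro mult_right_mono) (auto simp: power_le_one)
      then have "(?f' s)\<^sup>2 \<le> 2 * (G j (x + 1 - s))\<^sup>2 + 2 * (G (Suc j) (x + 1 - s))\<^sup>2"
        using real_sq_diff_le[of "G j (x + 1 - s)" "s * G (Suc j) (x + 1 - s)"] by (simp add: power_mult_distrib)
      from ennreal_leI[OF this] show ?thesis using True by (simp add: ennreal_mult)
    qed simp
  qed
  also have "\<dots> = 2 * nn2 (G j) + 2 * nn2 (G (Suc j))"
    unfolding nn2_def using nn_integral_reflect[of "\<lambda>s. ennreal ((G j s)\<^sup>2)" "x + 1"] nn_integral_reflect[of "\<lambda>s. ennreal ((G (Suc j) s)\<^sup>2)" "x + 1"]
    by (simp add: nn_integral_add nn_integral_cmult)
  also have "\<dots> \<le> 2 * ennreal A + 2 * ennreal A"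
    using j by (intro add_mono mult_left_mono nn2_bound) auto
  also have "\<dots> = ennreal (4 * A)" using A by (simp add: ennreal_plus[symmetric] ennreal_mult del: ennreal_plus flip: distrib_right)
  finally have "ennreal ((G j x)\<^sup>2) \<le> 2 * ennreal (4 * A)" by (simp add: mult_left_mono)
  also have "\<dots> = ennreal (8 * A)" using A by (simp add: ennreal_mult mult.assoc[symmetric])
  finally have "(G j x)\<^sup>2 \<le> 8 * A" using A by simp
  then show ?thesis unfolding B_def using real_sqrt_le_mono by fastforce
qed

lemma G_lip: "j \<le> 2 \<Longrightarrow> \<bar>G j a - G j b\<bar> \<le> B * \<bar>a - b\<bar>"
  by (rule Lipschitz_of_deriv[OF deriv G_sup]) auto

lemma nn2_fin: "1 \<le> j \<Longrightarrow> j \<le> 4 \<Longrightarrow> nn2 (G j) < \<infinity>"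
  using nn2_bound[of j] by (auto intro: le_less_trans)

definition T :: "real \<Rightarrow> real" where "T = Hl (G 1)"

text \<open>The bound of \<open>Hl_abs_le\<close> with K = 2 A, which covers the difference
  quotients of \<open>G 1\<close>; it serves both as a bound and as a Lipschitz constant for
  \<open>T\<close>.\<close>

definition M0 :: real where "M0 = (2 * B + pi + 4 * A) / pi"

lemma M0: "0 \<le> M0"
  using B A by (simp add: M0_def)

lemma T_meas [measurable]: "T \<in> borel_measurable borel"
  unfolding T_def by (rule Hl_meas) measurable

lemma T_sup: "\<bar>T x\<bar> \<le> M0"
proof -
  have "\<bar>T x\<bar> \<le> (2 * B + pi + 2 * A) / pi"
    unfolding T_def by (rule Hl_abs_le[OF _ G_lip nn2_bound A]) auto
  also have "\<dots> \<le> M0" unfolding M0_def using A by (intro divide_right_mono) auto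
  finally show ?thesis .
qed

lemma nn2_T: "nn2 T \<le> ennreal (6 * A)"
proof -
  have "nn2 T \<le> 2 * nn2 (G 1) + 4 * nn2 (G 2)"
    unfolding T_def numeral_2_eq_2 One_nat_def by (rule Hl_bound[OF deriv G_cont G_sup nn2_fin]) auto
  also have "\<dots> \<le> 2 * ennreal A + 4 * ennreal A" by (intro add_mono mult_left_mono nn2_bound) auto
  also have "\<dots> = ennreal (6 * A)" using A by (simp add: ennreal_mult flip: distrib_right)
  finally show ?thesis .
qed

lemma hl_G_integrable: "integrable lborel (hl_int (G 1) x)"
  by (rule hl_int_integrable[OF _ G_lip nn2_fin]) auto

lemma T_diff: "T x - T (x + a) = Hl (\<lambda>z. G 1 z - G 1 (z + a)) x"
proof -
  have "hl_int (\<lambda>z. G 1 z - G 1 (z + a)) x u = hl_int (G 1) x u - hl_int (G 1) (x + a) u" for u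
  proof -
    have e: "x + a - u = x - u + a" "x + a + u = x + u + a" by simp_all
    have "i * ((P - P' - (Q - Q')) / u) = i * ((P - Q) / u) - i * ((P' - Q') / u)" for i P P' Q Q' :: real
      by (simp add: divide_inverse algebra_simps)
    then show ?thesis unfolding hl_int_def e .
  qed
  then have "hl_int (\<lambda>z. G 1 z - G 1 (z + a)) x = (\<lambda>u. hl_int (G 1) x u - hl_int (G 1) (x + a) u)" by blast
  then show ?thesis
    unfolding T_def Hl_def using hl_G_integrable by (simp only: Bochner_Integration.integral_diff diff_divide_distrib)
qed

lemma nn2_shift: "j \<in> {1,2,3} \<Longrightarrow> nn2 (\<lambda>x. G j x - G j (x + a)) \<le> ennreal (2 * A * a\<^sup>2)"
proof -
  assume j: "j \<in> {1,2,3}"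
  have "nn2 (\<lambda>x. G j x - G j (x + a)) \<le> ennreal (2 * a\<^sup>2) * nn2 (G (Suc j))"
    using nn2_translate_diff[OF deriv G_cont, where a=0 and b=a] by simp
  also have "\<dots> \<le> ennreal (2 * a\<^sup>2) * ennreal A" using j by (intro mult_left_mono nn2_bound) auto
  also have "\<dots> = ennreal (2 * A * a\<^sup>2)" using A by (simp add: ennreal_mult[symmetric] mult_ac)
  finally show ?thesis .
qed

lemma shift_deriv: "((\<lambda>z. G j z - G j (z + a)) has_real_derivative G (Suc j) x - G (Suc j) (x + a)) (at x)"
proof -
  have "((\<lambda>z. z + a) has_real_derivative 1) (at x)" by (auto intro!: derivative_eq_intros)
  from DERIV_diff[OF deriv DERIV_chain2[OF deriv this]] show ?thesis by simp
qed

lemma nn2_T_diff: "nn2 (\<lambda>x. T x - T (x + a)) \<le> ennreal (12 * A * a\<^sup>2)"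
proof -
  have b: "\<bar>G 2 x - G 2 (x + a)\<bar> \<le> B * \<bar>a\<bar>" for x using G_lip[of 2 x "x + a"] by simp
  have "nn2 (\<lambda>x. T x - T (x + a)) \<le> 2 * nn2 (\<lambda>x. G 1 x - G 1 (x + a)) + 4 * nn2 (\<lambda>x. G 2 x - G 2 (x + a))"
    unfolding T_diff
  proof (rule Hl_bound[where B="B * \<bar>a\<bar>"])
    show "((\<lambda>z. G 1 z - G 1 (z + a)) has_real_derivative G 2 x - G 2 (x + a)) (at x)" for x
      using shift_deriv[of 1 a x] by (simp add: numeral_2_eq_2)
    show "continuous_on UNIV (\<lambda>x. G 2 x - G 2 (x + a))"
      by (intro continuous_intros G_cont continuous_on_compose2[OF G_cont]) auto
    show "nn2 (\<lambda>z. G 1 z - G 1 (z + a)) < \<infinity>" using nn2_shift[of 1 a] by (auto intro: le_less_trans)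
  qed (rule b)
  also have "\<dots> \<le> 2 * ennreal (2 * A * a\<^sup>2) + 4 * ennreal (2 * A * a\<^sup>2)"
    by (intro add_mono mult_left_mono nn2_shift) auto
  also have "\<dots> = 6 * ennreal (2 * A * a\<^sup>2)" by (simp flip: distrib_right)
  also have "\<dots> = ennreal (6 * (2 * A * a\<^sup>2))" using A by (simp only: ennreal_mult mult_nonneg_nonneg zero_le_power2 zero_le_numeral ennreal_numeral)
  finally show ?thesis by (simp add: mult.assoc)
qed

lemma nn2_T_diff': "nn2 (\<lambda>x. T x - T (x + a)) \<le> ennreal (24 * A)"
proof -
  have "nn2 (\<lambda>x. T x - T (x + a)) \<le> 2 * nn2 T + 2 * nn2 T"
    using nn2_diff_le[of T "\<lambda>x. T (x + a)"] nn2_translate[OF T_meas, of a] by simp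
  also have "\<dots> = 4 * nn2 T" by (simp flip: distrib_right)
  also have "\<dots> \<le> 4 * ennreal (6 * A)" by (intro mult_left_mono nn2_T) auto
  also have "\<dots> = ennreal (24 * A)" using A by (simp add: ennreal_mult mult.assoc[symmetric])
  finally show ?thesis .
qed

text \<open>A difference quotient of \<open>T\<close> is \<open>Hl\<close> of the corresponding
  difference quotient of \<open>G 1\<close>. The latter is B-Lipschitz because \<open>G 2\<close>
  is, and its squared norm is at most 2 A, both independently of a.\<close>

lemma T_lip: "\<bar>T x - T (x + a)\<bar> \<le> M0 * \<bar>a\<bar>"
proof (cases "a = 0")
  case False
  let ?g = "\<lambda>z. (G 1 z - G 1 (z + a)) / a"
  have "hl_int ?g x u = hl_int (\<lambda>z. G 1 z - G 1 (z + a)) x u / a" for u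
  proof -
    have "i * ((P / a - Q / a) / u) = i * ((P - Q) / u) / a" for i P Q :: real
      by (simp add: divide_inverse algebra_simps)
    then show ?thesis unfolding hl_int_def .
  qed
  then have "Hl ?g x = (T x - T (x + a)) / a"
    unfolding T_diff by (simp add: Hl_def)
  moreover have "\<bar>Hl ?g x\<bar> \<le> (2 * B + pi + 2 * (2 * A)) / pi"
  proof (rule Hl_abs_le)
    show "\<bar>?g p - ?g q\<bar> \<le> B * \<bar>p - q\<bar>" for p q
    proof (rule Lipschitz_of_deriv)
      show "(?g has_real_derivative (G 2 x - G 2 (x + a)) / a) (at x)" for x
        using DERIV_cdivide[OF shift_deriv[of 1 a x]] by (simp add: numeral_2_eq_2)
      show "\<bar>(G 2 x - G 2 (x + a)) / a\<bar> \<le> B" for x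
        using G_lip[of 2 x "x + a"] False by (simp add: pos_divide_le_eq)
    qed
    have "nn2 ?g = (\<integral>\<^sup>+x. ennreal (1 / a\<^sup>2) * ennreal ((G 1 x - G 1 (x + a))\<^sup>2) \<partial>lborel)"
      unfolding nn2_def by (simp add: power_divide ennreal_mult[symmetric])
    also have "\<dots> = ennreal (1 / a\<^sup>2) * nn2 (\<lambda>x. G 1 x - G 1 (x + a))"
      unfolding nn2_def by (rule nn_integral_cmult) measurable
    also have "\<dots> \<le> ennreal (1 / a\<^sup>2) * ennreal (2 * A * a\<^sup>2)" by (intro mult_left_mono nn2_shift) auto
    also have "\<dots> = ennreal (2 * A)" using False A by (subst ennreal_mult[symmetric]) auto
    finally show "nn2 ?g \<le> ennreal (2 * A)" .
  qed (use A in auto)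
  ultimately show ?thesis using False by (simp add: M0_def pos_divide_le_eq)
qed simp

text \<open>The difference quotient of \<open>G 0\<close> between y and x, written as a mean of
  \<open>G 1\<close> over the segment, hence regular across the diagonal; \<open>kap\<close> below
  is the same quotient with the value 0 at x = y.\<close>

definition avg :: "real \<Rightarrow> real \<Rightarrow> real" where
  "avg y x = (LINT s|lborel. indicator {0..1} s * G 1 (y + s * (x - y)))"

definition Mavg :: "real \<Rightarrow> real \<Rightarrow> real" where
  "Mavg y x = (LINT s|lborel. indicator {0..1} s * T (y + s * (x - y)))"

lemma indicator_bounded_integrable:
  assumes [measurable]: "f \<in> borel_measurable borel" and "\<And>s. \<bar>f s\<bar> \<le> (C :: real)"
  shows "integrable lborel (\<lambda>s. indicator {0..1::real} s * f s)"
proof (rule Bochner_Integration.integrable_bound)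
  show "integrable lborel (\<lambda>s :: real. indicator {0..1} s * C)" by (simp add: integrable_mult_left)
  show "AE s in lborel. norm (indicator {0..1} s * f s) \<le> norm (indicator {0..1} s * C)"
    using assms(2) order.trans[OF abs_ge_zero assms(2)] by (auto simp: indicator_def)
qed measurable

lemma avg_integrable: "integrable lborel (\<lambda>s. indicator {0..1} s * G 1 (y + s * (x - y)))"
  by (rule indicator_bounded_integrable[OF _ G_sup]) auto

lemma Mavg_integrable: "integrable lborel (\<lambda>s. indicator {0..1} s * T (y + s * (x - y)))"
  by (rule indicator_bounded_integrable[OF _ T_sup]) measurable

lemma avg_eq: "(x - y) * avg y x = G 0 x - G 0 y"
proof -
  have "(LINT s|lborel. indicator {0..1} s *\<^sub>R (G 1 (y + s * (x - y)) * (x - y))) = G 0 (y + 1 * (x - y)) - G 0 (y + 0 * (x - y))"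
  proof (rule integral_FTC_Icc)
    show "((\<lambda>s. G 0 (y + s * (x - y))) has_vector_derivative G 1 (y + s * (x - y)) * (x - y)) (at s within {0..1})" for s
    proof -
      have "((\<lambda>s. y + s * (x - y)) has_real_derivative (x - y)) (at s)" by (auto intro!: derivative_eq_intros)
      from DERIV_chain2[OF deriv[of 0] this] show ?thesis
        by (simp add: has_real_derivative_iff_has_vector_derivative has_vector_derivative_at_within)
    qed
    show "continuous_on {0..1} (\<lambda>s. G 1 (y + s * (x - y)) * (x - y))"
      by (intro continuous_intros continuous_on_compose2[OF G_cont]) auto
  qed simp
  moreover have "(\<lambda>s. indicator {0..1} s *\<^sub>R (G 1 (y + s * (x - y)) * (x - y))) = (\<lambda>s. (x - y) * (indicator {0..1} s * G 1 (y + s * (x - y))))"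
    by (auto simp: fun_eq_iff)
  ultimately show ?thesis by (simp add: avg_def)
qed

lemma avg_meas [measurable]: "avg y \<in> borel_measurable borel"
  unfolding avg_def[abs_def] by measurable

lemma Mavg_sym: "Mavg y x = Mavg x y"
proof -
  have "Mavg y x = (LINT s|lborel. indicator {0..1} (1 - s) * T (y + (1 - s) * (x - y)))"
    unfolding Mavg_def by (subst lborel_integral_real_affine[of "-1" _ 1]) simp_all
  also have "\<dots> = Mavg x y"
    unfolding Mavg_def by (intro Bochner_Integration.integral_cong refl arg_cong2[of _ _ _ _ "(*)"] arg_cong[of _ _ T])
      (auto simp: indicator_def algebra_simps)
  finally show ?thesis .
qed

text \<open>For s > 0 the substitution u -> s u removes s from the inner integral, so
  \<open>hl_int_nn_le\<close> bounds it uniformly; this permits exchanging the mean over s with the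
  Hilbert transform.\<close>

lemma scaled_integrable:
  "integrable (lborel \<Otimes>\<^sub>M lborel) (\<lambda>(s, u). indicator {0..1} s * (s * hl_int (G 1) (y + s * (x - y)) (s * u)))"
proof (rule integrableI_bounded)
  let ?F = "\<lambda>(s, u). indicator {0..1} s * (s * hl_int (G 1) (y + s * (x - y)) (s * u))"
  show m: "?F \<in> borel_measurable (lborel \<Otimes>\<^sub>M lborel)" unfolding hl_int_def by measurable
  let ?C = "ennreal (2 * B + pi) + 2 * nn2 (G 1)"
  have "(\<integral>\<^sup>+z. ennreal (norm (?F z)) \<partial>(lborel \<Otimes>\<^sub>M lborel)) = (\<integral>\<^sup>+s. \<integral>\<^sup>+u. ennreal (norm (?F (s, u))) \<partial>lborel \<partial>lborel)"
    by (rule lborel.nn_integral_fst[symmetric]) (use m in measurable)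
  also have "\<dots> \<le> (\<integral>\<^sup>+s. ?C * indicator {0..1} (s::real) \<partial>lborel)"
  proof (rule nn_integral_mono)
    fix s :: real
    let ?w = "y + s * (x - y)"
    show "(\<integral>\<^sup>+u. ennreal (norm (?F (s, u))) \<partial>lborel) \<le> ?C * indicator {0..1} s"
    proof (cases "0 < s \<and> s \<le> 1")
      case True
      have [measurable]: "hl_int (G 1) ?w \<in> borel_measurable borel" by (rule hl_int_meas) measurable
      have "(\<integral>\<^sup>+u. ennreal (norm (?F (s, u))) \<partial>lborel) = (\<integral>\<^sup>+u. ennreal s * ennreal \<bar>hl_int (G 1) ?w (s * u)\<bar> \<partial>lborel)"
        using True by (intro nn_integral_cong) (simp add: abs_mult ennreal_mult)
      also have "\<dots> = ennreal s * (\<integral>\<^sup>+u. ennreal \<bar>hl_int (G 1) ?w (s * u)\<bar> \<partial>lborel)"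
        by (rule nn_integral_cmult) measurable
      also have "\<dots> = (\<integral>\<^sup>+u. ennreal \<bar>hl_int (G 1) ?w u\<bar> \<partial>lborel)"
      proof -
        have "(\<lambda>u. ennreal \<bar>hl_int (G 1) ?w u\<bar>) \<in> borel_measurable borel" by measurable
        from nn_integral_real_affine[OF this, of s 0] show ?thesis using True by simp
      qed
      also have "\<dots> \<le> ?C" by (rule hl_int_nn_le[OF _ G_lip]) auto
      finally show ?thesis using True by simp
    next
      case False
      then have "(\<lambda>u. ennreal (norm (?F (s, u)))) = (\<lambda>u. 0)" by (auto simp: indicator_def fun_eq_iff)
      then show ?thesis by (simp only:) simp
    qed
  qed
  also have "\<dots> = ?C" by (simp add: nn_integral_cmult_indicator)
  also have "\<dots> < \<infinity>" using nn2_fin[of 1] by (simp add: ennreal_mult_less_top)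
  finally show "(\<integral>\<^sup>+z. ennreal (norm (?F z)) \<partial>(lborel \<Otimes>\<^sub>M lborel)) < \<infinity>" .
qed

text \<open>Moving x by u moves the point y + s (x - y) by s u, whence the dilated integrand and the
  factor s.\<close>

lemma hl_avg: "hl_int (avg y) x u = (LINT s|lborel. indicator {0..1} s * (s * hl_int (G 1) (y + s * (x - y)) (s * u)))"
proof (cases "0 < u")
  case True
  have "avg y (x - u) - avg y (x + u)
      = (LINT s|lborel. indicator {0..1} s * G 1 (y + s * (x - u - y)) - indicator {0..1} s * G 1 (y + s * (x + u - y)))"
    unfolding avg_def using avg_integrable by simp
  also have "\<dots> = (LINT s|lborel. u * (indicator {0..1} s * (s * hl_int (G 1) (y + s * (x - y)) (s * u))))"
  proof (rule Bochner_Integration.integral_cong[OF refl])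
    fix s :: real
    have e: "y + s * (x - u - y) = y + s * (x - y) - s * u" "y + s * (x + u - y) = y + s * (x - y) + s * u"
      by (simp_all add: algebra_simps)
    have key: "indicator {0..1} s * P - indicator {0..1} s * Q = u * (indicator {0..1} s * (s * (indicator {0<..} (s * u) * ((P - Q) / (s * u)))))"
      if "s = 0 \<Longrightarrow> P = Q" for P Q :: real
      using that True by (cases "s = 0") (auto simp: indicator_def zero_less_mult_iff field_simps)
    show "indicator {0..1} s * G 1 (y + s * (x - u - y)) - indicator {0..1} s * G 1 (y + s * (x + u - y))
        = u * (indicator {0..1} s * (s * hl_int (G 1) (y + s * (x - y)) (s * u)))"
      unfolding hl_int_def e by (rule key) simp
  qed
  finally show ?thesis using True by (simp add: hl_int_def)
next
  case False
  then have "(\<lambda>s. indicator {0..1} s * (s * hl_int (G 1) (y + s * (x - y)) (s * u))) = (\<lambda>s. 0)"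
    by (auto simp: fun_eq_iff hl_int_def indicator_def zero_less_mult_iff)
  then show ?thesis using False by (simp only:) (simp add: hl_int_def)
qed

lemma hl_avg_integrable: "integrable lborel (hl_int (avg y) x)"
  unfolding hl_avg by (rule lborel_pair.integrable_snd[OF scaled_integrable])

lemma Hl_avg: "(LINT u|lborel. hl_int (avg y) x u) = pi * Mavg y x"
proof -
  have "(LINT u|lborel. hl_int (avg y) x u)
      = (LINT s|lborel. LINT u|lborel. indicator {0..1} s * (s * hl_int (G 1) (y + s * (x - y)) (s * u)))"
    unfolding hl_avg by (rule lborel_pair.Fubini_integral[OF scaled_integrable])
  also have "\<dots> = (LINT s|lborel. indicator {0..1} s * (pi * T (y + s * (x - y))))"
  proof (rule integral_cong_AE)
    show "AE s in lborel. (LINT u|lborel. indicator {0..1} s * (s * hl_int (G 1) (y + s * (x - y)) (s * u))) = indicator {0..1} s * (pi * T (y + s * (x - y)))"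
      using AE_lborel_singleton[of "0::real"]
    proof eventually_elim
      case (elim s)
      show ?case
      proof (cases "s \<in> {0..1}")
        case True
        then show ?thesis using elim lborel_integral_real_affine[of s "hl_int (G 1) (y + s * (x - y))" 0]
          by (simp add: T_def Hl_def)
      qed simp
    qed
    show "(\<lambda>s. LINT u|lborel. indicator {0..1} s * (s * hl_int (G 1) (y + s * (x - y)) (s * u))) \<in> borel_measurable lborel"
      using lborel_pair.integrable_fst[OF scaled_integrable, of y x] by (rule borel_measurable_integrable)
  qed measurable
  also have "\<dots> = (LINT s|lborel. pi * (indicator {0..1} s * T (y + s * (x - y))))" by (simp add: mult.left_commute)
  also have "\<dots> = pi * Mavg y x" by (simp add: Mavg_def)
  finally show ?thesis .
qed

lemma \<delta>2_le: "\<bar>\<delta>2 (G 0) u x\<bar> \<le> B * u\<^sup>2" "\<bar>\<delta>2 (G 0) u x\<bar> \<le> 4"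
proof -
  have "\<bar>(G 0 x - G 0 (x + - u)) - (G 0 (x + u) - G 0 (x + u + - u))\<bar> \<le> (B * \<bar>u\<bar>) * \<bar>x - (x + u)\<bar>"
  proof (rule Lipschitz_of_deriv[where g="\<lambda>z. G 0 z - G 0 (z + - u)"])
    show "\<bar>G (Suc 0) z - G (Suc 0) (z + - u)\<bar> \<le> B * \<bar>u\<bar>" for z using G_lip[of "Suc 0" z "z + - u"] by simp
  qed (rule shift_deriv)
  then show "\<bar>\<delta>2 (G 0) u x\<bar> \<le> B * u\<^sup>2" by (simp add: \<delta>2_def power2_eq_square mult.assoc algebra_simps)
  show "\<bar>\<delta>2 (G 0) u x\<bar> \<le> 4"
    unfolding \<delta>2_def using bound[of x] bound[of "x - u"] bound[of "x + u"] by linarith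
qed

lemma frac_G_integrable: "integrable lborel (frac_int (G 0) x)"
proof (rule Bochner_Integration.integrable_bound)
  show "integrable lborel (\<lambda>u. (2 * B + 8) * pk u)" using pk_integrable by simp
  show "frac_int (G 0) x \<in> borel_measurable lborel" unfolding frac_int_def \<delta>2_def by measurable
  have "\<bar>frac_int (G 0) x u\<bar> \<le> (2 * B + 8) * pk u" for u
  proof (cases "0 < u")
    case True
    have e: "\<bar>frac_int (G 0) x u\<bar> = \<bar>\<delta>2 (G 0) u x\<bar> * inverse (u\<^sup>2)"
      using True by (simp add: frac_int_def divide_inverse abs_mult)
    show ?thesis
    proof (cases "u \<le> 1")
      case le: True
      have "\<bar>frac_int (G 0) x u\<bar> \<le> B * u\<^sup>2 * inverse (u\<^sup>2)"
        unfolding e by (intro mult_right_mono \<delta>2_le) auto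
      also have "\<dots> = B * 1" using True by simp
      also have "\<dots> \<le> B * (2 * pk u)" using B one_le_pk[of u] True le by (intro mult_left_mono) auto
      finally show ?thesis using pk_pos[of u] by (simp add: algebra_simps)
    next
      case False
      have "\<bar>frac_int (G 0) x u\<bar> \<le> 4 * (2 * pk u)"
        unfolding e by (intro mult_mono \<delta>2_le inverse_sq_le_pk) (use False in auto)
      then show ?thesis using mult_nonneg_nonneg[OF B(1) less_imp_le[OF pk_pos[of u]]] by (simp add: algebra_simps)
    qed
  qed (use B pk_pos[of u] in \<open>simp add: frac_int_def\<close>)
  then show "AE u in lborel. norm (frac_int (G 0) x u) \<le> norm ((2 * B + 8) * pk u)"
    by (intro AE_I2) (simp add: order.trans[OF _ abs_ge_self])
qed

text \<open>Integration by parts: - \<delta>2/u is a primitive of the difference of the two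
  integrands, since the u-derivative of \<delta>2 is G 1 (x - u) - G 1 (x + u). It vanishes at 0 by
  the bound B u^2 and at infinity by the bound 4.\<close>

lemma frac_G: "(LINT u|lborel. frac_int (G 0) x u) = pi * T x"
proof -
  let ?F = "\<lambda>u. - (\<delta>2 (G 0) u x / u)" and ?f = "\<lambda>u. \<delta>2 (G 0) u x / u\<^sup>2 - (G 1 (x - u) - G 1 (x + u)) / u"
  have i: "integrable lborel (\<lambda>u. frac_int (G 0) x u - hl_int (G 1) x u)"
    using frac_G_integrable hl_G_integrable by simp
  have e: "(\<lambda>u. frac_int (G 0) x u - hl_int (G 1) x u) = (\<lambda>u. indicator (einterval 0 \<infinity>) u *\<^sub>R ?f u)"
    by (auto simp: frac_int_def hl_int_def einterval_def indicator_def fun_eq_iff)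
  have \<delta>c: "continuous_on UNIV (\<lambda>u. \<delta>2 (G 0) u x)"
    unfolding \<delta>2_def by (intro continuous_intros continuous_on_compose2[OF G_cont]) auto
  have l0: "(?F \<longlongrightarrow> 0) (at_right 0)"
  proof (rule tendsto_rabs_zero_cancel, rule tendsto_sandwich[where f="\<lambda>_. 0" and h="\<lambda>u. B * u"])
    have "\<bar>?F u\<bar> \<le> B * u" if "0 < u" for u
      using \<delta>2_le(1)[of u x] that by (simp add: pos_divide_le_eq power2_eq_square mult.assoc)
    then show "\<forall>\<^sub>F u in at_right 0. \<bar>?F u\<bar> \<le> B * u" by (auto simp: eventually_at_right_field intro: exI[of _ 1])
    show "((\<lambda>u. B * u) \<longlongrightarrow> 0) (at_right 0)" by (auto intro!: tendsto_eq_intros)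
  qed auto
  have l1: "(?F \<longlongrightarrow> 0) at_top"
  proof (rule tendsto_rabs_zero_cancel, rule tendsto_sandwich[where f="\<lambda>_. 0" and h="\<lambda>u. 4 / u"])
    have "\<bar>?F u\<bar> \<le> 4 / u" if "0 < u" for u
      using \<delta>2_le(2)[of u x] that by (simp add: divide_right_mono)
    then show "\<forall>\<^sub>F u in at_top. \<bar>?F u\<bar> \<le> 4 / u" using eventually_gt_at_top[of 0] by (rule eventually_mono[rotated]) auto
    show "((\<lambda>u::real. 4 / u) \<longlongrightarrow> 0) at_top" by real_asymp
  qed auto
  have "(LBINT u=0..\<infinity>. ?f u) = 0 - 0"
  proof (rule interval_integral_FTC_integrable)
    fix u assume "0 < ereal u" then have u: "0 < u" by simp
    have "((\<lambda>u. x - u) has_real_derivative -1) (at u)" "((\<lambda>u. x + u) has_real_derivative 1) (at u)"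
      by (auto intro!: derivative_eq_intros)
    from DERIV_diff[OF DERIV_diff[OF DERIV_const[of "2 * G 0 x"] DERIV_chain2[OF deriv[of 0] this(1)]] DERIV_chain2[OF deriv[of 0] this(2)]]
    have \<delta>d: "((\<lambda>u. \<delta>2 (G 0) u x) has_real_derivative G 1 (x - u) - G 1 (x + u)) (at u)"
      unfolding \<delta>2_def by (rule DERIV_cong) simp
    have "(?F has_real_derivative ?f u) (at u)"
      by (rule DERIV_cong[OF DERIV_minus[OF DERIV_divide[OF \<delta>d DERIV_ident less_imp_neq[OF u, symmetric]]]])
        (use u in \<open>simp add: field_simps power2_eq_square\<close>)
    then show "(?F has_vector_derivative ?f u) (at u)" by (simp add: has_real_derivative_iff_has_vector_derivative)
    have c1: "isCont (\<lambda>u. \<delta>2 (G 0) u x) u" using \<delta>c by (simp add: continuous_on_eq_continuous_at)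
    have c2: "isCont (\<lambda>u. G 1 (x - u)) u" "isCont (\<lambda>u. G 1 (x + u)) u"
      by (intro isCont_o2[OF _ DERIV_isCont[OF deriv]] continuous_intros)+
    show "isCont ?f u" using u c1 c2 by (intro continuous_intros) auto
  next
    show "set_integrable lborel (einterval 0 \<infinity>) ?f" using i unfolding e set_integrable_def .
    show "((?F \<circ> real_of_ereal) \<longlongrightarrow> 0) (at_right 0)"
      using l0 unfolding zero_ereal_def by (simp add: ereal_tendsto_simps)
    show "((?F \<circ> real_of_ereal) \<longlongrightarrow> 0) (at_left \<infinity>)" using l1 by (simp add: ereal_tendsto_simps)
  qed simp
  then have "(LINT u|lborel. frac_int (G 0) x u - hl_int (G 1) x u) = 0"
    unfolding e by (simp add: interval_lebesgue_integral_def set_lebesgue_integral_def)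
  then show ?thesis using frac_G_integrable hl_G_integrable by (simp add: T_def Hl_def)
qed

text \<open>The Hilbert transform commutes with translations and dilations, so that of the average \<open>avg y\<close> is
  \<open>Mavg y\<close>; hence \<open>dd x y\<close> is \<open>|\<nabla>|\<close> of the difference quotient, and is \<open>0\<close> for \<open>x = y\<close>.\<close>

definition dd :: "real \<Rightarrow> real \<Rightarrow> real" where
  "dd x y = inverse (x - y) * (T x - Mavg y x)"

text \<open>\<open>G 0\<close> is a constant plus (x - y) \<open>avg y x\<close>, and the second
  difference of a product with a linear factor is that factor times the second difference plus u
  times a symmetric first difference. Divided by u^2 this reads |\<nabla>|((x - y) f) = (x - y)
  |\<nabla>| f + H f.\<close>

lemma frac_avg:
  assumes "x \<noteq> y"
  shows "integrable lborel (frac_int (avg y) x)" "(LINT u|lborel. frac_int (avg y) x u) = pi * dd x y"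
proof -
  have e: "frac_int (avg y) x u = inverse (x - y) * (frac_int (G 0) x u - hl_int (avg y) x u)" for u
  proof (cases "0 < u")
    case True
    have "\<delta>2 (G 0) u x = (x - y) * \<delta>2 (avg y) u x + u * (avg y (x - u) - avg y (x + u))"
      using avg_eq[of x y] avg_eq[of "x - u" y] avg_eq[of "x + u" y] by (simp add: \<delta>2_def algebra_simps)
    then have "\<delta>2 (G 0) u x / u\<^sup>2 - (avg y (x - u) - avg y (x + u)) / u = (x - y) * (\<delta>2 (avg y) u x / u\<^sup>2)"
      using True by (simp add: field_simps power2_eq_square)
    then have "frac_int (G 0) x u - hl_int (avg y) x u = (x - y) * frac_int (avg y) x u"
      using True by (simp add: frac_int_def hl_int_def)
    then show ?thesis using assms by simp
  qed (simp add: frac_int_def hl_int_def)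
  show "integrable lborel (frac_int (avg y) x)"
    unfolding e using frac_G_integrable hl_avg_integrable by simp
  show "(LINT u|lborel. frac_int (avg y) x u) = pi * dd x y"
    unfolding e using frac_G_integrable hl_avg_integrable frac_G Hl_avg by (simp add: dd_def algebra_simps)
qed

end

section \<open>Decay away from the diagonal, and symmetry of the fractional integral\<close>

lemma sq_decay:
  fixes c :: real
  assumes "\<bar>c\<bar> \<le> b1" "\<bar>u\<bar> * \<bar>c\<bar> \<le> b2"
  shows "c\<^sup>2 \<le> (2 * b1\<^sup>2 + 2 * b2\<^sup>2) * pk u"
proof (cases "\<bar>u\<bar> \<le> 1")
  case True
  have "c\<^sup>2 \<le> b1\<^sup>2" using power_mono[OF assms(1), of 2] by simp
  also have "\<dots> \<le> b1\<^sup>2 * (2 * pk u)" using mult_left_mono[OF one_le_pk[OF True], of "b1\<^sup>2"] by simp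
  also have "\<dots> \<le> (2 * b1\<^sup>2 + 2 * b2\<^sup>2) * pk u" using pk_pos[of u] by (simp add: algebra_simps)
  finally show ?thesis .
next
  case False
  have "(u * c)\<^sup>2 \<le> b2\<^sup>2" using power_mono[OF assms(2), of 2] by (simp add: power_mult_distrib)
  then have "inverse (u\<^sup>2) * (u * c)\<^sup>2 \<le> (2 * pk u) * b2\<^sup>2"
    by (intro mult_mono inverse_sq_le_pk) (use False pk_pos[of u] in auto)
  moreover have "inverse (u\<^sup>2) * (u * c)\<^sup>2 = c\<^sup>2" using False by (auto simp: power_mult_distrib)
  ultimately have "c\<^sup>2 \<le> 2 * b2\<^sup>2 * pk u" by (simp add: mult_ac)
  also have "\<dots> \<le> (2 * b1\<^sup>2 + 2 * b2\<^sup>2) * pk u" using pk_pos[of u] by (simp add: algebra_simps)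
  finally show ?thesis .
qed

lemma nn2_le_pk:
  assumes "\<And>x. (f x)\<^sup>2 \<le> C * pk (x - y)" "0 \<le> C"
  shows "nn2 f \<le> ennreal (C * pi)"
proof -
  have "nn2 f \<le> (\<integral>\<^sup>+x. ennreal C * ennreal (pk (x - y)) \<partial>lborel)"
    unfolding nn2_def using assms pk_pos by (intro nn_integral_mono) (simp add: ennreal_mult[symmetric] less_imp_le)
  also have "\<dots> = ennreal C * ennreal pi"
    using nn_integral_pk_shift[of y] by (subst nn_integral_cmult) simp_all
  finally show ?thesis using assms(2) by (simp add: ennreal_mult)
qed

lemma sq_integrable_nn2: "f \<in> borel_measurable borel \<Longrightarrow> nn2 f \<le> ennreal C \<Longrightarrow> sq_integrable lborel f"
  unfolding sq_integrable_iff_nn nn2_def[symmetric] by (auto intro: le_less_trans)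

text \<open>A quantity that is quadratic for small u and bounded for large u is, after division by
  u^2, dominated by the integrable weight \<open>pk\<close>.\<close>

lemma inverse_sq_mult_le_pk:
  assumes "J \<le> ennreal (C * u\<^sup>2)" "J \<le> ennreal C" "0 \<le> C"
  shows "ennreal (inverse (u\<^sup>2)) * J \<le> ennreal (2 * C) * ennreal (pk u)"
proof -
  have p: "0 \<le> pk u" using pk_pos[of u] by simp
  have "ennreal (inverse (u\<^sup>2)) * J \<le> ennreal (C * (2 * pk u))"
  proof (cases "\<bar>u\<bar> \<le> 1")
    case True
    have "ennreal (inverse (u\<^sup>2)) * J \<le> ennreal (inverse (u\<^sup>2)) * ennreal (C * u\<^sup>2)" by (intro mult_left_mono assms) auto
    also have "\<dots> = ennreal (inverse (u\<^sup>2) * (C * u\<^sup>2))" using assms(3) by (intro ennreal_mult[symmetric]) auto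
    also have "\<dots> \<le> ennreal C" using assms(3) by (intro ennreal_leI) (cases "u = 0", simp_all add: field_simps)
    also have "\<dots> \<le> ennreal (C * (2 * pk u))"
      using mult_left_mono[OF one_le_pk[OF True] assms(3)] by (intro ennreal_leI) simp
    finally show ?thesis .
  next
    case False
    have "ennreal (inverse (u\<^sup>2)) * J \<le> ennreal (2 * pk u) * ennreal C"
      by (intro mult_mono ennreal_leI inverse_sq_le_pk assms) (use False in auto)
    then show ?thesis using p assms(3) by (simp add: ennreal_mult[symmetric] mult_ac)
  qed
  then show ?thesis using p assms(3) by (simp add: ennreal_mult[symmetric] mult_ac)
qed

text \<open>The substitution y = x - u: kernels of difference quotients are estimated along each
  line x - y = u, where bounds for translates apply.\<close>

lemma nn_integral_difference_coordinates:
  assumes [measurable]: "(\<lambda>z. f (fst z) (snd z)) \<in> borel_measurable (borel \<Otimes>\<^sub>M borel)"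
    and le: "\<And>u. (\<integral>\<^sup>+x. f x (x - u) \<partial>lborel) \<le> ennreal C * ennreal (pk u)"
  shows "(\<integral>\<^sup>+z. f (fst z) (snd z) \<partial>(lborel \<Otimes>\<^sub>M lborel)) \<le> ennreal C * ennreal pi"
proof -
  have m2: "(\<lambda>(x, u). f x (x - u)) \<in> borel_measurable (lborel \<Otimes>\<^sub>M lborel)"
    using measurable_compose[OF _ assms(1), of "\<lambda>z. (fst z, fst z - snd z)" "lborel \<Otimes>\<^sub>M lborel"]
    by (simp add: case_prod_unfold)
  have m1: "(\<lambda>y. f x y) \<in> borel_measurable borel" for x
    using measurable_compose[OF _ assms(1), of "\<lambda>y. (x, y)" borel] by simp
  have "(\<integral>\<^sup>+z. f (fst z) (snd z) \<partial>(lborel \<Otimes>\<^sub>M lborel)) = (\<integral>\<^sup>+x. \<integral>\<^sup>+y. f x y \<partial>lborel \<partial>lborel)"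
    by (subst lborel.nn_integral_fst[symmetric]) simp_all
  also have "\<dots> = (\<integral>\<^sup>+x. \<integral>\<^sup>+u. f x (x - u) \<partial>lborel \<partial>lborel)"
    by (intro nn_integral_cong nn_integral_reflect[symmetric] m1)
  also have "\<dots> = (\<integral>\<^sup>+u. \<integral>\<^sup>+x. f x (x - u) \<partial>lborel \<partial>lborel)"
    by (rule lborel_pair.Fubini'[symmetric]) (rule m2)
  also have "\<dots> \<le> (\<integral>\<^sup>+u. ennreal C * ennreal (pk u) \<partial>lborel)" by (intro nn_integral_mono le)
  also have "\<dots> = ennreal C * ennreal pi" by (simp add: nn_integral_cmult nn_integral_pk)
  finally show ?thesis .
qed

lemma \<delta>2_symmetric:
  assumes a: "sq_integrable lborel a" and b: "sq_integrable lborel b"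
  shows "(LINT x|lborel. a x * \<delta>2 b u x) = (LINT x|lborel. \<delta>2 a u x * b x)"
proof -
  have sh: "sq_integrable lborel (\<lambda>x. g (x + v))" if g: "sq_integrable lborel g" for g :: "real \<Rightarrow> real" and v
  proof -
    have [measurable]: "g \<in> borel_measurable borel" using g by (simp add: sq_integrable_def)
    show ?thesis
      using g lborel_integrable_real_affine[of "\<lambda>y. (g y)\<^sup>2" 1 v] by (simp add: sq_integrable_def add.commute)
  qed
  note ip = sq_integrable_mult[OF a sh[OF b]] sq_integrable_mult[OF sh[OF a] b] sq_integrable_mult[OF a b]
  have t: "(LINT x|lborel. a x * b (x + v)) = (LINT x|lborel. a (x + - v) * b x)" for v
    by (subst lborel_integral_real_affine[of 1 _ "- v"]) (simp_all add: add.commute)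
  have "(LINT x|lborel. a x * \<delta>2 b u x) = (LINT x|lborel. 2 * (a x * b x) - a x * b (x + - u) - a x * b (x + u))"
    by (simp add: \<delta>2_def algebra_simps)
  also have "\<dots> = 2 * (LINT x|lborel. a x * b x) - (LINT x|lborel. a (x + u) * b x) - (LINT x|lborel. a (x + - u) * b x)"
    using ip t[of "- u"] t[of u] by (simp only: Bochner_Integration.integral_diff Bochner_Integration.integrable_diff
      integrable_mult_right integral_mult_right_zero minus_minus)
  also have "\<dots> = (LINT x|lborel. 2 * (a x * b x) - a (x + - u) * b x - a (x + u) * b x)"
    using ip by ((simp only: Bochner_Integration.integral_diff Bochner_Integration.integrable_diff
      integrable_mult_right integral_mult_right_zero); simp?)
  also have "\<dots> = (LINT x|lborel. \<delta>2 a u x * b x)"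
    by (simp add: \<delta>2_def algebra_simps)
  finally show ?thesis .
qed

context line_component
begin

lemma indicator_integral_le:
  assumes "f \<in> borel_measurable borel" "\<And>s. s \<in> {0..1} \<Longrightarrow> \<bar>f s\<bar> \<le> (C :: real)"
  shows "\<bar>LINT s|lborel. indicator {0..1::real} s * f s\<bar> \<le> C"
proof -
  have "\<bar>LINT s|lborel. indicator {0..1::real} s * f s\<bar> \<le> (LINT s|lborel. indicator {0..1::real} s * C)"
  proof (rule order.trans[OF integral_abs_bound integral_mono])
    show "integrable lborel (\<lambda>s::real. indicator {0..1} s * C)" by (simp add: integrable_mult_left)
    show "integrable lborel (\<lambda>s. \<bar>indicator {0..1::real} s * f s\<bar>)"
    proof (rule integrable_abs, rule Bochner_Integration.integrable_bound)
      show "integrable lborel (\<lambda>s::real. indicator {0..1} s * C)" by (simp add: integrable_mult_left)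
      show "AE s in lborel. norm (indicator {0..1} s * f s) \<le> norm (indicator {0..1} s * C)"
        using assms(2) by (intro AE_I2) (force simp: indicator_def)
    qed (use assms(1) in measurable)
    show "\<bar>indicator {0..1} s * f s\<bar> \<le> indicator {0..1} s * C" for s using assms(2)[of s] by (auto simp: indicator_def)
  qed
  then show ?thesis by simp
qed

text \<open>2 B^2 + 2 * 2^2 with B^2 = 8 A: the bounds B for the mean of \<open>G 1\<close> and 2
  for the increment of \<open>G 0\<close>, fed into \<open>sq_decay\<close>.\<close>

definition K1 :: real where "K1 = 16 * A + 8"

lemma K1: "0 \<le> K1" using A by (simp add: K1_def)

definition kap :: "real \<Rightarrow> real \<Rightarrow> real" where "kap x y = inverse (x - y) * (G 0 x - G 0 y)"

lemma kap_avg: "x \<noteq> y \<Longrightarrow> kap x y = avg y x"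
  unfolding kap_def avg_eq[symmetric] by simp

lemma avg_sq: "(avg y x)\<^sup>2 \<le> K1 * pk (x - y)"
proof -
  have "\<bar>avg y x\<bar> \<le> B" unfolding avg_def by (rule indicator_integral_le) (auto intro: G_sup)
  moreover have "\<bar>x - y\<bar> * \<bar>avg y x\<bar> \<le> 2"
    unfolding abs_mult[symmetric] avg_eq using bound[of x] bound[of y] by linarith
  ultimately have "(avg y x)\<^sup>2 \<le> (2 * B\<^sup>2 + 2 * 2\<^sup>2) * pk (x - y)" by (rule sq_decay)
  then show ?thesis by (simp add: K1_def B)
qed

lemma kap_sq: "(kap x y)\<^sup>2 \<le> K1 * pk (x - y)"
  using avg_sq[of y x] kap_avg[of x y] K1 pk_pos[of 0] by (cases "x = y") (auto simp: kap_def)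

lemma T_Mavg: "T x - Mavg y x = (LINT s|lborel. indicator {0..1} s * (T x - T (y + s * (x - y))))"
proof -
  have "(LINT s|lborel. indicator {0..1} s * (T x - T (y + s * (x - y))))
      = (LINT s|lborel. indicator {0..1} s * T x - indicator {0..1} s * T (y + s * (x - y)))"
    by (simp add: algebra_simps)
  also have "\<dots> = T x - Mavg y x"
    unfolding Mavg_def using Mavg_integrable by (subst Bochner_Integration.integral_diff) (simp_all add: integrable_mult_left)
  finally show ?thesis by simp
qed

text \<open>Near the diagonal the Lipschitz bound of \<open>T\<close> gives M0; away from it the
  supremum of \<open>T\<close> gives 2 M0 for the product with |x - y|.\<close>

lemma dd_sq: "(dd x y)\<^sup>2 \<le> (2 * M0\<^sup>2 + 2 * (2 * M0)\<^sup>2) * pk (x - y)"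
proof (rule sq_decay)
  have "\<bar>T x - Mavg y x\<bar> \<le> M0 * \<bar>x - y\<bar>"
    unfolding T_Mavg
  proof (rule indicator_integral_le)
    fix s :: real assume s: "s \<in> {0..1}"
    have "\<bar>T x - T (x + (s - 1) * (x - y))\<bar> \<le> M0 * \<bar>(s - 1) * (x - y)\<bar>" by (rule T_lip)
    also have "\<dots> \<le> M0 * (1 * \<bar>x - y\<bar>)"
      unfolding abs_mult using s M0 by (intro mult_left_mono mult_right_mono) auto
    also have "x + (s - 1) * (x - y) = y + s * (x - y)" by (simp add: algebra_simps)
    finally show "\<bar>T x - T (y + s * (x - y))\<bar> \<le> M0 * \<bar>x - y\<bar>" by simp
  qed measurable
  from mult_left_mono[OF this, of "\<bar>inverse (x - y)\<bar>"]
  have "\<bar>dd x y\<bar> \<le> \<bar>inverse (x - y)\<bar> * (M0 * \<bar>x - y\<bar>)" by (simp add: dd_def abs_mult)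
  also have "\<dots> \<le> M0" using M0 by (cases "x = y") (simp_all add: field_simps)
  finally show "\<bar>dd x y\<bar> \<le> M0" .
  have "\<bar>Mavg y x\<bar> \<le> M0" unfolding Mavg_def by (rule indicator_integral_le) (auto intro: T_sup)
  then have "\<bar>T x - Mavg y x\<bar> \<le> 2 * M0" using T_sup[of x] by linarith
  moreover have "\<bar>x - y\<bar> * \<bar>dd x y\<bar> \<le> \<bar>T x - Mavg y x\<bar>"
    unfolding dd_def abs_mult[symmetric] by (cases "x = y") (simp_all add: mult.assoc[symmetric])
  ultimately show "\<bar>x - y\<bar> * \<bar>dd x y\<bar> \<le> 2 * M0" by linarith
qed

lemma dd_meas2: "(\<lambda>z. dd (fst z) (snd z)) \<in> borel_measurable (borel \<Otimes>\<^sub>M borel)"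
proof -
  have "(\<lambda>(z, s). indicator {0..1} s * T (snd z + s * (fst z - snd z))) \<in> borel_measurable ((borel \<Otimes>\<^sub>M borel) \<Otimes>\<^sub>M lborel)"
    by measurable
  then have [measurable]: "(\<lambda>z. Mavg (snd z) (fst z)) \<in> borel_measurable (borel \<Otimes>\<^sub>M borel)"
    unfolding Mavg_def by (rule lborel.borel_measurable_lebesgue_integral)
  show ?thesis unfolding dd_def by measurable
qed

lemma dd_meas: "(\<lambda>x. dd x y) \<in> borel_measurable borel"
  using measurable_compose[OF _ dd_meas2, of "\<lambda>x. (x, y)" borel] by simp

lemma kap_meas2: "(\<lambda>z. kap (fst z) (snd z)) \<in> borel_measurable (borel \<Otimes>\<^sub>M borel)"
  unfolding kap_def by measurable

lemma kap_meas [measurable]: "(\<lambda>x. kap x y) \<in> borel_measurable borel"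
  unfolding kap_def by measurable

lemma avg_nn2: "nn2 (avg y) \<le> ennreal (K1 * pi)"
  by (rule nn2_le_pk[OF avg_sq K1])

lemma avg_sq_int: "sq_integrable lborel (avg y)"
  by (rule sq_integrable_nn2[OF avg_meas avg_nn2])

text \<open>\<open>Mavg\<close> is symmetric in x and y while 1/(x - y) is odd, so the means
  cancel.\<close>

lemma dd_sum: "dd x y + dd y x = inverse (x - y) * (T x - T y)"
proof -
  have "inverse (y - x) = - inverse (x - y)" using inverse_minus_eq[of "x - y"] by simp
  then show ?thesis unfolding dd_def Mavg_sym[of x y] by (simp only:) (simp add: algebra_simps)
qed

lemma \<delta>2_G_nn2: "nn2 (\<delta>2 (G 1) v) \<le> ennreal (4 * A * v ^ 4)"
proof -
  let ?k = "\<lambda>z. G 1 z - G 1 (z + - v)"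
  have "\<delta>2 (G 1) v = (\<lambda>x. ?k (x + 0) - ?k (x + v))" by (auto simp: \<delta>2_def fun_eq_iff)
  then have "nn2 (\<delta>2 (G 1) v) = nn2 (\<lambda>x. ?k (x + 0) - ?k (x + v))" by (rule arg_cong)
  also have "\<dots> \<le> ennreal (2 * (0 - v)\<^sup>2) * nn2 (\<lambda>z. G 2 z - G 2 (z + - v))"
  proof (rule nn2_translate_diff)
    show "(?k has_real_derivative G 2 x - G 2 (x + - v)) (at x)" for x
      using shift_deriv[of 1 "- v" x] by (simp add: numeral_2_eq_2)
    show "continuous_on UNIV (\<lambda>z. G 2 z - G 2 (z + - v))"
      by (intro continuous_intros G_cont continuous_on_compose2[OF G_cont]) auto
  qed
  also have "\<dots> \<le> ennreal (2 * (0 - v)\<^sup>2) * ennreal (2 * A * (- v)\<^sup>2)" by (intro mult_left_mono nn2_shift) auto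
  also have "\<dots> = ennreal (4 * A * v ^ 4)"
    using A by (subst ennreal_mult[symmetric]) (auto simp: power2_eq_square power4_eq_xxxx mult_ac)
  finally show ?thesis .
qed

lemma \<delta>2_avg: "\<delta>2 (avg y) u x = (LINT s|lborel. indicator {0..1} s * \<delta>2 (G 1) (s * u) (y + s * (x - y)))"
proof -
  have e: "y + s * (x - u - y) = y + s * (x - y) - s * u" "y + s * (x + u - y) = y + s * (x - y) + s * u" for s
    by (simp_all add: algebra_simps)
  have "(LINT s|lborel. indicator {0..1} s * \<delta>2 (G 1) (s * u) (y + s * (x - y)))
      = (LINT s|lborel. 2 * (indicator {0..1} s * G 1 (y + s * (x - y))) - indicator {0..1} s * G 1 (y + s * (x - u - y))
          - indicator {0..1} s * G 1 (y + s * (x + u - y)))"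
    unfolding e by (simp add: \<delta>2_def algebra_simps)
  also have "\<dots> = \<delta>2 (avg y) u x"
    unfolding \<delta>2_def avg_def using avg_integrable
    by (simp only: Bochner_Integration.integral_diff Bochner_Integration.integrable_diff
      integrable_mult_right integral_mult_right_zero)
  finally show ?thesis by simp
qed

lemma \<delta>2_avg_meas [measurable]: "\<delta>2 (avg y) u \<in> borel_measurable borel"
  unfolding \<delta>2_def[abs_def] by measurable

text \<open>The second difference of the mean is a mean of second differences with step s u.
  Substituting y + s (x - y) for x costs a factor 1/s, which the fourth power (s u)^4
  absorbs.\<close>

lemma \<delta>2_avg_nn2: "nn2 (\<delta>2 (avg y) u) \<le> ennreal (4 * A * u ^ 4)"
proof -
  have [measurable]: "(\<lambda>(x, s). \<delta>2 (G 1) (s * u) (y + s * (x - y))) \<in> borel_measurable (lborel \<Otimes>\<^sub>M lborel)"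
    unfolding \<delta>2_def by measurable
  have [measurable]: "\<delta>2 (G 1) v \<in> borel_measurable borel" for v unfolding \<delta>2_def[abs_def] by measurable
  let ?d = "\<lambda>x s. ennreal ((\<delta>2 (G 1) (s * u) (y + s * (x - y)))\<^sup>2) * indicator {0..1} s"
  have "nn2 (\<delta>2 (avg y) u) \<le> (\<integral>\<^sup>+x. \<integral>\<^sup>+s. ?d x s \<partial>lborel \<partial>lborel)"
    unfolding nn2_def
  proof (rule nn_integral_mono)
    fix x
    let ?b = "\<lambda>s. indicator {0..1} s * \<delta>2 (G 1) (s * u) (y + s * (x - y))"
    have bm: "?b \<in> borel_measurable lborel" unfolding \<delta>2_def by measurable
    have "(\<lambda>s. indicator {0..1} s * ?b s) = ?b" by (auto simp: indicator_def fun_eq_iff)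
    then have "\<delta>2 (avg y) u x = (LINT s|lborel. indicator {0..1} s * ?b s)" by (simp only: \<delta>2_avg)
    then have "ennreal ((\<delta>2 (avg y) u x)\<^sup>2) \<le> (\<integral>\<^sup>+s. ennreal ((indicator {0..1::real} s)\<^sup>2) \<partial>lborel) * (\<integral>\<^sup>+s. ennreal ((?b s)\<^sup>2) \<partial>lborel)"
      using LINT_Cauchy_Schwarz[OF _ bm, of "indicator {0..1}"] by simp
    also have "(\<integral>\<^sup>+s. ennreal ((indicator {0..1::real} s)\<^sup>2) \<partial>lborel) = (\<integral>\<^sup>+s. indicator {0..1::real} s \<partial>lborel)"
      by (intro nn_integral_cong) (simp add: indicator_def)
    also have "\<dots> = 1" by simp
    also have "(\<integral>\<^sup>+s. ennreal ((?b s)\<^sup>2) \<partial>lborel) = (\<integral>\<^sup>+s. ?d x s \<partial>lborel)"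
      by (intro nn_integral_cong) (simp add: indicator_def)
    finally show "ennreal ((\<delta>2 (avg y) u x)\<^sup>2) \<le> (\<integral>\<^sup>+s. ?d x s \<partial>lborel)" by simp
  qed
  also have "\<dots> = (\<integral>\<^sup>+s. \<integral>\<^sup>+x. ?d x s \<partial>lborel \<partial>lborel)"
    by (rule lborel_pair.Fubini'[symmetric]) measurable
  also have "\<dots> \<le> (\<integral>\<^sup>+s. ennreal (4 * A * u ^ 4) * indicator {0..1::real} s \<partial>lborel)"
  proof (rule nn_integral_mono_AE)
    show "AE s in lborel. (\<integral>\<^sup>+x. ?d x s \<partial>lborel) \<le> ennreal (4 * A * u ^ 4) * indicator {0..1} s"
      using AE_lborel_singleton[of "0::real"]
    proof eventually_elim
      case (elim s)
      show ?case
      proof (cases "s \<in> {0..1}")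
        case True
        then have s: "0 < s" "s \<le> 1" using elim by auto
        let ?I = "\<integral>\<^sup>+x. ennreal ((\<delta>2 (G 1) (s * u) (y + s * (x - y)))\<^sup>2) \<partial>lborel"
        have e: "(y - s * y) + s * x = y + s * (x - y)" for x by (simp add: algebra_simps)
        have "nn2 (\<delta>2 (G 1) (s * u)) = ennreal s * ?I"
        proof -
          have "(\<lambda>x. ennreal ((\<delta>2 (G 1) (s * u) x)\<^sup>2)) \<in> borel_measurable borel" by measurable
          from nn_integral_real_affine[OF this, of s "y - s * y"] show ?thesis using s unfolding e nn2_def by simp
        qed
        then have "ennreal s * ?I \<le> ennreal (4 * A * (s * u) ^ 4)" using \<delta>2_G_nn2[of "s * u"] by simp
        also have "\<dots> \<le> ennreal (s * (4 * A * u ^ 4))"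
        proof (rule ennreal_leI)
          have "s ^ 4 \<le> s" using power_decreasing[of 1 4 s] s by simp
          then have "s ^ 4 * (4 * A * u ^ 4) \<le> s * (4 * A * u ^ 4)" using A by (intro mult_right_mono) auto
          then show "4 * A * (s * u) ^ 4 \<le> s * (4 * A * u ^ 4)" by (simp add: power_mult_distrib mult_ac)
        qed
        also have "\<dots> = ennreal s * ennreal (4 * A * u ^ 4)" using s A by (intro ennreal_mult) auto
        finally have "?I \<le> ennreal (4 * A * u ^ 4)" using s by (subst (asm) ennreal_mult_le_mult_iff) auto
        then show ?thesis using True by simp
      qed simp
    qed
  qed
  also have "\<dots> = ennreal (4 * A * u ^ 4)" by (simp add: nn_integral_cmult_indicator)
  finally show ?thesis .
qed

lemma \<delta>2_avg_nn2': "nn2 (\<delta>2 (avg y) u) \<le> ennreal (16 * (K1 * pi))"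
proof -
  have t: "nn2 (\<lambda>x. avg y x - avg y (x + v)) \<le> 4 * nn2 (avg y)" for v
  proof -
    have "nn2 (\<lambda>x. avg y x - avg y (x + v)) \<le> 2 * nn2 (avg y) + 2 * nn2 (avg y)"
      using nn2_diff_le[of "avg y" "\<lambda>x. avg y (x + v)"] nn2_translate[OF avg_meas[of y], of v] by simp
    then show ?thesis by (simp flip: distrib_right)
  qed
  have "\<delta>2 (avg y) u = (\<lambda>x. (avg y x - avg y (x + - u)) + (avg y x - avg y (x + u)))"
    by (auto simp: \<delta>2_def fun_eq_iff)
  then have "nn2 (\<delta>2 (avg y) u) = nn2 (\<lambda>x. (avg y x - avg y (x + - u)) + (avg y x - avg y (x + u)))" by (rule arg_cong)
  also have "\<dots> \<le> 2 * nn2 (\<lambda>x. avg y x - avg y (x + - u)) + 2 * nn2 (\<lambda>x. avg y x - avg y (x + u))"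
    by (rule nn2_add_le) measurable
  also have "\<dots> \<le> 2 * (4 * nn2 (avg y)) + 2 * (4 * nn2 (avg y))" by (intro add_mono mult_left_mono t) auto
  also have "\<dots> = 16 * nn2 (avg y)" by (simp add: mult.assoc[symmetric] flip: distrib_right)
  also have "\<dots> \<le> 16 * ennreal (K1 * pi)" by (intro mult_left_mono avg_nn2) auto
  finally show ?thesis using K1 by (simp add: ennreal_mult)
qed

text \<open>For u \<le> 1 the second difference has norm of order u^2, which compensates the
  singularity u^(-2). For u > 1 its norm is bounded and u^(-2) is integrable.\<close>

lemma frac_product_integrable:
  assumes [measurable]: "g \<in> borel_measurable borel" and g: "nn2 g \<le> ennreal (K1 * pi)"
  shows "integrable (lborel \<Otimes>\<^sub>M lborel) (\<lambda>(x, u). g x * frac_int (avg y) x u)"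
proof (rule integrableI_bounded)
  let ?N = "K1 * pi"
  let ?K = "2 * (17 * ?N + 4 * A)"
  have N: "0 \<le> ?N" using K1 by simp
  show m: "(\<lambda>(x, u). g x * frac_int (avg y) x u) \<in> borel_measurable (lborel \<Otimes>\<^sub>M lborel)"
    unfolding frac_int_def \<delta>2_def by measurable
  have "(\<integral>\<^sup>+w. ennreal (norm (case w of (x, u) \<Rightarrow> g x * frac_int (avg y) x u)) \<partial>(lborel \<Otimes>\<^sub>M lborel))
      = (\<integral>\<^sup>+u. \<integral>\<^sup>+x. ennreal \<bar>g x * frac_int (avg y) x u\<bar> \<partial>lborel \<partial>lborel)"
    by (subst lborel_pair.nn_integral_snd[symmetric]) (use m in simp_all)
  also have "\<dots> \<le> (\<integral>\<^sup>+u. ennreal ?K * ennreal (pk u) \<partial>lborel)"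
  proof (rule nn_integral_mono)
    fix u :: real
    have p: "0 < pk u" by (rule pk_pos)
    show "(\<integral>\<^sup>+x. ennreal \<bar>g x * frac_int (avg y) x u\<bar> \<partial>lborel) \<le> ennreal ?K * ennreal (pk u)"
    proof (cases "0 < u")
      case True
      have f: "frac_int (avg y) x u = inverse (u\<^sup>2) * \<delta>2 (avg y) u x" for x
        using True by (simp add: frac_int_def divide_inverse)
      show ?thesis
      proof (cases "u \<le> 1")
        case le: True
        have "(\<integral>\<^sup>+x. ennreal \<bar>g x * frac_int (avg y) x u\<bar> \<partial>lborel)
            \<le> (\<integral>\<^sup>+x. ennreal ((g x)\<^sup>2) + ennreal ((inverse (u\<^sup>2))\<^sup>2) * ennreal ((\<delta>2 (avg y) u x)\<^sup>2) \<partial>lborel)"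
        proof (rule nn_integral_mono)
          fix x
          from ennreal_leI[OF abs_mult_le_sq_sum[of "g x" "inverse (u\<^sup>2) * \<delta>2 (avg y) u x"]]
          show "ennreal \<bar>g x * frac_int (avg y) x u\<bar> \<le> ennreal ((g x)\<^sup>2) + ennreal ((inverse (u\<^sup>2))\<^sup>2) * ennreal ((\<delta>2 (avg y) u x)\<^sup>2)"
            unfolding f power_mult_distrib by (simp add: ennreal_mult)
        qed
        also have "\<dots> = nn2 g + ennreal ((inverse (u\<^sup>2))\<^sup>2) * nn2 (\<delta>2 (avg y) u)"
          unfolding nn2_def by (subst nn_integral_add, measurable, subst nn_integral_cmult) simp_all
        also have "\<dots> \<le> ennreal ?N + ennreal ((inverse (u\<^sup>2))\<^sup>2) * ennreal (4 * A * u ^ 4)"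
          by (intro add_mono mult_left_mono g \<delta>2_avg_nn2) auto
        also have "ennreal ((inverse (u\<^sup>2))\<^sup>2) * ennreal (4 * A * u ^ 4) = ennreal (4 * A)"
        proof -
          have "(inverse (u\<^sup>2))\<^sup>2 * u ^ 4 = 1" using True by (simp add: power_inverse flip: power_mult)
          then have "(inverse (u\<^sup>2))\<^sup>2 * (4 * A * u ^ 4) = 4 * A" by (simp add: mult.left_commute)
          then show ?thesis using A by (subst ennreal_mult[symmetric]) auto
        qed
        also have "ennreal ?N + ennreal (4 * A) = ennreal (?N + 4 * A)" using N A by simp
        also have "\<dots> \<le> ennreal ((?N + 4 * A) * (2 * pk u))"
          using mult_left_mono[OF one_le_pk[of u], of "?N + 4 * A"] True le N A by (intro ennreal_leI) auto
        also have "\<dots> \<le> ennreal (?K * pk u)"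
        proof (rule ennreal_leI)
          have "(?N + 4 * A) * (2 * pk u) \<le> (17 * ?N + 4 * A) * (2 * pk u)" by (intro mult_right_mono) (use N p in linarith)+
          then show "(?N + 4 * A) * (2 * pk u) \<le> ?K * pk u" by (simp add: mult_ac)
        qed
        also have "\<dots> = ennreal ?K * ennreal (pk u)" by (rule ennreal_mult) (use N A p in \<open>auto simp: mult.commute[of pi]\<close>)
        finally show ?thesis .
      next
        case False
        have "(\<integral>\<^sup>+x. ennreal \<bar>g x * frac_int (avg y) x u\<bar> \<partial>lborel)
            \<le> (\<integral>\<^sup>+x. ennreal (2 * pk u) * (ennreal ((g x)\<^sup>2) + ennreal ((\<delta>2 (avg y) u x)\<^sup>2)) \<partial>lborel)"
        proof (rule nn_integral_mono)
          fix x
          have "\<bar>g x * frac_int (avg y) x u\<bar> = inverse (u\<^sup>2) * \<bar>g x * \<delta>2 (avg y) u x\<bar>"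
            unfolding f by (simp add: abs_mult)
          also have "\<dots> \<le> (2 * pk u) * ((g x)\<^sup>2 + (\<delta>2 (avg y) u x)\<^sup>2)"
            by (intro mult_mono inverse_sq_le_pk abs_mult_le_sq_sum) (use False p in auto)
          finally show "ennreal \<bar>g x * frac_int (avg y) x u\<bar> \<le> ennreal (2 * pk u) * (ennreal ((g x)\<^sup>2) + ennreal ((\<delta>2 (avg y) u x)\<^sup>2))"
            using p by (simp add: ennreal_mult[symmetric] ennreal_plus[symmetric] del: ennreal_plus)
        qed
        also have "\<dots> = ennreal (2 * pk u) * (nn2 g + nn2 (\<delta>2 (avg y) u))"
          unfolding nn2_def by (subst nn_integral_cmult, measurable, subst nn_integral_add) simp_all
        also have "\<dots> \<le> ennreal (2 * pk u) * (ennreal ?N + ennreal (16 * ?N))"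
          by (intro mult_left_mono add_mono g \<delta>2_avg_nn2') auto
        also have "ennreal ?N + ennreal (16 * ?N) = ennreal (17 * ?N)"
        proof -
          have "ennreal n + ennreal (16 * n) = ennreal (17 * n)" if "0 \<le> n" for n
            using that by (simp add: ennreal_plus[symmetric] del: ennreal_plus)
          from this[OF N] show ?thesis .
        qed
        also have "ennreal (2 * pk u) * ennreal (17 * ?N) = ennreal (2 * pk u * (17 * ?N))"
          by (rule ennreal_mult[symmetric]) (use N p in auto)
        also have "\<dots> \<le> ennreal (?K * pk u)"
        proof (rule ennreal_leI)
          have "(2 * pk u) * (17 * ?N) \<le> (2 * pk u) * (17 * ?N + 4 * A)" using A p by (intro mult_left_mono) auto
          then show "2 * pk u * (17 * ?N) \<le> ?K * pk u" by (simp add: mult_ac)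
        qed
        also have "\<dots> = ennreal ?K * ennreal (pk u)" by (rule ennreal_mult) (use N A p in \<open>auto simp: mult.commute[of pi]\<close>)
        finally show ?thesis .
      qed
    qed (simp add: frac_int_def)
  qed
  also have "\<dots> = ennreal ?K * ennreal pi" by (simp add: nn_integral_cmult nn_integral_pk)
  also have "\<dots> < \<infinity>" by (simp add: ennreal_mult_less_top)
  finally show "(\<integral>\<^sup>+w. ennreal (norm (case w of (x, u) \<Rightarrow> g x * frac_int (avg y) x u)) \<partial>(lborel \<Otimes>\<^sub>M lborel)) < \<infinity>" .
qed

text \<open>By \<open>frac_avg\<close>, \<open>dd\<close> is 1/pi times an integral of second
  differences for x \<noteq> y. Exchanging the integrals puts the pairing of g with a second
  difference inside, where translation invariance applies.\<close>

lemma dd_product: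
  assumes [measurable]: "g \<in> borel_measurable borel" and g: "nn2 g \<le> ennreal (K1 * pi)"
  shows "pi * (LINT x|lborel. g x * dd x y)
    = (LINT u|lborel. (indicator {0<..} u / u\<^sup>2) * (LINT x|lborel. g x * \<delta>2 (avg y) u x))"
proof -
  have "pi * (LINT x|lborel. g x * dd x y) = (LINT x|lborel. g x * (pi * dd x y))"
    by (simp add: mult.left_commute)
  also have "\<dots> = (LINT x|lborel. LINT u|lborel. g x * frac_int (avg y) x u)"
  proof (rule integral_cong_AE)
    show "AE x in lborel. g x * (pi * dd x y) = (LINT u|lborel. g x * frac_int (avg y) x u)"
      using AE_lborel_singleton[of y]
    proof eventually_elim
      case (elim x)
      show ?case using frac_avg(2)[OF elim] by simp
    qed
    show "(\<lambda>x. LINT u|lborel. g x * frac_int (avg y) x u) \<in> borel_measurable lborel"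
      using lborel_pair.integrable_fst[OF frac_product_integrable[OF assms], of y] by (rule borel_measurable_integrable)
    show "(\<lambda>x. g x * (pi * dd x y)) \<in> borel_measurable lborel" using dd_meas[of y] by measurable
  qed
  also have "\<dots> = (LINT u|lborel. LINT x|lborel. g x * frac_int (avg y) x u)"
    by (rule lborel_pair.Fubini_integral[OF frac_product_integrable[OF assms], symmetric])
  also have "\<dots> = (LINT u|lborel. LINT x|lborel. (indicator {0<..} u / u\<^sup>2) * (g x * \<delta>2 (avg y) u x))"
    unfolding frac_int_def by (intro Bochner_Integration.integral_cong refl) simp
  finally show ?thesis by simp
qed

end

text \<open>Symmetry of |\<nabla>| for \<open>avg z\<close> of one component and
  \<open>avg y\<close> of the other. \<open>kap\<close> and \<open>avg\<close> differ at one point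
  only, and \<open>dd_product\<close> reduces both sides to
  \<open>\<delta>2_symmetric\<close>.\<close>

lemma kap_dd_mixed:
  assumes "line_component G A" "line_component H A"
  shows "(LINT x|lborel. line_component.kap G x z * line_component.dd H x y)
    = (LINT x|lborel. line_component.dd G x z * line_component.kap H x y)"
proof -
  let ?kG = "line_component.kap G" and ?kH = "line_component.kap H"
  let ?dG = "line_component.dd G" and ?dH = "line_component.dd H"
  let ?aG = "line_component.avg G" and ?aH = "line_component.avg H"
  interpret G: line_component G A by (rule assms(1))
  interpret H: line_component H A by (rule assms(2))
  have 1: "(LINT x|lborel. ?kG x z * ?dH x y) = (LINT x|lborel. ?aG z x * ?dH x y)"
  proof (rule integral_cong_AE)
    show "AE x in lborel. ?kG x z * ?dH x y = ?aG z x * ?dH x y"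
      using AE_lborel_singleton[of z] by eventually_elim (simp add: G.kap_avg)
  qed (use H.dd_meas[of y] in measurable)
  have 2: "(LINT x|lborel. ?dG x z * ?kH x y) = (LINT x|lborel. ?aH y x * ?dG x z)"
  proof (rule integral_cong_AE)
    show "AE x in lborel. ?dG x z * ?kH x y = ?aH y x * ?dG x z"
      using AE_lborel_singleton[of y] by eventually_elim (simp add: H.kap_avg)
  qed (use G.dd_meas[of z] in measurable)
  have "pi * (LINT x|lborel. ?aG z x * ?dH x y) = pi * (LINT x|lborel. ?aH y x * ?dG x z)"
    unfolding H.dd_product[OF G.avg_meas G.avg_nn2] G.dd_product[OF H.avg_meas H.avg_nn2]
      \<delta>2_symmetric[OF G.avg_sq_int H.avg_sq_int] by (simp only: mult.commute)
  then show ?thesis unfolding 1 2 by simp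
qed

section \<open>Square integrability over pairs of points, and the principal value\<close>

lemma LINT_indicator_sq_le:
  assumes [measurable]: "f \<in> borel_measurable borel"
  shows "ennreal ((LINT s|lborel. indicator {0..1::real} s * f s)\<^sup>2) \<le> (\<integral>\<^sup>+s. ennreal ((f s)\<^sup>2) * indicator {0..1} s \<partial>lborel)"
proof -
  have "(\<lambda>s. indicator {0..1::real} s * (indicator {0..1} s * f s)) = (\<lambda>s. indicator {0..1} s * f s)"
    by (auto simp: indicator_def fun_eq_iff)
  then have "ennreal ((LINT s|lborel. indicator {0..1::real} s * f s)\<^sup>2)
      \<le> (\<integral>\<^sup>+s. ennreal ((indicator {0..1::real} s)\<^sup>2) \<partial>lborel) * (\<integral>\<^sup>+s. ennreal ((indicator {0..1} s * f s)\<^sup>2) \<partial>lborel)"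
    using LINT_Cauchy_Schwarz[of "indicator {0..1}" lborel "\<lambda>s. indicator {0..1} s * f s"] by simp
  also have "(\<integral>\<^sup>+s. ennreal ((indicator {0..1::real} s)\<^sup>2) \<partial>lborel) = (\<integral>\<^sup>+s. indicator {0..1::real} s \<partial>lborel)"
    by (intro nn_integral_cong) (simp add: indicator_def)
  also have "\<dots> = 1" by simp
  also have "(\<integral>\<^sup>+s. ennreal ((indicator {0..1} s * f s)\<^sup>2) \<partial>lborel) = (\<integral>\<^sup>+s. ennreal ((f s)\<^sup>2) * indicator {0..1} s \<partial>lborel)"
    by (intro nn_integral_cong) (simp add: indicator_def)
  finally show ?thesis by simp
qed

lemma weighted_nn_integral_le:
  fixes f :: "real \<Rightarrow> real" and k :: "real \<Rightarrow> real \<Rightarrow> real"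
  assumes [measurable]: "f \<in> borel_measurable borel" "(\<lambda>z. k (fst z) (snd z)) \<in> borel_measurable (borel \<Otimes>\<^sub>M borel)"
    and k: "\<And>x y. (k x y)\<^sup>2 \<le> K * pk (x - y)" and f: "nn2 f \<le> ennreal C" and "0 \<le> K" "0 \<le> C"
  shows "(\<integral>\<^sup>+z. ennreal ((f (fst z) * k (fst z) (snd z))\<^sup>2) \<partial>(lborel \<Otimes>\<^sub>M lborel)) \<le> ennreal (C * (K * pi))"
proof -
  have "(\<integral>\<^sup>+z. ennreal ((f (fst z) * k (fst z) (snd z))\<^sup>2) \<partial>(lborel \<Otimes>\<^sub>M lborel))
      \<le> (\<integral>\<^sup>+z. ennreal ((f (fst z))\<^sup>2) * (ennreal K * ennreal (pk (fst z - snd z))) \<partial>(lborel \<Otimes>\<^sub>M lborel))"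
  proof (rule nn_integral_mono)
    fix z :: "real \<times> real"
    have "(f (fst z) * k (fst z) (snd z))\<^sup>2 \<le> (f (fst z))\<^sup>2 * (K * pk (fst z - snd z))"
      unfolding power_mult_distrib by (intro mult_left_mono k) auto
    from ennreal_leI[OF this]
    show "ennreal ((f (fst z) * k (fst z) (snd z))\<^sup>2) \<le> ennreal ((f (fst z))\<^sup>2) * (ennreal K * ennreal (pk (fst z - snd z)))"
      using \<open>0 \<le> K\<close> less_imp_le[OF pk_pos] by (simp add: ennreal_mult)
  qed
  also have "\<dots> = (\<integral>\<^sup>+x. \<integral>\<^sup>+y. ennreal ((f x)\<^sup>2) * (ennreal K * ennreal (pk (x - y))) \<partial>lborel \<partial>lborel)"
    by (subst lborel.nn_integral_fst[symmetric]) simp_all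
  also have "\<dots> = (\<integral>\<^sup>+x. ennreal ((f x)\<^sup>2) * (ennreal K * ennreal pi) \<partial>lborel)"
    by (simp add: nn_integral_cmult nn_integral_pk_shift')
  also have "\<dots> = nn2 f * (ennreal K * ennreal pi)"
    unfolding nn2_def by (rule nn_integral_multc) measurable
  also have "\<dots> \<le> ennreal C * (ennreal K * ennreal pi)" by (intro mult_right_mono f) auto
  finally show ?thesis using \<open>0 \<le> K\<close> \<open>0 \<le> C\<close> by (simp add: ennreal_mult)
qed

context line_component
begin

text \<open>On the line x - y = u, \<open>dd\<close> is 1/u times a mean of T(x) - T(x + (s - 1) u).
  Its squared norm before division is at most 12 A u^2 and also at most 24 A; the larger constant
  serves for both regimes of u.\<close>

lemma dd_nn_integral:
  "(\<integral>\<^sup>+z. ennreal ((dd (fst z) (snd z))\<^sup>2) \<partial>(lborel \<Otimes>\<^sub>M lborel)) \<le> ennreal (48 * A * pi)"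
proof -
  have "(\<integral>\<^sup>+z. ennreal ((dd (fst z) (snd z))\<^sup>2) \<partial>(lborel \<Otimes>\<^sub>M lborel)) \<le> ennreal (2 * (24 * A)) * ennreal pi"
  proof (rule nn_integral_difference_coordinates[where f="\<lambda>x y. ennreal ((dd x y)\<^sup>2)"])
    show "(\<lambda>z. ennreal ((dd (fst z) (snd z))\<^sup>2)) \<in> borel_measurable (borel \<Otimes>\<^sub>M borel)"
      using dd_meas2 by measurable
    fix u
    let ?D = "\<lambda>x s. ennreal ((T x - T (x + (s - 1) * u))\<^sup>2) * indicator {0..1} s"
    let ?J = "\<integral>\<^sup>+x. \<integral>\<^sup>+s. ?D x s \<partial>lborel \<partial>lborel"
    have Jm: "?J = (\<integral>\<^sup>+s. nn2 (\<lambda>x. T x - T (x + (s - 1) * u)) * indicator {0..1} s \<partial>lborel)"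
    proof -
      have "?J = (\<integral>\<^sup>+s. \<integral>\<^sup>+x. ?D x s \<partial>lborel \<partial>lborel)"
        by (rule lborel_pair.Fubini'[symmetric]) measurable
      then show ?thesis by (simp add: nn_integral_multc nn2_def)
    qed
    have le: "?J \<le> ennreal c" if "\<And>s. s \<in> {0..1} \<Longrightarrow> nn2 (\<lambda>x. T x - T (x + (s - 1) * u)) \<le> ennreal c" for c
    proof -
      have "?J \<le> (\<integral>\<^sup>+s. ennreal c * indicator {0..1::real} s \<partial>lborel)"
        unfolding Jm using that by (intro nn_integral_mono) (auto simp: indicator_def)
      also have "\<dots> = ennreal c" by (simp add: nn_integral_cmult_indicator)
      finally show ?thesis .
    qed
    have J1: "?J \<le> ennreal (24 * A * u\<^sup>2)"
    proof (rule le)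
      fix s :: real assume s: "s \<in> {0..1}"
      have "(s - 1)\<^sup>2 \<le> 1\<^sup>2" using s by (intro iffD1[OF abs_le_square_iff]) auto
      then have "12 * A * ((s - 1)\<^sup>2 * u\<^sup>2) \<le> 12 * A * (1 * u\<^sup>2)"
        using A by (intro mult_left_mono mult_right_mono) auto
      also have "\<dots> \<le> 24 * A * u\<^sup>2" using A by simp
      finally have "ennreal (12 * A * ((s - 1) * u)\<^sup>2) \<le> ennreal (24 * A * u\<^sup>2)"
        by (intro ennreal_leI) (simp add: power_mult_distrib)
      then show "nn2 (\<lambda>x. T x - T (x + (s - 1) * u)) \<le> ennreal (24 * A * u\<^sup>2)"
        by (rule order.trans[OF nn2_T_diff])
    qed
    have J2: "?J \<le> ennreal (24 * A)" by (rule le[OF nn2_T_diff'])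
    have "(\<integral>\<^sup>+x. ennreal ((dd x (x - u))\<^sup>2) \<partial>lborel) \<le> (\<integral>\<^sup>+x. ennreal (inverse (u\<^sup>2)) * (\<integral>\<^sup>+s. ?D x s \<partial>lborel) \<partial>lborel)"
    proof (rule nn_integral_mono)
      fix x
      have e: "x - u + s * (x - (x - u)) = x + (s - 1) * u" for s by (simp add: algebra_simps)
      have "(dd x (x - u))\<^sup>2 = inverse (u\<^sup>2) * (LINT s|lborel. indicator {0..1} s * (T x - T (x + (s - 1) * u)))\<^sup>2"
        unfolding dd_def T_Mavg e by (simp add: power_mult_distrib power_inverse)
      then have "ennreal ((dd x (x - u))\<^sup>2) = ennreal (inverse (u\<^sup>2)) * ennreal ((LINT s|lborel. indicator {0..1} s * (T x - T (x + (s - 1) * u)))\<^sup>2)"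
        by (simp add: ennreal_mult)
      also have "\<dots> \<le> ennreal (inverse (u\<^sup>2)) * (\<integral>\<^sup>+s. ?D x s \<partial>lborel)"
        by (intro mult_left_mono LINT_indicator_sq_le) measurable
      finally show "ennreal ((dd x (x - u))\<^sup>2) \<le> ennreal (inverse (u\<^sup>2)) * (\<integral>\<^sup>+s. ?D x s \<partial>lborel)" .
    qed
    also have "\<dots> = ennreal (inverse (u\<^sup>2)) * ?J" by (rule nn_integral_cmult) measurable
    also have "\<dots> \<le> ennreal (2 * (24 * A)) * ennreal (pk u)"
      using A by (intro inverse_sq_mult_le_pk J1 J2) auto
    finally show "(\<integral>\<^sup>+x. ennreal ((dd x (x - u))\<^sup>2) \<partial>lborel) \<le> ennreal (2 * (24 * A)) * ennreal (pk u)" .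
  qed
  also have "\<dots> = ennreal (48 * A * pi)" using A by (simp add: ennreal_mult[symmetric])
  finally show ?thesis .
qed

text \<open>This is for time 0, where rational data supply the constant c. Small shifts u are
  handled by the derivative, large ones by the square integrability of G 0 - c.\<close>

lemma kap_nn_integral:
  assumes c: "nn2 (\<lambda>x. G 0 x - c) \<le> ennreal A0" and A0: "0 \<le> A0"
  shows "(\<integral>\<^sup>+z. ennreal ((kap (fst z) (snd z))\<^sup>2) \<partial>(lborel \<Otimes>\<^sub>M lborel)) < \<infinity>"
proof -
  let ?C = "2 * A + 4 * A0"
  have "(\<integral>\<^sup>+z. ennreal ((kap (fst z) (snd z))\<^sup>2) \<partial>(lborel \<Otimes>\<^sub>M lborel)) \<le> ennreal (2 * ?C) * ennreal pi"
  proof (rule nn_integral_difference_coordinates[where f="\<lambda>x y. ennreal ((kap x y)\<^sup>2)"])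
    show "(\<lambda>z. ennreal ((kap (fst z) (snd z))\<^sup>2)) \<in> borel_measurable (borel \<Otimes>\<^sub>M borel)"
      using kap_meas2 by measurable
    fix u
    let ?J = "nn2 (\<lambda>x. G 0 (x + 0) - G 0 (x + - u))"
    have "(\<integral>\<^sup>+x. ennreal ((kap x (x - u))\<^sup>2) \<partial>lborel) = ennreal (inverse (u\<^sup>2)) * ?J"
      unfolding kap_def nn2_def
      by (subst nn_integral_cmult[symmetric]) (measurable, simp add: power_mult_distrib power_inverse ennreal_mult)
    also have "\<dots> \<le> ennreal (2 * ?C) * ennreal (pk u)"
    proof (rule inverse_sq_mult_le_pk)
      have "?J \<le> ennreal (2 * (0 - - u)\<^sup>2) * nn2 (G (Suc 0))" by (rule nn2_translate_diff[OF deriv G_cont])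
      also have "\<dots> \<le> ennreal (2 * (0 - - u)\<^sup>2) * ennreal A" by (intro mult_left_mono nn2_bound) auto
      also have "\<dots> = ennreal (2 * A * u\<^sup>2)" using A by (subst ennreal_mult[symmetric]) (auto simp: mult_ac)
      also have "\<dots> \<le> ennreal (?C * u\<^sup>2)" using A0 by (intro ennreal_leI mult_right_mono) auto
      finally show "?J \<le> ennreal (?C * u\<^sup>2)" .
      have "?J = nn2 (\<lambda>x. (G 0 x - c) - (G 0 (x + - u) - c))" by (simp add: nn2_def)
      also have "\<dots> \<le> 2 * nn2 (\<lambda>x. G 0 x - c) + 2 * nn2 (\<lambda>x. G 0 (x + - u) - c)" by (rule nn2_diff_le) measurable
      also have "nn2 (\<lambda>x. G 0 (x + - u) - c) = nn2 (\<lambda>x. G 0 x - c)"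
        using nn2_translate[of "\<lambda>x. G 0 x - c" "- u"] by simp
      also have "2 * nn2 (\<lambda>x. G 0 x - c) + 2 * nn2 (\<lambda>x. G 0 x - c) = 4 * nn2 (\<lambda>x. G 0 x - c)" by (simp flip: distrib_right)
      also have "\<dots> \<le> 4 * ennreal A0" by (intro mult_left_mono c) auto
      also have "\<dots> = ennreal (4 * A0)" using A0 by (simp add: ennreal_mult)
      also have "\<dots> \<le> ennreal ?C" using A by (intro ennreal_leI) auto
      finally show "?J \<le> ennreal ?C" .
    qed (use A A0 in auto)
    finally show "(\<integral>\<^sup>+x. ennreal ((kap x (x - u))\<^sup>2) \<partial>lborel) \<le> ennreal (2 * ?C) * ennreal (pk u)" .
  qed
  also have "\<dots> < \<infinity>" by (simp add: ennreal_mult_less_top)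
  finally show ?thesis .
qed

text \<open>The truncated kernel 1/u is odd and square integrable, so
  \<open>odd_kernel_half_line\<close> folds it onto u > \<epsilon>.\<close>

lemma truncated_kernel:
  assumes e: "0 < \<epsilon>"
  shows "(LINT y:{y. \<epsilon> < \<bar>x - y\<bar>}|lborel. G 1 y / (x - y)) = (LINT u|lborel. indicator {\<epsilon><..} u * hl_int (G 1) x u)"
proof -
  let ?k = "\<lambda>u. indicator {u. \<epsilon> < \<bar>u\<bar>} u / u"
  have km: "?k \<in> borel_measurable borel" by measurable
  have "sq_integrable lborel ?k"
  proof (rule sq_integrable_nn2[OF km nn2_le_pk[where y=0]])
    show "(?k u)\<^sup>2 \<le> (2 * (1 / \<epsilon>)\<^sup>2 + 2 * 1\<^sup>2) * pk (u - 0)" for u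
      unfolding diff_zero by (rule sq_decay) (use e in \<open>auto simp: indicator_def divide_simps\<close>)
  qed (use e in auto)
  moreover have "?k (- u) = - ?k u" for u by (simp add: indicator_def)
  moreover have "sq_integrable lborel (G 1)" by (rule sq_integrable_nn2[OF G_meas nn2_bound]) auto
  ultimately have "(LINT u|lborel. indicator {0<..} u * (?k u * (G 1 (x - u) - G 1 (x + u)))) = (LINT y|lborel. ?k (x - y) * G 1 y)"
    by (rule odd_kernel_half_line(2))
  moreover have "indicator {0<..} u * (?k u * (G 1 (x - u) - G 1 (x + u))) = indicator {\<epsilon><..} u * hl_int (G 1) x u" for u
    using e by (auto simp: hl_int_def indicator_def)
  moreover have "?k (x - y) * G 1 y = indicator {y. \<epsilon> < \<bar>x - y\<bar>} y *\<^sub>R (G 1 y / (x - y))" for y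
    by (simp add: indicator_def)
  ultimately show ?thesis by (simp only: set_lebesgue_integral_def)
qed

text \<open>The folded integrand is absolutely integrable, so dominated convergence in the
  truncation turns the principal value into a plain integral.\<close>

lemma hilbert_transform_eq: "hilbert_transform (G 1) x = T x"
proof -
  have "((\<lambda>\<epsilon>. LINT u|lborel. indicator {\<epsilon><..} u * hl_int (G 1) x u) \<longlongrightarrow> (LINT u|lborel. hl_int (G 1) x u)) (at_right 0)"
  proof (rule tendsto_at_right_sequentially[of 0 1])
    fix s :: "nat \<Rightarrow> real" assume s: "\<And>n. 0 < s n" "s \<longlonglongrightarrow> 0"
    show "(\<lambda>n. LINT u|lborel. indicator {s n<..} u * hl_int (G 1) x u) \<longlonglongrightarrow> (LINT u|lborel. hl_int (G 1) x u)"
    proof (rule integral_dominated_convergence[where w="\<lambda>u. \<bar>hl_int (G 1) x u\<bar>"])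
      show "AE u in lborel. (\<lambda>n. indicator {s n<..} u * hl_int (G 1) x u) \<longlonglongrightarrow> hl_int (G 1) x u"
      proof (rule AE_I2)
        fix u :: real
        show "(\<lambda>n. indicator {s n<..} u * hl_int (G 1) x u) \<longlonglongrightarrow> hl_int (G 1) x u"
        proof (cases "0 < u")
          case True
          have "eventually (\<lambda>n. s n < u) sequentially" using order_tendstoD(2)[OF s(2) True] .
          then have "eventually (\<lambda>n. indicator {s n<..} u * hl_int (G 1) x u = hl_int (G 1) x u) sequentially"
            by eventually_elim simp
          then show ?thesis by (rule tendsto_eventually)
        qed (simp add: hl_int_def)
      qed
      show "AE u in lborel. norm (indicator {s n<..} u * hl_int (G 1) x u) \<le> \<bar>hl_int (G 1) x u\<bar>" for n
        by (auto simp: indicator_def)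
      have [measurable]: "hl_int (G 1) x \<in> borel_measurable borel" by (rule hl_int_meas) measurable
      show "(\<lambda>u. indicator {s n<..} u * hl_int (G 1) x u) \<in> borel_measurable lborel" for n by measurable
    qed (use hl_G_integrable in auto)
  qed simp
  then have "((\<lambda>\<epsilon>. LINT y:{y. \<epsilon> < \<bar>x - y\<bar>}|lborel. G 1 y / (x - y)) \<longlongrightarrow> (LINT u|lborel. hl_int (G 1) x u)) (at_right 0)"
  proof (rule Lim_transform_eventually)
    show "eventually (\<lambda>\<epsilon>. (LINT u|lborel. indicator {\<epsilon><..} u * hl_int (G 1) x u)
        = (LINT y:{y. \<epsilon> < \<bar>x - y\<bar>}|lborel. G 1 y / (x - y))) (at_right 0)"
      using eventually_at_right_less[of 0] by eventually_elim (rule truncated_kernel[symmetric])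
  qed
  from tendsto_Lim[OF trivial_limit_at_right_real this] show ?thesis
    by (simp add: hilbert_transform_def T_def Hl_def)
qed

end

section \<open>Bounded rational functions on the line\<close>

lemma poly_quotient_tendsto:
  fixes p q :: "real poly"
  assumes "degree p \<le> degree q" and q: "\<And>x. poly q x \<noteq> 0"
  shows "\<exists>c r. (\<forall>x. poly p x / poly q x - c = poly r x / poly q x) \<and> (r = 0 \<or> degree r < degree q)
    \<and> ((\<lambda>x. poly p x / poly q x) \<longlongrightarrow> c) at_infinity"
proof -
  have q0: "q \<noteq> 0" using q[of 0] by auto
  define c where "c = coeff p (degree q) / lead_coeff q"
  define r where "r = p - smult c q"
  have r: "r = 0 \<or> degree r < degree q"
  proof (rule eq_zero_or_degree_less)
    show "degree r \<le> degree q" unfolding r_def using assms(1) by (intro degree_diff_le) auto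
    show "coeff r (degree q) = 0" using q0 by (simp add: r_def c_def)
  qed
  have e: "poly p x / poly q x = c + poly r x / poly q x" for x
    using q[of x] by (simp add: r_def field_simps)
  have "((\<lambda>x. poly r x / poly q x) \<longlongrightarrow> 0) at_infinity"
    using r poly_divide_tendsto_0_at_infinity[of r q] by auto
  from tendsto_add[OF tendsto_const[of c] this] have "((\<lambda>x. poly p x / poly q x) \<longlongrightarrow> c) at_infinity"
    unfolding e by simp
  then show ?thesis using r e by (intro exI[of _ c] exI[of _ r]) auto
qed

lemma poly_quotient_bounded:
  fixes p q :: "real poly"
  assumes "degree p \<le> degree q" and q: "\<And>x. poly q x \<noteq> 0"
  shows "\<exists>b. \<forall>x. \<bar>poly p x / poly q x\<bar> \<le> b"
proof -
  obtain c where "((\<lambda>x. poly p x / poly q x) \<longlongrightarrow> c) at_infinity" using poly_quotient_tendsto[OF assms] by blast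
  from tendstoD[OF this, of 1] obtain R where R: "\<And>x. R \<le> norm x \<Longrightarrow> dist (poly p x / poly q x) c < 1"
    by (auto simp: eventually_at_infinity)
  have "compact ((\<lambda>x. poly p x / poly q x) ` {- R..R})"
    using q by (intro compact_continuous_image continuous_intros) auto
  then obtain b where b: "\<And>x. x \<in> {- R..R} \<Longrightarrow> \<bar>poly p x / poly q x\<bar> \<le> b"
    using compact_imp_bounded by (fastforce simp: bounded_iff)
  have "\<bar>poly p x / poly q x\<bar> \<le> max b (\<bar>c\<bar> + 1)" for x
  proof (cases "R \<le> \<bar>x\<bar>")
    case True
    then have "\<bar>poly p x / poly q x - c\<bar> < 1" using R[of x] by (simp add: dist_real_def)
    then show ?thesis by linarith
  next
    case False
    then have "x \<in> {- R..R}" by auto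
    then show ?thesis by (intro max.coboundedI1 b)
  qed
  then show ?thesis by blast
qed

text \<open>Boundedness forces deg p \<le> deg q. Subtracting the limit c at infinity leaves a
  numerator of degree below that of q, so |x| times the difference is bounded, and
  \<open>sq_decay\<close> makes it square integrable.\<close>

lemma bounded_rational_decay:
  fixes p q :: "real poly"
  assumes q: "\<And>x. poly q x \<noteq> 0" and bd: "\<And>x. \<bar>poly p x / poly q x\<bar> \<le> 1"
  shows "\<exists>c b. 0 \<le> b \<and> nn2 (\<lambda>x. poly p x / poly q x - c) \<le> ennreal b"
proof -
  have deg: "degree p \<le> degree q"
  proof (rule ccontr)
    assume "\<not> ?thesis"
    then have d: "degree q < degree p" by simp
    have "eventually (\<lambda>x. norm (poly q x / poly p x) < 1) at_infinity"
      using tendstoD[OF poly_divide_tendsto_0_at_infinity[OF d], of 1] by simp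
    moreover have "eventually (\<lambda>x. 1 \<le> norm (poly p x)) at_infinity"
      using filterlim_poly_at_infinity[of p] d by (auto simp: filterlim_at_infinity[of 0])
    ultimately have "eventually (\<lambda>x::real. False) at_infinity"
    proof eventually_elim
      case (elim x)
      have "poly p x \<noteq> 0" using elim(2) by auto
      then have "\<bar>poly q x\<bar> < \<bar>poly p x\<bar>" using elim(1) by (simp add: field_simps)
      moreover have "\<bar>poly p x\<bar> \<le> \<bar>poly q x\<bar>" using bd[of x] q[of x] by (simp add: field_simps)
      ultimately show False by simp
    qed
    then show False by (simp add: trivial_limit_at_infinity)
  qed
  obtain c r where cr: "\<And>x. poly p x / poly q x - c = poly r x / poly q x" "r = 0 \<or> degree r < degree q"
    using poly_quotient_tendsto[OF deg q] by blast
  have "degree (pCons 0 r) \<le> degree q" using cr(2) by (auto simp: degree_pCons_eq_if)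
  from poly_quotient_bounded[OF this q] obtain b where b: "\<And>x. \<bar>poly (pCons 0 r) x / poly q x\<bar> \<le> b" by blast
  have "(poly p x / poly q x - c)\<^sup>2 \<le> (2 * (1 + \<bar>c\<bar>)\<^sup>2 + 2 * b\<^sup>2) * pk (x - 0)" for x
    unfolding diff_zero
  proof (rule sq_decay)
    show "\<bar>poly p x / poly q x - c\<bar> \<le> 1 + \<bar>c\<bar>" using bd[of x] by linarith
    show "\<bar>x\<bar> * \<bar>poly p x / poly q x - c\<bar> \<le> b" unfolding cr(1) using b[of x] by (simp add: abs_mult)
  qed
  from nn2_le_pk[OF this] show ?thesis
    by (intro exI[of _ c] exI[of _ "(2 * (1 + \<bar>c\<bar>)\<^sup>2 + 2 * b\<^sup>2) * pi"]) auto
qed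

section \<open>Rational data on the line\<close>

lemma nn_integral_norm_sq:
  fixes f :: "'a \<Rightarrow> real ^ 3"
  assumes "\<And>a. (\<lambda>z. f z $ a) \<in> borel_measurable M"
  shows "(\<integral>\<^sup>+z. ennreal ((norm (f z))\<^sup>2) \<partial>M) = (\<Sum>a\<in>UNIV. \<integral>\<^sup>+z. ennreal ((f z $ a)\<^sup>2) \<partial>M)"
proof -
  have "(norm (f z))\<^sup>2 = (\<Sum>a\<in>UNIV. (f z $ a)\<^sup>2)" for z
    unfolding power2_norm_eq_inner inner_vec_def by (simp add: power2_eq_square)
  then have "(\<integral>\<^sup>+z. ennreal ((norm (f z))\<^sup>2) \<partial>M) = (\<integral>\<^sup>+z. (\<Sum>a\<in>UNIV. ennreal ((f z $ a)\<^sup>2)) \<partial>M)"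
    by (simp add: sum_ennreal)
  also have "\<dots> = (\<Sum>a\<in>UNIV. \<integral>\<^sup>+z. ennreal ((f z $ a)\<^sup>2) \<partial>M)"
    using assms by (intro nn_integral_sum) measurable
  finally show ?thesis .
qed

lemma nn_integral_norm_sq_le:
  fixes f :: "'a \<Rightarrow> real ^ 3"
  assumes "\<And>a. (\<lambda>z. f z $ a) \<in> borel_measurable M" "0 \<le> c"
    and "\<And>a. (\<integral>\<^sup>+z. ennreal ((f z $ a)\<^sup>2) \<partial>M) \<le> ennreal c"
  shows "(\<integral>\<^sup>+z. ennreal ((norm (f z))\<^sup>2) \<partial>M) \<le> ennreal (3 * c)"
proof -
  have "(\<integral>\<^sup>+z. ennreal ((norm (f z))\<^sup>2) \<partial>M) \<le> (\<Sum>a\<in>(UNIV :: 3 set). ennreal c)"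
    unfolding nn_integral_norm_sq[OF assms(1)] by (intro sum_mono assms(3))
  also have "\<dots> = ennreal (3 * c)" using assms(2) by (simp add: ennreal_mult)
  finally show ?thesis .
qed

lemma norm_sq_le_3:
  fixes v :: "real ^ 3"
  assumes "\<And>a. (v $ a)\<^sup>2 \<le> c"
  shows "(norm v)\<^sup>2 \<le> 3 * c"
proof -
  have "(norm v)\<^sup>2 = (\<Sum>a\<in>UNIV. (v $ a)\<^sup>2)"
    unfolding power2_norm_eq_inner inner_vec_def by (simp add: power2_eq_square)
  also have "\<dots> \<le> (\<Sum>a\<in>(UNIV :: 3 set). c)" by (intro sum_mono assms)
  finally show ?thesis by simp
qed

lemma poly_map_of_real: "poly (map_poly complex_of_real p) (of_real x) = of_real (poly p x)"
  by (induction p) (simp_all add: map_poly_pCons)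

lemma poly_map_Re: "Re (poly p (of_real x)) = poly (map_poly Re p) x"
  and poly_map_Im: "Im (poly p (of_real x)) = poly (map_poly Im p) x"
  by (induction p) (simp_all add: map_poly_pCons)

text \<open>On the real axis, extending the fraction by the conjugate of q gives the real
  denominator |q|^2; as f is real, only the real part of the new numerator is kept.\<close>

lemma rational_in_x_of_complex:
  assumes "\<And>x. poly q (complex_of_real x) \<noteq> 0" "\<And>x. complex_of_real (f x) = poly p (of_real x) / poly q (of_real x)"
  shows "rational_in_x f"
proof -
  define P where "P = map_poly Re p * map_poly Re q + map_poly Im p * map_poly Im q"
  define Q where "Q = (map_poly Re q)\<^sup>2 + (map_poly Im q)\<^sup>2"
  have Q: "poly Q x = (Re (poly q (of_real x)))\<^sup>2 + (Im (poly q (of_real x)))\<^sup>2" for x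
    by (simp add: Q_def poly_map_Re poly_map_Im)
  have P: "poly P x = Re (poly p (of_real x)) * Re (poly q (of_real x)) + Im (poly p (of_real x)) * Im (poly q (of_real x))" for x
    by (simp add: P_def poly_map_Re poly_map_Im)
  have "poly Q x \<noteq> 0" for x
    using assms(1)[of x] unfolding Q by (simp add: sum_power2_eq_zero_iff complex_eq_iff)
  moreover have "f x = poly P x / poly Q x" for x
    using arg_cong[OF assms(2)[of x], of Re] unfolding P Q by (simp add: Re_divide)
  ultimately show ?thesis unfolding rational_in_x_def by blast
qed

lemma compact_locally_bounded:
  fixes N :: "'a :: metric_space \<Rightarrow> real"
  assumes "compact K" and "\<And>t. t \<in> K \<Longrightarrow> \<exists>e>0. \<exists>c. \<forall>s\<in>K. dist t s < e \<longrightarrow> N s \<le> c"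
  shows "\<exists>c\<ge>0. \<forall>s\<in>K. N s \<le> c"
proof -
  obtain e c where ec: "\<And>t. t \<in> K \<Longrightarrow> 0 < e t" "\<And>t s. t \<in> K \<Longrightarrow> s \<in> K \<Longrightarrow> dist t s < e t \<Longrightarrow> N s \<le> c t"
    using assms(2) by metis
  have "K \<subseteq> (\<Union>t\<in>K. ball t (e t))" using ec(1) by force
  from compactE_image[OF assms(1) _ this] obtain F where F: "F \<subseteq> K" "finite F" "K \<subseteq> (\<Union>t\<in>F. ball t (e t))"
    by auto
  have "N s \<le> (\<Sum>t\<in>F. \<bar>c t\<bar>)" if s: "s \<in> K" for s
  proof -
    obtain t where t: "t \<in> F" "dist t s < e t" using F(3) s by auto
    then have "N s \<le> \<bar>c t\<bar>" using ec(2)[of t s] F(1) s by fastforce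
    also have "\<dots> \<le> (\<Sum>t\<in>F. \<bar>c t\<bar>)" using t(1) F(2) by (intro member_le_sum) auto
    finally show ?thesis .
  qed
  moreover have "0 \<le> (\<Sum>t\<in>F. \<bar>c t\<bar>)" by (intro sum_nonneg) auto
  ultimately show ?thesis by blast
qed

text \<open>Continuity at t in the Sobolev norm of order three bounds the squared norm near t by 2
  N(t) + 2, and compactness of the time path makes this uniform. Order three for the x-derivative of
  S accounts for the derivatives one to four of S.\<close>

lemma (in smooth_flow) sobolev_bound:
  assumes sob: "continuous_in_sobolev I 3 (\<lambda>t. dx (S t))"
  shows "\<exists>A\<ge>0. \<forall>r a j. 1 \<le> j \<longrightarrow> j \<le> 4 \<longrightarrow> nn2 (\<lambda>x. D 0 j (path r) x $ a) \<le> ennreal A"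
proof -
  have dxD: "dx (D 0 k t) = D 0 (Suc k) t" if "t \<in> I" for k t
    unfolding dx_def using vector_derivative_at[OF D_x[OF that]] by blast
  have dxj: "(dx ^^ j) (dx (S t)) = D 0 (Suc j) t" if "t \<in> I" for j t
    by (induction j) (simp_all add: dxD[OF that] flip: D0)
  have dxj_diff: "(dx ^^ j) (\<lambda>x. dx (S s) x - dx (S t) x) = (\<lambda>x. D 0 (Suc j) s x - D 0 (Suc j) t x)"
    if "s \<in> I" "t \<in> I" for j s t
  proof (induction j)
    case 0
    then show ?case using dxj[OF that(1), of 0] dxj[OF that(2), of 0] by simp
  next
    case (Suc j)
    have "dx (\<lambda>x. D 0 (Suc j) s x - D 0 (Suc j) t x) = (\<lambda>x. D 0 (Suc (Suc j)) s x - D 0 (Suc (Suc j)) t x)"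
      unfolding dx_def using vector_derivative_at[OF has_vector_derivative_diff[OF D_x[OF that(1)] D_x[OF that(2)]]] by blast
    then show ?case by (simp add: Suc)
  qed
  have Dm: "D 0 j t \<in> borel_measurable borel" if "t \<in> I" for j t
    using has_vector_derivative_continuous[OF D_x[OF that]]
    by (intro borel_measurable_continuous_onI continuous_at_imp_continuous_on) auto
  have int: "integrable lborel (\<lambda>x. (norm (D 0 (Suc j) t x))\<^sup>2)" if "t \<in> I" "j \<le> 3" for j t
    using sob that dxj[OF that(1), of j] unfolding continuous_in_sobolev_def in_sobolev_def by force
  define N where "N t = (\<Sum>j\<le>(3::nat). LINT x|lborel. (norm (D 0 (Suc j) t x))\<^sup>2)" for t
  have "\<exists>c\<ge>0. \<forall>s\<in>path ` {0..1}. N s \<le> c"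
  proof (rule compact_locally_bounded[OF path_compact])
    fix t assume "t \<in> path ` {0..1}"
    then have t: "t \<in> I" using path_I by auto
    have "((\<lambda>s. sobolev_norm 3 (\<lambda>x. dx (S s) x - dx (S t) x)) \<longlongrightarrow> 0) (at t within I)"
      using sob t unfolding continuous_in_sobolev_def by blast
    from tendstoD[OF this, of 1] obtain e where e: "0 < e"
      "\<And>s. s \<in> I \<Longrightarrow> s \<noteq> t \<Longrightarrow> dist s t < e \<Longrightarrow> \<bar>sobolev_norm 3 (\<lambda>x. dx (S s) x - dx (S t) x)\<bar> < 1"
      by (auto simp: eventually_at)
    have N0: "0 \<le> N t" unfolding N_def by (intro sum_nonneg) auto
    have "N s \<le> 2 * N t + 2" if s: "s \<in> I" "dist t s < e" for s
    proof (cases "s = t")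
      case False
      let ?d = "\<lambda>j x. D 0 (Suc j) s x - D 0 (Suc j) t x"
      have "\<bar>sqrt (\<Sum>j\<le>3. LINT x|lborel. (norm (?d j x))\<^sup>2)\<bar> < 1"
        using e(2)[OF s(1) False] s(2) unfolding sobolev_norm_def dxj_diff[OF s(1) t] by (simp add: dist_commute)
      then have "sqrt (\<Sum>j\<le>3. LINT x|lborel. (norm (?d j x))\<^sup>2) < 1" by linarith
      then have d1: "(\<Sum>j\<le>(3::nat). LINT x|lborel. (norm (?d j x))\<^sup>2) < 1" by (simp only: real_sqrt_lt_1_iff)
      have sq: "(norm (u - v))\<^sup>2 \<le> 2 * (norm u)\<^sup>2 + 2 * (norm v)\<^sup>2" for u v :: "real ^ 3"
        by (rule order.trans[OF power_mono[OF norm_triangle_ineq4] real_sq_sum_le]) simp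
      have "(LINT x|lborel. (norm (D 0 (Suc j) s x))\<^sup>2)
          \<le> 2 * (LINT x|lborel. (norm (?d j x))\<^sup>2) + 2 * (LINT x|lborel. (norm (D 0 (Suc j) t x))\<^sup>2)" if j: "j \<le> 3" for j
      proof -
        note js = int[OF s(1) j] and it = int[OF t j]
        have id: "integrable lborel (\<lambda>x. (norm (?d j x))\<^sup>2)"
        proof (rule Bochner_Integration.integrable_bound)
          show "integrable lborel (\<lambda>x. 2 * (norm (D 0 (Suc j) s x))\<^sup>2 + 2 * (norm (D 0 (Suc j) t x))\<^sup>2)"
            using js it by simp
          show "(\<lambda>x. (norm (?d j x))\<^sup>2) \<in> borel_measurable lborel" using Dm[OF s(1)] Dm[OF t] by measurable
          show "AE x in lborel. norm ((norm (?d j x))\<^sup>2) \<le> norm (2 * (norm (D 0 (Suc j) s x))\<^sup>2 + 2 * (norm (D 0 (Suc j) t x))\<^sup>2)"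
            using sq by (auto intro: order.trans[OF _ abs_ge_self])
        qed
        have "(LINT x|lborel. (norm (D 0 (Suc j) s x))\<^sup>2) \<le> (LINT x|lborel. 2 * (norm (?d j x))\<^sup>2 + 2 * (norm (D 0 (Suc j) t x))\<^sup>2)"
        proof (rule integral_mono[OF js])
          show "integrable lborel (\<lambda>x. 2 * (norm (?d j x))\<^sup>2 + 2 * (norm (D 0 (Suc j) t x))\<^sup>2)" using id it by simp
          show "(norm (D 0 (Suc j) s x))\<^sup>2 \<le> 2 * (norm (?d j x))\<^sup>2 + 2 * (norm (D 0 (Suc j) t x))\<^sup>2" for x
            using sq[of "?d j x" "- D 0 (Suc j) t x"] by simp
        qed
        also have "\<dots> = 2 * (LINT x|lborel. (norm (?d j x))\<^sup>2) + 2 * (LINT x|lborel. (norm (D 0 (Suc j) t x))\<^sup>2)"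
          using id it by simp
        finally show ?thesis .
      qed
      then have "N s \<le> (\<Sum>j\<le>(3::nat). 2 * (LINT x|lborel. (norm (?d j x))\<^sup>2) + 2 * (LINT x|lborel. (norm (D 0 (Suc j) t x))\<^sup>2))"
        unfolding N_def by (intro sum_mono) auto
      also have "\<dots> = 2 * (\<Sum>j\<le>(3::nat). LINT x|lborel. (norm (?d j x))\<^sup>2) + 2 * N t"
        unfolding N_def by (simp only: sum.distrib sum_distrib_left)
      also have "\<dots> \<le> 2 * N t + 2" using d1 by linarith
      finally show ?thesis .
    qed (use N0 in simp)
    then show "\<exists>e>0. \<exists>c. \<forall>s\<in>path ` {0..1}. dist t s < e \<longrightarrow> N s \<le> c"
      using e(1) path_I by (intro exI[of _ e] conjI exI[of _ "2 * N t + 2"]) auto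
  qed
  then obtain A where A: "0 \<le> A" "\<And>s. s \<in> path ` {0..1} \<Longrightarrow> N s \<le> A" by blast
  have "nn2 (\<lambda>x. D 0 j (path r) x $ a) \<le> ennreal A" if j: "1 \<le> j" "j \<le> 4" for r a j
  proof -
    obtain k where k: "j = Suc k" "k \<le> 3" using j by (cases j) auto
    have "path r = path (max 0 (min 1 r))" by (simp add: path_def)
    then have p: "path r \<in> path ` {0..1}" by auto
    have "nn2 (\<lambda>x. D 0 j (path r) x $ a) \<le> (\<integral>\<^sup>+x. ennreal ((norm (D 0 (Suc k) (path r) x))\<^sup>2) \<partial>lborel)"
      unfolding nn2_def k(1)
    proof (intro nn_integral_mono ennreal_leI)
      show "(D 0 (Suc k) (path r) x $ a)\<^sup>2 \<le> (norm (D 0 (Suc k) (path r) x))\<^sup>2" for x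
        using power_mono[OF component_le_norm_cart[of "D 0 (Suc k) (path r) x" a], of 2] by simp
    qed
    also have "\<dots> = ennreal (LINT x|lborel. (norm (D 0 (Suc k) (path r) x))\<^sup>2)"
      by (intro nn_integral_eq_integral int path_I k) auto
    also have "\<dots> \<le> ennreal (N (path r))"
      unfolding N_def using k(2)
      by (intro ennreal_leI member_le_sum[where f="\<lambda>j. LINT x|lborel. (norm (D 0 (Suc j) (path r) x))\<^sup>2"]) auto
    also have "\<dots> \<le> ennreal A" by (intro ennreal_leI A p)
    finally show ?thesis .
  qed
  then show ?thesis using A(1) by blast
qed

lemma kernel_param_line: "kernel_param of_real (\<lambda>_. 1) (\<lambda>u. u)"
proof
  show "\<forall>\<^sub>F x' in at x. complex_of_real x' \<noteq> z" for x z
  proof (cases "of_real x = z")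
    case True
    then show ?thesis using eventually_neq_at_within[of x x UNIV] by (auto elim: eventually_mono)
  next
    case False
    have "((\<lambda>x. complex_of_real x) \<longlongrightarrow> of_real x) (at x)" by (intro tendsto_intros)
    from tendsto_imp_eventually_ne[OF this False] show ?thesis .
  qed
qed (auto intro!: continuous_intros simp: divide_inverse simp flip: of_real_diff of_real_inverse)

theorem line_rational:
  assumes I: "is_interval I" "0 \<in> I" and hw: "half_wave_maps_line I S"
    and init: "\<And>i. rational_in_x (\<lambda>x. S 0 x $ i)" and \<tau>: "\<tau> \<in> I"
  shows "rational_in_x (\<lambda>x. S \<tau> x $ i)"
proof -
  obtain D where D: "D 0 0 = S" "\<And>j k. continuous_on (I \<times> UNIV) (\<lambda>(t, x). D j k t x)"
    "\<And>j k t x. t \<in> I \<Longrightarrow> ((\<lambda>s. D j k s x) has_vector_derivative D (Suc j) k t x) (at t within I)"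
    "\<And>j k t x. t \<in> I \<Longrightarrow> (D j k t has_vector_derivative D j (Suc k) t x) (at x)"
    using hw unfolding half_wave_maps_line_def smooth_tx_def by blast
  interpret smooth_flow I S D abs_nabla_line \<tau>
    using I \<tau> D hw unfolding half_wave_maps_line_def by unfold_locales auto
  have "continuous_in_sobolev I 3 (\<lambda>t. dx (S t))" using hw unfolding half_wave_maps_line_def by blast
  from sobolev_bound[OF this] obtain A where A: "0 \<le> A"
    "\<And>r a j. 1 \<le> j \<Longrightarrow> j \<le> 4 \<Longrightarrow> nn2 (\<lambda>x. D 0 j (path r) x $ a) \<le> ennreal A" by blast
  define G where "G r a j x = D 0 j (path r) x $ a" for r a j x
  have G0: "G r a 0 = (\<lambda>x. S (path r) x $ a)" for r a by (auto simp: G_def D0)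
  have lc: "line_component (G r a) A" for r a
  proof
    show "(G r a j has_real_derivative G r a (Suc j) x) (at x)" for j x
      unfolding G_def by (rule D_component_deriv[OF path_I])
    show "\<bar>G r a 0 x\<bar> \<le> 1" for x
      unfolding G0 using component_le_norm_cart[of "S (path r) x" a] unit[of r x] by simp
    show "nn2 (G r a j) \<le> ennreal A" if "1 \<le> j" "j \<le> 4" for j
      unfolding G_def[abs_def] by (rule A(2)[OF that])
  qed (rule A(1))
  note M0 = line_component.M0[OF lc] and K1 = line_component.K1[OF lc]
  let ?M0 = "line_component.M0 A" and ?K1 = "line_component.K1 A"
  define T where "T r x = abs_nabla_line (S (path r)) x" for r x
  have Ta: "T r x $ a = line_component.T (G r a) x" for r x a
  proof -
    have "deriv (\<lambda>y. S (path r) y $ a) = G r a 1"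
      using DERIV_imp_deriv[OF line_component.deriv[OF lc, of r a 0]] unfolding G0 by auto
    then show ?thesis by (simp only: T_def abs_nabla_line_def vec_lambda_beta line_component.hilbert_transform_eq[OF lc])
  qed
  define d where "d r x y = (\<chi> a. line_component.dd (G r a) x y)" for r x y
  define \<kappa>' where "\<kappa>' r x y = inverse (x - y) *\<^sub>R (S (path r) x - S (path r) y)" for r x y
  have \<kappa>a: "\<kappa>' r x y $ a = line_component.kap (G r a) x y" for r x y a
    by (simp add: \<kappa>'_def line_component.kap_def[OF lc] G0)
  have da: "d r x y $ a = line_component.dd (G r a) x y" for r x y a by (simp add: d_def)
  have Tm: "T r \<in> borel_measurable borel" for r
    by (rule borel_measurable_vecI) (simp add: Ta line_component.T_meas[OF lc])
  have dm: "(\<lambda>z. d r (fst z) (snd z)) \<in> borel_measurable (borel \<Otimes>\<^sub>M borel)" for r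
    by (rule borel_measurable_vecI) (simp add: da line_component.dd_meas2[OF lc])
  have km: "(\<lambda>z. \<kappa>' r (fst z) (snd z)) \<in> borel_measurable (borel \<Otimes>\<^sub>M borel)" for r
    by (rule borel_measurable_vecI) (simp add: \<kappa>a line_component.kap_meas2[OF lc])
  have dm1: "(\<lambda>x. d r x y) \<in> borel_measurable borel" for r y
    by (rule borel_measurable_vecI) (simp add: da line_component.dd_meas[OF lc])
  have km1: "(\<lambda>x. \<kappa>' r x y) \<in> borel_measurable borel" for r y
    by (rule borel_measurable_vecI) (simp add: \<kappa>a line_component.kap_meas[OF lc])
  have k_sq: "(norm (\<kappa>' r x y))\<^sup>2 \<le> (3 * ?K1) * pk (x - y)" for r x y
    using norm_sq_le_3[of "\<kappa>' r x y"] line_component.kap_sq[OF lc, of r _ x y] unfolding \<kappa>a by (simp add: mult.assoc)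
  have d_sq: "(norm (d r x y))\<^sup>2 \<le> (3 * (2 * ?M0\<^sup>2 + 2 * (2 * ?M0)\<^sup>2)) * pk (x - y)" for r x y
    using norm_sq_le_3[of "d r x y"] line_component.dd_sq[OF lc, of r _ x y] unfolding da mult.assoc[of 3] by blast
  have T_norm: "(norm (T r x))\<^sup>2 \<le> 3 * ?M0\<^sup>2" for r x
  proof (rule norm_sq_le_3)
    show "(T r x $ a)\<^sup>2 \<le> ?M0\<^sup>2" for a
      unfolding Ta using power_mono[OF line_component.T_sup[OF lc, of r a x], of 2] by simp
  qed
  have T_nn2: "nn2 (\<lambda>x. norm (T r x)) \<le> ennreal (18 * A)" for r
    unfolding nn2_def using nn_integral_norm_sq_le[of "T r" lborel "6 * A"] Tm[of r] A(1)
      line_component.nn2_T[OF lc, of r] line_component.T_meas[OF lc] unfolding Ta nn2_def by simp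
  have Tk_sq: "(norm (T r x) * norm (\<kappa>' r x y))\<^sup>2 \<le> (3 * ?M0\<^sup>2 * (3 * ?K1)) * pk (x - y)" for r x y
  proof -
    have "(norm (T r x) * norm (\<kappa>' r x y))\<^sup>2 \<le> (3 * ?M0\<^sup>2) * ((3 * ?K1) * pk (x - y))"
      unfolding power_mult_distrib by (intro mult_mono T_norm k_sq) auto
    then show ?thesis by (simp add: mult.assoc)
  qed
  \<comment> \<open>48 A pi bounds each component of \<open>d\<close>, 18 A = 3 * 6 A bounds the
    squared norm of \<open>T\<close>, and 3 K1 pi bounds the integral of |\<kappa>|^2 in one
    variable. The sum of the two numbers serves as the single constant of the locale.\<close>
  let ?c1 = "3 * (48 * A * pi)" and ?c2 = "18 * A * (3 * ?K1 * pi)"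
  have c: "0 \<le> ?c1" "0 \<le> ?c2" using A(1) K1 by auto
  interpret hwl: half_wave_lax lborel "\<lambda>u. u" "\<lambda>r. S (path r)" "\<lambda>r x. \<tau> *\<^sub>R D 1 0 (path r) x" T d \<tau> "?c1 + ?c2"
  proof (rule half_wave_lax.intro)
    show "sigma_finite_measure (lborel :: real measure)" by (rule sigma_finite_lborel)
    show "(\<lambda>(r, x). S (path r) x) \<in> borel_measurable (borel \<Otimes>\<^sub>M borel)" using D_path_meas[of 0 0] by (simp add: D0)
    show "(\<lambda>(r, x). \<tau> *\<^sub>R D 1 0 (path r) x) \<in> borel_measurable (borel \<Otimes>\<^sub>M borel)"
      using D_path_meas[of 1 0] by (simp add: case_prod_unfold)
    show "continuous_on {0..1} (\<lambda>r. \<tau> *\<^sub>R D 1 0 (path r) x)" for x by (intro continuous_intros path_section_cont)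
    show "norm (S (path r) x) = 1" for r x by (rule unit)
    show "((\<lambda>r. S (path r) x) has_vector_derivative \<tau> *\<^sub>R D 1 0 (path r) x) (at r within {0..1})" if "r \<in> {0..1}" for r x
      using path_deriv[OF that, of 0 0 x] by (simp add: D0)
    show "\<tau> *\<^sub>R D 1 0 (path r) x = \<tau> *\<^sub>R cross3 (S (path r) x) (T r x)" for r x
      unfolding T_def by (rule D_t_eq)
    show "d r x y + d r y x = inverse (x - y) *\<^sub>R (T r x - T r y)" for r x y
      by (simp add: vec_eq_iff da Ta line_component.dd_sum[OF lc])
    show "T r \<in> borel_measurable borel" for r by (rule Tm)
    show "(\<lambda>z. d r (fst z) (snd z)) \<in> borel_measurable (borel \<Otimes>\<^sub>M borel)" for r by (rule dm)
    show "(\<integral>\<^sup>+z. ennreal ((norm (d r (fst z) (snd z)))\<^sup>2) \<partial>(lborel \<Otimes>\<^sub>M lborel)) \<le> ennreal (?c1 + ?c2)" for r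
    proof (rule order.trans[OF nn_integral_norm_sq_le ennreal_leI])
      show "(\<lambda>z. d r (fst z) (snd z) $ a) \<in> borel_measurable (lborel \<Otimes>\<^sub>M lborel)" for a
        using line_component.dd_meas2[OF lc, of r a] by (simp add: da)
      show "(\<integral>\<^sup>+z. ennreal ((d r (fst z) (snd z) $ a)\<^sup>2) \<partial>(lborel \<Otimes>\<^sub>M lborel)) \<le> ennreal (48 * A * pi)" for a
        unfolding da by (rule line_component.dd_nn_integral[OF lc])
    qed (use c A in auto)
    show "(\<integral>\<^sup>+z. ennreal ((norm (T r (fst z)) * norm (inverse (fst z - snd z) *\<^sub>R (S (path r) (fst z) - S (path r) (snd z))))\<^sup>2) \<partial>(lborel \<Otimes>\<^sub>M lborel)) \<le> ennreal (?c1 + ?c2)" for r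
      unfolding \<kappa>'_def[symmetric]
    proof (rule order.trans[OF weighted_nn_integral_le[where K="3 * ?K1" and C="18 * A"] ennreal_leI])
      show "(\<lambda>x. norm (T r x)) \<in> borel_measurable borel" using Tm[of r] by measurable
      show "(\<lambda>z. norm (\<kappa>' r (fst z) (snd z))) \<in> borel_measurable (borel \<Otimes>\<^sub>M borel)" using km[of r] by measurable
    qed (use k_sq T_nn2 c K1 A in auto)
    show "sq_integrable lborel (\<lambda>x. norm (inverse (x - y) *\<^sub>R (S (path r) x - S (path r) y)))" for r y
      unfolding \<kappa>'_def[symmetric]
      by (rule sq_integrable_nn2[OF _ nn2_le_pk[OF k_sq]]) (use km1 K1 in auto)
    show "sq_integrable lborel (\<lambda>x. norm (d r x y))" for r y
      by (rule sq_integrable_nn2[OF _ nn2_le_pk[OF d_sq]]) (use dm1 in auto)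
    show "sq_integrable lborel (\<lambda>x. norm (T r x) * norm (inverse (x - y) *\<^sub>R (S (path r) x - S (path r) y)))" for r y
      unfolding \<kappa>'_def[symmetric]
      by (rule sq_integrable_nn2[OF _ nn2_le_pk[OF Tk_sq]]) (use km1[of r y] Tm[of r] K1 in auto)
    show "(LINT x|lborel. (inverse (x - z) *\<^sub>R (S (path r) x - S (path r) z)) $ a * d r x y $ b) =
        (LINT x|lborel. d r x z $ a * (inverse (x - y) *\<^sub>R (S (path r) x - S (path r) y)) $ b)" for r y z a b
      unfolding \<kappa>'_def[symmetric] \<kappa>a da by (rule kap_dd_mixed[OF lc lc])
    show "(\<integral>\<^sup>+z. ennreal ((norm (inverse (fst z - snd z) *\<^sub>R (S (path 0) (fst z) - S (path 0) (snd z))))\<^sup>2) \<partial>(lborel \<Otimes>\<^sub>M lborel)) < \<infinity>"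
      unfolding \<kappa>'_def[symmetric]
    proof (subst nn_integral_norm_sq)
      show "(\<lambda>z. \<kappa>' 0 (fst z) (snd z) $ a) \<in> borel_measurable (lborel \<Otimes>\<^sub>M lborel)" for a
        using line_component.kap_meas2[OF lc, of 0 a] by (simp add: \<kappa>a)
      have "(\<integral>\<^sup>+z. ennreal ((\<kappa>' 0 (fst z) (snd z) $ a)\<^sup>2) \<partial>(lborel \<Otimes>\<^sub>M lborel)) < \<infinity>" for a
      proof -
        obtain p q where pq: "\<And>x. poly q x \<noteq> 0" "\<And>x. S 0 x $ a = poly p x / poly q x"
          using init[of a] unfolding rational_in_x_def by blast
        have G00: "G 0 a 0 x = poly p x / poly q x" for x unfolding G0 path_01 by (rule pq(2))
        have "\<bar>poly p x / poly q x\<bar> \<le> 1" for x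
          using line_component.bound[OF lc, of 0 a x] unfolding G00 .
        \<comment> \<open>The sphere bounds each rational component by 1; this is what makes it
          approach a constant at infinity and the initial kernel square integrable.\<close>
        from bounded_rational_decay[OF pq(1) this] obtain c b where "0 \<le> b" "nn2 (\<lambda>x. G 0 a 0 x - c) \<le> ennreal b"
          unfolding G00 by blast
        then show ?thesis unfolding \<kappa>a by (intro line_component.kap_nn_integral[OF lc])
      qed
      then show "(\<Sum>a\<in>UNIV. \<integral>\<^sup>+z. ennreal ((\<kappa>' 0 (fst z) (snd z) $ a)\<^sup>2) \<partial>(lborel \<Otimes>\<^sub>M lborel)) < \<infinity>"
        by (simp add: less_top)
    qed
  qed simp_all
  have "\<exists>p q. \<forall>x. poly q (of_real x) \<noteq> 0 \<and> complex_of_real (S (path 1) x $ i) = poly p (of_real x) / poly q (of_real x)"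
  proof (rule hwl.rational_propagates[OF kernel_param_line, where X=UNIV])
    show "\<exists>p q. \<forall>x. poly q (complex_of_real x) \<noteq> 0 \<and> complex_of_real (S (path 0) x $ k) = poly p (of_real x) / poly q (of_real x)" for k
    proof -
      obtain p q where pq: "\<And>x. poly q x \<noteq> 0" "\<And>x. S 0 x $ k = poly p x / poly q x"
        using init[of k] unfolding rational_in_x_def by blast
      then show ?thesis
        by (intro exI[of _ "map_poly of_real p"] exI[of _ "map_poly of_real q"]) (simp add: poly_map_of_real path_01)
    qed
    show "AE x in lborel. x - y \<noteq> 0" for y :: real
      using AE_lborel_singleton[of y] by eventually_elim simp
    show "emeasure lborel U \<noteq> 0" if "open U" "x \<in> U" for U and x :: real
      using that by (rule emeasure_lborel_open_nonzero)
    show "isCont (S (path 1)) x" for x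
      using has_vector_derivative_continuous[OF D_x[OF path_I, of 0 0 1 x]] by (simp add: D0)
  qed auto
  then show ?thesis unfolding path_01 by (auto intro: rational_in_x_of_complex)
qed

theorem corollary2:
  fixes I :: "real set" and S :: "real \<Rightarrow> real \<Rightarrow> real ^ 3"
  assumes "is_interval I" and "0 \<in> I"
  shows "(half_wave_maps_line I S \<longrightarrow>
            (\<forall>i. rational_in_x (\<lambda>x. S 0 x $ i)) \<longrightarrow>
            (\<forall>t\<in>I. \<forall>i. rational_in_x (\<lambda>x. S t x $ i))) \<and>
         (half_wave_maps_torus I S \<longrightarrow>
            (\<forall>i. rational_in_exp_ix (\<lambda>x. S 0 x $ i)) \<longrightarrow>
            (\<forall>t\<in>I. \<forall>i. rational_in_exp_ix (\<lambda>x. S t x $ i)))"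
proof (intro conjI impI allI ballI)
  show "rational_in_x (\<lambda>x. S t x $ i)"
    if "half_wave_maps_line I S" "\<forall>i. rational_in_x (\<lambda>x. S 0 x $ i)" "t \<in> I" for t i
    using line_rational[OF assms that(1) _ that(3)] that(2) by blast
  show "rational_in_exp_ix (\<lambda>x. S t x $ i)"
    if "half_wave_maps_torus I S" "\<forall>i. rational_in_exp_ix (\<lambda>x. S 0 x $ i)" "t \<in> I" for t i
    using torus_rational[OF assms that(1) _ that(3)] that(2) by blast
qed

end
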